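(* Let $\rho\in[1,2)$ and assume that the covariance of the Gaussian process $w$ has finite 2D Hölder-controlled $\rho$-variation. Let $\alpha\in(1/4,1/2]$ satisfy $2\rho<1/\alpha<\lfloor2\rho\rfloor+1$. Then the complement of $\mathcal{Z}_{\alpha\text{-Hld}}$ in $\mathcal{W}$ is a slim set. Moreover, the map $\mathcal{S}_{\alpha\text{-Hld}}\colon\mathcal{W}\to G\Omega_{\alpha\text{-Hld}}(\mathbb{R}^d)$ is $\infty$-quasi-continuous.
   Context: Notation. Fix $T>0$, $\triangle_T=\{(s,t):0\le s\le t\le T\}$, $\mathbb{N}=\{1,2,\dots\}$. For a Euclidean space $V$, $C_0(V)$ is the Banach space of continuous paths $[0,T]\to V$ starting at $0$ (sup-norm), and $C_0^{1\text{-Hld}}(V)$ is the set of Lipschitz paths in it. Gaussian process. $w=(w_t)_{t\in[0,T]}=(w^1_t,\dots,w^d_t)$ is a $d$-dimensional centered continuous Gaussian process with independent components and $w_0=0$. For a real centered continuous Gaussian process $\xi$ put $\hat R\binom{s,t}{u,v}=\mathbb{E}[(\xi_t-\xi_s)(\xi_v-\xi_u)]$, and let $$V_\rho(\hat R,[s,t]\times[s',t'])=\sup_{\pi,\pi'}\Big(\sum_{j,k}\Big|\hat R\tbinom{t_{j-1},t_j}{u_{k-1},u_k}\Big|^\rho\Big)^{1/\rho},$$ the supremum being over partitions $\pi=\{t_j\}$ of $[s,t]$ and $\pi'=\{u_k\}$ of $[s',t']$. The covariance of $\xi$ has finite 2D Hölder-controlled $\rho$-variation if there is $C>0$ with $V_\rho(\hat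 R,[s,t]^2)\le C(t-s)^{1/\rho}$ for all $(s,t)\in\triangle_T$; the covariance of $w$ has this property if that of each component $w^i$ does. Let $\mu$ be the law of $w$ on $C_0(\mathbb{R}^d)$, $\mathcal{H}$ its Cameron–Martin space, and $\mathcal{W}=\overline{\mathcal{H}}$ (closure in $C_0(\mathbb{R}^d)$). Then $(\mathcal{W},\mathcal{H},\mu)$ is an abstract Wiener space, on which $w$ is realized as the coordinate process. Hölder rough paths. For continuous $\eta:\triangle_T\to V$ let $\|\eta\|_{\gamma\text{-Hld}}=\sup_{s<t}|\eta_{s,t}|/(t-s)^\gamma$. Let $T^k(V)=\bigoplus_{i=0}^kV^{\otimes i}$ and, for $x\in C_0^{1\text{-Hld}}(V)$, $S_k(x)_{s,t}=(1,S(x)^1_{s,t},\dots,S(x)^k_{s,t})$ with $S(x)^i_{s,t}=\int_{s\le t_1\le\cdots\le t_i\le t}dx_{t_1}\otimes\cdots\otimes dx_{t_i}$. For $\alpha\in(1/4,1/2]$ and $k=\lfloor1/\alpha\rfloor$, an $\alpha$-Hölder rough path is a continuous $X=(1,X^1,\dots,X^k):\triangle_T\to T^k(V)$ with $X_{s,t}=X_{s,u}\otimes X_{u,t}$ ($s\le u\le t$) and $\|X^i\|_{i\alpha\text{-Hld}}<\infty$ for $1\le i\le k$; the distance is $d_{\alpha\text{-Hld}}(X,\hat X)=\sum_{i=1}^k\|X^i-\hat X^i\|_{i\alpha\text{-Hld}}$. $G\Omega_{\alpha\text{-Hld}}(V)$ is the closure of $\{S_k(x):x\in C_0^{1\text{-Hld}}(V)\}$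 with respect to this distance. Lift. For $l\in\mathbb{N}$, $w(l)$ is the piecewise linear interpolation of $w$ along $\{jT/2^l:0\le j\le2^l\}$ and $W(l)=S_{\lfloor1/\alpha\rfloor}(w(l))$. Let $\mathcal{Z}_{\alpha\text{-Hld}}=\{w\in\mathcal{W}:\lim_{l\to\infty}W(l)\text{ exists in }G\Omega_{\alpha\text{-Hld}}(\mathbb{R}^d)\}$, and $\mathcal{S}_{\alpha\text{-Hld}}(w)=\lim_{l\to\infty}W(l)$ if $w\in\mathcal{Z}_{\alpha\text{-Hld}}$, and the zero rough path $\mathbf 0=(1,0,\dots,0)$ otherwise. Capacities. $\mathbf{D}_{q,k}$ ($1<q<\infty$, $k\in\mathbb{N}$) is the Gaussian Sobolev space of Malliavin calculus on $(\mathcal{W},\mathcal{H},\mu)$. For open $O\subset\mathcal{W}$, $\mathrm{Cap}_{q,k}(O)=\inf\{\|u\|_{\mathbf{D}_{q,k}}:u\ge0\ \mu\text{-a.e.},\ u\ge1\ \mu\text{-a.e. on }O\}$; for arbitrary $A$, $\mathrm{Cap}_{q,k}(A)=\inf\{\mathrm{Cap}_{q,k}(O):O\supset A\text{ open}\}$. $A$ is slim if $\mathrm{Cap}_{q,k}(A)=0$ for all $q\in(1,\infty)$, $k\in\mathbb{N}$. A map $F$ from $\mathcal{W}$ to a topological space is $\infty$-quasi-continuous if for all $q\in(1,\infty)$, $k\in\mathbb{N}$ and $\varepsilon>0$ there is an open $O\subset\mathcal{W}$ with $\mathrm{Cap}_{q,k}(O)<\varepsilon$ such that $F|_{\mathcal{W}\setminus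 O}$ is continuous. *)

theory Defs
  imports "HOL-Probability.Probability"
begin

section \<open>Path space\<close>

text \<open>The Banach space \<open>C\<^sub>0(\<real>\<^sup>d)\<close> of continuous paths on \<open>[0,T]\<close> started at \<open>0\<close> is encoded isometrically
  as a closed subspace of the bounded continuous functions on \<open>\<real>\<close>: a path is extended by
  constants to the left of \<open>0\<close> and to the right of \<open>T\<close>.\<close>

type_synonym 'd path = "real \<Rightarrow>\<^sub>C (real ^ 'd)"

definition C0 :: "real \<Rightarrow> ('d::finite) path set" where
  "C0 T = {x. apply_bcontfun x 0 = 0 \<and>
              (\<forall>t. apply_bcontfun x t = apply_bcontfun x (max 0 (min T t)))}"

definition path_of :: "real \<Rightarrow> (real \<Rightarrow> real ^ 'd) \<Rightarrow> ('d::finite) path" where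
  "path_of T f = Bcontfun (\<lambda>t. f (max 0 (min T t)))"

definition lipschitz_paths :: "real \<Rightarrow> (real \<Rightarrow> real ^ ('d::finite)) set" where
  "lipschitz_paths T = {x. x 0 = 0 \<and> (\<exists>C. C-lipschitz_on {0..T} x)}"


section \<open>Gaussian processes and their covariance\<close>

text \<open>Degenerate (constantly zero) variables count as Gaussian.\<close>

definition centered_gaussian :: "'a measure \<Rightarrow> ('a \<Rightarrow> real) \<Rightarrow> bool" where
  "centered_gaussian M X \<longleftrightarrow>
     X \<in> borel_measurable M \<and>
     (distr M borel X = return borel 0 \<or>
      (\<exists>\<sigma>>0. distributed M lborel X (\<lambda>x. ennreal (normal_density 0 \<sigma> x))))"

definition gaussian_process ::
  "'a measure \<Rightarrow> real \<Rightarrow> (real \<Rightarrow> 'a \<Rightarrow> real ^ ('d::finite)) \<Rightarrow> bool" where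
  "gaussian_process M T w \<longleftrightarrow>
     prob_space M \<and>
     (\<forall>\<omega>\<in>space M. w 0 \<omega> = 0 \<and> continuous_on {0..T} (\<lambda>t. w t \<omega>)) \<and>
     (\<forall>S c. finite S \<and> S \<subseteq> {0..T} \<times> UNIV \<longrightarrow>
        centered_gaussian M (\<lambda>\<omega>. \<Sum>(t, i)\<in>S. c (t, i) * w t \<omega> $ i)) \<and>
     prob_space.indep_vars M (\<lambda>i. PiM {0..T} (\<lambda>_. borel))
        (\<lambda>i \<omega>. \<lambda>t\<in>{0..T}. w t \<omega> $ i) UNIV"

definition incr_cov ::
  "'a measure \<Rightarrow> (real \<Rightarrow> 'a \<Rightarrow> real) \<Rightarrow> real \<Rightarrow> real \<Rightarrow> real \<Rightarrow> real \<Rightarrow> real" where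
  "incr_cov M \<xi> s t u v = (\<integral>\<omega>. (\<xi> t \<omega> - \<xi> s \<omega>) * (\<xi> v \<omega> - \<xi> u \<omega>) \<partial>M)"

definition partitions :: "real \<Rightarrow> real \<Rightarrow> real list set" where
  "partitions a b = {p. p \<noteq> [] \<and> hd p = a \<and> last p = b \<and> sorted_wrt (<) p}"

definition rho_variation ::
  "real \<Rightarrow> (real \<Rightarrow> real \<Rightarrow> real \<Rightarrow> real \<Rightarrow> real) \<Rightarrow> real \<Rightarrow> real \<Rightarrow> real \<Rightarrow> real \<Rightarrow> ennreal" where
  "rho_variation \<rho> R s t s' t' =
     (SUP p\<in>partitions s t. SUP p'\<in>partitions s' t'.
        ennreal ((\<Sum>j<length p - 1. \<Sum>k<length p' - 1.
                    \<bar>R (p ! j) (p ! Suc j) (p' ! k) (p' ! Suc k)\<bar> powr \<rho>) powr (1 / \<rho>)))"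

definition hoelder_controlled_covariance ::
  "'a measure \<Rightarrow> real \<Rightarrow> real \<Rightarrow> (real \<Rightarrow> 'a \<Rightarrow> real ^ ('d::finite)) \<Rightarrow> bool" where
  "hoelder_controlled_covariance M T \<rho> w \<longleftrightarrow>
     (\<forall>i. \<exists>C>0. \<forall>s t. 0 \<le> s \<and> s \<le> t \<and> t \<le> T \<longrightarrow>
        rho_variation \<rho> (incr_cov M (\<lambda>r \<omega>. w r \<omega> $ i)) s t s t \<le> ennreal (C * (t - s) powr (1 / \<rho>)))"


section \<open>The abstract Wiener space of a Gaussian process\<close>

definition path_law ::
  "'a measure \<Rightarrow> real \<Rightarrow> (real \<Rightarrow> 'a \<Rightarrow> real ^ 'd) \<Rightarrow> ('d::finite) path measure" where
  "path_law M T w = distr M (restrict_space borel (C0 T)) (\<lambda>\<omega>. path_of T (\<lambda>t. w t \<omega>))"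

text \<open>The closure in \<open>L\<^sup>2(\<mu>)\<close> of the linear span of the coordinate variables \<open>x \<mapsto> x\<^sub>t\<^sup>i\<close>.\<close>

definition first_chaos :: "real \<Rightarrow> ('d::finite) path measure \<Rightarrow> ('d path \<Rightarrow> real) set" where
  "first_chaos T \<mu> = {Z \<in> borel_measurable \<mu>. \<forall>\<epsilon>>0. \<exists>S c. finite S \<and> S \<subseteq> {0..T} \<times> UNIV \<and>
     (\<integral>\<^sup>+x. ennreal ((Z x - (\<Sum>(t, i)\<in>S. c (t, i) * apply_bcontfun x t $ i))\<^sup>2) \<partial>\<mu>) < ennreal \<epsilon>}"

text \<open>The Cameron--Martin space consists of the paths \<open>h\<^sub>t = E[Z w\<^sub>t]\<close> with \<open>Z\<close> in the first chaos;
  \<open>Z\<close> is determined by \<open>h\<close> up to null sets, and \<open>\<langle>h, h'\<rangle> = E[Z Z']\<close>.\<close>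

definition cm_represents ::
  "real \<Rightarrow> ('d::finite) path measure \<Rightarrow> ('d path \<Rightarrow> real) \<Rightarrow> 'd path \<Rightarrow> bool" where
  "cm_represents T \<mu> Z h \<longleftrightarrow> Z \<in> first_chaos T \<mu> \<and> h \<in> C0 T \<and>
     (\<forall>t\<in>{0..T}. \<forall>i. apply_bcontfun h t $ i = (\<integral>x. Z x * apply_bcontfun x t $ i \<partial>\<mu>))"

definition cameron_martin :: "real \<Rightarrow> ('d::finite) path measure \<Rightarrow> 'd path set" where
  "cameron_martin T \<mu> = {h. \<exists>Z. cm_represents T \<mu> Z h}"

definition cm_inner :: "real \<Rightarrow> ('d::finite) path measure \<Rightarrow> 'd path \<Rightarrow> 'd path \<Rightarrow> real" where
  "cm_inner T \<mu> h h' = (THE r. \<exists>Z Z'. cm_represents T \<mu> Z h \<and> cm_represents T \<mu> Z' h' \<and>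
                                      r = (\<integral>x. Z x * Z' x \<partial>\<mu>))"

text \<open>A triple \<open>(\<W>, \<H>, \<mu>)\<close>; the Banach space \<open>\<W>\<close> is the space of the measure.\<close>

record 'b wiener_space =
  wmeasure :: "'b measure"
  cm_space :: "'b set"
  cm_ip :: "'b \<Rightarrow> 'b \<Rightarrow> real"

definition wiener_space_of ::
  "'a measure \<Rightarrow> real \<Rightarrow> (real \<Rightarrow> 'a \<Rightarrow> real ^ 'd) \<Rightarrow> ('d::finite) path wiener_space" where
  "wiener_space_of M T w =
     \<lparr>wmeasure = restrict_space (path_law M T w) (closure (cameron_martin T (path_law M T w))),
      cm_space = cameron_martin T (path_law M T w),
      cm_ip = cm_inner T (path_law M T w)\<rparr>"

abbreviation wspace :: "'b wiener_space \<Rightarrow> 'b set" where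
  "wspace B \<equiv> space (wmeasure B)"


section \<open>Gaussian Sobolev spaces\<close>

text \<open>Continuous linear functionals are only required to be linear and bounded on \<open>\<W>\<close>.\<close>

definition dual_functionals :: "('b::real_normed_vector) wiener_space \<Rightarrow> ('b \<Rightarrow> real) set" where
  "dual_functionals B = {\<phi>.
     (\<forall>x\<in>wspace B. \<forall>y\<in>wspace B. \<phi> (x + y) = \<phi> x + \<phi> y) \<and>
     (\<forall>c. \<forall>x\<in>wspace B. \<phi> (c *\<^sub>R x) = c * \<phi> x) \<and>
     (\<exists>K. \<forall>x\<in>wspace B. \<bar>\<phi> x\<bar> \<le> K * norm x)}"

inductive_set polynomial_functionals ::
  "('b::real_normed_vector) wiener_space \<Rightarrow> ('b \<Rightarrow> real) set"
  for B :: "'b wiener_space" where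
  const: "(\<lambda>_. c) \<in> polynomial_functionals B"
| dual: "\<phi> \<in> dual_functionals B \<Longrightarrow> \<phi> \<in> polynomial_functionals B"
| add: "F \<in> polynomial_functionals B \<Longrightarrow> G \<in> polynomial_functionals B \<Longrightarrow>
        (\<lambda>x. F x + G x) \<in> polynomial_functionals B"
| mult: "F \<in> polynomial_functionals B \<Longrightarrow> G \<in> polynomial_functionals B \<Longrightarrow>
        (\<lambda>x. F x * G x) \<in> polynomial_functionals B"

text \<open>\<open>D\<^sup>jF(x)[h\<^sub>1, \<dots>, h\<^sub>j]\<close> for a polynomial functional \<open>F\<close>.\<close>

primrec dir_deriv :: "('b::real_normed_vector \<Rightarrow> real) \<Rightarrow> 'b list \<Rightarrow> 'b \<Rightarrow> real" where
  "dir_deriv F [] x = F x"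
| "dir_deriv F (h # hs) x = deriv (\<lambda>s. dir_deriv F hs (x + s *\<^sub>R h)) 0"

definition enn_powr :: "ennreal \<Rightarrow> real \<Rightarrow> ennreal" where
  "enn_powr a p = (if a = \<infinity> then \<infinity> else ennreal (enn2real a powr p))"

definition Lq_norm :: "'b measure \<Rightarrow> real \<Rightarrow> ('b \<Rightarrow> ennreal) \<Rightarrow> ennreal" where
  "Lq_norm \<mu> q f = enn_powr (\<integral>\<^sup>+x. enn_powr (f x) q \<partial>\<mu>) (1 / q)"

definition cm_orthonormal :: "'b wiener_space \<Rightarrow> 'b set \<Rightarrow> bool" where
  "cm_orthonormal B E \<longleftrightarrow> E \<subseteq> cm_space B \<and>
     (\<forall>e\<in>E. \<forall>e'\<in>E. cm_ip B e e' = (if e = e' then 1 else 0))"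

text \<open>The Hilbert--Schmidt norm, i.e. the norm of \<open>\<H>\<^sup>\<otimes>\<^sup>j\<close>, of a \<open>j\<close>-linear form on \<open>\<H>\<close>: the sum of the
  squares of its values on an orthonormal basis, exhausted by finite orthonormal families.\<close>

definition hs_norm :: "'b wiener_space \<Rightarrow> nat \<Rightarrow> ('b list \<Rightarrow> real) \<Rightarrow> ennreal" where
  "hs_norm B j A = (SUP E\<in>{E. finite E \<and> cm_orthonormal B E}.
     ennreal (sqrt (\<Sum>hs | set hs \<subseteq> E \<and> length hs = j. (A hs)\<^sup>2)))"

definition poly_sobolev_norm ::
  "('b::real_normed_vector) wiener_space \<Rightarrow> real \<Rightarrow> nat \<Rightarrow> ('b \<Rightarrow> real) \<Rightarrow> ennreal" where
  "poly_sobolev_norm B q k F =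
     (\<Sum>j\<le>k. Lq_norm (wmeasure B) q (\<lambda>x. hs_norm B j (\<lambda>hs. dir_deriv F hs x)))"

text \<open>\<open>\<D>\<^sub>q\<^sub>,\<^sub>k\<close> is the completion of the polynomial functionals under the above norm, realized inside
  \<open>L\<^sup>q\<close>. By closability of the derivative, the limit of the norms does not depend on the
  approximating sequence, so that the infimum below ranges over a single value if \<open>u \<in> \<D>\<^sub>q\<^sub>,\<^sub>k\<close>.\<close>

definition sobolev_approx ::
  "('b::real_normed_vector) wiener_space \<Rightarrow> real \<Rightarrow> nat \<Rightarrow> ('b \<Rightarrow> real) \<Rightarrow> (nat \<Rightarrow> 'b \<Rightarrow> real) \<Rightarrow> bool"
  where
  "sobolev_approx B q k u F \<longleftrightarrow>
     (\<forall>n. F n \<in> polynomial_functionals B) \<and>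
     (\<lambda>n. Lq_norm (wmeasure B) q (\<lambda>x. ennreal \<bar>F n x - u x\<bar>)) \<longlonglongrightarrow> 0 \<and>
     (\<forall>\<epsilon>>0. \<exists>N. \<forall>m\<ge>N. \<forall>n\<ge>N. poly_sobolev_norm B q k (\<lambda>x. F m x - F n x) < ennreal \<epsilon>)"

definition sobolev_space ::
  "('b::real_normed_vector) wiener_space \<Rightarrow> real \<Rightarrow> nat \<Rightarrow> ('b \<Rightarrow> real) set" where
  "sobolev_space B q k = {u \<in> borel_measurable (wmeasure B). \<exists>F. sobolev_approx B q k u F}"

definition sobolev_norm ::
  "('b::real_normed_vector) wiener_space \<Rightarrow> real \<Rightarrow> nat \<Rightarrow> ('b \<Rightarrow> real) \<Rightarrow> ennreal" where
  "sobolev_norm B q k u =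
     (INF F\<in>{F. sobolev_approx B q k u F}. lim (\<lambda>n. poly_sobolev_norm B q k (F n)))"


section \<open>Capacities\<close>

definition cap_open ::
  "('b::real_normed_vector) wiener_space \<Rightarrow> real \<Rightarrow> nat \<Rightarrow> 'b set \<Rightarrow> ennreal" where
  "cap_open B q k U = (INF u\<in>{u \<in> sobolev_space B q k.
       (AE x in wmeasure B. 0 \<le> u x) \<and> (AE x in wmeasure B. x \<in> U \<longrightarrow> 1 \<le> u x)}.
     sobolev_norm B q k u)"

definition cap ::
  "('b::real_normed_vector) wiener_space \<Rightarrow> real \<Rightarrow> nat \<Rightarrow> 'b set \<Rightarrow> ennreal" where
  "cap B q k A = (INF U\<in>{U. openin (top_of_set (wspace B)) U \<and> A \<subseteq> U}. cap_open B q k U)"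

definition slim :: "('b::real_normed_vector) wiener_space \<Rightarrow> 'b set \<Rightarrow> bool" where
  "slim B A \<longleftrightarrow> (\<forall>q>1. \<forall>k\<ge>1. cap B q k A = 0)"

definition infty_quasi_continuous ::
  "('b::real_normed_vector) wiener_space \<Rightarrow> 'c topology \<Rightarrow> ('b \<Rightarrow> 'c) \<Rightarrow> bool" where
  "infty_quasi_continuous B Y F \<longleftrightarrow> F \<in> wspace B \<rightarrow> topspace Y \<and>
     (\<forall>q>1. \<forall>k\<ge>1. \<forall>\<epsilon>>0. \<exists>U. openin (top_of_set (wspace B)) U \<and> cap_open B q k U < ennreal \<epsilon> \<and>
        continuous_map (top_of_set (wspace B - U)) Y F)"


section \<open>Rough paths\<close>

text \<open>An element of \<open>T\<^sup>k(\<real>\<^sup>d)\<close> is given by its coordinates, indexed by words over the index type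
  \<open>'d\<close>; the words of length \<open>i\<close> index the basis of \<open>(\<real>\<^sup>d)\<^sup>\<otimes>\<^sup>i\<close>, with its Euclidean norm.
  Two-parameter maps are set to \<open>0\<close> off the simplex and on words longer than \<open>k\<close>, so that
  equality of functions is equality of rough paths.\<close>

type_synonym 'd tensor = "'d list \<Rightarrow> real"
type_synonym 'd two_param = "real \<Rightarrow> real \<Rightarrow> 'd tensor"

definition tensor_mult :: "'d tensor \<Rightarrow> 'd tensor \<Rightarrow> 'd tensor" where
  "tensor_mult a b v = (\<Sum>j\<le>length v. a (take j v) * b (drop j v))"

definition level_norm :: "nat \<Rightarrow> ('d::finite) tensor \<Rightarrow> real" where
  "level_norm i a = L2_set a {v. length v = i}"

definition hoelder_norm :: "real \<Rightarrow> real \<Rightarrow> nat \<Rightarrow> ('d::finite) two_param \<Rightarrow> ennreal" where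
  "hoelder_norm T \<gamma> i X =
     (SUP (s, t)\<in>{(s, t). 0 \<le> s \<and> s < t \<and> t \<le> T}. ennreal (level_norm i (X s t) / (t - s) powr \<gamma>))"

definition rp_level :: "real \<Rightarrow> nat" where
  "rp_level \<alpha> = nat \<lfloor>1 / \<alpha>\<rfloor>"

definition rough_paths :: "real \<Rightarrow> real \<Rightarrow> ('d::finite) two_param set" where
  "rough_paths T \<alpha> = {X.
     (\<forall>s t v. X s t v \<noteq> 0 \<longrightarrow> 0 \<le> s \<and> s \<le> t \<and> t \<le> T \<and> length v \<le> rp_level \<alpha>) \<and>
     (\<forall>v. continuous_on {(s, t). 0 \<le> s \<and> s \<le> t \<and> t \<le> T} (\<lambda>(s, t). X s t v)) \<and>
     (\<forall>s t. 0 \<le> s \<and> s \<le> t \<and> t \<le> T \<longrightarrow> X s t [] = 1) \<and>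
     (\<forall>s u t v. 0 \<le> s \<and> s \<le> u \<and> u \<le> t \<and> t \<le> T \<and> length v \<le> rp_level \<alpha> \<longrightarrow>
        X s t v = tensor_mult (X s u) (X u t) v) \<and>
     (\<forall>i\<in>{1..rp_level \<alpha>}. hoelder_norm T (real i * \<alpha>) i X < \<infinity>)}"

definition rp_dist :: "real \<Rightarrow> real \<Rightarrow> ('d::finite) two_param \<Rightarrow> 'd two_param \<Rightarrow> real" where
  "rp_dist T \<alpha> X Y =
     enn2real (\<Sum>i=1..rp_level \<alpha>. hoelder_norm T (real i * \<alpha>) i (\<lambda>s t v. X s t v - Y s t v))"

text \<open>\<open>Metric_space.mtopology\<close> is meaningful only for an actual metric, hence the following lemmas.\<close>

lemma hoelder_norm_diff_triangle:
  "hoelder_norm T \<gamma> i (\<lambda>s t v. X s t v - Z s t v) \<le>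
     hoelder_norm T \<gamma> i (\<lambda>s t v. X s t v - Y s t v) + hoelder_norm T \<gamma> i (\<lambda>s t v. Y s t v - Z s t v)"
  unfolding hoelder_norm_def
proof (rule SUP_least, clarify)
  fix s t :: real assume st: "0 \<le> s" "s < t" "t \<le> T"
  let ?I = "{(s, t). 0 \<le> s \<and> s < t \<and> t \<le> T}"
  let ?n = "\<lambda>A :: real \<Rightarrow> real \<Rightarrow> 'a list \<Rightarrow> real. level_norm i (A s t) / (t - s) powr \<gamma>"
  let ?XZ = "\<lambda>s t v. X s t v - Z s t v" and ?XY = "\<lambda>s t v. X s t v - Y s t v"
    and ?YZ = "\<lambda>s t v. Y s t v - Z s t v"
  have "level_norm i (?XZ s t) \<le> level_norm i (?XY s t) + level_norm i (?YZ s t)"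
    using L2_set_triangle_ineq[of "?XY s t" "?YZ s t" "{v. length v = i}"]
    by (simp add: level_norm_def)
  hence "?n ?XZ \<le> ?n ?XY + ?n ?YZ"
    unfolding add_divide_distrib[symmetric] by (intro divide_right_mono) auto
  hence "ennreal (?n ?XZ) \<le> ennreal (?n ?XY + ?n ?YZ)"
    by (rule ennreal_leI)
  also have "\<dots> = ennreal (?n ?XY) + ennreal (?n ?YZ)"
    by (rule ennreal_plus) (simp_all add: level_norm_def)
  also have "\<dots> \<le> (SUP (s, t)\<in>?I. ennreal (level_norm i (?XY s t) / (t - s) powr \<gamma>)) +
                 (SUP (s, t)\<in>?I. ennreal (level_norm i (?YZ s t) / (t - s) powr \<gamma>))"
    by (intro add_mono; rule SUP_upper2[where i = "(s, t)"]) (use st in auto)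
  finally show "ennreal (?n ?XZ) \<le> \<dots>" .
qed

lemma hoelder_norm_commute:
  "hoelder_norm T \<gamma> i (\<lambda>s t v. X s t v - Y s t v) = hoelder_norm T \<gamma> i (\<lambda>s t v. Y s t v - X s t v)"
  by (simp add: hoelder_norm_def level_norm_def L2_set_def power2_commute)

lemma rough_paths_finite:
  "X \<in> rough_paths T \<alpha> \<Longrightarrow> i \<in> {1..rp_level \<alpha>} \<Longrightarrow> hoelder_norm T (real i * \<alpha>) i X < \<infinity>"
  unfolding rough_paths_def by blast

lemma hoelder_norm_diff_finite:
  assumes "X \<in> rough_paths T \<alpha>" "Y \<in> rough_paths T \<alpha>" "i \<in> {1..rp_level \<alpha>}"
  shows "hoelder_norm T (real i * \<alpha>) i (\<lambda>s t v. X s t v - Y s t v) < \<infinity>"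
proof -
  have "hoelder_norm T (real i * \<alpha>) i (\<lambda>s t v. X s t v - Y s t v) \<le>
        hoelder_norm T (real i * \<alpha>) i X + hoelder_norm T (real i * \<alpha>) i Y"
    using hoelder_norm_diff_triangle[of T "real i * \<alpha>" i X Y "\<lambda>_ _ _. 0"]
      hoelder_norm_commute[of T "real i * \<alpha>" i Y "\<lambda>_ _ _. 0"]
    by (simp add: hoelder_norm_def level_norm_def L2_set_def)
  also have "\<dots> < \<infinity>"
    using rough_paths_finite[OF assms(1,3)] rough_paths_finite[OF assms(2,3)] by simp
  finally show ?thesis .
qed

lemma rough_paths_unit: "X \<in> rough_paths T \<alpha> \<Longrightarrow> 0 \<le> s \<Longrightarrow> s \<le> t \<Longrightarrow> t \<le> T \<Longrightarrow> X s t [] = 1"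
  unfolding rough_paths_def by blast

lemma rough_paths_mult:
  "X \<in> rough_paths T \<alpha> \<Longrightarrow> 0 \<le> s \<Longrightarrow> s \<le> u \<Longrightarrow> u \<le> t \<Longrightarrow> t \<le> T \<Longrightarrow> length v \<le> rp_level \<alpha> \<Longrightarrow>
     X s t v = tensor_mult (X s u) (X u t) v"
  unfolding rough_paths_def by blast

lemma rough_paths_zero:
  "X \<in> rough_paths T \<alpha> \<Longrightarrow> \<not> (0 \<le> s \<and> s \<le> t \<and> t \<le> T \<and> length v \<le> rp_level \<alpha>) \<Longrightarrow> X s t v = 0"
  unfolding rough_paths_def by blast

lemma rough_path_diagonal:
  assumes X: "X \<in> rough_paths T \<alpha>" and s: "0 \<le> s" "s \<le> T" and v: "v \<noteq> []"
  shows "X s s v = 0"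
  using v
proof (induction v rule: length_induct)
  case (1 v)
  show ?case
  proof (cases "length v \<le> rp_level \<alpha>")
    case True
    let ?f = "\<lambda>j. X s s (take j v) * X s s (drop j v)"
    have one: "X s s [] = 1" using rough_paths_unit[OF X] s by simp
    have "X s s v = sum ?f {..length v}"
      using rough_paths_mult[OF X s(1) _ _ s(2) True, of s] by (simp add: tensor_mult_def)
    also have "\<dots> = sum ?f {0, length v}"
    proof (rule sum.mono_neutral_right)
      show "\<forall>j\<in>{..length v} - {0, length v}. ?f j = 0"
      proof
        fix j assume j: "j \<in> {..length v} - {0, length v}"
        hence "length (take j v) < length v" "take j v \<noteq> []" by auto
        hence "X s s (take j v) = 0" using "1.IH" by blast
        thus "?f j = 0" by simp
      qed
    qed auto
    also have "\<dots> = 2 * X s s v" using "1.prems" one by simp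
    finally show ?thesis by simp
  next
    case False
    thus ?thesis using rough_paths_zero[OF X] by simp
  qed
qed

lemma Metric_space_rough_paths: "Metric_space (rough_paths T \<alpha>) (rp_dist T \<alpha>)"
proof
  fix X Y :: "'a two_param"
  show "0 \<le> rp_dist T \<alpha> X Y" by (simp add: rp_dist_def)
  show "rp_dist T \<alpha> X Y = rp_dist T \<alpha> Y X"
    by (simp add: rp_dist_def hoelder_norm_commute[of _ _ _ X])
next
  fix X Y Z :: "'a two_param"
  assume XYZ: "X \<in> rough_paths T \<alpha>" "Y \<in> rough_paths T \<alpha>" "Z \<in> rough_paths T \<alpha>"
  let ?h = "\<lambda>X Y. \<Sum>i=1..rp_level \<alpha>. hoelder_norm T (real i * \<alpha>) i (\<lambda>s t v. X s t v - Y s t v)"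
  have fin: "?h A B < \<infinity>" if "A \<in> rough_paths T \<alpha>" "B \<in> rough_paths T \<alpha>" for A B :: "'a two_param"
    using hoelder_norm_diff_finite[OF that] by simp
  have "?h X Z \<le> ?h X Y + ?h Y Z"
    unfolding sum.distrib[symmetric] by (intro sum_mono hoelder_norm_diff_triangle)
  thus "rp_dist T \<alpha> X Z \<le> rp_dist T \<alpha> X Y + rp_dist T \<alpha> Y Z"
    unfolding rp_dist_def using fin[OF XYZ(1,2)] fin[OF XYZ(2,3)]
    by (subst enn2real_plus[symmetric]) (auto intro!: enn2real_mono)
next
  fix X Y :: "'a two_param"
  assume XY: "X \<in> rough_paths T \<alpha>" "Y \<in> rough_paths T \<alpha>"
  show "rp_dist T \<alpha> X Y = 0 \<longleftrightarrow> X = Y"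
  proof
    assume "rp_dist T \<alpha> X Y = 0"
    hence h0: "hoelder_norm T (real i * \<alpha>) i (\<lambda>s t v. X s t v - Y s t v) = 0"
      if "i \<in> {1..rp_level \<alpha>}" for i
    proof -
      have "hoelder_norm T (real j * \<alpha>) j (\<lambda>s t v. X s t v - Y s t v) \<noteq> \<top>"
        if "j \<in> {1..rp_level \<alpha>}" for j
        using hoelder_norm_diff_finite[OF XY that] by simp
      thus ?thesis
        using that \<open>rp_dist T \<alpha> X Y = 0\<close> by (auto simp: rp_dist_def enn2real_eq_0_iff)
    qed
    have "X s t v = Y s t v" for s t v
    proof -
      consider "\<not> (0 \<le> s \<and> s \<le> t \<and> t \<le> T \<and> length v \<le> rp_level \<alpha>)"
        | "0 \<le> s" "s \<le> t" "t \<le> T" "v = []"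
        | "0 \<le> s" "s = t" "t \<le> T" "v \<noteq> []"
        | "0 \<le> s" "s < t" "t \<le> T" "v \<noteq> []" "length v \<le> rp_level \<alpha>" by fastforce
      thus ?thesis
      proof cases
        case 1
        have "X s t v = 0" "Y s t v = 0" using rough_paths_zero XY 1 by blast+
        thus ?thesis by simp
      next
        case 2
        thus ?thesis
          using rough_paths_unit[OF XY(1), of s t] rough_paths_unit[OF XY(2), of s t] by simp
      next
        case 3
        thus ?thesis
          using rough_path_diagonal[OF XY(1), of s v] rough_path_diagonal[OF XY(2), of s v] by simp
      next
        case 4
        let ?D = "\<lambda>v. X s t v - Y s t v" and ?i = "length v"
        have "ennreal (level_norm ?i ?D / (t - s) powr (real ?i * \<alpha>)) \<le>
              hoelder_norm T (real ?i * \<alpha>) ?i (\<lambda>s t v. X s t v - Y s t v)"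
          unfolding hoelder_norm_def by (rule SUP_upper2[where i = "(s, t)"]) (use 4 in auto)
        also have "\<dots> = 0" using 4 by (intro h0) (auto simp: Suc_le_eq)
        finally have "level_norm ?i ?D / (t - s) powr (real ?i * \<alpha>) \<le> 0"
          by (simp add: ennreal_eq_0_iff)
        hence "level_norm ?i ?D \<le> 0"
          using 4 by (simp add: divide_le_0_iff)
        moreover have "\<bar>?D v\<bar> \<le> level_norm ?i ?D"
          unfolding level_norm_def
          using member_le_L2_set[of "{u::'a list. length u = ?i}" v "\<lambda>u. \<bar>?D u\<bar>"]
            finite_lists_length_eq[of "UNIV :: 'a set" ?i]
          by (simp add: L2_set_def)
        ultimately show ?thesis by simp
      qed
    qed
    thus "X = Y" by (intro ext)
  next
    assume "X = Y"
    moreover have "hoelder_norm T \<gamma> i (\<lambda>s t (v::'a list). 0) = 0" for \<gamma> i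
    proof -
      have "hoelder_norm T \<gamma> i (\<lambda>s t (v::'a list). 0) \<le> 0"
        unfolding hoelder_norm_def by (rule SUP_least) (auto simp: level_norm_def L2_set_def)
      thus ?thesis by simp
    qed
    ultimately show "rp_dist T \<alpha> X Y = 0"
      by (simp add: rp_dist_def)
  qed
qed

definition rp_topology :: "real \<Rightarrow> real \<Rightarrow> ('d::finite) two_param topology" where
  "rp_topology T \<alpha> = Metric_space.mtopology (rough_paths T \<alpha>) (rp_dist T \<alpha>)"

text \<open>Riemann--Stieltjes integrals; they exist for continuous integrands and Lipschitz integrators.\<close>

definition has_rs_integral ::
  "(real \<Rightarrow> real) \<Rightarrow> (real \<Rightarrow> real) \<Rightarrow> real \<Rightarrow> real \<Rightarrow> real \<Rightarrow> bool" where
  "has_rs_integral f g a b I \<longleftrightarrow>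
     (\<forall>\<epsilon>>0. \<exists>\<delta>>0. \<forall>p\<in>partitions a b. \<forall>\<tau>.
        (\<forall>j<length p - 1. p ! j \<le> \<tau> j \<and> \<tau> j \<le> p ! Suc j \<and> p ! Suc j - p ! j < \<delta>) \<longrightarrow>
        \<bar>(\<Sum>j<length p - 1. f (\<tau> j) * (g (p ! Suc j) - g (p ! j))) - I\<bar> < \<epsilon>)"

definition rs_integral :: "(real \<Rightarrow> real) \<Rightarrow> (real \<Rightarrow> real) \<Rightarrow> real \<Rightarrow> real \<Rightarrow> real" where
  "rs_integral f g a b = (THE I. has_rs_integral f g a b I)"

text \<open>The coordinates of the iterated integrals over \<open>s \<le> t\<^sub>1 \<le> \<dots> \<le> t\<^sub>n \<le> t\<close>; the outermost integration
  variable is \<open>t\<^sub>1\<close>.\<close>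

primrec iterated_integral :: "(real \<Rightarrow> real ^ 'd) \<Rightarrow> 'd list \<Rightarrow> real \<Rightarrow> real \<Rightarrow> real" where
  "iterated_integral x [] s t = 1"
| "iterated_integral x (i # v) s t =
     rs_integral (\<lambda>u. iterated_integral x v u t) (\<lambda>u. x u $ i) s t"

definition signature :: "real \<Rightarrow> nat \<Rightarrow> (real \<Rightarrow> real ^ 'd) \<Rightarrow> 'd two_param" where
  "signature T k x s t v =
     (if 0 \<le> s \<and> s \<le> t \<and> t \<le> T \<and> length v \<le> k then iterated_integral x v s t else 0)"

definition geometric_rough_paths :: "real \<Rightarrow> real \<Rightarrow> ('d::finite) two_param set" where
  "geometric_rough_paths T \<alpha> =
     rp_topology T \<alpha> closure_of (signature T (rp_level \<alpha>) ` lipschitz_paths T)"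

definition geometric_rp_topology :: "real \<Rightarrow> real \<Rightarrow> ('d::finite) two_param topology" where
  "geometric_rp_topology T \<alpha> = subtopology (rp_topology T \<alpha>) (geometric_rough_paths T \<alpha>)"

definition zero_rough_path :: "real \<Rightarrow> 'd two_param" where
  "zero_rough_path T s t v = (if 0 \<le> s \<and> s \<le> t \<and> t \<le> T \<and> v = [] then 1 else 0)"


section \<open>The rough path lift\<close>

definition dyadic_interpolation ::
  "real \<Rightarrow> nat \<Rightarrow> ('d::finite) path \<Rightarrow> real \<Rightarrow> real ^ 'd" where
  "dyadic_interpolation T l x t =
     (let \<delta> = T / 2 ^ l; j = of_int \<lfloor>t / \<delta>\<rfloor> in
      apply_bcontfun x (j * \<delta>) +
      ((t - j * \<delta>) / \<delta>) *\<^sub>R (apply_bcontfun x ((j + 1) * \<delta>) - apply_bcontfun x (j * \<delta>)))"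

definition dyadic_lift :: "real \<Rightarrow> real \<Rightarrow> nat \<Rightarrow> ('d::finite) path \<Rightarrow> 'd two_param" where
  "dyadic_lift T \<alpha> l x = signature T (rp_level \<alpha>) (dyadic_interpolation T l x)"

text \<open>In the next two definitions \<open>l\<close> starts from \<open>0\<close>, which does not affect the limit.\<close>

definition lift_domain ::
  "real \<Rightarrow> real \<Rightarrow> ('d::finite) path wiener_space \<Rightarrow> 'd path set" where
  "lift_domain T \<alpha> B = {x \<in> wspace B. \<exists>X.
     limitin (geometric_rp_topology T \<alpha>) (\<lambda>l. dyadic_lift T \<alpha> l x) X sequentially}"

definition rp_lift ::
  "real \<Rightarrow> real \<Rightarrow> ('d::finite) path wiener_space \<Rightarrow> 'd path \<Rightarrow> 'd two_param" where
  "rp_lift T \<alpha> B x =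
     (if x \<in> lift_domain T \<alpha> B
      then THE X. limitin (geometric_rp_topology T \<alpha>) (\<lambda>l. dyadic_lift T \<alpha> l x) X sequentially
      else zero_rough_path T)"

end

theory Submission
  imports Defs
begin

text \<open>
  A nonnegative polynomial in the evaluations, homogeneous of degree \<open>N\<close>, has all its Sobolev norms
  bounded by its \<open>L\<^sup>2\<close>-norm, by hypercontractivity and Bessel's inequality. Hence, if \<open>G\<^sub>m \<ge> 0\<close> are such polynomials
  with \<open>\<Sum>\<^sub>m \<parallel>G\<^sub>m\<parallel> < \<infinity>\<close> in \<open>L\<^sup>2\<close>, the open set where some \<open>G\<^sub>m\<close> exceeds \<open>K\<close> has capacity \<open>O(1/K)\<close>.
  This is applied to sums \<open>G\<^sub>m\<close> of high powers of the increments of the path and of the differences of the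
  iterated integrals of \<open>w(m + 1)\<close> and \<open>w(m)\<close> over dyadic intervals. These differences are explicit sums of
  products of increments over cells of level \<open>m + 1\<close>; their second moments follow from Wick's formula and the
  bound on the \<open>\<rho>\<close>-variation, in which \<open>\<rho> < 2\<close> leaves a positive power of the cell size.
  Off the exceptional set the dyadic bounds imply Hoelder bounds by chaining, so that the continuous maps \<open>W(m)\<close>
  converge uniformly; this gives both the existence of the limit and the continuity of the lift.
  Only upper bounds of integrals over \<open>\<W>\<close> are needed, so that \<open>\<mu>(\<W>) = 1\<close> plays no role.
\<close>

section \<open>Polynomials in Gaussian forms\<close>

text \<open>Gaussianity enters through the moments of single linear forms; polynomials are kept as
  sums \<open>\<Sum>r. c r * L r ^ n\<close>. Homogeneity is what makes the moment bounds
  elementary: for an independent copy \<open>y\<close> of \<open>x\<close> the point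
  \<open>x + y\<close> is distributed like a multiple of \<open>x\<close>, and comparing fourth
  moments on both sides allows an induction on the degree. Derivatives of such sums are governed by
  the Gram-type expression \<open>cov_form\<close>, again a nonnegative homogeneous polynomial, so
  the same bounds apply to it.

  The powers in \<open>G m\<close> must be high because level \<open>m\<close> carries about
  \<open>2 ^ m\<close> intervals while each normalized quantity gains only a small factor
  \<open>r ^ m\<close>. This gain has two sources: \<open>1 / \<rho> - 2 * \<alpha> > 0\<close> for
  the size of the interval, and the interpolation exponent \<open>2 - \<rho>\<close> for the depth
  of refinement.

  The delicate moment is that of the third level, where a bracket of two cells is multiplied by an
  increment over a long interval that varies from cell to cell. The variation bound speaks of fixed
  partitions only; one envelope valid for all long intervals costs a power of the depth, which the
  exponential gain absorbs.\<close>

lemma coefficient_extraction: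
  fixes n :: nat
  assumes "j \<le> n"
  obtains c :: "nat \<Rightarrow> real"
  where "\<And>a. (a j :: real) = (\<Sum>i\<le>n. c i * (\<Sum>k\<le>n. a k * real i ^ k))"
proof -
  \<comment> \<open>The Lagrange basis for the nodes \<open>0, ..., n\<close>. A polynomial of
    degree at most \<open>n\<close> is the combination of the \<open>l i\<close> with its values at
    the nodes as weights, so its \<open>j\<close>-th coefficient is a combination of these values
    with weights \<open>coeff (l i) j\<close> that do not depend on the polynomial. This serves for
    polarization and for bounding the coefficients of \<open>F (x + s y)\<close> in L2.\<close>
  define l :: "nat \<Rightarrow> real poly" where
    "l i = (\<Prod>k\<in>{..n} - {i}. smult (1 / (real i - real k)) [:- real k, 1:])" for i
  have poly_l: "poly (l i) (real m) = (if i = m then 1 else 0)" if "i \<le> n" "m \<le> n" for i m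
  proof (cases "i = m")
    case True
    show ?thesis unfolding l_def poly_prod using True
      by (subst prod.neutral) (auto simp: diff_divide_distrib[symmetric])
  next
    case False
    have "\<exists>k\<in>{..n} - {i}. poly (smult (1 / (real i - real k)) [:- real k, 1:]) (real m) = 0"
      using False that by (intro bexI[of _ m]) auto
    thus ?thesis unfolding l_def poly_prod using False by (simp add: prod_zero_iff)
  qed
  have deg_l: "degree (l i) \<le> n" if "i \<le> n" for i
  proof -
    have "degree (l i) \<le> (\<Sum>k\<in>{..n} - {i}. degree (smult (1 / (real i - real k)) [:- real k, 1:]))"
      unfolding l_def by (rule order.trans[OF degree_prod_sum_le]) (simp_all only: o_def, simp_all)
    also have "\<dots> \<le> (\<Sum>k\<in>{..n} - {i}. 1)"
      by (intro sum_mono order.trans[OF degree_smult_le]) simp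
    also have "\<dots> = n" using that by simp
    finally show ?thesis .
  qed
  show ?thesis
  proof
    fix a :: "nat \<Rightarrow> real"
    define p where "p = (\<Sum>k\<le>n. monom (a k) k)"
    define q where "q = (\<Sum>i\<le>n. smult (poly p (real i)) (l i))"
    have "p = q"
    proof (rule poly_eqI_degree)
      show "poly p x = poly q x" if "x \<in> real ` {..n}" for x
      proof -
        obtain m where m: "m \<le> n" "x = real m" using \<open>x \<in> real ` {..n}\<close> by (elim imageE) simp
        have "poly q x = (\<Sum>i\<le>n. poly p (real i) * (if i = m then 1 else 0))"
          unfolding q_def poly_sum m using m(1) by (intro sum.cong) (auto simp: poly_l)
        also have "\<dots> = poly p x" using m by (simp add: if_distrib sum.delta cong: if_cong)
        finally show ?thesis ..
      qed
      have card: "card (real ` {..n}) = Suc n" by (subst card_image) auto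
      show "degree p < card (real ` {..n})"
        unfolding card p_def by (intro le_imp_less_Suc degree_sum_le) (auto intro: order.trans[OF degree_monom_le])
      show "degree q < card (real ` {..n})"
        unfolding card q_def
        by (intro le_imp_less_Suc degree_sum_le) (auto intro!: order.trans[OF degree_smult_le] deg_l)
    qed
    moreover have "coeff p j = a j"
      unfolding p_def coeff_sum using assms by (simp add: sum.delta)
    ultimately have "a j = coeff q j" by simp
    also have "\<dots> = (\<Sum>i\<le>n. coeff (l i) j * poly p (real i))"
      unfolding q_def coeff_sum by (simp add: mult.commute)
    also have "poly p = (\<lambda>x. \<Sum>k\<le>n. a k * x ^ k)"
      unfolding p_def by (intro ext) (simp add: poly_sum poly_monom)
    finally show "a j = (\<Sum>i\<le>n. coeff (l i) j * (\<Sum>k\<le>n. a k * real i ^ k))" .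
  qed
qed

section \<open>Gaussian moments and homogeneous polynomials in Gaussian forms\<close>

lemma pair_integral_mult:
  fixes f :: "'a \<Rightarrow> real" and g :: "'b \<Rightarrow> real"
  assumes "prob_space M" "prob_space N" and f: "integrable M f" and g: "integrable N g"
  shows "has_bochner_integral (M \<Otimes>\<^sub>M N) (\<lambda>p. f (fst p) * g (snd p))
    (integral\<^sup>L M f * integral\<^sup>L N g)"
proof -
  interpret M: prob_space M by fact
  interpret N: prob_space N by fact
  interpret pair_prob_space M N ..
  have meas [measurable]: "f \<in> borel_measurable M" "g \<in> borel_measurable N"
    using f g by auto
  have int: "integrable (M \<Otimes>\<^sub>M N) (\<lambda>p. f (fst p) * g (snd p))"
    by (rule Fubini_integrable) (use f g in \<open>auto simp: abs_mult\<close>)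
  have "integral\<^sup>L (M \<Otimes>\<^sub>M N) (\<lambda>p. f (fst p) * g (snd p)) = (\<integral>x. \<integral>y. f x * g y \<partial>N \<partial>M)"
    using integral_fst[of "\<lambda>x y. f x * g y"] int by (simp add: case_prod_beta')
  also have "\<dots> = integral\<^sup>L M f * integral\<^sup>L N g" by simp
  finally show ?thesis using int by (simp add: has_bochner_integral_iff)
qed

text \<open>The \<open>n\<close>-th moment of the standard normal law, that is
  \<open>(n - 1)!!\<close> for even \<open>n\<close>.\<close>

definition gauss_moment :: "nat \<Rightarrow> real" where
  "gauss_moment n = (if even n then fact n / (2 ^ (n div 2) * fact (n div 2)) else 0)"

lemma gauss_moment_0 [simp]: "gauss_moment 0 = 1"
  and gauss_moment_2 [simp]: "gauss_moment 2 = 1"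
  and gauss_moment_1 [simp]: "gauss_moment (Suc 0) = 0"
  and gauss_moment_4: "gauss_moment 4 = 3"
  by (simp_all add: gauss_moment_def fact_numeral)

lemma gauss_moment_Suc_Suc: "gauss_moment (Suc (Suc n)) = (real n + 1) * gauss_moment n"
proof (cases "even n")
  case True
  then obtain k where n: "n = 2 * k" by (elim evenE)
  have "fact (Suc (Suc (2 * k))) = (2 * real k + 2) * (2 * real k + 1) * fact (2 * k)"
    by (simp add: algebra_simps)
  moreover have "(2::real) ^ Suc k * fact (Suc k) = (2 * real k + 2) * (2 ^ k * fact k)"
    by (simp add: algebra_simps)
  ultimately show ?thesis unfolding gauss_moment_def n by (simp del: fact_Suc power_Suc)
qed (simp add: gauss_moment_def)

text \<open>The moment version of the fact that independent centered normal variables of variances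
  \<open>a\<close> and \<open>b\<close> have a normal sum of variance \<open>a + b\<close>. Only
  even \<open>j\<close> contribute, and there the factorials turn
  \<open>2 * k choose (2 * i)\<close> into \<open>k choose i\<close>, which leaves the binomial
  formula for \<open>(a + b) ^ k\<close>.\<close>

lemma gauss_moment_add:
  "(\<Sum>j\<le>n. real (n choose j) * (gauss_moment j * a ^ (j div 2)) *
      (gauss_moment (n - j) * b ^ ((n - j) div 2))) = gauss_moment n * (a + b) ^ (n div 2)"
proof (cases "even n")
  case False
  hence "gauss_moment j = 0 \<or> gauss_moment (n - j) = 0" if "j \<le> n" for j
    using that by (auto simp: gauss_moment_def)
  hence "real (n choose j) * (gauss_moment j * a ^ (j div 2)) *
      (gauss_moment (n - j) * b ^ ((n - j) div 2)) = 0" if "j \<le> n" for j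
    using that by fastforce
  thus ?thesis using False by (subst sum.neutral) (auto simp: gauss_moment_def)
next
  case True
  then obtain k where n: "n = 2 * k" by (elim evenE)
  let ?f = "\<lambda>j. real (n choose j) * (gauss_moment j * a ^ (j div 2)) *
      (gauss_moment (n - j) * b ^ ((n - j) div 2))"
  have "(\<Sum>j\<le>n. ?f j) = (\<Sum>j\<in>(*) 2 ` {..k}. ?f j)"
  proof (rule sum.mono_neutral_right)
    show "\<forall>i\<in>{..n} - (*) 2 ` {..k}. ?f i = 0"
    proof
      fix i assume i: "i \<in> {..n} - (*) 2 ` {..k}"
      have "odd i"
      proof
        assume "even i"
        then obtain m where "i = 2 * m" by (elim evenE)
        thus False using i by (auto simp: n)
      qed
      thus "?f i = 0" by (simp add: gauss_moment_def)
    qed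
  qed (auto simp: n)
  also have "\<dots> = (\<Sum>i\<le>k. ?f (2 * i))"
    by (subst sum.reindex) (auto simp: inj_on_def)
  also have "\<dots> = (\<Sum>i\<le>k. gauss_moment n * (real (k choose i) * a ^ i * b ^ (k - i)))"
  proof (rule sum.cong)
    fix i assume "i \<in> {..k}"
    hence i: "i \<le> k" by simp
    have e: "2 * k - 2 * i = 2 * (k - i)" by simp
    have *: "real (2 * k choose (2 * i)) = fact (2 * k) / (fact (2 * i) * fact (2 * (k - i)))"
      using i e by (subst binomial_fact) (auto simp del: fact_double simp: diff_mult_distrib2)
    have **: "real (k choose i) = fact k / (fact i * fact (k - i))"
      using i by (subst binomial_fact) auto
    have p: "(2::real) ^ k = 2 ^ i * 2 ^ (k - i)" using i by (simp flip: power_add)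
    show "?f (2 * i) = gauss_moment n * (real (k choose i) * a ^ i * b ^ (k - i))"
      unfolding n e * ** gauss_moment_def by (simp add: p)
  qed simp
  also have "\<dots> = gauss_moment n * (a + b) ^ k"
    by (simp add: binomial_ring sum_distrib_left)
  finally show ?thesis by (simp add: n)
qed

text \<open>Joint Gaussianity is encoded by the moments of every single form, which suffices because
  \<open>Lin\<close> is closed under linear combinations. Forms of zero variance are included, and
  the axioms are inherited by products of two such spaces, where independent copies live.\<close>

locale gaussian_forms =
  fixes \<mu> :: "'b::real_vector measure" and Lin :: "('b \<Rightarrow> real) set"
  assumes prob: "prob_space \<mu>"
    and Lin_zero: "(\<lambda>_. 0) \<in> Lin"
    and Lin_add: "L \<in> Lin \<Longrightarrow> L' \<in> Lin \<Longrightarrow> (\<lambda>x. L x + L' x) \<in> Lin"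
    and Lin_scale: "L \<in> Lin \<Longrightarrow> (\<lambda>x. c * L x) \<in> Lin"
    and form_add: "L \<in> Lin \<Longrightarrow> L (x + y) = L x + L y"
    and form_scale: "L \<in> Lin \<Longrightarrow> L (c *\<^sub>R x) = c * L x"
    and moments: "L \<in> Lin \<Longrightarrow>
      has_bochner_integral \<mu> (\<lambda>x. L x ^ n) (gauss_moment n * (\<integral>x. (L x)\<^sup>2 \<partial>\<mu>) ^ (n div 2))"
begin

sublocale prob_space \<mu> by (rule prob)

lemma form_measurable: "L \<in> Lin \<Longrightarrow> L \<in> borel_measurable \<mu>"
  using borel_measurable_integrable[OF integrable.intros[OF moments[of L 1]]] by simp

lemma Lin_sum: "(\<And>i. i \<in> A \<Longrightarrow> L i \<in> Lin) \<Longrightarrow> (\<lambda>x. \<Sum>i\<in>A. c i * L i x) \<in> Lin"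
  by (induction A rule: infinite_finite_induct) (auto intro!: Lin_zero Lin_add Lin_scale)

text \<open>By polarization these are all homogeneous polynomials of degree \<open>n\<close> in the
  forms. With powers of single forms as generators, each induction comes down to one Gaussian
  variable.\<close>

inductive_set hom :: "nat \<Rightarrow> ('b \<Rightarrow> real) set" for n where
  pow: "L \<in> Lin \<Longrightarrow> (\<lambda>x. c * L x ^ n) \<in> hom n"
| add: "F \<in> hom n \<Longrightarrow> G \<in> hom n \<Longrightarrow> (\<lambda>x. F x + G x) \<in> hom n"

lemma hom_scale: "F \<in> hom n \<Longrightarrow> (\<lambda>x. a * F x) \<in> hom n"
proof (induction rule: hom.induct)
  case (pow L c)
  have "(\<lambda>x. (a * c) * L x ^ n) \<in> hom n" by (rule hom.pow) (rule pow)
  thus ?case by (simp add: mult.assoc)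
next
  case (add F G)
  thus ?case using hom.add[OF add.IH] by (simp add: distrib_left)
qed

lemma hom_zero: "(\<lambda>_. 0) \<in> hom n"
  using hom.pow[OF Lin_zero, of 0 n] by simp

lemma hom_sum: "(\<And>i. i \<in> A \<Longrightarrow> F i \<in> hom n) \<Longrightarrow> (\<lambda>x. \<Sum>i\<in>A. F i x) \<in> hom n"
  by (induction A rule: infinite_finite_induct) (auto intro: hom_zero hom.add)

lemma hom_rep:
  assumes "F \<in> hom n"
  obtains N :: nat and c L where "\<And>r. r < N \<Longrightarrow> L r \<in> Lin"
    and "F = (\<lambda>x. \<Sum>r<N. c r * L r x ^ n)"
proof -
  have "\<exists>(N::nat) c L. (\<forall>r<N. L r \<in> Lin) \<and> F = (\<lambda>x. \<Sum>r<N. c r * L r x ^ n)"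
    using assms
  proof (induction rule: hom.induct)
    case (pow L c)
    thus ?case by (intro exI[of _ 1] exI[of _ "\<lambda>_. c"] exI[of _ "\<lambda>_. L"]) auto
  next
    case (add F G)
    from add.IH(1) obtain N1 :: nat and c1 L1
      where 1: "\<forall>r<N1. L1 r \<in> Lin" "F = (\<lambda>x. \<Sum>r<N1. c1 r * L1 r x ^ n)" by blast
    from add.IH(2) obtain N2 :: nat and c2 L2
      where 2: "\<forall>r<N2. L2 r \<in> Lin" "G = (\<lambda>x. \<Sum>r<N2. c2 r * L2 r x ^ n)" by blast
    let ?c = "\<lambda>r. if r < N1 then c1 r else c2 (r - N1)"
    let ?L = "\<lambda>r. if r < N1 then L1 r else L2 (r - N1)"
    have split: "(\<Sum>r<N1 + N2. f r) = (\<Sum>r<N1. f r) + (\<Sum>r<N2. f (N1 + r))"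
      for f :: "nat \<Rightarrow> real"
      by (induction N2) (auto simp: add.assoc)
    have "(\<lambda>x. F x + G x) = (\<lambda>x. \<Sum>r<N1 + N2. ?c r * ?L r x ^ n)"
      unfolding split 1(2) 2(2) by simp
    moreover have "\<forall>r<N1 + N2. ?L r \<in> Lin" using 1(1) 2(1) by auto
    ultimately show ?case by (intro exI[of _ "N1 + N2"] exI[of _ ?c] exI[of _ ?L] conjI)
  qed
  thus ?thesis using that by blast
qed

text \<open>Polarization: \<open>(n + 1) * L' * L ^ n\<close> is the coefficient of \<open>s\<close>
  in \<open>(L + s * L') ^ (n + 1)\<close>, and this coefficient is a combination of the values at
  \<open>s = 0, ..., n + 1\<close>, which are powers of forms.\<close>

lemma hom_mult_form:
  assumes "L' \<in> Lin" "F \<in> hom n"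
  shows "(\<lambda>x. L' x * F x) \<in> hom (Suc n)"
  using assms(2)
proof (induction rule: hom.induct)
  case (pow L a)
  obtain c where c: "\<And>p. (p 1 :: real) = (\<Sum>i\<le>Suc n. c i * (\<Sum>k\<le>Suc n. p k * real i ^ k))"
    using coefficient_extraction[of 1 "Suc n"] by auto
  have "L' x * (a * L x ^ n) = (\<Sum>i\<le>Suc n. (a * c i / (real n + 1)) * (L x + real i * L' x) ^ Suc n)" for x
  proof -
    let ?p = "\<lambda>k. real (Suc n choose k) * L' x ^ k * L x ^ (Suc n - k)"
    have "(\<Sum>k\<le>Suc n. ?p k * real i ^ k) = (L x + real i * L' x) ^ Suc n" for i
    proof -
      have "(L x + real i * L' x) ^ Suc n = (real i * L' x + L x) ^ Suc n" by (simp add: add.commute)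
      also have "\<dots> = (\<Sum>k\<le>Suc n. ?p k * real i ^ k)"
        unfolding binomial_ring by (intro sum.cong) (auto simp: power_mult_distrib mult_ac)
      finally show ?thesis ..
    qed
    hence "?p 1 = (\<Sum>i\<le>Suc n. c i * (L x + real i * L' x) ^ Suc n)"
      using c[of ?p] by simp
    moreover have "?p 1 = (real n + 1) * (L' x * L x ^ n)" by simp
    ultimately have "L' x * L x ^ n = (\<Sum>i\<le>Suc n. c i * (L x + real i * L' x) ^ Suc n) / (real n + 1)"
      by (simp add: field_simps)
    hence "L' x * (a * L x ^ n) = a * ((\<Sum>i\<le>Suc n. c i * (L x + real i * L' x) ^ Suc n) / (real n + 1))"
      by (simp add: mult_ac)
    also have "\<dots> = (\<Sum>i\<le>Suc n. (a * c i / (real n + 1)) * (L x + real i * L' x) ^ Suc n)"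
      by (simp add: sum_distrib_left sum_divide_distrib mult_ac del: sum.atMost_Suc power_Suc)
    finally show ?thesis .
  qed
  moreover have "(\<lambda>x. \<Sum>i\<le>Suc n. (a * c i / (real n + 1)) * (L x + real i * L' x) ^ Suc n) \<in> hom (Suc n)"
    by (intro hom_sum hom.pow Lin_add Lin_scale pow assms)
  ultimately show ?case by simp
next
  case (add F G)
  thus ?case using hom.add[OF add.IH] by (simp add: distrib_left)
qed

lemma hom_mult:
  assumes "F \<in> hom m" "G \<in> hom n"
  shows "(\<lambda>x. F x * G x) \<in> hom (m + n)"
  using assms(1)
proof (induction rule: hom.induct)
  case (pow L c)
  have "(\<lambda>x. L x ^ m * G x) \<in> hom (m + n)"
  proof (induction m)
    case (Suc m)
    show ?case using hom_mult_form[OF pow Suc] by (simp add: mult.assoc)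
  qed (use assms in simp)
  from hom_scale[OF this, of c] show ?case by (simp add: mult.assoc)
next
  case (add F1 F2)
  thus ?case using hom.add[OF add.IH] by (simp add: distrib_right)
qed

lemma hom_const: "(\<lambda>_. c) \<in> hom 0"
  using hom.pow[OF Lin_zero, of c 0] by simp

lemma hom_form: "L \<in> Lin \<Longrightarrow> L \<in> hom 1"
  using hom.pow[of L 1 1] by simp

lemma hom_power: "F \<in> hom n \<Longrightarrow> (\<lambda>x. F x ^ k) \<in> hom (n * k)"
proof (induction k)
  case (Suc k)
  thus ?case using hom_mult[of F n "\<lambda>x. F x ^ k" "n * k"] by simp
qed (simp add: hom_const)

lemma hom_integrable: "F \<in> hom n \<Longrightarrow> integrable \<mu> F"
  by (induction rule: hom.induct)
     (auto intro!: integrable_mult_right integrable.intros[OF moments])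

lemma hom_measurable: "F \<in> hom n \<Longrightarrow> F \<in> borel_measurable \<mu>"
  using hom_integrable borel_measurable_integrable by blast

lemma hom_power_integrable: "F \<in> hom n \<Longrightarrow> integrable \<mu> (\<lambda>x. F x ^ k)"
  using hom_integrable[OF hom_power] .

lemma hom_0_const: "F \<in> hom 0 \<Longrightarrow> \<exists>c. F = (\<lambda>_. c)"
  by (induction rule: hom.induct) auto

lemma hom_1_form: "F \<in> hom 1 \<Longrightarrow> F \<in> Lin"
  by (induction rule: hom.induct) (auto intro: Lin_scale Lin_add)

end

text \<open>The binomial expansion separates the two coordinates, Fubini evaluates each term, and
  \<open>gauss_moment_add\<close> sums them to the moment that belongs to the added
  variances.\<close>

lemma gaussian_forms_pair:
  assumes "gaussian_forms \<mu> Lin" "gaussian_forms \<nu> Lin'"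
  shows "gaussian_forms (\<mu> \<Otimes>\<^sub>M \<nu>) {\<lambda>p. L (fst p) + L' (snd p) |L L'. L \<in> Lin \<and> L' \<in> Lin'}"
    (is "gaussian_forms _ ?P")
proof -
  interpret A: gaussian_forms \<mu> Lin by fact
  interpret B: gaussian_forms \<nu> Lin' by fact
  interpret pair_prob_space \<mu> \<nu> ..
  show ?thesis
  proof
    show "(\<lambda>_. 0) \<in> ?P"
      using A.Lin_zero B.Lin_zero
      by (intro CollectI exI[of _ "\<lambda>_. 0"]) auto
  next
    fix K K' assume "K \<in> ?P" "K' \<in> ?P"
    then obtain L L' M M' where "L \<in> Lin" "L' \<in> Lin'" "M \<in> Lin" "M' \<in> Lin'"
      and K: "K = (\<lambda>p. L (fst p) + L' (snd p))" "K' = (\<lambda>p. M (fst p) + M' (snd p))" by blast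
    hence "(\<lambda>x. L x + M x) \<in> Lin" "(\<lambda>x. L' x + M' x) \<in> Lin'"
      by (auto intro: A.Lin_add B.Lin_add)
    moreover have "(\<lambda>p. K p + K' p) = (\<lambda>p. (\<lambda>x. L x + M x) (fst p) + (\<lambda>x. L' x + M' x) (snd p))"
      by (simp add: K fun_eq_iff)
    ultimately show "(\<lambda>p. K p + K' p) \<in> ?P"
      by (intro CollectI exI[of _ "\<lambda>x. L x + M x"] exI[of _ "\<lambda>x. L' x + M' x"]) simp
  next
    fix K c assume "K \<in> ?P"
    then obtain L L' where "L \<in> Lin" "L' \<in> Lin'"
      and K: "K = (\<lambda>p. L (fst p) + L' (snd p))" by blast
    hence "(\<lambda>x. c * L x) \<in> Lin" "(\<lambda>x. c * L' x) \<in> Lin'"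
      by (auto intro: A.Lin_scale B.Lin_scale)
    moreover have "(\<lambda>p. c * K p) = (\<lambda>p. (\<lambda>x. c * L x) (fst p) + (\<lambda>x. c * L' x) (snd p))"
      by (simp add: K fun_eq_iff distrib_left)
    ultimately show "(\<lambda>p. c * K p) \<in> ?P"
      by (intro CollectI exI[of _ "\<lambda>x. c * L x"] exI[of _ "\<lambda>x. c * L' x"]) simp
  next
    fix K x y assume "K \<in> ?P"
    thus "K (x + y) = K x + K y" by (auto simp: A.form_add B.form_add)
  next
    fix K c x assume "K \<in> ?P"
    thus "K (c *\<^sub>R x) = c * K x" by (auto simp: A.form_scale B.form_scale distrib_left)
  next
    fix K n assume "K \<in> ?P"
    then obtain L L' where L: "L \<in> Lin" "L' \<in> Lin'"
      and K: "K = (\<lambda>p. L (fst p) + L' (snd p))" by blast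
    let ?a = "\<integral>x. (L x)\<^sup>2 \<partial>\<mu>" and ?b = "\<integral>x. (L' x)\<^sup>2 \<partial>\<nu>"
    have mom: "has_bochner_integral (\<mu> \<Otimes>\<^sub>M \<nu>) (\<lambda>p. K p ^ m)
        (gauss_moment m * (?a + ?b) ^ (m div 2))" for m
    proof -
      have "has_bochner_integral (\<mu> \<Otimes>\<^sub>M \<nu>)
        (\<lambda>p. \<Sum>j\<le>m. real (m choose j) * (L (fst p) ^ j * L' (snd p) ^ (m - j)))
        (\<Sum>j\<le>m. real (m choose j) * ((gauss_moment j * ?a ^ (j div 2)) *
           (gauss_moment (m - j) * ?b ^ ((m - j) div 2))))"
      proof (rule has_bochner_integral_sum, rule has_bochner_integral_mult_right)
        fix j
        show "has_bochner_integral (\<mu> \<Otimes>\<^sub>M \<nu>) (\<lambda>p. L (fst p) ^ j * L' (snd p) ^ (m - j))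
          ((gauss_moment j * ?a ^ (j div 2)) * (gauss_moment (m - j) * ?b ^ ((m - j) div 2)))"
          using pair_integral_mult[OF A.prob B.prob
             integrable.intros[OF A.moments[OF L(1), of j]]
             integrable.intros[OF B.moments[OF L(2), of "m - j"]]]
          by (simp add: has_bochner_integral_integral_eq[OF A.moments[OF L(1), of j]]
               has_bochner_integral_integral_eq[OF B.moments[OF L(2), of "m - j"]])
      qed
      also have "(\<lambda>p. \<Sum>j\<le>m. real (m choose j) * (L (fst p) ^ j * L' (snd p) ^ (m - j))) = (\<lambda>p. K p ^ m)"
        by (intro ext) (simp add: K binomial_ring mult.assoc)
      also have "(\<Sum>j\<le>m. real (m choose j) * ((gauss_moment j * ?a ^ (j div 2)) *
           (gauss_moment (m - j) * ?b ^ ((m - j) div 2)))) = gauss_moment m * (?a + ?b) ^ (m div 2)"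
        using gauss_moment_add[of m ?a ?b] by (simp add: mult.assoc)
      finally show ?thesis .
    qed
    have "(\<integral>p. (K p)\<^sup>2 \<partial>(\<mu> \<Otimes>\<^sub>M \<nu>)) = ?a + ?b"
      using has_bochner_integral_integral_eq[OF mom[of 2]] by simp
    thus "has_bochner_integral (\<mu> \<Otimes>\<^sub>M \<nu>) (\<lambda>p. K p ^ n)
        (gauss_moment n * (\<integral>p. (K p)\<^sup>2 \<partial>(\<mu> \<Otimes>\<^sub>M \<nu>)) ^ (n div 2))"
      using mom[of n] by simp
  qed
qed

section \<open>Hypercontractivity\<close>

lemma integral_Cauchy_Schwarz:
  fixes f g :: "'a \<Rightarrow> real"
  assumes "integrable M (\<lambda>x. (f x)\<^sup>2)" "integrable M (\<lambda>x. (g x)\<^sup>2)" "integrable M (\<lambda>x. f x * g x)"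
  shows "(\<integral>x. f x * g x \<partial>M)\<^sup>2 \<le> (\<integral>x. (f x)\<^sup>2 \<partial>M) * (\<integral>x. (g x)\<^sup>2 \<partial>M)"
proof -
  let ?A = "\<integral>x. (f x)\<^sup>2 \<partial>M" and ?B = "\<integral>x. f x * g x \<partial>M" and ?C = "\<integral>x. (g x)\<^sup>2 \<partial>M"
  have q: "0 \<le> ?A - 2 * t * ?B + t\<^sup>2 * ?C" for t
  proof -
    have "0 \<le> (\<integral>x. (f x - t * g x)\<^sup>2 \<partial>M)" by simp
    also have "(\<lambda>x. (f x - t * g x)\<^sup>2) = (\<lambda>x. (f x)\<^sup>2 - 2 * t * (f x * g x) + t\<^sup>2 * (g x)\<^sup>2)"
      by (simp add: fun_eq_iff power2_eq_square algebra_simps)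
    also have "(\<integral>x. (f x)\<^sup>2 - 2 * t * (f x * g x) + t\<^sup>2 * (g x)\<^sup>2 \<partial>M) = ?A - 2 * t * ?B + t\<^sup>2 * ?C"
      using assms by simp
    finally show ?thesis .
  qed
  have C: "0 \<le> ?C" by simp
  show ?thesis
  proof (cases "?C = 0")
    case True
    have "?B = 0"
    proof (rule ccontr)
      assume B: "?B \<noteq> 0"
      \<comment> \<open>With \<open>?C = 0\<close> this \<open>t\<close> gives the nonnegative
        expression the value \<open>-1\<close>.\<close>
      have "2 * ((?A + 1) / (2 * ?B)) * ?B = ?A + 1" using B by (simp add: field_simps)
      thus False using q[of "(?A + 1) / (2 * ?B)"] True by simp
    qed
    thus ?thesis using True by simp
  next
    case False
    have "0 \<le> ?C * (?A - 2 * (?B / ?C) * ?B + (?B / ?C)\<^sup>2 * ?C)"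
      using q[of "?B / ?C"] C by simp
    also have "\<dots> = ?A * ?C - ?B\<^sup>2"
      using False by (simp add: field_simps power2_eq_square)
    finally show ?thesis by simp
  qed
qed

lemma (in prob_space) integral_square_le:
  fixes f :: "'a \<Rightarrow> real"
  assumes "integrable M f" "integrable M (\<lambda>x. (f x)\<^sup>2)"
  shows "(\<integral>x. f x \<partial>M)\<^sup>2 \<le> (\<integral>x. (f x)\<^sup>2 \<partial>M)"
  using integral_Cauchy_Schwarz[of M f "\<lambda>_. 1"] assms by (simp add: prob_space)

text \<open>Convexity of the fourth power with weights 2/3 and 1/3; the difference of the two sides
  is \<open>(a - 2 * b)\<close> squared times a nonnegative quadratic form. The uneven weights keep
  the factor of \<open>a ^ 4\<close> small: in \<open>hypercontractivity\<close> it has to stay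
  below 16 after multiplication by 9/4.\<close>

lemma add_power4_le: "(a + b) ^ 4 \<le> 27 / 8 * a ^ 4 + 27 * (b :: real) ^ 4"
proof -
  have "27 / 8 * a ^ 4 + 27 * b ^ 4 - (a + b) ^ 4
    = (a - 2 * b)\<^sup>2 * (19 / 8 * (a + 22 / 19 * b)\<^sup>2 + (13 / 2 - 19 / 8 * (22 / 19)\<^sup>2) * b\<^sup>2)"
    by (simp add: power2_eq_square power4_eq_xxxx field_simps)
  moreover have "\<dots> \<ge> 0" by (intro mult_nonneg_nonneg add_nonneg_nonneg) (auto simp: power2_eq_square)
  ultimately show ?thesis by linarith
qed

lemma sum_power4_le: "(\<Sum>i\<in>I. f i) ^ 4 \<le> real (card I) ^ 3 * (\<Sum>i\<in>I. (f i :: real) ^ 4)"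
proof -
  have "(\<Sum>i\<in>I. f i) ^ 4 = ((\<Sum>i\<in>I. f i)\<^sup>2)\<^sup>2" by simp
  also have "\<dots> \<le> ((\<Sum>i\<in>I. (f i)\<^sup>2) * real (card I))\<^sup>2"
    by (intro power_mono sum_squared_le_sum_of_squares) auto
  also have "\<dots> = (\<Sum>i\<in>I. (f i)\<^sup>2)\<^sup>2 * real (card I) ^ 2" by (simp add: power_mult_distrib)
  also have "\<dots> \<le> ((\<Sum>i\<in>I. ((f i)\<^sup>2)\<^sup>2) * real (card I)) * real (card I) ^ 2"
    by (intro mult_right_mono sum_squared_le_sum_of_squares) auto
  finally show ?thesis by (simp add: power2_eq_square power3_eq_cube power4_eq_xxxx mult_ac)
qed

context gaussian_forms
begin

definition Lin2 :: "('b \<times> 'b \<Rightarrow> real) set" where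
  "Lin2 = {\<lambda>p. L (fst p) + L' (snd p) |L L'. L \<in> Lin \<and> L' \<in> Lin}"

lemma pair_forms: "gaussian_forms (\<mu> \<Otimes>\<^sub>M \<mu>) Lin2"
  unfolding Lin2_def using gaussian_forms_pair gaussian_forms_axioms by blast

interpretation P: pair_prob_space \<mu> \<mu> ..

lemma Lin2I: "L \<in> Lin \<Longrightarrow> L' \<in> Lin \<Longrightarrow> (\<lambda>p. L (fst p) + L' (snd p)) \<in> Lin2"
  by (auto simp: Lin2_def)

lemma Lin2_fst: "L \<in> Lin \<Longrightarrow> (\<lambda>p. L (fst p)) \<in> Lin2"
  using Lin2I[of L "\<lambda>_. 0"] Lin_zero by simp

lemma Lin2_snd: "L \<in> Lin \<Longrightarrow> (\<lambda>p. L (snd p)) \<in> Lin2"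
  using Lin2I[of "\<lambda>_. 0" L] Lin_zero by simp

lemma hom_shift:
  assumes "F \<in> hom n"
  shows "(\<lambda>p. F (fst p + s *\<^sub>R snd p)) \<in> gaussian_forms.hom Lin2 n"
  using assms
proof (induction rule: hom.induct)
  case (pow L c)
  interpret Q: gaussian_forms "\<mu> \<Otimes>\<^sub>M \<mu>" Lin2 by (rule pair_forms)
  have "(\<lambda>p. c * (L (fst p) + s * L (snd p)) ^ n) \<in> Q.hom n"
    by (intro Q.hom.pow Lin2I pow Lin_scale)
  thus ?case using pow by (simp add: form_add form_scale)
next
  case (add F G)
  interpret Q: gaussian_forms "\<mu> \<Otimes>\<^sub>M \<mu>" Lin2 by (rule pair_forms)
  show ?case using Q.hom.add[OF add.IH] by simp
qed

lemma hom_fst: "F \<in> hom n \<Longrightarrow> (\<lambda>p. F (fst p)) \<in> gaussian_forms.hom Lin2 n"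
  using hom_shift[of F n 0] by simp

lemma hom_snd:
  assumes "F \<in> hom n"
  shows "(\<lambda>p. F (snd p)) \<in> gaussian_forms.hom Lin2 n"
  using assms
proof (induction rule: hom.induct)
  case (pow L c)
  interpret Q: gaussian_forms "\<mu> \<Otimes>\<^sub>M \<mu>" Lin2 by (rule pair_forms)
  show ?case by (intro Q.hom.pow Lin2_snd pow)
next
  case (add F G)
  interpret Q: gaussian_forms "\<mu> \<Otimes>\<^sub>M \<mu>" Lin2 by (rule pair_forms)
  show ?case using Q.hom.add[OF add.IH] by simp
qed

lemma pair_variance:
  assumes "L \<in> Lin" "L' \<in> Lin"
  shows "(\<integral>p. (L (fst p) + L' (snd p))\<^sup>2 \<partial>(\<mu> \<Otimes>\<^sub>M \<mu>)) = (\<integral>x. (L x)\<^sup>2 \<partial>\<mu>) + (\<integral>x. (L' x)\<^sup>2 \<partial>\<mu>)"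
proof -
  have i: "integrable \<mu> L" "integrable \<mu> L'" "integrable \<mu> (\<lambda>x. (L x)\<^sup>2)" "integrable \<mu> (\<lambda>x. (L' x)\<^sup>2)"
    using assms hom_integrable[OF hom_form] hom_power_integrable[OF hom_form] by auto
  have one: "integrable \<mu> (\<lambda>_. 1::real)" by simp
  have "has_bochner_integral (\<mu> \<Otimes>\<^sub>M \<mu>)
     (\<lambda>p. (L (fst p))\<^sup>2 * 1 + 2 * (L (fst p) * L' (snd p)) + 1 * (L' (snd p))\<^sup>2)
     ((\<integral>x. (L x)\<^sup>2 \<partial>\<mu>) * (\<integral>x. 1 \<partial>\<mu>) + 2 * ((\<integral>x. L x \<partial>\<mu>) * (\<integral>x. L' x \<partial>\<mu>)) + (\<integral>x. 1 \<partial>\<mu>) * (\<integral>x. (L' x)\<^sup>2 \<partial>\<mu>))"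
    by (intro has_bochner_integral_add has_bochner_integral_mult_right pair_integral_mult prob i one)
  moreover have "(\<integral>x. L x \<partial>\<mu>) = 0"
    using has_bochner_integral_integral_eq[OF moments[OF assms(1), of 1]] by simp
  moreover have "(\<lambda>p. (L (fst p))\<^sup>2 * 1 + 2 * (L (fst p) * L' (snd p)) + 1 * (L' (snd p))\<^sup>2)
     = (\<lambda>p. (L (fst p) + L' (snd p))\<^sup>2)"
    by (simp add: fun_eq_iff power2_sum)
  ultimately show ?thesis by (simp add: has_bochner_integral_iff prob_space)
qed

text \<open>\<open>x + s y\<close> has the law of \<open>(1 + s\<^sup>2)\<^sup>1\<^sup>/\<^sup>2 x\<close> if \<open>x\<close> and \<open>y\<close> are independent with law \<open>\<mu>\<close>.\<close>

lemma rotation: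
  assumes "F \<in> hom (2 * k)"
  shows "(\<integral>p. F (fst p + s *\<^sub>R snd p) \<partial>(\<mu> \<Otimes>\<^sub>M \<mu>)) = (1 + s\<^sup>2) ^ k * (\<integral>x. F x \<partial>\<mu>)"
  using assms
proof (induction rule: hom.induct)
  case (pow L c)
  interpret Q: gaussian_forms "\<mu> \<Otimes>\<^sub>M \<mu>" Lin2 by (rule pair_forms)
  let ?K = "\<lambda>p. L (fst p) + s * L (snd p)"
  have K: "?K \<in> Lin2" by (intro Lin2I pow Lin_scale)
  have v: "(\<integral>p. (?K p)\<^sup>2 \<partial>(\<mu> \<Otimes>\<^sub>M \<mu>)) = (1 + s\<^sup>2) * (\<integral>x. (L x)\<^sup>2 \<partial>\<mu>)"
    using pair_variance[OF pow Lin_scale[OF pow, of s]] by (simp add: power_mult_distrib algebra_simps)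
  have "(\<integral>p. c * ?K p ^ (2 * k) \<partial>(\<mu> \<Otimes>\<^sub>M \<mu>)) =
    c * (gauss_moment (2 * k) * (\<integral>p. (?K p)\<^sup>2 \<partial>(\<mu> \<Otimes>\<^sub>M \<mu>)) ^ k)"
    using has_bochner_integral_integral_eq[OF Q.moments[OF K, of "2 * k"]] by simp
  also have "\<dots> = (1 + s\<^sup>2) ^ k * (c * (gauss_moment (2 * k) * (\<integral>x. (L x)\<^sup>2 \<partial>\<mu>) ^ k))"
    unfolding v by (simp add: power_mult_distrib)
  also have "gauss_moment (2 * k) * (\<integral>x. (L x)\<^sup>2 \<partial>\<mu>) ^ k = (\<integral>x. L x ^ (2 * k) \<partial>\<mu>)"
    using has_bochner_integral_integral_eq[OF moments[OF pow, of "2 * k"]] by simp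
  finally show ?case using pow by (simp add: form_add form_scale)
next
  case (add F G)
  interpret Q: gaussian_forms "\<mu> \<Otimes>\<^sub>M \<mu>" Lin2 by (rule pair_forms)
  note i = Q.hom_integrable[OF hom_shift[OF add.hyps(1), of s]] Q.hom_integrable[OF hom_shift[OF add.hyps(2), of s]]
  show ?case using add.IH i hom_integrable[OF add.hyps(1)] hom_integrable[OF add.hyps(2)]
    by (simp add: algebra_simps)
qed

text \<open>\<open>M j\<close> is the part of \<open>F (x + y)\<close> of degree
  \<open>n - j\<close> in \<open>x\<close> and \<open>j\<close> in \<open>y\<close>. For a power of
  a form it is a binomial term, whose degrees in each variable and jointly can be read off; sums are
  treated coefficientwise.\<close>

lemma hom_expansion:
  assumes "F \<in> hom n"
  shows "\<exists>M. (\<forall>x y s. F (x + s *\<^sub>R y) = (\<Sum>j\<le>n. M j x y * s ^ j)) \<and>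
    (\<forall>j\<le>n. (\<forall>y. (\<lambda>x. M j x y) \<in> hom (n - j)) \<and> (\<forall>x. M j x \<in> hom j) \<and>
       (\<lambda>p. M j (fst p) (snd p)) \<in> gaussian_forms.hom Lin2 n) \<and>
    (\<forall>x y. M n x y = F y)"
  using assms
proof (induction rule: hom.induct)
  case (pow L c)
  interpret Q: gaussian_forms "\<mu> \<Otimes>\<^sub>M \<mu>" Lin2 by (rule pair_forms)
  define M where "M j x y = c * real (n choose j) * L x ^ (n - j) * L y ^ j" for j x y
  have "c * L (x + s *\<^sub>R y) ^ n = (\<Sum>j\<le>n. M j x y * s ^ j)" for x y s
  proof -
    have "L (x + s *\<^sub>R y) ^ n = (s * L y + L x) ^ n" using pow by (simp add: form_add form_scale add.commute)
    thus ?thesis by (simp add: binomial_ring M_def sum_distrib_left power_mult_distrib mult_ac)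
  qed
  moreover have "(\<lambda>x. M j x y) \<in> hom (n - j)" if "j \<le> n" for j y
    using hom.pow[OF pow, of "c * real (n choose j) * L y ^ j" "n - j"]
    by (simp add: M_def mult_ac)
  moreover have "(\<lambda>y. M j x y) \<in> hom j" if "j \<le> n" for j x
    unfolding M_def by (rule hom.pow[OF pow])
  moreover have "(\<lambda>p. M j (fst p) (snd p)) \<in> Q.hom n" if "j \<le> n" for j
    using Q.hom_mult[OF Q.hom.pow[OF Lin2_fst[OF pow], of "c * real (n choose j)" "n - j"]
       Q.hom.pow[OF Lin2_snd[OF pow], of 1 j]] that
    by (simp add: M_def)
  moreover have "M n x y = c * L y ^ n" for x y by (simp add: M_def)
  ultimately show ?case by blast
next
  case (add F G)
  interpret Q: gaussian_forms "\<mu> \<Otimes>\<^sub>M \<mu>" Lin2 by (rule pair_forms)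
  from add.IH(1) obtain M where M: "\<And>x y s. F (x + s *\<^sub>R y) = (\<Sum>j\<le>n. M j x y * s ^ j)"
    "\<And>j y. j \<le> n \<Longrightarrow> (\<lambda>x. M j x y) \<in> hom (n - j)" "\<And>j x. j \<le> n \<Longrightarrow> M j x \<in> hom j"
    "\<And>j. j \<le> n \<Longrightarrow> (\<lambda>p. M j (fst p) (snd p)) \<in> Q.hom n" "\<And>x y. M n x y = F y" by blast
  from add.IH(2) obtain N where N: "\<And>x y s. G (x + s *\<^sub>R y) = (\<Sum>j\<le>n. N j x y * s ^ j)"
    "\<And>j y. j \<le> n \<Longrightarrow> (\<lambda>x. N j x y) \<in> hom (n - j)" "\<And>j x. j \<le> n \<Longrightarrow> N j x \<in> hom j"
    "\<And>j. j \<le> n \<Longrightarrow> (\<lambda>p. N j (fst p) (snd p)) \<in> Q.hom n" "\<And>x y. N n x y = G y" by blast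
  show ?case
    by (intro exI[of _ "\<lambda>j x y. M j x y + N j x y"] conjI allI impI)
       (auto simp: M(1,5) N(1,5) sum.distrib algebra_simps intro!: hom.add Q.hom.add M N)
qed

text \<open>The coefficients are determined by \<open>F\<close>, so the bound may range over every
  expansion \<open>M\<close>; it then applies directly to coefficients given by explicit
  formulas.\<close>

definition coefficient_bound :: "nat \<Rightarrow> nat \<Rightarrow> real \<Rightarrow> bool" where
  "coefficient_bound n j K \<longleftrightarrow> 0 \<le> K \<and>
     (\<forall>F M. F \<in> hom n \<longrightarrow> (\<forall>x y s. F (x + s *\<^sub>R y) = (\<Sum>j\<le>n. M j x y * s ^ j)) \<longrightarrow>
       (\<integral>p. (M j (fst p) (snd p))\<^sup>2 \<partial>(\<mu> \<Otimes>\<^sub>M \<mu>)) \<le> K * (\<integral>x. (F x)\<^sup>2 \<partial>\<mu>))"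

text \<open>By \<open>coefficient_extraction\<close> each coefficient is a fixed combination of the
  values \<open>F (x + i y)\<close> with \<open>i \<le> n\<close>. By \<open>rotation\<close> the
  second moment of such a value is \<open>(1 + i^2) ^ n\<close> times that of \<open>F\<close>, and
  Cauchy-Schwarz over \<open>i\<close> gives \<open>K\<close>.\<close>

lemma coefficient_bound_exists:
  assumes "j \<le> n"
  shows "\<exists>K. coefficient_bound n j K"
proof -
  interpret Q: gaussian_forms "\<mu> \<Otimes>\<^sub>M \<mu>" Lin2 by (rule pair_forms)
  obtain c where c: "\<And>a. (a j :: real) = (\<Sum>i\<le>n. c i * (\<Sum>k\<le>n. a k * real i ^ k))"
    using coefficient_extraction[OF assms] by blast
  define K where "K = (\<Sum>i\<le>n. (c i)\<^sup>2) * (\<Sum>i\<le>n. (1 + (real i)\<^sup>2) ^ n)"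
  show ?thesis
    unfolding coefficient_bound_def
  proof (intro exI[of _ K] conjI allI impI)
    show "K \<ge> 0" unfolding K_def by (intro mult_nonneg_nonneg sum_nonneg) auto
    fix F M assume F: "F \<in> hom n"
      and M: "\<forall>x y s. F (x + s *\<^sub>R y) = (\<Sum>j\<le>n. M j x y * s ^ j)"
    have M_eq: "M j x y = (\<Sum>i\<le>n. c i * F (x + real i *\<^sub>R y))" for x y
      using c[of "\<lambda>j. M j x y"] by (simp add: M)
    have Mh: "(\<lambda>p. M j (fst p) (snd p)) \<in> Q.hom n"
      unfolding M_eq by (intro Q.hom_sum Q.hom_scale hom_shift F)
    have int: "integrable (\<mu> \<Otimes>\<^sub>M \<mu>) (\<lambda>p. (F (fst p + real i *\<^sub>R snd p))\<^sup>2)" for i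
      by (rule Q.hom_power_integrable[OF hom_shift[OF F]])
    have F2: "(\<lambda>x. (F x)\<^sup>2) \<in> hom (2 * n)" using hom_power[OF F, of 2] by (simp add: mult.commute)
    have "(\<integral>p. (M j (fst p) (snd p))\<^sup>2 \<partial>(\<mu> \<Otimes>\<^sub>M \<mu>)) \<le>
      (\<integral>p. (\<Sum>i\<le>n. (c i)\<^sup>2) * (\<Sum>i\<le>n. (F (fst p + real i *\<^sub>R snd p))\<^sup>2) \<partial>(\<mu> \<Otimes>\<^sub>M \<mu>))"
    proof (rule integral_mono)
      fix p
      show "(M j (fst p) (snd p))\<^sup>2 \<le> (\<Sum>i\<le>n. (c i)\<^sup>2) * (\<Sum>i\<le>n. (F (fst p + real i *\<^sub>R snd p))\<^sup>2)"
        unfolding M_eq by (rule Cauchy_Schwarz_ineq_sum)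
    qed (use int Q.hom_power_integrable[OF Mh] in auto)
    also have "\<dots> = K * (\<integral>x. (F x)\<^sup>2 \<partial>\<mu>)"
      using int by (simp add: rotation[OF F2] K_def mult.assoc flip: sum_distrib_right)
    finally show "(\<integral>p. (M j (fst p) (snd p))\<^sup>2 \<partial>(\<mu> \<Otimes>\<^sub>M \<mu>)) \<le> K * (\<integral>x. (F x)\<^sup>2 \<partial>\<mu>)" .
  qed
qed

definition hyper :: "nat \<Rightarrow> real \<Rightarrow> bool" where
  "hyper n C \<longleftrightarrow> 0 \<le> C \<and> (\<forall>F\<in>hom n. (\<integral>x. F x ^ 4 \<partial>\<mu>) \<le> C * (\<integral>x. (F x)\<^sup>2 \<partial>\<mu>)\<^sup>2)"

text \<open>The bound in \<open>x\<close> for fixed \<open>y\<close> leaves \<open>S\<close>, the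
  integral of the square of \<open>q y = \<integral>x. (G x y)^2\<close>. Writing one factor
  \<open>q\<close> out and exchanging the integrals, Cauchy-Schwarz in \<open>y\<close> together
  with the bound in \<open>y\<close> gives \<open>S \<le> sqrt (S * Cb) * E\<close>, hence
  \<open>S \<le> Cb * E^2\<close>. This replaces Minkowski's inequality for integrals.\<close>

lemma decoupled_hyper:
  assumes a: "hyper a Ca" and b: "hyper b Cb"
    and G: "(\<lambda>p. G (fst p) (snd p)) \<in> gaussian_forms.hom Lin2 m"
    and Ga: "\<And>y. (\<lambda>x. G x y) \<in> hom a" and Gb: "\<And>x. G x \<in> hom b"
  shows "(\<integral>p. G (fst p) (snd p) ^ 4 \<partial>(\<mu> \<Otimes>\<^sub>M \<mu>)) \<le> Ca * Cb * (\<integral>p. (G (fst p) (snd p))\<^sup>2 \<partial>(\<mu> \<Otimes>\<^sub>M \<mu>))\<^sup>2"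
proof -
  interpret Q: gaussian_forms "\<mu> \<Otimes>\<^sub>M \<mu>" Lin2 by (rule pair_forms)
  define q where "q y = (\<integral>x. (G x y)\<^sup>2 \<partial>\<mu>)" for y
  have i2: "integrable (\<mu> \<Otimes>\<^sub>M \<mu>) (case_prod (\<lambda>x y. (G x y)\<^sup>2))"
    and i4: "integrable (\<mu> \<Otimes>\<^sub>M \<mu>) (case_prod (\<lambda>x y. (G x y) ^ 4))"
    using Q.hom_power_integrable[OF G] by (auto simp: case_prod_beta')
  have qi: "integrable \<mu> q" unfolding q_def using P.integrable_snd[OF i2] .
  have q0: "0 \<le> q y" for y by (simp add: q_def)
  have q2le: "(q y)\<^sup>2 \<le> (\<integral>x. G x y ^ 4 \<partial>\<mu>)" for y
    using integral_square_le[of "\<lambda>x. (G x y)\<^sup>2"] hom_power_integrable[OF Ga[of y], of 2]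
      hom_power_integrable[OF Ga[of y], of 4] by (simp add: q_def)
  have q2i: "integrable \<mu> (\<lambda>y. (q y)\<^sup>2)"
    by (rule Bochner_Integration.integrable_bound[OF P.integrable_snd[OF i4]])
       (use q2le borel_measurable_integrable[OF qi] in \<open>auto intro: order.trans\<close>)
  define S where "S = (\<integral>y. (q y)\<^sup>2 \<partial>\<mu>)"
  define E where "E = (\<integral>p. (G (fst p) (snd p))\<^sup>2 \<partial>(\<mu> \<Otimes>\<^sub>M \<mu>))"
  have S0: "0 \<le> S" by (simp add: S_def)
  have Ca: "0 \<le> Ca" and Cb: "0 \<le> Cb" using a b by (auto simp: hyper_def)
  have qG: "integrable (\<mu> \<Otimes>\<^sub>M \<mu>) (case_prod (\<lambda>x y. q y * (G x y)\<^sup>2))"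
  proof (rule Bochner_Integration.integrable_bound)
    have "integrable (\<mu> \<Otimes>\<^sub>M \<mu>) (\<lambda>p. 1 * (q (snd p))\<^sup>2)"
      by (rule integrable.intros[OF pair_integral_mult]) (use prob q2i in auto)
    thus "integrable (\<mu> \<Otimes>\<^sub>M \<mu>) (\<lambda>p. (q (snd p))\<^sup>2 + G (fst p) (snd p) ^ 4)"
      using Q.hom_power_integrable[OF G, of 4] by simp
    have [measurable]: "q \<in> borel_measurable \<mu>" using qi by auto
    have [measurable]: "(\<lambda>p. G (fst p) (snd p)) \<in> borel_measurable (\<mu> \<Otimes>\<^sub>M \<mu>)"
      using Q.hom_measurable[OF G] .
    show "case_prod (\<lambda>x y. q y * (G x y)\<^sup>2) \<in> borel_measurable (\<mu> \<Otimes>\<^sub>M \<mu>)"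
      unfolding case_prod_beta' by measurable
    have "u * v\<^sup>2 \<le> u\<^sup>2 + v ^ 4" for u v :: real
    proof -
      have "0 \<le> (u - v\<^sup>2 / 2)\<^sup>2 + 3 / 4 * v ^ 4" by simp
      thus ?thesis by (simp add: power2_diff power_divide)
    qed
    thus "AE p in \<mu> \<Otimes>\<^sub>M \<mu>. norm (case p of (x, y) \<Rightarrow> q y * (G x y)\<^sup>2) \<le> norm ((q (snd p))\<^sup>2 + G (fst p) (snd p) ^ 4)"
      using q0 by (auto simp: case_prod_beta')
  qed
  have inner: "(\<integral>y. q y * (G x y)\<^sup>2 \<partial>\<mu>) \<le> sqrt (S * Cb) * (\<integral>y. (G x y)\<^sup>2 \<partial>\<mu>)"
    if int: "integrable \<mu> (\<lambda>y. q y * (G x y)\<^sup>2)" for x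
  proof -
    have "(\<integral>y. q y * (G x y)\<^sup>2 \<partial>\<mu>)\<^sup>2 \<le> S * (\<integral>y. ((G x y)\<^sup>2)\<^sup>2 \<partial>\<mu>)"
      unfolding S_def using hom_power_integrable[OF Gb[of x], of 4]
      by (intro integral_Cauchy_Schwarz q2i int) simp
    also have "\<dots> \<le> S * (Cb * (\<integral>y. (G x y)\<^sup>2 \<partial>\<mu>)\<^sup>2)"
      using b Gb[of x] S0 by (intro mult_left_mono) (auto simp: hyper_def)
    also have "\<dots> = (sqrt (S * Cb) * (\<integral>y. (G x y)\<^sup>2 \<partial>\<mu>))\<^sup>2"
      using S0 Cb by (simp add: power_mult_distrib mult.assoc)
    finally show ?thesis
      by (rule power2_le_imp_le) (use S0 Cb in auto)
  qed
  have "S = (\<integral>y. (\<integral>x. q y * (G x y)\<^sup>2 \<partial>\<mu>) \<partial>\<mu>)"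
    by (simp add: S_def q_def power2_eq_square)
  also have "\<dots> = (\<integral>x. (\<integral>y. q y * (G x y)\<^sup>2 \<partial>\<mu>) \<partial>\<mu>)"
    using P.integral_snd[OF qG] P.integral_fst[OF qG] by simp
  also have "\<dots> \<le> (\<integral>x. sqrt (S * Cb) * (\<integral>y. (G x y)\<^sup>2 \<partial>\<mu>) \<partial>\<mu>)"
    using P.AE_integrable_fst[OF qG] P.integrable_fst[OF qG] P.integrable_fst[OF i2] inner
    by (intro integral_mono_AE) auto
  also have "\<dots> = sqrt (S * Cb) * E"
    using P.integral_fst[OF i2] by (simp add: E_def case_prod_beta')
  finally have SE: "S \<le> sqrt (S * Cb) * E" .
  have S: "S \<le> Cb * E\<^sup>2"
  proof (cases "S = 0")
    case False
    have "S\<^sup>2 \<le> (sqrt (S * Cb) * E)\<^sup>2" using SE S0 by (intro power_mono)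
    also have "\<dots> = S * (Cb * E\<^sup>2)" using S0 Cb by (simp add: power_mult_distrib)
    finally have "S * S \<le> S * (Cb * E\<^sup>2)" by (simp add: power2_eq_square)
    thus ?thesis using False S0 by (simp add: mult_le_cancel_left)
  qed (use Cb in simp)
  have "(\<integral>p. G (fst p) (snd p) ^ 4 \<partial>(\<mu> \<Otimes>\<^sub>M \<mu>)) = (\<integral>y. (\<integral>x. G x y ^ 4 \<partial>\<mu>) \<partial>\<mu>)"
    using P.integral_snd[OF i4] by (simp add: case_prod_beta')
  also have "\<dots> \<le> (\<integral>y. Ca * (q y)\<^sup>2 \<partial>\<mu>)"
    using P.integrable_snd[OF i4] q2i a Ga by (intro integral_mono) (auto simp: hyper_def q_def)
  also have "\<dots> = Ca * S" by (simp add: S_def)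
  also have "\<dots> \<le> Ca * (Cb * E\<^sup>2)" by (rule mult_left_mono[OF S Ca])
  finally show ?thesis by (simp add: E_def mult.assoc)
qed

interpretation P: pair_prob_space \<mu> \<mu> ..

text \<open>Let \<open>A\<close> be the fourth and \<open>B\<close> the second moment of
  \<open>F\<close>, and \<open>x\<close>, \<open>y\<close> independent. Then
  \<open>F (x + y)\<close> has fourth moment \<open>4 ^ n * A\<close>. On the other hand
  \<open>F (x + y) = F x + F y + R\<close>, where the parts of \<open>R\<close> have lower degree in
  each variable and are handled by induction, while \<open>F x + F y\<close> has fourth moment about
  \<open>2 * A\<close>. For \<open>n \<ge> 2\<close> the left side dominates and \<open>A\<close>
  can be absorbed; degrees 0 and 1 are computed directly.\<close>

lemma hypercontractivity: "\<exists>C. hyper n C"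
proof (induction n rule: less_induct)
  case (less n)
  interpret Q: gaussian_forms "\<mu> \<Otimes>\<^sub>M \<mu>" Lin2 by (rule pair_forms)
  consider "n = 0" | "n = 1" | "2 \<le> n" by linarith
  thus ?case
  proof cases
    case 1
    have "hyper 0 1"
      unfolding hyper_def
    proof (intro conjI ballI)
      fix F assume "F \<in> hom 0"
      then obtain c where "F = (\<lambda>_. c)" using hom_0_const by blast
      thus "(\<integral>x. F x ^ 4 \<partial>\<mu>) \<le> 1 * (\<integral>x. (F x)\<^sup>2 \<partial>\<mu>)\<^sup>2" by (simp add: prob_space)
    qed simp
    thus ?thesis using 1 by blast
  next
    case 2
    have "hyper 1 3"
      unfolding hyper_def
    proof (intro conjI ballI)
      fix F assume "F \<in> hom 1"
      hence F: "F \<in> Lin" by (rule hom_1_form)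
      show "(\<integral>x. F x ^ 4 \<partial>\<mu>) \<le> 3 * (\<integral>x. (F x)\<^sup>2 \<partial>\<mu>)\<^sup>2"
        using has_bochner_integral_integral_eq[OF moments[OF F, of 4]] by (simp add: gauss_moment_4)
    qed simp
    thus ?thesis using 2 by blast
  next
    case 3
    have "\<forall>j. \<exists>C. j < n \<longrightarrow> hyper j C" using less by blast
    then obtain C where C: "\<And>j. j < n \<Longrightarrow> hyper j (C j)" by metis
    have "\<forall>j. \<exists>K. j \<le> n \<longrightarrow> coefficient_bound n j K" using coefficient_bound_exists by blast
    then obtain K where K: "\<And>j. j \<le> n \<Longrightarrow> coefficient_bound n j (K j)" by metis
    \<comment> \<open>\<open>sum_power4_le\<close> over the mixed parts, then
      \<open>decoupled_hyper\<close> for degrees \<open>n - j\<close> and \<open>j\<close>, then the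
      square of the coefficient bound.\<close>
    define D where "D = real n ^ 3 * (\<Sum>j\<in>{1..<n}. C (n - j) * C j * (K j)\<^sup>2)"
    have C0: "0 \<le> C j" if "j < n" for j using C[OF that] by (simp add: hyper_def)
    have D0: "0 \<le> D" unfolding D_def using C0 by (intro mult_nonneg_nonneg sum_nonneg) auto
    \<comment> \<open>\<open>237\<close> rounds up \<open>27/8 * 70 = 945/4\<close>; after
      absorption \<open>A\<close> keeps a factor \<open>16 - 243/32 > 1\<close>, which is given
      away.\<close>
    have "hyper n (237 + 27 * D)"
      unfolding hyper_def
    proof (intro conjI ballI)
      show "0 \<le> 237 + 27 * D" using D0 by simp
      fix F assume F: "F \<in> hom n"
      let ?\<nu> = "\<mu> \<Otimes>\<^sub>M \<mu>"
      define A where "A = (\<integral>x. F x ^ 4 \<partial>\<mu>)"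
      define B where "B = (\<integral>x. (F x)\<^sup>2 \<partial>\<mu>)"
      have A0: "0 \<le> A" and B0: "0 \<le> B" by (simp_all add: A_def B_def)
      obtain M where M: "\<And>x y s. F (x + s *\<^sub>R y) = (\<Sum>j\<le>n. M j x y * s ^ j)"
        "\<And>j y. j \<le> n \<Longrightarrow> (\<lambda>x. M j x y) \<in> hom (n - j)" "\<And>j x. j \<le> n \<Longrightarrow> M j x \<in> hom j"
        "\<And>j. j \<le> n \<Longrightarrow> (\<lambda>p. M j (fst p) (snd p)) \<in> Q.hom n" "\<And>x y. M n x y = F y"
        using hom_expansion[OF F] by blast
      have M0: "M 0 x y = F x" for x y
        using M(1)[of x 0 y] by (simp add: power_0_left if_distrib sum.delta cong: if_cong)
      define R where "R p = (\<Sum>j\<in>{1..<n}. M j (fst p) (snd p))" for p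
      have Fsum: "F (fst p + 1 *\<^sub>R snd p) = (F (fst p) + F (snd p)) + R p" for p
      proof -
        have "{..n} = insert 0 (insert n {1..<n})" using 3 by auto
        thus ?thesis using M(1)[of "fst p" 1 "snd p"] 3 by (simp add: R_def M0 M(5))
      qed
      have Rh: "R \<in> Q.hom n" unfolding R_def by (intro Q.hom_sum M(4)) auto
      have ER: "(\<integral>p. R p ^ 4 \<partial>?\<nu>) \<le> D * B\<^sup>2"
      proof -
        have "(\<integral>p. R p ^ 4 \<partial>?\<nu>) \<le> (\<integral>p. real n ^ 3 * (\<Sum>j\<in>{1..<n}. M j (fst p) (snd p) ^ 4) \<partial>?\<nu>)"
        proof (rule integral_mono)
          fix p
          have "R p ^ 4 \<le> real (card {1..<n}) ^ 3 * (\<Sum>j\<in>{1..<n}. M j (fst p) (snd p) ^ 4)"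
            unfolding R_def by (rule sum_power4_le)
          also have "\<dots> \<le> real n ^ 3 * (\<Sum>j\<in>{1..<n}. M j (fst p) (snd p) ^ 4)"
            by (intro mult_right_mono power_mono sum_nonneg) auto
          finally show "R p ^ 4 \<le> real n ^ 3 * (\<Sum>j\<in>{1..<n}. M j (fst p) (snd p) ^ 4)" .
        qed (use Q.hom_power_integrable[OF Rh] Q.hom_power_integrable[OF M(4)] in \<open>auto intro!: integrable_mult_right Bochner_Integration.integrable_sum\<close>)
        also have "\<dots> = real n ^ 3 * (\<Sum>j\<in>{1..<n}. (\<integral>p. M j (fst p) (snd p) ^ 4 \<partial>?\<nu>))"
          using Q.hom_power_integrable[OF M(4)] by (subst integral_mult_right_zero, subst Bochner_Integration.integral_sum) auto
        also have "\<dots> \<le> real n ^ 3 * (\<Sum>j\<in>{1..<n}. C (n - j) * C j * (K j)\<^sup>2 * B\<^sup>2)"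
        proof (intro mult_left_mono sum_mono)
          fix j assume "j \<in> {1..<n}"
          hence j: "j \<le> n" "j < n" "n - j < n" by auto
          have "(\<integral>p. M j (fst p) (snd p) ^ 4 \<partial>?\<nu>) \<le> C (n - j) * C j * (\<integral>p. (M j (fst p) (snd p))\<^sup>2 \<partial>?\<nu>)\<^sup>2"
            by (rule decoupled_hyper[OF C[OF j(3)] C[OF j(2)] M(4)[OF j(1)] M(2)[OF j(1)] M(3)[OF j(1)]])
          also have "\<dots> \<le> C (n - j) * C j * (K j * B)\<^sup>2"
            using C0[OF j(2)] C0[OF j(3)] K[OF j(1)] F M(1)
            by (intro mult_left_mono power_mono) (auto simp: B_def coefficient_bound_def)
          finally show "(\<integral>p. M j (fst p) (snd p) ^ 4 \<partial>?\<nu>) \<le> C (n - j) * C j * (K j)\<^sup>2 * B\<^sup>2"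
            by (simp add: power_mult_distrib mult.assoc)
        qed simp
        also have "\<dots> = D * B\<^sup>2" by (simp add: D_def sum_distrib_right mult.assoc)
        finally show ?thesis .
      qed
      have i: "integrable \<mu> (\<lambda>x. F x ^ k)" for k using hom_power_integrable[OF F] .
      \<comment> \<open>\<open>F\<close> may have a nonzero mean, so the mixed term
        \<open>8 * E F^3 * E F\<close> remains. Cauchy-Schwarz bounds it by
        \<open>8 * sqrt (A * B * B)\<close>, which is split so that only \<open>A / 4\<close> is
        added to \<open>2 * A\<close>; hence \<open>9/4\<close> and
        \<open>70 = 64 + 6\<close>.\<close>
      have EFF: "(\<integral>p. (F (fst p) + F (snd p)) ^ 4 \<partial>?\<nu>) \<le> 9 / 4 * A + 70 * B\<^sup>2"
      proof -
        have "has_bochner_integral ?\<nu> (\<lambda>p. F (fst p) ^ 4 * F (snd p) ^ 0 + 4 * (F (fst p) ^ 3 * F (snd p) ^ 1)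
            + 6 * (F (fst p) ^ 2 * F (snd p) ^ 2) + 4 * (F (fst p) ^ 1 * F (snd p) ^ 3) + F (fst p) ^ 0 * F (snd p) ^ 4)
          ((\<integral>x. F x ^ 4 \<partial>\<mu>) * (\<integral>x. F x ^ 0 \<partial>\<mu>) + 4 * ((\<integral>x. F x ^ 3 \<partial>\<mu>) * (\<integral>x. F x ^ 1 \<partial>\<mu>))
            + 6 * ((\<integral>x. F x ^ 2 \<partial>\<mu>) * (\<integral>x. F x ^ 2 \<partial>\<mu>)) + 4 * ((\<integral>x. F x ^ 1 \<partial>\<mu>) * (\<integral>x. F x ^ 3 \<partial>\<mu>))
            + (\<integral>x. F x ^ 0 \<partial>\<mu>) * (\<integral>x. F x ^ 4 \<partial>\<mu>))"
          by (intro has_bochner_integral_add has_bochner_integral_mult_right pair_integral_mult prob i)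
        moreover have "(\<lambda>p. F (fst p) ^ 4 * F (snd p) ^ 0 + 4 * (F (fst p) ^ 3 * F (snd p) ^ 1)
            + 6 * (F (fst p) ^ 2 * F (snd p) ^ 2) + 4 * (F (fst p) ^ 1 * F (snd p) ^ 3) + F (fst p) ^ 0 * F (snd p) ^ 4)
            = (\<lambda>p. (F (fst p) + F (snd p)) ^ 4)"
          by (rule ext) (simp add: power2_eq_square power3_eq_cube power4_eq_xxxx algebra_simps)
        ultimately have "(\<integral>p. (F (fst p) + F (snd p)) ^ 4 \<partial>?\<nu>) =
            2 * A + 8 * ((\<integral>x. F x ^ 3 \<partial>\<mu>) * (\<integral>x. F x \<partial>\<mu>)) + 6 * B\<^sup>2"
          by (simp add: has_bochner_integral_iff prob_space A_def B_def power2_eq_square[of "expectation _"])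
        moreover have "8 * ((\<integral>x. F x ^ 3 \<partial>\<mu>) * (\<integral>x. F x \<partial>\<mu>)) \<le> A / 4 + 64 * B\<^sup>2"
        proof -
          have "(\<integral>x. (F x)\<^sup>2 * F x \<partial>\<mu>)\<^sup>2 \<le> (\<integral>x. ((F x)\<^sup>2)\<^sup>2 \<partial>\<mu>) * (\<integral>x. (F x)\<^sup>2 \<partial>\<mu>)"
            using i[of 2] i[of 3] i[of 4] by (intro integral_Cauchy_Schwarz) (auto simp: power2_eq_square power3_eq_cube power4_eq_xxxx mult_ac)
          hence 1: "(\<integral>x. F x ^ 3 \<partial>\<mu>)\<^sup>2 \<le> A * B"
            by (simp add: A_def B_def power3_eq_cube power2_eq_square power4_eq_xxxx mult_ac)
          have 2: "(\<integral>x. F x \<partial>\<mu>)\<^sup>2 \<le> B"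
            unfolding B_def using i[of 1] i[of 2] by (intro integral_square_le) auto
          have "(8 * ((\<integral>x. F x ^ 3 \<partial>\<mu>) * (\<integral>x. F x \<partial>\<mu>)))\<^sup>2 \<le> 64 * (A * B * B)"
            using mult_mono[OF 1 2] A0 B0 by (simp add: power_mult_distrib)
          also have "\<dots> \<le> (A / 4 + 64 * B\<^sup>2)\<^sup>2"
          proof -
            have "0 \<le> (A / 4 - 64 * B\<^sup>2)\<^sup>2" by simp
            thus ?thesis by (simp add: power2_eq_square algebra_simps)
          qed
          finally show ?thesis by (rule power2_le_imp_le) (use A0 B0 in auto)
        qed
        ultimately show ?thesis by linarith
      qed
      \<comment> \<open>The place where \<open>n \<ge> 2\<close> matters: 16 exceeds
        \<open>27/8 * 9/4 = 243/32\<close>.\<close>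
      have "16 * A \<le> 4 ^ n * A"
      proof (rule mult_right_mono)
        have "(4::real) ^ 2 \<le> 4 ^ n" using 3 by (intro power_increasing) auto
        thus "(16::real) \<le> 4 ^ n" by simp
      qed fact
      also have "4 ^ n * A = (\<integral>p. F (fst p + 1 *\<^sub>R snd p) ^ 4 \<partial>?\<nu>)"
      proof -
        have "(\<lambda>x. F x ^ 4) \<in> hom (2 * (2 * n))" using hom_power[OF F, of 4] by (simp add: mult.commute)
        from rotation[OF this, of 1] show ?thesis by (simp add: A_def power_mult)
      qed
      also have "\<dots> \<le> (\<integral>p. 27 / 8 * (F (fst p) + F (snd p)) ^ 4 + 27 * R p ^ 4 \<partial>?\<nu>)"
      proof (rule integral_mono)
        show "integrable ?\<nu> (\<lambda>p. F (fst p + 1 *\<^sub>R snd p) ^ 4)"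
          by (rule Q.hom_power_integrable[OF hom_shift[OF F]])
        show "integrable ?\<nu> (\<lambda>p. 27 / 8 * (F (fst p) + F (snd p)) ^ 4 + 27 * R p ^ 4)"
          using Q.hom_power_integrable[OF Rh] Q.hom_power_integrable[OF Q.hom.add[OF hom_fst[OF F] hom_snd[OF F]]]
          by (intro Bochner_Integration.integrable_add integrable_mult_right) auto
        fix p
        show "F (fst p + 1 *\<^sub>R snd p) ^ 4 \<le> 27 / 8 * (F (fst p) + F (snd p)) ^ 4 + 27 * R p ^ 4"
          unfolding Fsum by (rule add_power4_le)
      qed
      also have "\<dots> = 27 / 8 * (\<integral>p. (F (fst p) + F (snd p)) ^ 4 \<partial>?\<nu>) + 27 * (\<integral>p. R p ^ 4 \<partial>?\<nu>)"
        using Q.hom_power_integrable[OF Rh] Q.hom_power_integrable[OF Q.hom.add[OF hom_fst[OF F] hom_snd[OF F]]]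
        by simp
      also have "\<dots> \<le> 27 / 8 * (9 / 4 * A + 70 * B\<^sup>2) + 27 * (D * B\<^sup>2)"
        by (intro add_mono mult_left_mono EFF ER) auto
      finally have "16 * A \<le> 243 / 32 * A + (945 / 4) * B\<^sup>2 + 27 * (D * B\<^sup>2)" by (simp add: field_simps)
      hence "A \<le> 237 * B\<^sup>2 + 27 * (D * B\<^sup>2)" using A0 zero_le_power2[of B] by linarith
      thus "(\<integral>x. F x ^ 4 \<partial>\<mu>) \<le> (237 + 27 * D) * (\<integral>x. (F x)\<^sup>2 \<partial>\<mu>)\<^sup>2"
        by (simp add: A_def B_def algebra_simps)
    qed
    thus ?thesis by blast
  qed
qed

text \<open>Iteration: the bound for \<open>k\<close>, applied to the square of \<open>F\<close>, of
  degree \<open>2 * n\<close>, leaves a power of the fourth moment of \<open>F\<close>, to which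
  \<open>hyper\<close> applies.\<close>

lemma hypercontractivity_power:
  "\<exists>C\<ge>1. \<forall>F\<in>hom n. (\<integral>x. F x ^ 2 ^ Suc k \<partial>\<mu>) \<le> C * (\<integral>x. (F x)\<^sup>2 \<partial>\<mu>) ^ 2 ^ k"
proof (induction k arbitrary: n)
  case 0
  show ?case by (intro exI[of _ 1]) auto
next
  case (Suc k)
  obtain C where C: "C \<ge> 1" "\<And>F. F \<in> hom (2 * n) \<Longrightarrow> (\<integral>x. F x ^ 2 ^ Suc k \<partial>\<mu>) \<le> C * (\<integral>x. (F x)\<^sup>2 \<partial>\<mu>) ^ 2 ^ k"
    using Suc[of "2 * n"] by blast
  obtain D where D: "hyper n D" using hypercontractivity by blast
  show ?case
  proof (intro exI[of _ "C * max 1 D ^ 2 ^ k"] conjI ballI)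
    have "1 \<le> max 1 D ^ 2 ^ k" by (rule one_le_power) simp
    thus "1 \<le> C * max 1 D ^ 2 ^ k" using C(1) mult_mono[of 1 C 1 "max 1 D ^ 2 ^ k"] by simp
    fix F assume F: "F \<in> hom n"
    have F2: "(\<lambda>x. (F x)\<^sup>2) \<in> hom (2 * n)" using hom_power[OF F, of 2] by (simp add: mult.commute)
    have "(\<integral>x. F x ^ 2 ^ Suc (Suc k) \<partial>\<mu>) = (\<integral>x. ((F x)\<^sup>2) ^ 2 ^ Suc k \<partial>\<mu>)"
      by (simp add: power_mult[symmetric] mult.commute)
    also have "\<dots> \<le> C * (\<integral>x. ((F x)\<^sup>2)\<^sup>2 \<partial>\<mu>) ^ 2 ^ k" by (rule C(2)[OF F2])
    also have "(\<integral>x. ((F x)\<^sup>2)\<^sup>2 \<partial>\<mu>) \<le> max 1 D * (\<integral>x. (F x)\<^sup>2 \<partial>\<mu>)\<^sup>2"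
    proof -
      have "(\<integral>x. ((F x)\<^sup>2)\<^sup>2 \<partial>\<mu>) \<le> D * (\<integral>x. (F x)\<^sup>2 \<partial>\<mu>)\<^sup>2"
        using D F by (auto simp: hyper_def)
      also have "\<dots> \<le> max 1 D * (\<integral>x. (F x)\<^sup>2 \<partial>\<mu>)\<^sup>2" by (intro mult_right_mono) auto
      finally show ?thesis .
    qed
    hence "C * (\<integral>x. ((F x)\<^sup>2)\<^sup>2 \<partial>\<mu>) ^ 2 ^ k \<le> C * (max 1 D * (\<integral>x. (F x)\<^sup>2 \<partial>\<mu>)\<^sup>2) ^ 2 ^ k"
      using C(1) by (intro mult_left_mono power_mono) auto
    also have "\<dots> = C * max 1 D ^ 2 ^ k * (\<integral>x. (F x)\<^sup>2 \<partial>\<mu>) ^ 2 ^ Suc k"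
      by (simp add: power_mult_distrib power_mult[symmetric] mult.commute mult.assoc)
    finally show "(\<integral>x. F x ^ 2 ^ Suc (Suc k) \<partial>\<mu>) \<le> C * max 1 D ^ 2 ^ k * (\<integral>x. (F x)\<^sup>2 \<partial>\<mu>) ^ 2 ^ Suc k" .
  qed
qed

text \<open>With \<open>a\<close>, \<open>b\<close>, \<open>c\<close>, \<open>d\<close> the moments
  of order 1 to 4, Cauchy-Schwarz gives \<open>b^2 \<le> a * c\<close> (here nonnegativity is used,
  to take the root of \<open>F\<close>) and \<open>c^2 \<le> b * d\<close>, and hypercontractivity
  gives \<open>d \<le> D * b^2\<close>. Together \<open>b^4 \<le> D * a^2 * b^3\<close>.\<close>

lemma reverse_hoelder:
  obtains C where "C \<ge> 1"
    and "\<And>F. F \<in> hom n \<Longrightarrow> (\<And>x. 0 \<le> F x) \<Longrightarrow> (\<integral>x. (F x)\<^sup>2 \<partial>\<mu>) \<le> C * (\<integral>x. F x \<partial>\<mu>)\<^sup>2"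
proof -
  obtain D where D: "hyper n D" using hypercontractivity by blast
  show ?thesis
  proof (rule that[of "max 1 D"])
    fix F assume F: "F \<in> hom n" and pos: "\<And>x. 0 \<le> F x"
    have i: "integrable \<mu> (\<lambda>x. F x ^ k)" for k using hom_power_integrable[OF F] .
    let ?a = "\<integral>x. F x \<partial>\<mu>" and ?b = "\<integral>x. (F x)\<^sup>2 \<partial>\<mu>" and ?c = "\<integral>x. F x ^ 3 \<partial>\<mu>"
      and ?d = "\<integral>x. F x ^ 4 \<partial>\<mu>"
    have nonneg: "0 \<le> ?a" "0 \<le> ?b" "0 \<le> ?c" "0 \<le> ?d" using pos by auto
    have "(\<integral>x. sqrt (F x) * (F x * sqrt (F x)) \<partial>\<mu>)\<^sup>2 \<le>
      (\<integral>x. (sqrt (F x))\<^sup>2 \<partial>\<mu>) * (\<integral>x. (F x * sqrt (F x))\<^sup>2 \<partial>\<mu>)"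
      using pos i[of 1] i[of 2] i[of 3]
      by (intro integral_Cauchy_Schwarz) (auto simp: power_mult_distrib power2_eq_square power3_eq_cube mult_ac)
    hence 1: "?b\<^sup>2 \<le> ?a * ?c"
      using pos by (simp add: power_mult_distrib power2_eq_square power3_eq_cube mult_ac)
    have "(\<integral>x. F x * (F x)\<^sup>2 \<partial>\<mu>)\<^sup>2 \<le> ?b * (\<integral>x. ((F x)\<^sup>2)\<^sup>2 \<partial>\<mu>)"
      using i[of 2] i[of 3] i[of 4] by (intro integral_Cauchy_Schwarz) (auto simp: power2_eq_square power3_eq_cube power4_eq_xxxx mult_ac)
    hence 2: "?c\<^sup>2 \<le> ?b * ?d"
      by (simp add: power2_eq_square power3_eq_cube power4_eq_xxxx mult_ac)
    have 3: "?d \<le> D * ?b\<^sup>2" using D F by (auto simp: hyper_def)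
    have D0: "0 \<le> D" using D by (simp add: hyper_def)
    have "?b \<le> D * ?a\<^sup>2"
    proof (cases "?b = 0")
      case False
      have "(?b\<^sup>2)\<^sup>2 \<le> (?a * ?c)\<^sup>2" using 1 by (intro power_mono) auto
      also have "\<dots> = ?a\<^sup>2 * ?c\<^sup>2" by (simp add: power_mult_distrib)
      also have "\<dots> \<le> ?a\<^sup>2 * (?b * (D * ?b\<^sup>2))"
        using 2 3 nonneg by (intro mult_left_mono order.trans[OF 2]) auto
      finally have "?b * ?b ^ 3 \<le> (D * ?a\<^sup>2) * ?b ^ 3"
        by (simp add: power2_eq_square power3_eq_cube mult_ac)
      moreover have "0 < ?b ^ 3" using False nonneg(2) by (metis less_le zero_less_power)
      ultimately show ?thesis by (rule mult_right_le_imp_le)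
    qed (use D0 in auto)
    also have "\<dots> \<le> max 1 D * ?a\<^sup>2" by (intro mult_right_mono) auto
    finally show "?b \<le> max 1 D * ?a\<^sup>2" .
  qed simp
qed

section \<open>Wick's formula and contractions\<close>

interpretation P: pair_prob_space \<mu> \<mu> ..

abbreviation cov :: "('b \<Rightarrow> real) \<Rightarrow> ('b \<Rightarrow> real) \<Rightarrow> real" where
  "cov L L' \<equiv> \<integral>x. L x * L' x \<partial>\<mu>"

lemma cov_integrable: "L \<in> Lin \<Longrightarrow> L' \<in> Lin \<Longrightarrow> integrable \<mu> (\<lambda>x. L x * L' x)"
  by (intro hom_integrable[OF hom_mult[OF hom_form hom_form]])

text \<open>Both sides come from the moment of order \<open>n + 1\<close> of
  \<open>L + s * L'\<close>, differentiated at \<open>s = 0\<close>. Expanded in \<open>s\<close>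
  its linear coefficient is \<open>(n + 1) * E[L' L^n]\<close>; by the Gaussian formula it is a
  power of the variance, whose linear part is \<open>2 * s * cov L' L\<close>.\<close>

lemma stein_power:
  assumes L: "L \<in> Lin" "L' \<in> Lin"
  shows "(\<integral>x. L' x * L x ^ n \<partial>\<mu>) = real n * cov L' L * (\<integral>x. L x ^ (n - 1) \<partial>\<mu>)"
proof -
  define N where "N = Suc n"
  define e where "e j = real (N choose j) * (\<integral>x. L' x ^ j * L x ^ (N - j) \<partial>\<mu>)" for j
  let ?a = "\<integral>x. (L x)\<^sup>2 \<partial>\<mu>" and ?b = "\<integral>x. (L' x)\<^sup>2 \<partial>\<mu>" and ?k = "cov L' L"
  have int: "integrable \<mu> (\<lambda>x. L' x ^ i * L x ^ j)" for i j
    by (rule hom_integrable[OF hom_mult[OF hom_power[OF hom_form[OF L(2)]] hom_power[OF hom_form[OF L(1)]]]])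
  have poly: "(\<Sum>j\<le>N. e j * s ^ j) = gauss_moment N * (?a + 2 * s * ?k + s\<^sup>2 * ?b) ^ (N div 2)" for s
  proof -
    let ?K = "\<lambda>x. L x + s * L' x"
    have K: "?K \<in> Lin" by (intro Lin_add Lin_scale L)
    have "(\<integral>x. (?K x)\<^sup>2 \<partial>\<mu>) = (\<integral>x. (L x)\<^sup>2 + 2 * s * (L' x * L x) + s\<^sup>2 * (L' x)\<^sup>2 \<partial>\<mu>)"
      by (intro Bochner_Integration.integral_cong) (auto simp: power2_eq_square algebra_simps)
    also have "\<dots> = ?a + 2 * s * ?k + s\<^sup>2 * ?b"
      using int[of 0 2] int[of 1 1] int[of 2 0] by simp
    finally have v: "(\<integral>x. (?K x)\<^sup>2 \<partial>\<mu>) = ?a + 2 * s * ?k + s\<^sup>2 * ?b" .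
    have "(\<integral>x. ?K x ^ N \<partial>\<mu>) = (\<integral>x. (\<Sum>j\<le>N. real (N choose j) * s ^ j * (L' x ^ j * L x ^ (N - j))) \<partial>\<mu>)"
      by (intro Bochner_Integration.integral_cong refl, subst add.commute, subst binomial_ring)
         (simp add: power_mult_distrib mult_ac)
    also have "\<dots> = (\<Sum>j\<le>N. real (N choose j) * s ^ j * (\<integral>x. L' x ^ j * L x ^ (N - j) \<partial>\<mu>))"
      by (subst Bochner_Integration.integral_sum) (simp_all add: int)
    also have "\<dots> = (\<Sum>j\<le>N. e j * s ^ j)"
      by (simp add: e_def mult_ac)
    finally show ?thesis
      using has_bochner_integral_integral_eq[OF moments[OF K, of N]] v by simp
  qed
  have d1: "((\<lambda>s. \<Sum>j\<le>N. e j * s ^ j) has_real_derivative e 1) (at 0)"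
  proof -
    have "((\<lambda>s. \<Sum>j\<le>N. e j * s ^ j) has_real_derivative (\<Sum>j\<le>N. e j * (real j * 0 ^ (j - 1)))) (at 0)"
      by (auto intro!: derivative_eq_intros sum.cong simp: mult_ac)
    also have "(\<Sum>j\<le>N. e j * (real j * 0 ^ (j - 1))) = (\<Sum>j\<le>N. if j = 1 then e j else 0)"
      by (intro sum.cong) (auto simp: power_0_left)
    also have "\<dots> = e 1" by (simp add: N_def)
    finally show ?thesis .
  qed
  have d2: "((\<lambda>s. \<Sum>j\<le>N. e j * s ^ j) has_real_derivative
     gauss_moment N * (real (N div 2) * ?a ^ (N div 2 - 1) * (2 * ?k))) (at 0)"
    unfolding poly by (auto intro!: derivative_eq_intros)
  have eq: "real N * (\<integral>x. L' x * L x ^ n \<partial>\<mu>) = gauss_moment N * (real (N div 2) * ?a ^ (N div 2 - 1) * (2 * ?k))"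
    using DERIV_unique[OF d1 d2] by (simp add: e_def N_def)
  show ?thesis
  proof (cases n)
    case 0
    thus ?thesis using eq by (simp add: N_def)
  next
    case (Suc m)
    have mom: "(\<integral>x. L x ^ m \<partial>\<mu>) = gauss_moment m * ?a ^ (m div 2)"
      using has_bochner_integral_integral_eq[OF moments[OF L(1), of m]] .
    have "real N * (\<integral>x. L' x * L x ^ n \<partial>\<mu>) = real N * (real n * ?k * (gauss_moment m * ?a ^ (m div 2)))"
    proof (cases "even m")
      case True
      then obtain k where k: "m = 2 * k" by (elim evenE)
      show ?thesis using eq by (simp add: N_def Suc k gauss_moment_Suc_Suc algebra_simps)
    next
      case False
      thus ?thesis using eq by (simp add: N_def Suc gauss_moment_def)
    qed
    thus ?thesis using Suc by (simp add: mom N_def del: of_nat_Suc)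
  qed
qed

text \<open>Gaussian integration by parts where the direction of the derivative is an independent
  copy \<open>y\<close>: since \<open>G x y\<close> is linear in the forms evaluated at
  \<open>y\<close>, averaging it against \<open>L' y\<close> produces the covariances. The copy
  plays the part of the Cameron-Martin direction that represents \<open>L'\<close>.\<close>

lemma stein:
  assumes L': "L' \<in> Lin" and F: "F \<in> hom n"
    and G: "\<And>x y. ((\<lambda>s. F (x + s *\<^sub>R y)) has_real_derivative G x y) (at 0)"
  shows "(\<integral>x. L' x * F x \<partial>\<mu>) = (\<integral>p. L' (snd p) * G (fst p) (snd p) \<partial>(\<mu> \<Otimes>\<^sub>M \<mu>))"
proof -
  obtain N :: nat and c L where L: "\<And>r. r < N \<Longrightarrow> L r \<in> Lin" and F_eq: "F = (\<lambda>x. \<Sum>r<N. c r * L r x ^ n)"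
    using hom_rep[OF F] by metis
  have G_eq: "G x y = (\<Sum>r<N. c r * (real n * (L r x ^ (n - 1) * L r y)))" for x y
  proof (rule DERIV_unique[OF G])
    have "((\<lambda>s. \<Sum>r<N. c r * (L r x + s * L r y) ^ n) has_real_derivative
      (\<Sum>r<N. c r * (real n * (L r x ^ (n - 1) * L r y)))) (at 0)"
      by (auto intro!: derivative_eq_intros simp: mult_ac)
    also have "(\<lambda>s. \<Sum>r<N. c r * (L r x + s * L r y) ^ n) = (\<lambda>s. F (x + s *\<^sub>R y))"
      using L by (simp add: F_eq form_add form_scale)
    finally show "((\<lambda>s. F (x + s *\<^sub>R y)) has_real_derivative
      (\<Sum>r<N. c r * (real n * (L r x ^ (n - 1) * L r y)))) (at 0)" .
  qed
  have int: "integrable \<mu> (\<lambda>x. L r x ^ m)" if "r < N" for r m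
    using hom_power_integrable[OF hom_form[OF L[OF that]]] .
  have "has_bochner_integral (\<mu> \<Otimes>\<^sub>M \<mu>)
     (\<lambda>p. \<Sum>r<N. c r * (real n * (L r (fst p) ^ (n - 1) * (L' (snd p) * L r (snd p)))))
     (\<Sum>r<N. c r * (real n * ((\<integral>x. L r x ^ (n - 1) \<partial>\<mu>) * cov L' (L r))))"
    by (rule has_bochner_integral_sum)
       (auto intro!: has_bochner_integral_mult_right pair_integral_mult prob int cov_integrable L' L)
  hence "(\<integral>p. L' (snd p) * G (fst p) (snd p) \<partial>(\<mu> \<Otimes>\<^sub>M \<mu>)) =
    (\<Sum>r<N. c r * (real n * ((\<integral>x. L r x ^ (n - 1) \<partial>\<mu>) * cov L' (L r))))"
    by (simp add: has_bochner_integral_iff G_eq sum_distrib_left mult_ac)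
  also have "\<dots> = (\<Sum>r<N. c r * (\<integral>x. L' x * L r x ^ n \<partial>\<mu>))"
    using L L' by (intro sum.cong) (auto simp: stein_power)
  also have "\<dots> = (\<integral>x. (\<Sum>r<N. c r * (L' x * L r x ^ n)) \<partial>\<mu>)"
    using L by (subst Bochner_Integration.integral_sum)
       (auto intro!: integrable_mult_right hom_integrable[OF hom_mult[OF hom_form[OF L'] hom_power[OF hom_form]]])
  also have "\<dots> = (\<integral>x. L' x * F x \<partial>\<mu>)"
    by (intro Bochner_Integration.integral_cong) (auto simp: F_eq sum_distrib_left mult_ac)
  finally show ?thesis ..
qed

lemma hom_mult_form3: "A \<in> Lin \<Longrightarrow> B \<in> Lin \<Longrightarrow> C \<in> Lin \<Longrightarrow> (\<lambda>x. A x * (B x * C x)) \<in> hom 3"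
  using hom_mult_form[of A "\<lambda>x. B x * C x" 2] hom_mult_form[of B C 1] hom_form[of C]
  by (simp add: numeral_eq_Suc)

text \<open>\<open>stein\<close> with the form \<open>A\<close>: the product rule pairs
  \<open>A\<close> with each of the other factors in turn and leaves second moments. For six factors
  it leaves fourth moments, to which this lemma applies again.\<close>

lemma wick4:
  assumes L: "A \<in> Lin" "B \<in> Lin" "C \<in> Lin" "D \<in> Lin"
  shows "(\<integral>x. A x * (B x * (C x * D x)) \<partial>\<mu>) = cov A B * cov C D + cov A C * cov B D + cov A D * cov B C"
proof -
  define G where "G x y = B y * (C x * D x) + (C y * (B x * D x) + D y * (B x * C x))" for x y
  have "(\<integral>x. A x * (B x * (C x * D x)) \<partial>\<mu>) = (\<integral>p. A (snd p) * G (fst p) (snd p) \<partial>(\<mu> \<Otimes>\<^sub>M \<mu>))"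
  proof (rule stein[OF L(1) hom_mult_form3[OF L(2-4)]])
    fix x y
    show "((\<lambda>s. B (x + s *\<^sub>R y) * (C (x + s *\<^sub>R y) * D (x + s *\<^sub>R y))) has_real_derivative G x y) (at 0)"
      using L by (auto simp: form_add form_scale G_def algebra_simps intro!: derivative_eq_intros)
  qed
  also have "\<dots> = cov C D * cov A B + (cov B D * cov A C + cov B C * cov A D)"
  proof (rule has_bochner_integral_integral_eq)
    have "has_bochner_integral (\<mu> \<Otimes>\<^sub>M \<mu>)
      (\<lambda>p. (C (fst p) * D (fst p)) * (A (snd p) * B (snd p)) +
        ((B (fst p) * D (fst p)) * (A (snd p) * C (snd p)) + (B (fst p) * C (fst p)) * (A (snd p) * D (snd p))))
      (cov C D * cov A B + (cov B D * cov A C + cov B C * cov A D))"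
      by (intro has_bochner_integral_add pair_integral_mult prob cov_integrable L)
    thus "has_bochner_integral (\<mu> \<Otimes>\<^sub>M \<mu>) (\<lambda>p. A (snd p) * G (fst p) (snd p))
      (cov C D * cov A B + (cov B D * cov A C + cov B C * cov A D))"
      by (simp add: G_def algebra_simps)
  qed
  finally show ?thesis by (simp add: mult.commute)
qed

lemma hom_mult_form5:
  "A \<in> Lin \<Longrightarrow> B \<in> Lin \<Longrightarrow> C \<in> Lin \<Longrightarrow> D \<in> Lin \<Longrightarrow> E \<in> Lin \<Longrightarrow>
    (\<lambda>x. A x * (B x * (C x * (D x * E x)))) \<in> hom 5"
  using hom_mult_form[OF _ hom_mult_form[OF _ hom_mult_form3[of C D E]], of A B] by (simp add: numeral_eq_Suc)

lemma hom_mult_form4: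
  "A \<in> Lin \<Longrightarrow> B \<in> Lin \<Longrightarrow> C \<in> Lin \<Longrightarrow> D \<in> Lin \<Longrightarrow> (\<lambda>x. A x * (B x * (C x * D x))) \<in> hom 4"
  using hom_mult_form[OF _ hom_mult_form3[of B C D], of A] by (simp add: numeral_eq_Suc)

lemma wick6:
  assumes L: "A \<in> Lin" "B \<in> Lin" "C \<in> Lin" "D \<in> Lin" "E \<in> Lin" "F \<in> Lin"
  shows "(\<integral>x. A x * (B x * (C x * (D x * (E x * F x)))) \<partial>\<mu>) =
    cov A B * (cov C D * cov E F + cov C E * cov D F + cov C F * cov D E) +
    cov A C * (cov B D * cov E F + cov B E * cov D F + cov B F * cov D E) +
    cov A D * (cov B C * cov E F + cov B E * cov C F + cov B F * cov C E) +
    cov A E * (cov B C * cov D F + cov B D * cov C F + cov B F * cov C D) +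
    cov A F * (cov B C * cov D E + cov B D * cov C E + cov B E * cov C D)"
proof -
  define G where "G x y = B y * (C x * (D x * (E x * F x))) + (C y * (B x * (D x * (E x * F x))) +
     (D y * (B x * (C x * (E x * F x))) + (E y * (B x * (C x * (D x * F x))) + F y * (B x * (C x * (D x * E x))))))" for x y
  have "(\<integral>x. A x * (B x * (C x * (D x * (E x * F x)))) \<partial>\<mu>) = (\<integral>p. A (snd p) * G (fst p) (snd p) \<partial>(\<mu> \<Otimes>\<^sub>M \<mu>))"
  proof (rule stein[OF L(1) hom_mult_form5[OF L(2-6)]])
    fix x y
    show "((\<lambda>s. B (x + s *\<^sub>R y) * (C (x + s *\<^sub>R y) * (D (x + s *\<^sub>R y) * (E (x + s *\<^sub>R y) * F (x + s *\<^sub>R y)))))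
      has_real_derivative G x y) (at 0)"
      using L by (auto simp: form_add form_scale G_def algebra_simps intro!: derivative_eq_intros)
  qed
  also have "\<dots> = (\<integral>x. C x * (D x * (E x * F x)) \<partial>\<mu>) * cov A B + ((\<integral>x. B x * (D x * (E x * F x)) \<partial>\<mu>) * cov A C +
    ((\<integral>x. B x * (C x * (E x * F x)) \<partial>\<mu>) * cov A D + ((\<integral>x. B x * (C x * (D x * F x)) \<partial>\<mu>) * cov A E +
     (\<integral>x. B x * (C x * (D x * E x)) \<partial>\<mu>) * cov A F)))" (is "_ = ?R")
  proof (rule has_bochner_integral_integral_eq)
    have "has_bochner_integral (\<mu> \<Otimes>\<^sub>M \<mu>)
      (\<lambda>p. (C (fst p) * (D (fst p) * (E (fst p) * F (fst p)))) * (A (snd p) * B (snd p)) +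
        ((B (fst p) * (D (fst p) * (E (fst p) * F (fst p)))) * (A (snd p) * C (snd p)) +
        ((B (fst p) * (C (fst p) * (E (fst p) * F (fst p)))) * (A (snd p) * D (snd p)) +
        ((B (fst p) * (C (fst p) * (D (fst p) * F (fst p)))) * (A (snd p) * E (snd p)) +
         (B (fst p) * (C (fst p) * (D (fst p) * E (fst p)))) * (A (snd p) * F (snd p)))))) ?R"
      by (intro has_bochner_integral_add pair_integral_mult prob cov_integrable hom_integrable[OF hom_mult_form4] L)
    thus "has_bochner_integral (\<mu> \<Otimes>\<^sub>M \<mu>) (\<lambda>p. A (snd p) * G (fst p) (snd p)) ?R"
      by (simp add: G_def distrib_left mult_ac)
  qed
  finally show ?thesis by (simp add: wick4 L mult.commute)
qed

text \<open>The squared norm of the tensor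
  \<open>\<Sum>r. a r * (L r \<otimes> ... \<otimes> L r)\<close>, with \<open>j\<close> factors,
  over the L2 span of the forms. With \<open>a r = c r * L r x ^ (n - j)\<close> it bounds, up to
  the square of a falling factorial, the squared Hilbert-Schmidt norm at \<open>x\<close> of the
  \<open>j\<close>-th derivative of \<open>\<Sum>r. c r * L r ^ n\<close>.\<close>

definition cov_form :: "nat \<Rightarrow> (nat \<Rightarrow> 'b \<Rightarrow> real) \<Rightarrow> nat \<Rightarrow> (nat \<Rightarrow> real) \<Rightarrow> real" where
  "cov_form N L j a = (\<Sum>r<N. \<Sum>r'<N. a r * a r' * cov (L r) (L r') ^ j)"

lemma cov_form_0: "cov_form N L 0 a = (\<Sum>r<N. a r)\<^sup>2"
  by (simp add: cov_form_def power2_eq_square sum_product)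

text \<open>One covariance factor is written as the average over a point \<open>y\<close>, which
  moves \<open>L r y\<close> into the coefficients. This is the induction step for
  \<open>cov_form_nonneg\<close> and \<open>bessel_multilinear\<close>.\<close>

lemma cov_form_Suc:
  assumes "\<And>r. r < N \<Longrightarrow> L r \<in> Lin"
  shows "has_bochner_integral \<mu> (\<lambda>y. cov_form N L j (\<lambda>r. a r * L r y)) (cov_form N L (Suc j) a)"
proof -
  have "has_bochner_integral \<mu> (\<lambda>y. \<Sum>r<N. \<Sum>r'<N. (a r * a r' * cov (L r) (L r') ^ j) * (L r y * L r' y))
    (\<Sum>r<N. \<Sum>r'<N. (a r * a r' * cov (L r) (L r') ^ j) * cov (L r) (L r'))"
    by (intro has_bochner_integral_sum has_bochner_integral_mult_right has_bochner_integral_integrable cov_integrable assms) auto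
  thus ?thesis by (simp add: cov_form_def mult_ac)
qed

lemma cov_form_nonneg:
  assumes "\<And>r. r < N \<Longrightarrow> L r \<in> Lin"
  shows "0 \<le> cov_form N L j a"
proof (induction j arbitrary: a)
  case (Suc j)
  have "cov_form N L (Suc j) a = (\<integral>y. cov_form N L j (\<lambda>r. a r * L r y) \<partial>\<mu>)"
    using has_bochner_integral_integral_eq[OF cov_form_Suc[OF assms]] by simp
  also have "\<dots> \<ge> 0" by (intro integral_nonneg_AE AE_I2 Suc)
  finally show ?case .
qed (simp add: cov_form_0)

text \<open>Derivatives of a polynomial of fixed degree are bounded in L2 by the polynomial. In the
  step one covariance becomes an average over \<open>y\<close>; the induction hypothesis applies for
  fixed \<open>y\<close> to \<open>\<Sum>r. (c r * L r y) * L r ^ (n - 1)\<close>. As a function of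
  \<open>x\<close> and \<open>y\<close> this sum times \<open>n\<close> is the linear coefficient of
  \<open>F (x + s y)\<close>, so \<open>coefficient_bound\<close> closes the step.\<close>

lemma integral_cov_form_bound:
  assumes "j \<le> n"
  shows "\<exists>C\<ge>0. \<forall>(N::nat) c L. (\<forall>r<N. L r \<in> Lin) \<longrightarrow>
    (\<integral>x. cov_form N L j (\<lambda>r. c r * L r x ^ (n - j)) \<partial>\<mu>) \<le> C * (\<integral>x. (\<Sum>r<N. c r * L r x ^ n)\<^sup>2 \<partial>\<mu>)"
  using assms
proof (induction j arbitrary: n)
  case 0
  show ?case by (intro exI[of _ 1]) (auto simp: cov_form_0)
next
  case (Suc j)
  interpret Q: gaussian_forms "\<mu> \<Otimes>\<^sub>M \<mu>" Lin2 by (rule pair_forms)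
  obtain m where n: "n = Suc m" using Suc.prems by (cases n) auto
  have "j \<le> m" using Suc.prems n by simp
  from Suc.IH[OF this] obtain C where C: "C \<ge> 0"
    "\<And>(N::nat) c L. (\<forall>r<N. L r \<in> Lin) \<Longrightarrow> (\<integral>x. cov_form N L j (\<lambda>r. c r * L r x ^ (m - j)) \<partial>\<mu>) \<le> C * (\<integral>x. (\<Sum>r<N. c r * L r x ^ m)\<^sup>2 \<partial>\<mu>)"
    by blast
  obtain K where K: "coefficient_bound n 1 K" using coefficient_bound_exists[of 1 n] n by auto
  hence K0: "0 \<le> K" by (simp add: coefficient_bound_def)
  show ?case
  proof (intro exI[of _ "C * K"] conjI allI impI)
    show "0 \<le> C * K" using C K0 by simp
    fix N :: nat and c L assume L: "\<forall>r<N. L r \<in> (Lin :: ('b \<Rightarrow> real) set)"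
    let ?F = "\<lambda>x. \<Sum>r<N. c r * L r x ^ n"
    have F: "?F \<in> hom n" using L by (intro hom_sum hom.pow) auto
    define M where "M k x y = (\<Sum>r<N. c r * (real (n choose k) * L r y ^ k * L r x ^ (n - k)))" for k x y
    have M: "?F (x + s *\<^sub>R y) = (\<Sum>k\<le>n. M k x y * s ^ k)" for x y s
    proof -
      have "?F (x + s *\<^sub>R y) = (\<Sum>r<N. c r * (s * L r y + L r x) ^ n)"
        using L by (intro sum.cong) (auto simp: form_add form_scale add.commute)
      also have "\<dots> = (\<Sum>r<N. \<Sum>k\<le>n. c r * (real (n choose k) * L r y ^ k * L r x ^ (n - k)) * s ^ k)"
        by (simp add: binomial_ring sum_distrib_left power_mult_distrib mult_ac)
      also have "\<dots> = (\<Sum>k\<le>n. M k x y * s ^ k)"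
        unfolding M_def sum_distrib_right by (rule sum.swap)
      finally show ?thesis .
    qed
    have M1: "M 1 x y = real n * (\<Sum>r<N. (c r * L r y) * L r x ^ m)" for x y
      by (simp add: M_def n sum_distrib_left mult_ac)
    let ?S = "\<lambda>x y. \<Sum>r<N. (c r * L r y) * L r x ^ m"
    have int: "integrable \<mu> (\<lambda>x. (L r x ^ i * L r' x ^ j))" if "r < N" "r' < N" for r r' i j
      using L that by (intro hom_integrable[OF hom_mult[OF hom_power[OF hom_form] hom_power[OF hom_form]]]) auto
    have "(\<integral>x. cov_form N L (Suc j) (\<lambda>r. c r * L r x ^ (n - Suc j)) \<partial>\<mu>) =
      (\<Sum>r<N. \<Sum>r'<N. c r * c r' * (\<integral>x. L r x ^ (m - j) * L r' x ^ (m - j) \<partial>\<mu>) * cov (L r) (L r') ^ Suc j)"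
    proof -
      have "has_bochner_integral \<mu> (\<lambda>x. \<Sum>r<N. \<Sum>r'<N. (c r * c r' * cov (L r) (L r') ^ Suc j) * (L r x ^ (m - j) * L r' x ^ (m - j)))
       (\<Sum>r<N. \<Sum>r'<N. (c r * c r' * cov (L r) (L r') ^ Suc j) * (\<integral>x. L r x ^ (m - j) * L r' x ^ (m - j) \<partial>\<mu>))"
        by (intro has_bochner_integral_sum has_bochner_integral_mult_right has_bochner_integral_integrable int) auto
      from has_bochner_integral_integral_eq[OF this] show ?thesis
        by (simp add: cov_form_def n mult_ac)
    qed
    also have "\<dots> = (\<integral>y. (\<integral>x. cov_form N L j (\<lambda>r. (c r * L r y) * L r x ^ (m - j)) \<partial>\<mu>) \<partial>\<mu>)"
    proof -
      have in1: "(\<integral>x. cov_form N L j (\<lambda>r. (c r * L r y) * L r x ^ (m - j)) \<partial>\<mu>) =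
        (\<Sum>r<N. \<Sum>r'<N. (c r * c r' * (\<integral>x. L r x ^ (m - j) * L r' x ^ (m - j) \<partial>\<mu>) * cov (L r) (L r') ^ j) * (L r y * L r' y))" for y
      proof -
        have "has_bochner_integral \<mu> (\<lambda>x. \<Sum>r<N. \<Sum>r'<N. (c r * c r' * cov (L r) (L r') ^ j * (L r y * L r' y)) * (L r x ^ (m - j) * L r' x ^ (m - j)))
         (\<Sum>r<N. \<Sum>r'<N. (c r * c r' * cov (L r) (L r') ^ j * (L r y * L r' y)) * (\<integral>x. L r x ^ (m - j) * L r' x ^ (m - j) \<partial>\<mu>))"
          by (intro has_bochner_integral_sum has_bochner_integral_mult_right has_bochner_integral_integrable int) auto
        from has_bochner_integral_integral_eq[OF this] show ?thesis
          by (simp add: cov_form_def mult_ac)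
      qed
      have "has_bochner_integral \<mu> (\<lambda>y. \<Sum>r<N. \<Sum>r'<N. (c r * c r' * (\<integral>x. L r x ^ (m - j) * L r' x ^ (m - j) \<partial>\<mu>) * cov (L r) (L r') ^ j) * (L r y * L r' y))
        (\<Sum>r<N. \<Sum>r'<N. (c r * c r' * (\<integral>x. L r x ^ (m - j) * L r' x ^ (m - j) \<partial>\<mu>) * cov (L r) (L r') ^ j) * cov (L r) (L r'))"
        using L by (intro has_bochner_integral_sum has_bochner_integral_mult_right has_bochner_integral_integrable cov_integrable) auto
      from has_bochner_integral_integral_eq[OF this] show ?thesis
        unfolding in1 by (simp add: mult_ac)
    qed
    also have "\<dots> \<le> (\<integral>y. C * (\<integral>x. (?S x y)\<^sup>2 \<partial>\<mu>) \<partial>\<mu>)"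
    proof (rule integral_mono)
      have sq: "(?S x y)\<^sup>2 = (\<Sum>r<N. \<Sum>r'<N. (c r * c r' * (L r y * L r' y)) * (L r x ^ m * L r' x ^ m))" for x y
        by (simp add: power2_eq_square sum_product mult_ac)
      have e: "(\<integral>x. (?S x y)\<^sup>2 \<partial>\<mu>) = (\<Sum>r<N. \<Sum>r'<N. (c r * c r' * (\<integral>x. L r x ^ m * L r' x ^ m \<partial>\<mu>)) * (L r y * L r' y))" for y
      proof -
        have "has_bochner_integral \<mu> (\<lambda>x. \<Sum>r<N. \<Sum>r'<N. (c r * c r' * (L r y * L r' y)) * (L r x ^ m * L r' x ^ m))
          (\<Sum>r<N. \<Sum>r'<N. (c r * c r' * (L r y * L r' y)) * (\<integral>x. L r x ^ m * L r' x ^ m \<partial>\<mu>))"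
          by (intro has_bochner_integral_sum has_bochner_integral_mult_right has_bochner_integral_integrable int) auto
        from has_bochner_integral_integral_eq[OF this] show ?thesis
          unfolding sq by (simp add: mult_ac)
      qed
      show "integrable \<mu> (\<lambda>y. C * (\<integral>x. (?S x y)\<^sup>2 \<partial>\<mu>))"
        unfolding e using L by (auto intro!: integrable_mult_right Bochner_Integration.integrable_sum cov_integrable)
      have e': "(\<integral>x. cov_form N L j (\<lambda>r. (c r * L r y) * L r x ^ (m - j)) \<partial>\<mu>) =
        (\<Sum>r<N. \<Sum>r'<N. (c r * c r' * (\<integral>x. L r x ^ (m - j) * L r' x ^ (m - j) \<partial>\<mu>) * cov (L r) (L r') ^ j) * (L r y * L r' y))" for y
      proof -
        have "has_bochner_integral \<mu> (\<lambda>x. \<Sum>r<N. \<Sum>r'<N. (c r * c r' * cov (L r) (L r') ^ j * (L r y * L r' y)) * (L r x ^ (m - j) * L r' x ^ (m - j)))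
         (\<Sum>r<N. \<Sum>r'<N. (c r * c r' * cov (L r) (L r') ^ j * (L r y * L r' y)) * (\<integral>x. L r x ^ (m - j) * L r' x ^ (m - j) \<partial>\<mu>))"
          by (intro has_bochner_integral_sum has_bochner_integral_mult_right has_bochner_integral_integrable int) auto
        from has_bochner_integral_integral_eq[OF this] show ?thesis
          by (simp add: cov_form_def mult_ac)
      qed
      show "integrable \<mu> (\<lambda>y. \<integral>x. cov_form N L j (\<lambda>r. (c r * L r y) * L r x ^ (m - j)) \<partial>\<mu>)"
        unfolding e' using L by (auto intro!: integrable_mult_right Bochner_Integration.integrable_sum cov_integrable)
      fix y
      show "(\<integral>x. cov_form N L j (\<lambda>r. (c r * L r y) * L r x ^ (m - j)) \<partial>\<mu>) \<le> C * (\<integral>x. (?S x y)\<^sup>2 \<partial>\<mu>)"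
        using C(2)[OF L, of "\<lambda>r. c r * L r y"] .
    qed
    also have "\<dots> = C * (\<integral>y. (\<integral>x. (?S x y)\<^sup>2 \<partial>\<mu>) \<partial>\<mu>)" by simp
    also have "(\<integral>y. (\<integral>x. (?S x y)\<^sup>2 \<partial>\<mu>) \<partial>\<mu>) = (\<integral>p. (?S (fst p) (snd p))\<^sup>2 \<partial>(\<mu> \<Otimes>\<^sub>M \<mu>))"
    proof -
      have "(\<lambda>p. ?S (fst p) (snd p)) \<in> Q.hom n"
      proof (rule Q.hom_sum)
        fix r assume "r \<in> {..<N}"
        hence "L r \<in> Lin" using L by simp
        from Q.hom_mult[OF Q.hom.pow[OF Lin2_snd[OF this], of "c r" 1] Q.hom.pow[OF Lin2_fst[OF this], of 1 m]]
        show "(\<lambda>p. c r * L r (snd p) * L r (fst p) ^ m) \<in> Q.hom n" by (simp add: n)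
      qed
      hence "integrable (\<mu> \<Otimes>\<^sub>M \<mu>) (case_prod (\<lambda>x y. (?S x y)\<^sup>2))"
        using Q.hom_power_integrable by (auto simp: case_prod_beta')
      from P.integral_snd[OF this] show ?thesis by (simp add: case_prod_beta')
    qed
    also have "\<dots> \<le> (\<integral>p. (M 1 (fst p) (snd p))\<^sup>2 \<partial>(\<mu> \<Otimes>\<^sub>M \<mu>))"
    proof -
      have "1 * (\<integral>p. (?S (fst p) (snd p))\<^sup>2 \<partial>(\<mu> \<Otimes>\<^sub>M \<mu>)) \<le> (real n)\<^sup>2 * (\<integral>p. (?S (fst p) (snd p))\<^sup>2 \<partial>(\<mu> \<Otimes>\<^sub>M \<mu>))"
        using one_le_power[of "real n" 2] n by (intro mult_right_mono) auto
      thus ?thesis unfolding M1 power_mult_distrib by simp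
    qed
    also have "\<dots> \<le> K * (\<integral>x. (?F x)\<^sup>2 \<partial>\<mu>)"
      using K F M by (auto simp: coefficient_bound_def)
    finally show "(\<integral>x. cov_form N L (Suc j) (\<lambda>r. c r * L r x ^ (n - Suc j)) \<partial>\<mu>) \<le> C * K * (\<integral>x. (?F x)\<^sup>2 \<partial>\<mu>)"
      using C(1) by (simp add: mult_left_mono mult.assoc)
  qed
qed

lemma cov_form_hom:
  assumes "\<And>r. r < N \<Longrightarrow> L r \<in> Lin"
  shows "(\<lambda>x. cov_form N L j (\<lambda>r. c r * L r x ^ k)) \<in> hom (2 * k)"
proof -
  have "(\<lambda>x. \<Sum>r<N. \<Sum>r'<N. cov (L r) (L r') ^ j * ((c r * L r x ^ k) * (c r' * L r' x ^ k))) \<in> hom (k + k)"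
    using assms by (intro hom_sum hom_scale hom_mult hom.pow) auto
  thus ?thesis unfolding mult_2 by (simp add: cov_form_def mult_ac)
qed

text \<open>As a function of \<open>x\<close>, \<open>cov_form\<close> is a nonnegative homogeneous
  polynomial of degree \<open>2 * (n - j)\<close>. Its high moments are thus bounded through its
  second moment, that one by \<open>reverse_hoelder\<close> through its mean, and the mean by
  \<open>integral_cov_form_bound\<close>.\<close>

lemma cov_form_moment_bound:
  assumes "j \<le> n"
  shows "\<exists>C\<ge>1. \<forall>(N::nat) c L. (\<forall>r<N. L r \<in> Lin) \<longrightarrow>
    (\<integral>x. cov_form N L j (\<lambda>r. c r * L r x ^ (n - j)) ^ 2 ^ Suc m \<partial>\<mu>) \<le> C * (\<integral>x. (\<Sum>r<N. c r * L r x ^ n)\<^sup>2 \<partial>\<mu>) ^ 2 ^ Suc m"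
proof -
  obtain C1 where C1: "C1 \<ge> 0" "\<And>(N::nat) c L. (\<forall>r<N. L r \<in> Lin) \<Longrightarrow>
    (\<integral>x. cov_form N L j (\<lambda>r. c r * L r x ^ (n - j)) \<partial>\<mu>) \<le> C1 * (\<integral>x. (\<Sum>r<N. c r * L r x ^ n)\<^sup>2 \<partial>\<mu>)"
    using integral_cov_form_bound[OF assms] by blast
  obtain C2 where C2: "C2 \<ge> 1" "\<And>F. F \<in> hom (2 * (n - j)) \<Longrightarrow> (\<integral>x. F x ^ 2 ^ Suc m \<partial>\<mu>) \<le> C2 * (\<integral>x. (F x)\<^sup>2 \<partial>\<mu>) ^ 2 ^ m"
    using hypercontractivity_power by blast
  obtain C3 where C3: "C3 \<ge> 1" "\<And>F. F \<in> hom (2 * (n - j)) \<Longrightarrow> (\<And>x. 0 \<le> F x) \<Longrightarrow> (\<integral>x. (F x)\<^sup>2 \<partial>\<mu>) \<le> C3 * (\<integral>x. F x \<partial>\<mu>)\<^sup>2"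
    using reverse_hoelder by blast
  define C where "C = C2 * (C3 * C1\<^sup>2) ^ 2 ^ m"
  show ?thesis
  proof (intro exI[of _ "max 1 C"] conjI allI impI)
    fix N :: nat and c L assume L: "\<forall>r<N. L r \<in> (Lin :: ('b \<Rightarrow> real) set)"
    let ?f = "\<lambda>x. cov_form N L j (\<lambda>r. c r * L r x ^ (n - j))"
    let ?b = "\<integral>x. (\<Sum>r<N. c r * L r x ^ n)\<^sup>2 \<partial>\<mu>"
    have f: "?f \<in> hom (2 * (n - j))" and f0: "\<And>x. 0 \<le> ?f x"
      using L by (auto intro: cov_form_hom cov_form_nonneg)
    have "(\<integral>x. ?f x ^ 2 ^ Suc m \<partial>\<mu>) \<le> C2 * (\<integral>x. (?f x)\<^sup>2 \<partial>\<mu>) ^ 2 ^ m" by (rule C2(2)[OF f])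
    also have "\<dots> \<le> C2 * (C3 * (\<integral>x. ?f x \<partial>\<mu>)\<^sup>2) ^ 2 ^ m"
      using C2(1) C3(2)[OF f f0] by (intro mult_left_mono power_mono) auto
    also have "\<dots> \<le> C2 * (C3 * (C1 * ?b)\<^sup>2) ^ 2 ^ m"
      using C2(1) C3(1) C1(2)[OF L, of c] f0
      by (intro mult_left_mono power_mono) (auto intro!: integral_nonneg_AE)
    also have "\<dots> = C * ?b ^ 2 ^ Suc m"
      by (simp add: C_def power_mult_distrib power_mult[symmetric] mult_ac)
    also have "\<dots> \<le> max 1 C * ?b ^ 2 ^ Suc m" by (intro mult_right_mono) auto
    finally show "(\<integral>x. ?f x ^ 2 ^ Suc m \<partial>\<mu>) \<le> max 1 C * ?b ^ 2 ^ Suc m" .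
  qed simp
qed

end

section \<open>Dyadic interpolation and the law of a Gaussian process\<close>

lemma apply_path_of:
  assumes "0 \<le> T" "continuous_on {0..T} f"
  shows "apply_bcontfun (path_of T f) t = f (max 0 (min T t))"
proof -
  let ?g = "\<lambda>t. f (max 0 (min T t))"
  have "continuous_on UNIV ?g"
    by (rule continuous_on_compose2[OF assms(2)]) (use assms(1) in \<open>auto intro!: continuous_intros\<close>)
  moreover have "bounded (range ?g)"
  proof -
    have "bounded (f ` {0..T})"
      using assms(2) by (intro compact_imp_bounded compact_continuous_image) auto
    thus ?thesis by (rule bounded_subset) (use assms(1) in auto)
  qed
  ultimately have "?g \<in> bcontfun" by (simp add: bcontfun_def)
  thus ?thesis by (simp add: path_of_def Bcontfun_inverse)
qed

lemma path_of_in_C0: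
  assumes "0 \<le> T" "continuous_on {0..T} f" "f 0 = 0"
  shows "path_of T f \<in> C0 T"
  using assms by (auto simp: C0_def apply_path_of)

definition ramp :: "real \<Rightarrow> real" where "ramp u = max 0 (min 1 u)"

lemma ramp_bounds: "0 \<le> ramp u" "ramp u \<le> 1" "\<bar>ramp u\<bar> \<le> 1" by (auto simp: ramp_def)

lemma continuous_ramp [continuous_intros]: "continuous_on S f \<Longrightarrow> continuous_on S (\<lambda>x. ramp (f x))"
  unfolding ramp_def by (intro continuous_intros)

text \<open>Linear interpolation of the nodes \<open>c\<close> as a sum of ramps rather than by
  cases on the cell: it is visibly linear in the nodes and continuous in \<open>t\<close>, and its
  density is a step function.\<close>

definition polygon :: "real \<Rightarrow> nat \<Rightarrow> (nat \<Rightarrow> 'b::real_vector) \<Rightarrow> real \<Rightarrow> 'b" where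
  "polygon T N c t = c 0 + (\<Sum>k<N. ramp (real N * t / T - real k) *\<^sub>R (c (Suc k) - c k))"

lemma polygon_on_cell:
  assumes "0 < T" "j < N" "real j * T / real N \<le> t" "t \<le> real (Suc j) * T / real N"
  shows "polygon T N c t = c j + (real N * t / T - real j) *\<^sub>R (c (Suc j) - c j)"
proof -
  let ?f = "\<lambda>k. ramp (real N * t / T - real k) *\<^sub>R (c (Suc k) - c k)"
  have N: "0 < real N" using assms(2) by simp
  have 1: "real j \<le> real N * t / T" and 2: "real N * t / T \<le> real j + 1"
    using assms N by (auto simp: field_simps)
  have "{..<N} = {..<j} \<union> {j} \<union> {Suc j..<N}" using assms(2) by auto
  hence "sum ?f {..<N} = sum ?f ({..<j} \<union> {j} \<union> {Suc j..<N})" by simp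
  also have "\<dots> = sum ?f {..<j} + ?f j + sum ?f {Suc j..<N}"
    by (subst sum.union_disjoint, auto)+
  also have "sum ?f {..<j} = (\<Sum>k<j. c (Suc k) - c k)"
    using 1 by (intro sum.cong) (auto simp: ramp_def)
  also have "\<dots> = c j - c 0" by (rule sum_lessThan_telescope)
  also have "sum ?f {Suc j..<N} = 0"
    using 2 by (intro sum.neutral) (auto simp: ramp_def)
  also have "ramp (real N * t / T - real j) = real N * t / T - real j"
    using 1 2 by (auto simp: ramp_def)
  finally show ?thesis by (simp add: polygon_def)
qed

lemma polygon_cell_exists:
  assumes "0 < T" "0 < N" "0 \<le> t" "t \<le> T"
  obtains j where "j < N" "real j * T / real N \<le> t" "t \<le> real (Suc j) * T / real N"
    "t < T \<Longrightarrow> t < real (Suc j) * T / real N"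
proof (cases "t = T")
  case True
  thus ?thesis using that[of "N - 1"] assms by (auto simp: field_simps of_nat_diff)
next
  case False
  define j where "j = nat \<lfloor>real N * t / T\<rfloor>"
  have f: "real j = of_int \<lfloor>real N * t / T\<rfloor>" using assms by (simp add: j_def)
  have 1: "real j \<le> real N * t / T" and 2: "real N * t / T < real j + 1"
    unfolding f by linarith+
  have "real N * t / T < real N" using False assms by (simp add: field_simps)
  hence "j < N" using 1 by linarith
  moreover have "real j * T / real N \<le> t" "t < real (Suc j) * T / real N"
    using 1 2 assms by (auto simp: field_simps)
  ultimately show ?thesis using that[of j] by simp
qed

lemma dyadic_interpolation_polygon:
  assumes "0 < T" "0 \<le> t" "t \<le> T"
  shows "dyadic_interpolation T l x t = polygon T (2 ^ l) (\<lambda>k. apply_bcontfun x (real k * T / 2 ^ l)) t"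
proof -
  let ?N = "2 ^ l :: nat"
  obtain j where j: "j < ?N" "real j * T / real ?N \<le> t" "t \<le> real (Suc j) * T / real ?N"
    "t < T \<Longrightarrow> t < real (Suc j) * T / real ?N"
    using polygon_cell_exists[of T ?N t] assms by auto
  have p: "polygon T ?N (\<lambda>k. apply_bcontfun x (real k * T / 2 ^ l)) t =
     apply_bcontfun x (real j * T / 2 ^ l) + (2 ^ l * t / T - real j) *\<^sub>R
       (apply_bcontfun x (real (Suc j) * T / 2 ^ l) - apply_bcontfun x (real j * T / 2 ^ l))"
    using polygon_on_cell[OF assms(1) j(1-3), of "\<lambda>k. apply_bcontfun x (real k * T / 2 ^ l)"] by simp
  show ?thesis
  proof (cases "t = T")
    case True
    \<comment> \<open>At the right end point the definition selects the cell that starts at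
      \<open>T\<close>, with weight zero, whereas the polygon uses the last cell with weight
      one.\<close>
    have "\<lfloor>t / (T / 2 ^ l)\<rfloor> = 2 ^ l"
      using True assms by (simp add: floor_unique)
    moreover have "Suc j = ?N"
    proof -
      have "real ?N * T \<le> real (Suc j) * T" using j(3) True assms by (simp add: field_simps)
      hence "real ?N \<le> real (Suc j)" using assms(1) by (simp only: mult_le_cancel_right_pos)
      thus ?thesis using j(1) by (metis Suc_leI le_antisym of_nat_le_iff)
    qed
    moreover from this have "real j = 2 ^ l - 1" by (metis of_nat_Suc of_nat_numeral of_nat_power add_diff_cancel_left')
    ultimately show ?thesis
      unfolding p using True assms by (simp add: dyadic_interpolation_def Let_def)
  next
    case False
    hence "t < real (Suc j) * T / 2 ^ l" using j(4) assms by simp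
    hence "\<lfloor>t / (T / 2 ^ l)\<rfloor> = int j"
      using j(2) assms by (intro floor_unique) (auto simp: field_simps)
    moreover have "(t - real j * (T / 2 ^ l)) / (T / 2 ^ l) = 2 ^ l * t / T - real j"
      using assms by (simp add: field_simps)
    moreover have "real j * (T / 2 ^ l) = real j * T / 2 ^ l" "(real j + 1) * (T / 2 ^ l) = real (Suc j) * T / 2 ^ l"
      by (simp_all add: add.commute)
    ultimately show ?thesis
      unfolding p dyadic_interpolation_def Let_def by (simp add: add.commute[of 1])
  qed
qed

lemma continuous_polygon: "0 < T \<Longrightarrow> continuous_on S (polygon T N (c :: nat \<Rightarrow> 'b::real_normed_vector))"
  unfolding polygon_def by (auto intro!: continuous_intros)

lemma polygon_diff_le:
  fixes c c' :: "nat \<Rightarrow> 'b::real_normed_vector"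
  shows "norm (polygon T N c t - polygon T N c' t) \<le>
    norm (c 0 - c' 0) + (\<Sum>k<N. norm (c (Suc k) - c' (Suc k)) + norm (c k - c' k))"
proof -
  have "polygon T N c t - polygon T N c' t = (c 0 - c' 0) +
    (\<Sum>k<N. ramp (real N * t / T - real k) *\<^sub>R ((c (Suc k) - c' (Suc k)) - (c k - c' k)))"
    by (simp add: polygon_def algebra_simps sum.distrib sum_subtractf)
  also have "norm \<dots> \<le> norm (c 0 - c' 0) +
    (\<Sum>k<N. norm (ramp (real N * t / T - real k) *\<^sub>R ((c (Suc k) - c' (Suc k)) - (c k - c' k))))"
    by (intro order.trans[OF norm_triangle_ineq] add_left_mono norm_sum)
  also have "\<dots> \<le> norm (c 0 - c' 0) + (\<Sum>k<N. norm (c (Suc k) - c' (Suc k)) + norm (c k - c' k))"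
  proof (intro add_left_mono sum_mono)
    fix k
    have "norm (ramp (real N * t / T - real k) *\<^sub>R ((c (Suc k) - c' (Suc k)) - (c k - c' k))) \<le>
      1 * norm ((c (Suc k) - c' (Suc k)) - (c k - c' k))"
      unfolding norm_scaleR by (intro mult_right_mono ramp_bounds) auto
    also have "\<dots> \<le> norm (c (Suc k) - c' (Suc k)) + norm (c k - c' k)"
      using norm_triangle_ineq4 by simp
    finally show "norm (ramp (real N * t / T - real k) *\<^sub>R ((c (Suc k) - c' (Suc k)) - (c k - c' k))) \<le> \<dots>" .
  qed
  finally show ?thesis .
qed

text \<open>The map factors through the countable product of the nodal values, and from there into
  the sup norm it is continuous. The \<open>min T\<close> keeps every node in \<open>[0, T]\<close>,
  where \<open>w\<close> is measurable.\<close>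

lemma polygon_path_measurable:
  fixes w :: "real \<Rightarrow> 'a \<Rightarrow> real ^ 'd::finite"
  assumes T: "0 < T" and w: "\<And>t. 0 \<le> t \<Longrightarrow> t \<le> T \<Longrightarrow> w t \<in> borel_measurable M"
  shows "(\<lambda>\<omega>. path_of T (polygon T N (\<lambda>k. w (min T (real k * T / real N)) \<omega>))) \<in> borel_measurable M"
proof -
  have "(\<lambda>\<omega> k. w (min T (real k * T / real N)) \<omega>) \<in> borel_measurable M"
    using T by (intro measurable_coordinatewise_then_product w) auto
  moreover have "continuous_on UNIV (\<lambda>c :: nat \<Rightarrow> real ^ 'd. path_of T (polygon T N c))"
    unfolding continuous_on_def
  proof
    fix c :: "nat \<Rightarrow> real ^ 'd"
    let ?B = "\<lambda>c'. norm (c' 0 - c 0) + (\<Sum>k<N. norm (c' (Suc k) - c (Suc k)) + norm (c' k - c k))"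
    have "continuous_on UNIV ?B"
      by (intro continuous_intros continuous_on_product_coordinates)
    hence "(?B \<longlongrightarrow> ?B c) (at c)" unfolding continuous_on_def by blast
    hence B: "(?B \<longlongrightarrow> 0) (at c)" by simp
    have "dist (path_of T (polygon T N c')) (path_of T (polygon T N c)) \<le> ?B c'" for c'
    proof (rule dist_bound)
      fix t
      show "dist (apply_bcontfun (path_of T (polygon T N c')) t) (apply_bcontfun (path_of T (polygon T N c)) t) \<le> ?B c'"
        using T by (simp add: apply_path_of continuous_polygon dist_norm polygon_diff_le)
    qed
    hence "((\<lambda>c'. dist (path_of T (polygon T N c')) (path_of T (polygon T N c))) \<longlongrightarrow> 0) (at c)"
      by (intro Lim_null_comparison[OF _ B] always_eventually) auto
    thus "((\<lambda>c. path_of T (polygon T N c)) \<longlongrightarrow> path_of T (polygon T N c)) (at c)"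
      by (subst tendsto_dist_iff)
  qed
  hence "(\<lambda>c :: nat \<Rightarrow> real ^ 'd. path_of T (polygon T N c)) \<in> borel_measurable borel"
    by (rule borel_measurable_continuous_onI)
  ultimately show ?thesis using measurable_compose by blast
qed

text \<open>Sup-norm convergence presents the trajectory as a pointwise limit of the maps of
  \<open>polygon_path_measurable\<close>, hence as a Borel map into the path space.\<close>

lemma polygon_convergence:
  fixes f :: "real \<Rightarrow> real ^ 'd::finite"
  assumes T: "0 < T" and f: "continuous_on {0..T} f"
  shows "(\<lambda>N. path_of T (polygon T (Suc N) (\<lambda>k. f (min T (real k * T / real (Suc N)))))) \<longlonglongrightarrow> path_of T f"
proof (rule metric_LIMSEQ_I)
  fix e :: real assume e: "0 < e"
  have "uniformly_continuous_on {0..T} f"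
    using f by (intro compact_uniformly_continuous) auto
  then obtain d where d: "0 < d" "\<And>s t. s \<in> {0..T} \<Longrightarrow> t \<in> {0..T} \<Longrightarrow> dist s t < d \<Longrightarrow> dist (f s) (f t) < e / 4"
    unfolding uniformly_continuous_on_def using e by (metis zero_less_divide_iff zero_less_numeral)
  obtain N0 where N0: "T / d < real N0" using reals_Archimedean2 by blast
  show "\<exists>n0. \<forall>n\<ge>n0. dist (path_of T (polygon T (Suc n) (\<lambda>k. f (min T (real k * T / real (Suc n)))))) (path_of T f) < e"
  proof (intro exI[of _ N0] allI impI)
    fix n assume n: "N0 \<le> n"
    let ?N = "Suc n" and ?c = "\<lambda>k. f (min T (real k * T / real (Suc n)))"
    have mesh: "T / real ?N < d"
    proof -
      have "T / d < real ?N" using N0 n by linarith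
      thus ?thesis using d(1) by (simp add: field_simps)
    qed
    have "dist (path_of T (polygon T ?N ?c)) (path_of T f) \<le> e / 2"
    proof (rule dist_bound)
      fix t0
      define t where "t = max 0 (min T t0)"
      have t: "0 \<le> t" "t \<le> T" using T by (auto simp: t_def)
      obtain j where j: "j < ?N" "real j * T / real ?N \<le> t" "t \<le> real (Suc j) * T / real ?N"
        using polygon_cell_exists[OF T _ t, of ?N] by auto
      have jj: "real j * T / real ?N \<le> T" "real (Suc j) * T / real ?N \<le> T"
      proof -
        have "real (Suc j) * T \<le> real ?N * T" using j(1) T by (intro mult_right_mono) auto
        thus "real (Suc j) * T / real ?N \<le> T" by (simp add: divide_le_eq mult.commute)
        have "real j * T \<le> real ?N * T" using j(1) T by (intro mult_right_mono) auto
        thus "real j * T / real ?N \<le> T" by (simp add: divide_le_eq mult.commute)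
      qed
      have step: "real (Suc j) * T / real ?N = real j * T / real ?N + T / real ?N"
        by (simp only: of_nat_Suc distrib_right mult_1 add_divide_distrib add.commute)
      define th where "th = real ?N * t / T - real j"
      have th: "0 \<le> th" "th \<le> 1" using j T by (auto simp: th_def field_simps)
      have "polygon T ?N ?c t - f t = (f (real j * T / real ?N) - f t) + th *\<^sub>R (f (real (Suc j) * T / real ?N) - f (real j * T / real ?N))"
        using polygon_on_cell[OF T j, of ?c] jj by (simp add: th_def min_absorb2)
      also have "norm \<dots> \<le> norm (f (real j * T / real ?N) - f t) + th * norm (f (real (Suc j) * T / real ?N) - f (real j * T / real ?N))"
        using th by (intro order.trans[OF norm_triangle_ineq]) auto
      also have "\<dots> \<le> e / 4 + 1 * (e / 4)"
      proof (intro add_mono mult_mono th)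
        have jT: "0 \<le> real j * T / real ?N" using T by simp
        have "dist (real j * T / real ?N) t < d"
        proof -
          have "\<bar>a - t\<bar> < d" if "a \<le> t" "t \<le> b" "b = a + m" "m < d" for a b m
            using that by linarith
          from this[OF j(2,3) step mesh] show ?thesis by (simp add: dist_real_def)
        qed
        thus "norm (f (real j * T / real ?N) - f t) \<le> e / 4"
          using d(2)[of "real j * T / real ?N" t] jj t jT by (simp add: dist_norm)
        have "dist (real (Suc j) * T / real ?N) (real j * T / real ?N) < d"
          using mesh step T by (simp add: dist_real_def)
        thus "norm (f (real (Suc j) * T / real ?N) - f (real j * T / real ?N)) \<le> e / 4"
          using d(2)[of "real (Suc j) * T / real ?N" "real j * T / real ?N"] jj jT T by (simp add: dist_norm)
      qed auto
      finally have "dist (polygon T ?N ?c t) (f t) \<le> e / 2" by (simp add: dist_norm)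
      thus "dist (apply_bcontfun (path_of T (polygon T ?N ?c)) t0) (apply_bcontfun (path_of T f) t0) \<le> e / 2"
        using T f by (simp add: apply_path_of continuous_polygon t_def)
    qed
    thus "dist (path_of T (polygon T ?N ?c)) (path_of T f) < e" using e by linarith
  qed
qed

section \<open>Gaussian processes as an instance of Gaussian forms\<close>

lemma centered_gaussian_moments:
  assumes "prob_space M" "centered_gaussian M X"
  shows "has_bochner_integral M (\<lambda>\<omega>. X \<omega> ^ n) (gauss_moment n * (\<integral>\<omega>. (X \<omega>)\<^sup>2 \<partial>M) ^ (n div 2))"
proof -
  interpret prob_space M by fact
  have X [measurable]: "X \<in> borel_measurable M" using assms by (simp add: centered_gaussian_def)
  have "\<exists>v. \<forall>n. has_bochner_integral M (\<lambda>\<omega>. X \<omega> ^ n) (gauss_moment n * v ^ (n div 2))"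
  proof (cases "distr M borel X = return borel 0")
    case True
    have "has_bochner_integral M (\<lambda>\<omega>. X \<omega> ^ n) (gauss_moment n * 0 ^ (n div 2))" for n
    proof -
      have "AE x in distr M borel X. x = 0" unfolding True by (simp add: AE_return)
      hence ae: "AE \<omega> in M. X \<omega> = 0" by (simp add: AE_distr_iff)
      have "has_bochner_integral M (\<lambda>\<omega>. X \<omega> ^ n) (0 ^ n)"
      proof (subst has_bochner_integral_cong_AE[where g = "\<lambda>_. 0 ^ n"])
        show "AE x in M. X x ^ n = 0 ^ n" using ae by eventually_elim simp
        show "has_bochner_integral M (\<lambda>_. 0 ^ n :: real) (0 ^ n)"
          using has_bochner_integral_integrable[of M "\<lambda>_. 0 ^ n :: real"] by (simp add: prob_space)
      qed auto
      moreover have "(0::real) ^ n = gauss_moment n * 0 ^ (n div 2)"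
      proof (cases "n = 0 \<or> n = 1")
        case False
        hence "n \<noteq> 0" "n div 2 \<noteq> 0" by auto
        thus ?thesis by (simp add: power_0_left)
      qed auto
      ultimately show ?thesis by simp
    qed
    thus ?thesis by blast
  next
    case False
    then obtain s where s: "0 < s" and D: "distributed M lborel X (\<lambda>x. ennreal (normal_density 0 s x))"
      using assms by (auto simp: centered_gaussian_def)
    have "has_bochner_integral M (\<lambda>\<omega>. X \<omega> ^ n) (gauss_moment n * (s\<^sup>2) ^ (n div 2))" for n
    proof -
      have L: "has_bochner_integral lborel (\<lambda>x. normal_density 0 s x * x ^ n) (gauss_moment n * (s\<^sup>2) ^ (n div 2))"
      proof (cases "even n")
        case True
        then obtain k where n: "n = 2 * k" by (elim evenE)
        have "gauss_moment n * (s\<^sup>2) ^ (n div 2) = fact (2 * k) / ((2 / s\<^sup>2) ^ k * fact k)"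
          by (simp add: gauss_moment_def n power_divide)
        thus ?thesis using normal_moment_even[OF s, of 0 k] by (simp add: n)
      next
        case False
        then obtain k where n: "n = 2 * k + 1" by (elim oddE)
        thus ?thesis using normal_moment_odd[OF s, of 0 k] by (simp add: n gauss_moment_def)
      qed
      have "integrable M (\<lambda>\<omega>. X \<omega> ^ n)"
        using L distributed_integrable[OF D, of "\<lambda>x. x ^ n"] by (auto simp: has_bochner_integral_iff)
      moreover have "(\<integral>\<omega>. X \<omega> ^ n \<partial>M) = gauss_moment n * (s\<^sup>2) ^ (n div 2)"
        using L distributed_integral[OF D, of "\<lambda>x. x ^ n"] by (auto simp: has_bochner_integral_iff)
      ultimately show ?thesis by (simp add: has_bochner_integral_iff)
    qed
    thus ?thesis by blast
  qed
  then obtain v where v: "\<And>n. has_bochner_integral M (\<lambda>\<omega>. X \<omega> ^ n) (gauss_moment n * v ^ (n div 2))" by blast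
  have "(\<integral>\<omega>. (X \<omega>)\<^sup>2 \<partial>M) = v" using has_bochner_integral_integral_eq[OF v[of 2]] by simp
  thus ?thesis using v by simp
qed

definition evaluation_forms :: "real \<Rightarrow> ('d::finite path \<Rightarrow> real) set" where
  "evaluation_forms T = {L. \<exists>S c. finite S \<and> S \<subseteq> {0..T} \<times> UNIV \<and>
     L = (\<lambda>x. \<Sum>(t, i)\<in>S. c (t, i) * apply_bcontfun x t $ i)}"

lemma evaluation_form: "0 \<le> t \<Longrightarrow> t \<le> T \<Longrightarrow> (\<lambda>x. apply_bcontfun x t $ i) \<in> evaluation_forms T"
  unfolding evaluation_forms_def by (intro CollectI exI[of _ "{(t, i)}"] exI[of _ "\<lambda>_. 1"]) auto

lemma evaluation_forms_scale:
  assumes "L \<in> evaluation_forms T"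
  shows "(\<lambda>x. a * L x) \<in> evaluation_forms T"
proof -
  obtain S c where "finite S" "S \<subseteq> {0..T} \<times> UNIV" and L: "L = (\<lambda>x. \<Sum>(t, i)\<in>S. c (t, i) * apply_bcontfun x t $ i)"
    using assms by (auto simp: evaluation_forms_def)
  thus ?thesis unfolding evaluation_forms_def
    by (intro CollectI exI[of _ S] exI[of _ "\<lambda>p. a * c p"]) (auto simp: sum_distrib_left case_prod_beta' mult_ac)
qed

lemma evaluation_forms_add:
  assumes "L \<in> evaluation_forms T" "L' \<in> evaluation_forms T"
  shows "(\<lambda>x. L x + L' x) \<in> evaluation_forms T"
proof -
  obtain S c where S: "finite S" "S \<subseteq> {0..T} \<times> UNIV" "L = (\<lambda>x. \<Sum>(t, i)\<in>S. c (t, i) * apply_bcontfun x t $ i)"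
    using assms(1) by (auto simp: evaluation_forms_def)
  obtain S' c' where S': "finite S'" "S' \<subseteq> {0..T} \<times> UNIV" "L' = (\<lambda>x. \<Sum>(t, i)\<in>S'. c' (t, i) * apply_bcontfun x t $ i)"
    using assms(2) by (auto simp: evaluation_forms_def)
  let ?d = "\<lambda>p. (if p \<in> S then c p else 0) + (if p \<in> S' then c' p else 0)"
  have "L x + L' x = (\<Sum>(t, i)\<in>S \<union> S'. ?d (t, i) * apply_bcontfun x t $ i)" for x
  proof -
    have "L x = (\<Sum>p\<in>S \<union> S'. (if p \<in> S then c p else 0) * apply_bcontfun x (fst p) $ (snd p))"
      unfolding S(3) case_prod_beta' using S(1) S'(1) by (intro sum.mono_neutral_cong_left) auto
    moreover have "L' x = (\<Sum>p\<in>S \<union> S'. (if p \<in> S' then c' p else 0) * apply_bcontfun x (fst p) $ (snd p))"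
      unfolding S'(3) case_prod_beta' using S(1) S'(1) by (intro sum.mono_neutral_cong_left) auto
    ultimately show ?thesis by (simp add: case_prod_beta' sum.distrib[symmetric] distrib_right cong: if_cong)
  qed
  thus ?thesis unfolding evaluation_forms_def using S S'
    by (intro CollectI exI[of _ "S \<union> S'"] exI[of _ ?d]) auto
qed

lemma continuous_evaluation: "continuous_on S (\<lambda>x. apply_bcontfun x t $ i)"
proof -
  have "continuous_on S (\<lambda>x. apply_bcontfun x t)"
    unfolding continuous_on_iff by (meson dist_bounded le_less_trans)
  thus ?thesis by (intro continuous_intros)
qed

lemma evaluation_forms_continuous:
  assumes "L \<in> evaluation_forms T"
  shows "continuous_on S L"
proof -
  obtain A c where "L = (\<lambda>x. \<Sum>(t, i)\<in>A. c (t, i) * apply_bcontfun x t $ i)"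
    using assms by (auto simp: evaluation_forms_def)
  thus ?thesis by (auto simp: case_prod_beta' intro!: continuous_intros continuous_evaluation)
qed

lemma evaluation_forms_linear:
  assumes "L \<in> evaluation_forms T"
  shows "L (x + y) = L x + L y" "L (a *\<^sub>R x) = a * L x"
proof -
  obtain A c where L: "L = (\<lambda>x. \<Sum>(t, i)\<in>A. c (t, i) * apply_bcontfun x t $ i)"
    using assms by (auto simp: evaluation_forms_def)
  show "L (x + y) = L x + L y" unfolding L
    by (simp add: case_prod_beta' plus_bcontfun.rep_eq sum.distrib[symmetric] distrib_left)
  show "L (a *\<^sub>R x) = a * L x" unfolding L
    by (simp add: case_prod_beta' scaleR_bcontfun.rep_eq sum_distrib_left mult_ac)
qed

locale gaussian_path =
  fixes M :: "'a measure" and T :: real and w :: "real \<Rightarrow> 'a \<Rightarrow> real ^ 'd::finite"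
  assumes T_pos: "0 < T" and process: "gaussian_process M T w"
begin

sublocale base: prob_space M using process by (simp add: gaussian_process_def)

abbreviation trajectory :: "'a \<Rightarrow> 'd path" where "trajectory \<omega> \<equiv> path_of T (\<lambda>t. w t \<omega>)"

abbreviation \<mu> :: "'d path measure" where "\<mu> \<equiv> path_law M T w"

lemma w_continuous: "\<omega> \<in> space M \<Longrightarrow> continuous_on {0..T} (\<lambda>t. w t \<omega>)"
  and w_start: "\<omega> \<in> space M \<Longrightarrow> w 0 \<omega> = 0"
  using process by (auto simp: gaussian_process_def)

lemma w_gaussian: "finite S \<Longrightarrow> S \<subseteq> {0..T} \<times> UNIV \<Longrightarrow> centered_gaussian M (\<lambda>\<omega>. \<Sum>(t, i)\<in>S. c (t, i) * w t \<omega> $ i)"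
  using process by (auto simp: gaussian_process_def)

lemma w_component_measurable: "0 \<le> t \<Longrightarrow> t \<le> T \<Longrightarrow> (\<lambda>\<omega>. w t \<omega> $ i) \<in> borel_measurable M"
  using w_gaussian[of "{(t, i)}" "\<lambda>_. 1"] by (simp add: centered_gaussian_def)

lemma w_measurable: "0 \<le> t \<Longrightarrow> t \<le> T \<Longrightarrow> w t \<in> borel_measurable M"
  by (subst borel_measurable_euclidean_space)
     (auto simp: Basis_vec_def inner_axis intro!: w_component_measurable)

lemma trajectory_eval: "\<omega> \<in> space M \<Longrightarrow> 0 \<le> t \<Longrightarrow> t \<le> T \<Longrightarrow> apply_bcontfun (trajectory \<omega>) t = w t \<omega>"
  using T_pos by (simp add: apply_path_of w_continuous)

lemma trajectory_measurable: "trajectory \<in> measurable M (restrict_space borel (C0 T))"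
proof (rule measurable_restrict_space2)
  show "trajectory \<in> space M \<rightarrow> C0 T"
    using T_pos by (auto intro: path_of_in_C0 w_continuous w_start)
  show "trajectory \<in> borel_measurable M"
  proof (rule borel_measurable_LIMSEQ_metric)
    fix N
    show "(\<lambda>\<omega>. path_of T (polygon T (Suc N) (\<lambda>k. w (min T (real k * T / real (Suc N))) \<omega>))) \<in> borel_measurable M"
      by (rule polygon_path_measurable[OF T_pos w_measurable])
  next
    fix \<omega> assume "\<omega> \<in> space M"
    thus "(\<lambda>N. path_of T (polygon T (Suc N) (\<lambda>k. w (min T (real k * T / real (Suc N))) \<omega>))) \<longlonglongrightarrow> trajectory \<omega>"
      by (rule polygon_convergence[OF T_pos w_continuous])
  qed
qed

lemma space_path_law [simp]: "space \<mu> = C0 T"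
  by (simp add: path_law_def space_restrict_space)

lemma sets_path_law: "sets \<mu> = sets (restrict_space borel (C0 T))"
  by (simp add: path_law_def)

lemma path_law_bochner:
  fixes f :: "'d path \<Rightarrow> real"
  assumes "continuous_on UNIV f" "has_bochner_integral M (\<lambda>\<omega>. f (trajectory \<omega>)) a"
  shows "has_bochner_integral \<mu> f a"
proof -
  have f: "f \<in> borel_measurable (restrict_space borel (C0 T))"
    using assms(1) by (intro measurable_restrict_space1 borel_measurable_continuous_onI)
  show ?thesis
    using assms(2) trajectory_measurable f unfolding path_law_def
    by (simp add: has_bochner_integral_iff integrable_distr_eq integral_distr)
qed

lemma path_law_integral:
  fixes f :: "'d path \<Rightarrow> real"
  assumes "continuous_on UNIV f"
  shows "(\<integral>x. f x \<partial>\<mu>) = (\<integral>\<omega>. f (trajectory \<omega>) \<partial>M)"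
proof -
  have f: "f \<in> borel_measurable (restrict_space borel (C0 T))"
    using assms(1) by (intro measurable_restrict_space1 borel_measurable_continuous_onI)
  show ?thesis using trajectory_measurable f unfolding path_law_def by (simp add: integral_distr)
qed

text \<open>On trajectories an evaluation form is a finite linear combination of values of
  \<open>w\<close>, which is centered Gaussian by assumption; its moments pass to the image measure
  because the form is continuous.\<close>

sublocale gaussian_forms \<mu> "evaluation_forms T"
proof (rule gaussian_forms.intro)
  show "prob_space \<mu>" unfolding path_law_def by (rule base.prob_space_distr[OF trajectory_measurable])
  show "(\<lambda>_. 0) \<in> evaluation_forms T"
    unfolding evaluation_forms_def by (intro CollectI exI[of _ "{}"]) auto
next
  fix L :: "'d path \<Rightarrow> real" and n assume L: "L \<in> evaluation_forms T"
  then obtain A c where A: "finite A" "A \<subseteq> {0..T} \<times> UNIV" and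
    L_eq: "L = (\<lambda>x. \<Sum>(t, i)\<in>A. c (t, i) * apply_bcontfun x t $ i)"
    by (auto simp: evaluation_forms_def)
  define X where "X \<omega> = (\<Sum>(t, i)\<in>A. c (t, i) * w t \<omega> $ i)" for \<omega>
  have LX: "L (trajectory \<omega>) = X \<omega>" if "\<omega> \<in> space M" for \<omega>
    unfolding L_eq X_def using A that by (intro sum.cong) (auto simp: trajectory_eval)
  have cont: "continuous_on UNIV (\<lambda>x. L x ^ m)" for m
    by (intro continuous_intros evaluation_forms_continuous[OF L])
  have mom: "has_bochner_integral M (\<lambda>\<omega>. X \<omega> ^ n) (gauss_moment n * (\<integral>\<omega>. (X \<omega>)\<^sup>2 \<partial>M) ^ (n div 2))"
    using w_gaussian[OF A, of c] by (intro centered_gaussian_moments base.prob_space_axioms) (simp add: X_def[abs_def])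
  have "(\<integral>x. (L x)\<^sup>2 \<partial>\<mu>) = (\<integral>\<omega>. (X \<omega>)\<^sup>2 \<partial>M)"
    unfolding path_law_integral[OF cont] by (intro Bochner_Integration.integral_cong) (auto simp: LX)
  moreover have "has_bochner_integral \<mu> (\<lambda>x. L x ^ n) (gauss_moment n * (\<integral>\<omega>. (X \<omega>)\<^sup>2 \<partial>M) ^ (n div 2))"
    by (rule path_law_bochner[OF cont]) (use mom LX in \<open>simp cong: has_bochner_integral_cong\<close>)
  ultimately show "has_bochner_integral \<mu> (\<lambda>x. L x ^ n) (gauss_moment n * (\<integral>x. (L x)\<^sup>2 \<partial>\<mu>) ^ (n div 2))"
    by simp
qed (auto intro: evaluation_forms_add evaluation_forms_scale simp: evaluation_forms_linear)

lemma hom_continuous: "F \<in> hom n \<Longrightarrow> continuous_on S F"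
proof (induction rule: hom.induct)
  case (pow L c)
  show ?case by (intro continuous_intros evaluation_forms_continuous[OF pow])
qed (rule continuous_on_add)

abbreviation ev :: "real \<Rightarrow> 'd \<Rightarrow> 'd path \<Rightarrow> real" where "ev t i x \<equiv> apply_bcontfun x t $ i"

lemma ev_form: "0 \<le> t \<Longrightarrow> t \<le> T \<Longrightarrow> ev t i \<in> evaluation_forms T"
  by (rule evaluation_form)

lemma increment_form:
  "0 \<le> s \<Longrightarrow> s \<le> T \<Longrightarrow> 0 \<le> t \<Longrightarrow> t \<le> T \<Longrightarrow> (\<lambda>x. ev t i x - ev s i x) \<in> evaluation_forms T"
  using Lin_add[OF ev_form Lin_scale[OF ev_form], of t s i "-1" i] by simp

lemma cov_increment:
  assumes "0 \<le> s" "s \<le> T" "0 \<le> t" "t \<le> T" "0 \<le> u" "u \<le> T" "0 \<le> v" "v \<le> T"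
  shows "cov (\<lambda>x. ev t i x - ev s i x) (\<lambda>x. ev v i x - ev u i x) = incr_cov M (\<lambda>r \<omega>. w r \<omega> $ i) s t u v"
proof -
  have "continuous_on UNIV (\<lambda>x. (ev t i x - ev s i x) * (ev v i x - ev u i x))"
    by (intro continuous_intros continuous_evaluation)
  from path_law_integral[OF this] show ?thesis
    unfolding incr_cov_def using assms by (simp add: trajectory_eval cong: Bochner_Integration.integral_cong)
qed

lemma cov_independent:
  assumes "i \<noteq> j" "0 \<le> s" "s \<le> T" "0 \<le> t" "t \<le> T"
  shows "cov (ev s i) (ev t j) = 0"
proof -
  have int: "integrable M (\<lambda>\<omega>. w r \<omega> $ k)" and zero: "(\<integral>\<omega>. w r \<omega> $ k \<partial>M) = 0"
    if "0 \<le> r" "r \<le> T" for r k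
  proof -
    have "centered_gaussian M (\<lambda>\<omega>. w r \<omega> $ k)" using w_gaussian[of "{(r, k)}" "\<lambda>_. 1"] that by simp
    from centered_gaussian_moments[OF base.prob_space_axioms this, of 1]
    show "integrable M (\<lambda>\<omega>. w r \<omega> $ k)" "(\<integral>\<omega>. w r \<omega> $ k \<partial>M) = 0"
      by (auto simp: has_bochner_integral_iff)
  qed
  \<comment> \<open>One time for each component, so that composing the independent component paths
    with coordinate maps yields exactly the two variables whose product is integrated.\<close>
  let ?t = "\<lambda>k. if k = i then s else t"
  have "base.indep_vars (\<lambda>i. PiM {0..T} (\<lambda>_. borel)) (\<lambda>i \<omega>. \<lambda>t\<in>{0..T}. w t \<omega> $ i) UNIV"
    using process unfolding gaussian_process_def by (elim conjE)
  hence "base.indep_vars (\<lambda>i. PiM {0..T} (\<lambda>_. borel)) (\<lambda>i \<omega>. \<lambda>t\<in>{0..T}. w t \<omega> $ i) {i, j}"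
    by (rule base.indep_vars_subset) simp
  hence "base.indep_vars (\<lambda>_. borel) (\<lambda>k \<omega>. (\<lambda>f. f (?t k)) (\<lambda>t\<in>{0..T}. w t \<omega> $ k)) {i, j}"
  proof (rule base.indep_vars_compose2[where X = "\<lambda>i \<omega>. \<lambda>t\<in>{0..T}. w t \<omega> $ i" and Y = "\<lambda>k f. f (?t k)"])
    fix k
    have "?t k \<in> {0..T}" using assms by simp
    thus "(\<lambda>f. f (?t k)) \<in> measurable (PiM {0..T} (\<lambda>_. borel)) borel"
      by (rule measurable_component_singleton)
  qed
  hence "(\<integral>\<omega>. (\<Prod>k\<in>{i, j}. (\<lambda>f. f (?t k)) (\<lambda>t\<in>{0..T}. w t \<omega> $ k)) \<partial>M) =
      (\<Prod>k\<in>{i, j}. \<integral>\<omega>. (\<lambda>f. f (?t k)) (\<lambda>t\<in>{0..T}. w t \<omega> $ k) \<partial>M)"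
  proof (rule base.indep_vars_lebesgue_integral[rotated])
    fix k
    have "?t k \<in> {0..T}" using assms by simp
    thus "integrable M (\<lambda>\<omega>. (\<lambda>f. f (?t k)) (\<lambda>t\<in>{0..T}. w t \<omega> $ k))"
      using int[of "?t k" k] by (simp only: restrict_apply' atLeastAtMost_iff)
  qed simp
  hence "(\<integral>\<omega>. w s \<omega> $ i * w t \<omega> $ j \<partial>M) = 0" using assms zero by simp
  moreover have "continuous_on UNIV (\<lambda>x. ev s i x * ev t j x)"
    by (intro continuous_intros continuous_evaluation)
  ultimately show ?thesis
    using path_law_integral[of "\<lambda>x. ev s i x * ev t j x"] assms
    by (simp add: trajectory_eval cong: Bochner_Integration.integral_cong)
qed

end

section \<open>Sobolev norms of polynomials in the evaluations\<close>

lemma enn_powr_mono: "0 \<le> p \<Longrightarrow> a \<le> b \<Longrightarrow> enn_powr a p \<le> enn_powr b p"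
proof -
  assume p: "0 \<le> p" and ab: "a \<le> b"
  show ?thesis
  proof (cases "b = \<infinity>")
    case False
    hence "b < top" by (simp add: less_top)
    hence "a \<noteq> \<infinity>" using ab by auto
    have "enn2real a \<le> enn2real b" using ab \<open>b < top\<close> by (intro enn2real_mono) auto
    thus ?thesis using False \<open>a \<noteq> \<infinity>\<close> p by (auto simp: enn_powr_def intro!: ennreal_leI powr_mono2)
  qed (simp add: enn_powr_def)
qed

lemma enn_powr_ennreal: "0 \<le> x \<Longrightarrow> enn_powr (ennreal x) p = ennreal (x powr p)"
  by (simp add: enn_powr_def)

lemma Lq_norm_leI:
  assumes q: "0 < q" and f: "\<And>x. x \<in> space M \<Longrightarrow> f x \<le> ennreal (v x)" "\<And>x. 0 \<le> v x" and a: "0 \<le> a"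
    and int: "(\<integral>\<^sup>+x. ennreal (v x powr q) \<partial>M) \<le> ennreal (a powr q)"
  shows "Lq_norm M q f \<le> ennreal a"
proof -
  have "(\<integral>\<^sup>+x. enn_powr (f x) q \<partial>M) \<le> (\<integral>\<^sup>+x. ennreal (v x powr q) \<partial>M)"
  proof (rule nn_integral_mono)
    fix x assume "x \<in> space M"
    hence "enn_powr (f x) q \<le> enn_powr (ennreal (v x)) q"
      using q f by (intro enn_powr_mono) auto
    thus "enn_powr (f x) q \<le> ennreal (v x powr q)" by (simp only: enn_powr_ennreal f(2))
  qed
  also note int
  finally have "Lq_norm M q f \<le> enn_powr (ennreal (a powr q)) (1 / q)"
    unfolding Lq_norm_def by (rule enn_powr_mono[rotated]) (use q in simp)
  also have "\<dots> = ennreal a" using q a by (simp add: enn_powr_ennreal powr_powr)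
  finally show ?thesis .
qed

lemma powr_le_one_plus:
  assumes "0 \<le> x" "0 < q" "q \<le> real Q"
  shows "x powr q \<le> 1 + x ^ Q"
proof (cases "x \<le> 1")
  case True
  hence "x powr q \<le> 1" using assms by (simp add: powr_le1)
  thus ?thesis using assms by (simp add: add_increasing2)
next
  case False
  hence "x powr q \<le> x powr real Q" using assms by (intro powr_mono) auto
  also have "\<dots> = x ^ Q" using False by (simp add: powr_realpow)
  finally show ?thesis by simp
qed

lemma sum_lists_Suc:
  assumes "finite E"
  shows "(\<Sum>hs | set hs \<subseteq> E \<and> length hs = Suc j. f hs) = (\<Sum>hs | set hs \<subseteq> E \<and> length hs = j. \<Sum>e\<in>E. f (e # hs))"
proof -
  have "(\<Sum>hs | set hs \<subseteq> E \<and> length hs = Suc j. f hs) =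
    (\<Sum>p\<in>{hs. set hs \<subseteq> E \<and> length hs = j} \<times> E. f (snd p # fst p))"
    unfolding lists_length_Suc_eq by (subst sum.reindex) (auto simp: inj_on_def case_prod_beta')
  also have "\<dots> = (\<Sum>hs | set hs \<subseteq> E \<and> length hs = j. \<Sum>e\<in>E. f (e # hs))"
    by (subst sum.cartesian_product) (simp add: case_prod_beta')
  finally show ?thesis .
qed

section \<open>The Cameron-Martin space as part of L2, and Bessel's inequality\<close>

context gaussian_path
begin

abbreviation W :: "'d path wiener_space" where "W \<equiv> wiener_space_of M T w"

lemma square_integrable_mult:
  fixes f g :: "'d path \<Rightarrow> real"
  assumes [measurable]: "f \<in> borel_measurable \<mu>" "g \<in> borel_measurable \<mu>"
    and "integrable \<mu> (\<lambda>x. (f x)\<^sup>2)" "integrable \<mu> (\<lambda>x. (g x)\<^sup>2)"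
  shows "integrable \<mu> (\<lambda>x. f x * g x)"
proof (rule Bochner_Integration.integrable_bound[OF Bochner_Integration.integrable_add[OF assms(3,4)]])
  have "\<bar>a * b\<bar> \<le> a\<^sup>2 + b\<^sup>2" for a b :: real
  proof -
    have "0 \<le> (\<bar>a\<bar> - \<bar>b\<bar>)\<^sup>2" by simp
    moreover have "0 \<le> a\<^sup>2 + b\<^sup>2" by simp
    ultimately have "2 * \<bar>a * b\<bar> \<le> a\<^sup>2 + b\<^sup>2" by (simp add: power2_diff abs_mult)
    thus ?thesis using \<open>0 \<le> a\<^sup>2 + b\<^sup>2\<close> by linarith
  qed
  thus "AE x in \<mu>. norm (f x * g x) \<le> norm ((f x)\<^sup>2 + (g x)\<^sup>2)" by simp
qed auto

lemma form_square_integrable: "L \<in> evaluation_forms T \<Longrightarrow> integrable \<mu> (\<lambda>x. (L x)\<^sup>2)"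
  using hom_power_integrable[OF hom_form] .

lemma first_chaos_approx:
  assumes "Z \<in> first_chaos T \<mu>" "0 < e"
  obtains L where "L \<in> evaluation_forms T" "integrable \<mu> (\<lambda>x. (Z x - L x)\<^sup>2)" "(\<integral>x. (Z x - L x)\<^sup>2 \<partial>\<mu>) < e"
proof -
  obtain S c where S: "finite S" "S \<subseteq> {0..T} \<times> UNIV"
    "(\<integral>\<^sup>+x. ennreal ((Z x - (\<Sum>(t, i)\<in>S. c (t, i) * apply_bcontfun x t $ i))\<^sup>2) \<partial>\<mu>) < ennreal e"
    using assms unfolding first_chaos_def by blast
  define L :: "'d path \<Rightarrow> real" where "L = (\<lambda>x. \<Sum>(t, i)\<in>S. c (t, i) * apply_bcontfun x t $ i)"
  have L: "L \<in> evaluation_forms T" using S by (auto simp: evaluation_forms_def L_def)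
  have [measurable]: "L \<in> borel_measurable \<mu>" "Z \<in> borel_measurable \<mu>"
    using form_measurable[OF L] assms by (auto simp: first_chaos_def)
  have fin: "(\<integral>\<^sup>+x. ennreal ((Z x - L x)\<^sup>2) \<partial>\<mu>) < ennreal e" using S(3) by (simp add: L_def)
  hence int: "integrable \<mu> (\<lambda>x. (Z x - L x)\<^sup>2)"
    by (intro integrableI_nonneg) (auto intro: less_trans)
  hence "ennreal (\<integral>x. (Z x - L x)\<^sup>2 \<partial>\<mu>) < ennreal e"
    using fin by (simp add: nn_integral_eq_integral)
  hence "(\<integral>x. (Z x - L x)\<^sup>2 \<partial>\<mu>) < e" by (simp add: ennreal_less_iff)
  thus ?thesis using that L int by blast
qed

lemma first_chaos_square_integrable:
  assumes "Z \<in> first_chaos T \<mu>"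
  shows "integrable \<mu> (\<lambda>x. (Z x)\<^sup>2)" and "Z \<in> borel_measurable \<mu>"
proof -
  show Z [measurable]: "Z \<in> borel_measurable \<mu>" using assms by (auto simp: first_chaos_def)
  obtain L where L: "L \<in> evaluation_forms T" "integrable \<mu> (\<lambda>x. (Z x - L x)\<^sup>2)"
    using first_chaos_approx[OF assms, of 1] by auto
  have "integrable \<mu> (\<lambda>x. 2 * (Z x - L x)\<^sup>2 + 2 * (L x)\<^sup>2)"
    using L form_square_integrable by auto
  thus "integrable \<mu> (\<lambda>x. (Z x)\<^sup>2)"
  proof (rule Bochner_Integration.integrable_bound)
    have "a\<^sup>2 \<le> 2 * (a - b)\<^sup>2 + 2 * b\<^sup>2" for a b :: real
    proof -
      have "0 \<le> (a - 2 * b)\<^sup>2" by simp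
      thus ?thesis by (simp add: power2_eq_square algebra_simps)
    qed
    thus "AE x in \<mu>. norm ((Z x)\<^sup>2) \<le> norm (2 * (Z x - L x)\<^sup>2 + 2 * (L x)\<^sup>2)"
      by (auto simp: abs_of_nonneg)
  qed auto
qed

lemma cm_representsD:
  assumes "cm_represents T \<mu> Z h"
  shows "Z \<in> first_chaos T \<mu>" and "Z \<in> borel_measurable \<mu>" and "integrable \<mu> (\<lambda>x. (Z x)\<^sup>2)"
    and "L \<in> evaluation_forms T \<Longrightarrow> (\<integral>x. Z x * L x \<partial>\<mu>) = L h"
proof -
  show Z: "Z \<in> first_chaos T \<mu>" using assms by (simp add: cm_represents_def)
  show Zm: "Z \<in> borel_measurable \<mu>" and Z2: "integrable \<mu> (\<lambda>x. (Z x)\<^sup>2)"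
    using first_chaos_square_integrable[OF Z] by auto
  assume "L \<in> evaluation_forms T"
  then obtain S c where S: "finite S" "S \<subseteq> {0..T} \<times> UNIV" and
    L: "L = (\<lambda>x. \<Sum>(t, i)\<in>S. c (t, i) * apply_bcontfun x t $ i)"
    by (auto simp: evaluation_forms_def)
  have int: "integrable \<mu> (\<lambda>x. Z x * ev t i x)" if "(t, i) \<in> S" for t i
    using S that by (intro square_integrable_mult Zm Z2 form_square_integrable form_measurable ev_form) auto
  have "(\<integral>x. Z x * L x \<partial>\<mu>) = (\<integral>x. (\<Sum>p\<in>S. c p * (Z x * ev (fst p) (snd p) x)) \<partial>\<mu>)"
    by (intro Bochner_Integration.integral_cong) (auto simp: L sum_distrib_left case_prod_beta' mult_ac)
  also have "\<dots> = (\<Sum>p\<in>S. c p * (\<integral>x. Z x * ev (fst p) (snd p) x \<partial>\<mu>))"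
    using int by (subst Bochner_Integration.integral_sum) auto
  also have "\<dots> = (\<Sum>p\<in>S. c p * ev (fst p) (snd p) h)"
    using assms S by (intro sum.cong) (auto simp: cm_represents_def)
  also have "\<dots> = L h" by (simp add: L case_prod_beta')
  finally show "(\<integral>x. Z x * L x \<partial>\<mu>) = L h" .
qed

text \<open>The difference \<open>Z - Z'\<close> is orthogonal to all evaluation forms, since both
  represent the same path, and it is also an L2 limit of such forms. For a form \<open>K\<close>
  near it, orthogonality gives \<open>E (Z - Z')^2 \<le> E (Z - Z' - K)^2\<close>, and the right
  side is arbitrarily small.\<close>

lemma cm_represents_unique:
  assumes "cm_represents T \<mu> Z h" "cm_represents T \<mu> Z' h"
  shows "(\<integral>x. (Z x - Z' x)\<^sup>2 \<partial>\<mu>) = 0" and "integrable \<mu> (\<lambda>x. (Z x - Z' x)\<^sup>2)"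
proof -
  note Z = cm_representsD[OF assms(1)] and Z' = cm_representsD[OF assms(2)]
  have [measurable]: "Z \<in> borel_measurable \<mu>" "Z' \<in> borel_measurable \<mu>" using Z(2) Z'(2) .
  let ?D = "\<lambda>x. Z x - Z' x"
  have ZZ': "integrable \<mu> (\<lambda>x. Z x * Z' x)" by (intro square_integrable_mult Z Z')
  have "integrable \<mu> (\<lambda>x. (Z x)\<^sup>2 - 2 * (Z x * Z' x) + (Z' x)\<^sup>2)"
    using Z(3) Z'(3) ZZ' by auto
  moreover have "(\<lambda>x. (Z x)\<^sup>2 - 2 * (Z x * Z' x) + (Z' x)\<^sup>2) = (\<lambda>x. (?D x)\<^sup>2)"
    by (simp add: fun_eq_iff power2_diff)
  ultimately show D2: "integrable \<mu> (\<lambda>x. (?D x)\<^sup>2)" by simp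
  have small: "(\<integral>x. (?D x)\<^sup>2 \<partial>\<mu>) \<le> e" if "0 < e" for e
  proof -
    have e4: "0 < e / 4" using that by simp
    obtain L where L: "L \<in> evaluation_forms T" "integrable \<mu> (\<lambda>x. (Z x - L x)\<^sup>2)" "(\<integral>x. (Z x - L x)\<^sup>2 \<partial>\<mu>) < e / 4"
      using first_chaos_approx[OF Z(1) e4] by blast
    obtain L' where L': "L' \<in> evaluation_forms T" "integrable \<mu> (\<lambda>x. (Z' x - L' x)\<^sup>2)" "(\<integral>x. (Z' x - L' x)\<^sup>2 \<partial>\<mu>) < e / 4"
      using first_chaos_approx[OF Z'(1) e4] by blast
    define K where "K x = L x - L' x" for x
    have K: "K \<in> evaluation_forms T" using Lin_add[OF L(1) Lin_scale[OF L'(1), of "-1"]] by (simp add: K_def[abs_def])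
    note K2 = form_square_integrable[OF K] and [measurable] = form_measurable[OF K]
    have ZK: "integrable \<mu> (\<lambda>x. Z x * K x)" "integrable \<mu> (\<lambda>x. Z' x * K x)"
      by (intro square_integrable_mult Z Z' K2; measurable)+
    have DK: "(\<integral>x. ?D x * K x \<partial>\<mu>) = 0"
      using ZK Z(4)[OF K] Z'(4)[OF K] by (simp add: left_diff_distrib)
    have "(\<integral>x. (?D x)\<^sup>2 \<partial>\<mu>) \<le> (\<integral>x. (?D x)\<^sup>2 \<partial>\<mu>) - 2 * (\<integral>x. ?D x * K x \<partial>\<mu>) + (\<integral>x. (K x)\<^sup>2 \<partial>\<mu>)"
      unfolding DK by simp
    also have "\<dots> = (\<integral>x. (?D x)\<^sup>2 - 2 * (?D x * K x) + (K x)\<^sup>2 \<partial>\<mu>)"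
      using D2 K2 ZK by (simp add: left_diff_distrib)
    also have "\<dots> \<le> (\<integral>x. 2 * (Z x - L x)\<^sup>2 + 2 * (Z' x - L' x)\<^sup>2 \<partial>\<mu>)"
    proof (rule integral_mono)
      show "integrable \<mu> (\<lambda>x. (?D x)\<^sup>2 - 2 * (?D x * K x) + (K x)\<^sup>2)"
        using D2 K2 ZK by (simp add: left_diff_distrib)
      show "integrable \<mu> (\<lambda>x. 2 * (Z x - L x)\<^sup>2 + 2 * (Z' x - L' x)\<^sup>2)"
        using L(2) L'(2) by simp
      fix x
      have "0 \<le> ((Z x - L x) + (Z' x - L' x))\<^sup>2" by simp
      thus "(?D x)\<^sup>2 - 2 * (?D x * K x) + (K x)\<^sup>2 \<le> 2 * (Z x - L x)\<^sup>2 + 2 * (Z' x - L' x)\<^sup>2"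
        by (simp add: K_def power2_eq_square algebra_simps)
    qed
    also have "\<dots> = 2 * (\<integral>x. (Z x - L x)\<^sup>2 \<partial>\<mu>) + 2 * (\<integral>x. (Z' x - L' x)\<^sup>2 \<partial>\<mu>)"
      using L(2) L'(2) by simp
    also have "\<dots> \<le> e" using L(3) L'(3) by linarith
    finally show ?thesis .
  qed
  show "(\<integral>x. (?D x)\<^sup>2 \<partial>\<mu>) = 0"
    using field_le_epsilon[of "\<integral>x. (?D x)\<^sup>2 \<partial>\<mu>" 0] small by (intro antisym) auto
qed

text \<open>\<open>cm_inner\<close> is a definite description, so the integral has to be independent
  of the representatives. Two representatives of one path differ by a function of zero L2 norm,
  which Cauchy-Schwarz removes from the product.\<close>

lemma cm_inner_eq:
  assumes Z: "cm_represents T \<mu> Z h" and Z': "cm_represents T \<mu> Z' h'"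
  shows "cm_inner T \<mu> h h' = (\<integral>x. Z x * Z' x \<partial>\<mu>)"
  unfolding cm_inner_def
proof (rule the_equality)
  show "\<exists>Za Z'a. cm_represents T \<mu> Za h \<and> cm_represents T \<mu> Z'a h' \<and> (\<integral>x. Z x * Z' x \<partial>\<mu>) = (\<integral>x. Za x * Z'a x \<partial>\<mu>)"
    using assms by blast
next
  fix r assume "\<exists>Y Y'. cm_represents T \<mu> Y h \<and> cm_represents T \<mu> Y' h' \<and> r = (\<integral>x. Y x * Y' x \<partial>\<mu>)"
  then obtain Y Y' where Y: "cm_represents T \<mu> Y h" "cm_represents T \<mu> Y' h'" "r = (\<integral>x. Y x * Y' x \<partial>\<mu>)"
    by (elim exE conjE)
  have null: "(\<integral>x. (f x - g x) * k x \<partial>\<mu>) = 0 \<and> integrable \<mu> (\<lambda>x. (f x - g x) * k x)"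
    if f: "cm_represents T \<mu> f a" "cm_represents T \<mu> g a" and k: "cm_represents T \<mu> k b" for f g k a b
  proof -
    have [measurable]: "f \<in> borel_measurable \<mu>" "g \<in> borel_measurable \<mu>" "k \<in> borel_measurable \<mu>"
      using cm_representsD(2)[OF f(1)] cm_representsD(2)[OF f(2)] cm_representsD(2)[OF k] by auto
    have int: "integrable \<mu> (\<lambda>x. (f x - g x) * k x)"
      by (intro square_integrable_mult cm_represents_unique[OF f] cm_representsD[OF k]) auto
    have "(\<integral>x. (f x - g x) * k x \<partial>\<mu>)\<^sup>2 \<le> (\<integral>x. (f x - g x)\<^sup>2 \<partial>\<mu>) * (\<integral>x. (k x)\<^sup>2 \<partial>\<mu>)"
      by (intro integral_Cauchy_Schwarz int cm_represents_unique[OF f] cm_representsD[OF k])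
    hence "(\<integral>x. (f x - g x) * k x \<partial>\<mu>)\<^sup>2 \<le> 0"
      by (simp only: cm_represents_unique(1)[OF f] mult_zero_left)
    hence "(\<integral>x. (f x - g x) * k x \<partial>\<mu>) = 0" by (simp only: power2_less_eq_zero_iff)
    thus ?thesis using int by (rule conjI)
  qed
  have ZZ': "integrable \<mu> (\<lambda>x. Z x * Z' x)"
    by (intro square_integrable_mult cm_representsD[OF Z] cm_representsD[OF Z'])
  have "r = (\<integral>x. (Y x - Z x) * Y' x + ((Y' x - Z' x) * Z x + Z x * Z' x) \<partial>\<mu>)"
    unfolding Y(3) by (rule Bochner_Integration.integral_cong[OF refl]) (simp add: algebra_simps)
  also have "\<dots> = (\<integral>x. Z x * Z' x \<partial>\<mu>)"
    by (simp only: null[OF Y(1) Z Y(2)] null[OF Y(2) Z' Z] ZZ' Bochner_Integration.integral_add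
       Bochner_Integration.integrable_add add_0_left)
  finally show "r = (\<integral>x. Z x * Z' x \<partial>\<mu>)" .
qed

text \<open>If \<open>Z e\<close> represents \<open>e\<close>, then \<open>L e = E[Z e * L]\<close>,
  and orthonormality of the \<open>e\<close> in the Cameron-Martin space is orthonormality of the
  \<open>Z e\<close> in L2. The values \<open>L e\<close> are thus Fourier coefficients of
  \<open>L\<close>.\<close>

lemma bessel:
  assumes E: "finite E" "cm_orthonormal W E" and L: "L \<in> evaluation_forms T"
  shows "(\<Sum>e\<in>E. (L e)\<^sup>2) \<le> (\<integral>x. (L x)\<^sup>2 \<partial>\<mu>)"
proof -
  have "\<forall>e\<in>E. \<exists>Z. cm_represents T \<mu> Z e"
    using E(2) by (auto simp: cm_orthonormal_def wiener_space_of_def cameron_martin_def)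
  then obtain Z where Z: "\<And>e. e \<in> E \<Longrightarrow> cm_represents T \<mu> (Z e) e" by metis
  have on: "(\<integral>x. Z e x * Z e' x \<partial>\<mu>) = (if e = e' then 1 else 0)" if "e \<in> E" "e' \<in> E" for e e'
    using E(2) that cm_inner_eq[OF Z[OF that(1)] Z[OF that(2)]]
    by (simp add: cm_orthonormal_def wiener_space_of_def)
  note L2 = form_square_integrable[OF L]
  have ZZ: "integrable \<mu> (\<lambda>x. Z e x * Z e' x)" if "e \<in> E" "e' \<in> E" for e e'
    by (intro square_integrable_mult cm_representsD[OF Z[OF that(1)]] cm_representsD[OF Z[OF that(2)]])
  have ZL: "integrable \<mu> (\<lambda>x. Z e x * L x)" if "e \<in> E" for e
    by (intro square_integrable_mult cm_representsD[OF Z[OF that]] form_measurable L L2)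
  let ?P = "\<lambda>x. \<Sum>e\<in>E. L e * Z e x"
  have "0 \<le> (\<integral>x. (L x - ?P x)\<^sup>2 \<partial>\<mu>)" by simp
  also have "\<dots> = (\<integral>x. (L x)\<^sup>2 - 2 * (\<Sum>e\<in>E. L e * (Z e x * L x)) + (\<Sum>e\<in>E. \<Sum>e'\<in>E. L e * L e' * (Z e x * Z e' x)) \<partial>\<mu>)"
  proof (rule Bochner_Integration.integral_cong)
    fix x
    have 1: "(?P x)\<^sup>2 = (\<Sum>e\<in>E. \<Sum>e'\<in>E. L e * L e' * (Z e x * Z e' x))"
      unfolding power2_eq_square sum_product by (simp add: mult_ac)
    have 2: "L x * ?P x = (\<Sum>e\<in>E. L e * (Z e x * L x))"
      unfolding sum_distrib_left by (simp add: mult_ac)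
    show "(L x - ?P x)\<^sup>2 = (L x)\<^sup>2 - 2 * (\<Sum>e\<in>E. L e * (Z e x * L x)) + (\<Sum>e\<in>E. \<Sum>e'\<in>E. L e * L e' * (Z e x * Z e' x))"
      unfolding 1[symmetric] 2[symmetric] by (simp add: power2_diff)
  qed simp
  also have "\<dots> = (\<integral>x. (L x)\<^sup>2 \<partial>\<mu>) - 2 * (\<Sum>e\<in>E. L e * L e) + (\<Sum>e\<in>E. \<Sum>e'\<in>E. L e * L e' * (if e = e' then 1 else 0))"
  proof (rule has_bochner_integral_integral_eq)
    show "has_bochner_integral \<mu> (\<lambda>x. (L x)\<^sup>2 - 2 * (\<Sum>e\<in>E. L e * (Z e x * L x)) + (\<Sum>e\<in>E. \<Sum>e'\<in>E. L e * L e' * (Z e x * Z e' x)))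
      ((\<integral>x. (L x)\<^sup>2 \<partial>\<mu>) - 2 * (\<Sum>e\<in>E. L e * L e) + (\<Sum>e\<in>E. \<Sum>e'\<in>E. L e * L e' * (if e = e' then 1 else 0)))"
    proof (intro has_bochner_integral_add has_bochner_integral_diff has_bochner_integral_sum has_bochner_integral_mult_right)
      show "has_bochner_integral \<mu> (\<lambda>x. (L x)\<^sup>2) (\<integral>x. (L x)\<^sup>2 \<partial>\<mu>)" using L2 by (rule has_bochner_integral_integrable)
      show "has_bochner_integral \<mu> (\<lambda>x. Z e x * L x) (L e)" if "e \<in> E" for e
        using ZL[OF that] cm_representsD(4)[OF Z[OF that] L] by (simp add: has_bochner_integral_iff)
      show "has_bochner_integral \<mu> (\<lambda>x. Z e x * Z e' x) (if e = e' then 1 else 0)" if "e \<in> E" "e' \<in> E" for e e'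
        using ZZ[OF that] on[OF that] by (simp add: has_bochner_integral_iff)
    qed
  qed
  also have "\<dots> = (\<integral>x. (L x)\<^sup>2 \<partial>\<mu>) - (\<Sum>e\<in>E. (L e)\<^sup>2)"
    using E(1) by (simp add: if_distrib sum.delta power2_eq_square cong: if_cong)
  finally show ?thesis by simp
qed

text \<open>\<open>bessel\<close> applied to one argument at a time: with the other \<open>j\<close>
  arguments fixed, the multilinear expression is an evaluation form in the first one. Its variance
  is an average over \<open>y\<close> of the same expression with \<open>j\<close> arguments and
  coefficients \<open>a r * L r y\<close>, to which the induction hypothesis applies.\<close>

lemma bessel_multilinear:
  assumes E: "finite E" "cm_orthonormal W E" and L: "\<And>r. r < N \<Longrightarrow> L r \<in> evaluation_forms T"
  shows "(\<Sum>hs | set hs \<subseteq> E \<and> length hs = j. (\<Sum>r<N. a r * (\<Prod>h\<leftarrow>hs. L r h))\<^sup>2) \<le> cov_form N L j a"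
proof (induction j arbitrary: a)
  case 0
  have "{hs. set hs \<subseteq> E \<and> length hs = 0} = {[]}" by auto
  thus ?case by (simp add: cov_form_0)
next
  case (Suc j)
  let ?\<Lambda> = "\<lambda>hs y. \<Sum>r<N. (a r * (\<Prod>h\<leftarrow>hs. L r h)) * L r y"
  have form: "?\<Lambda> hs \<in> evaluation_forms T" for hs
    using L by (intro Lin_sum) auto
  have "(\<Sum>hs | set hs \<subseteq> E \<and> length hs = Suc j. (\<Sum>r<N. a r * (\<Prod>h\<leftarrow>hs. L r h))\<^sup>2) =
     (\<Sum>hs | set hs \<subseteq> E \<and> length hs = j. \<Sum>e\<in>E. (?\<Lambda> hs e)\<^sup>2)"
    by (subst sum_lists_Suc[OF E(1)]) (simp add: mult_ac)
  also have "\<dots> \<le> (\<Sum>hs | set hs \<subseteq> E \<and> length hs = j. (\<integral>y. (?\<Lambda> hs y)\<^sup>2 \<partial>\<mu>))"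
    by (intro sum_mono bessel E form)
  also have "\<dots> = (\<integral>y. (\<Sum>hs | set hs \<subseteq> E \<and> length hs = j. (?\<Lambda> hs y)\<^sup>2) \<partial>\<mu>)"
    using form_square_integrable[OF form] by (subst Bochner_Integration.integral_sum) auto
  also have "\<dots> \<le> (\<integral>y. cov_form N L j (\<lambda>r. a r * L r y) \<partial>\<mu>)"
  proof (rule integral_mono)
    show "integrable \<mu> (\<lambda>y. \<Sum>hs | set hs \<subseteq> E \<and> length hs = j. (?\<Lambda> hs y)\<^sup>2)"
      using form_square_integrable[OF form] by auto
    show "integrable \<mu> (\<lambda>y. cov_form N L j (\<lambda>r. a r * L r y))"
      using cov_form_Suc[of N L j a] L by (auto simp: has_bochner_integral_iff)
    fix y
    show "(\<Sum>hs | set hs \<subseteq> E \<and> length hs = j. (?\<Lambda> hs y)\<^sup>2) \<le> cov_form N L j (\<lambda>r. a r * L r y)"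
      using Suc[of "\<lambda>r. a r * L r y"] by (simp add: mult_ac)
  qed
  also have "\<dots> = cov_form N L (Suc j) a"
    using cov_form_Suc[of N L j a] L by (auto simp: has_bochner_integral_iff)
  finally show ?case .
qed

text \<open>The falling factorial vanishes once more than \<open>n\<close> derivatives are taken, so
  the truncated subtraction in the exponent is harmless.\<close>

lemma dir_deriv_hom:
  fixes L :: "nat \<Rightarrow> 'd path \<Rightarrow> real"
  assumes L: "\<And>r. r < N \<Longrightarrow> L r \<in> evaluation_forms T"
  shows "dir_deriv (\<lambda>x. \<Sum>r<N. c r * L r x ^ n) hs x =
    (\<Prod>i<length hs. real n - real i) * (\<Sum>r<N. c r * L r x ^ (n - length hs) * (\<Prod>h\<leftarrow>hs. L r h))"
proof (induction hs arbitrary: x)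
  case (Cons h hs)
  let ?j = "length hs"
  have "((\<lambda>s. (\<Prod>i<?j. real n - real i) * (\<Sum>r<N. c r * (L r x + s * L r h) ^ (n - ?j) * (\<Prod>h\<leftarrow>hs. L r h)))
    has_real_derivative (\<Prod>i<?j. real n - real i) * (\<Sum>r<N. c r * (real (n - ?j) * (L r x ^ (n - ?j - 1) * L r h)) * (\<Prod>h\<leftarrow>hs. L r h))) (at 0)"
    by (auto intro!: derivative_eq_intros sum.cong simp: mult_ac)
  also have "(\<lambda>s. (\<Prod>i<?j. real n - real i) * (\<Sum>r<N. c r * (L r x + s * L r h) ^ (n - ?j) * (\<Prod>h\<leftarrow>hs. L r h))) =
     (\<lambda>s. dir_deriv (\<lambda>x. \<Sum>r<N. c r * L r x ^ n) hs (x + s *\<^sub>R h))"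
    unfolding Cons using L
    by (intro ext arg_cong2[where f = "(*)"] refl sum.cong) (auto simp: form_add form_scale)
  finally have "dir_deriv (\<lambda>x. \<Sum>r<N. c r * L r x ^ n) (h # hs) x =
    (\<Prod>i<?j. real n - real i) * (\<Sum>r<N. c r * (real (n - ?j) * (L r x ^ (n - ?j - 1) * L r h)) * (\<Prod>h\<leftarrow>hs. L r h))"
    by (simp add: DERIV_imp_deriv)
  also have "\<dots> = (\<Prod>i<?j. real n - real i) * real (n - ?j) * (\<Sum>r<N. c r * L r x ^ (n - Suc ?j) * (L r h * (\<Prod>h\<leftarrow>hs. L r h)))"
    by (simp add: sum_distrib_left mult_ac)
  also have "(\<Prod>i<?j. real n - real i) * real (n - ?j) = (\<Prod>i<Suc ?j. real n - real i)"
  proof (cases "?j \<le> n")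
    case False
    hence "(\<Prod>i<?j. real n - real i) = 0" by (intro prod_zero) (auto intro!: bexI[of _ n])
    thus ?thesis by simp
  qed (simp add: of_nat_diff)
  finally show ?case by simp
qed simp

lemma hs_norm_le:
  assumes L: "\<And>r. r < N \<Longrightarrow> L r \<in> evaluation_forms T"
  shows "hs_norm W j (\<lambda>hs. dir_deriv (\<lambda>x. \<Sum>r<N. c r * L r x ^ n) hs x) \<le>
    ennreal (sqrt ((\<Prod>i<j. real n - real i)\<^sup>2 * cov_form N L j (\<lambda>r. c r * L r x ^ (n - j))))"
  unfolding hs_norm_def
proof (rule SUP_least, clarify)
  fix E assume E: "finite E" "cm_orthonormal W E"
  have "(\<Sum>hs | set hs \<subseteq> E \<and> length hs = j. (dir_deriv (\<lambda>x. \<Sum>r<N. c r * L r x ^ n) hs x)\<^sup>2) =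
    (\<Prod>i<j. real n - real i)\<^sup>2 * (\<Sum>hs | set hs \<subseteq> E \<and> length hs = j. (\<Sum>r<N. c r * L r x ^ (n - j) * (\<Prod>h\<leftarrow>hs. L r h))\<^sup>2)"
    unfolding sum_distrib_left by (intro sum.cong) (auto simp: dir_deriv_hom[OF L] power_mult_distrib)
  also have "\<dots> \<le> (\<Prod>i<j. real n - real i)\<^sup>2 * cov_form N L j (\<lambda>r. c r * L r x ^ (n - j))"
    by (intro mult_left_mono bessel_multilinear E L) auto
  finally show "ennreal (sqrt (\<Sum>hs | set hs \<subseteq> E \<and> length hs = j. (dir_deriv (\<lambda>x. \<Sum>r<N. c r * L r x ^ n) hs x)\<^sup>2)) \<le>
    ennreal (sqrt ((\<Prod>i<j. real n - real i)\<^sup>2 * cov_form N L j (\<lambda>r. c r * L r x ^ (n - j))))"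
    by (intro ennreal_leI real_sqrt_le_mono)
qed

lemma wmeasure_W: "wmeasure W = restrict_space \<mu> (closure (cameron_martin T \<mu>))"
  by (simp add: wiener_space_of_def)

lemma closure_inter_sets: "closure (cameron_martin T \<mu>) \<inter> space \<mu> \<in> sets \<mu>"
  unfolding sets_path_law space_path_law
  by (subst sets_restrict_space) (auto intro!: image_eqI[of _ _ "closure (cameron_martin T \<mu>)"])

lemma wspace_eq: "wspace W = closure (cameron_martin T \<mu>) \<inter> C0 T"
  by (simp add: wmeasure_W space_restrict_space)

lemma nn_integral_wmeasure_le: "(\<integral>\<^sup>+x. f x \<partial>wmeasure W) \<le> (\<integral>\<^sup>+x. f x \<partial>\<mu>)"
  unfolding wmeasure_W
  by (subst nn_integral_restrict_space[OF closure_inter_sets])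
     (auto intro!: nn_integral_mono simp: indicator_def)

lemma wmeasure_measurable: "f \<in> borel_measurable \<mu> \<Longrightarrow> f \<in> borel_measurable (wmeasure W)"
  unfolding wmeasure_W by (rule measurable_restrict_space1)

text \<open>\<open>s\<close> is a positive bound of the L2 norm and serves as the unit: the
  derivative norm is at most some \<open>v\<close>, and
  \<open>v powr q \<le> s powr q * (1 + (v / s) ^ Q)\<close> for a power of two
  \<open>Q \<ge> q\<close>. The moment of \<open>v\<close> of order \<open>Q\<close> is at most a
  constant times \<open>s ^ Q\<close>, so \<open>s\<close> cancels. A positive \<open>s\<close>
  allows division also when the norm of \<open>F\<close> is zero.\<close>

theorem sobolev_norm_hom_bound:
  assumes q: "1 < q"
  obtains C where "0 \<le> C"
    and "\<And>F s. F \<in> hom n \<Longrightarrow> 0 < s \<Longrightarrow> (\<integral>x. (F x)\<^sup>2 \<partial>\<mu>) \<le> s\<^sup>2 \<Longrightarrow> poly_sobolev_norm W q k F \<le> ennreal (C * s)"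
proof -
  obtain m0 :: nat where m0: "q \<le> real m0" using real_arch_simple by blast
  \<comment> \<open>\<open>cov_form\<close> is a squared norm: its moment of order
    \<open>2 ^ m\<close> controls the norm to the order \<open>2 ^ Suc m\<close>, which has to be at
    least \<open>q\<close>.\<close>
  define m where "m = Suc m0"
  have "m0 < 2 ^ m0" by (rule less_exp)
  hence "real m0 \<le> real (2 ^ m0)" by (simp only: of_nat_le_iff)
  also have "\<dots> \<le> real (2 ^ Suc (Suc m0))" by simp
  finally have qQ: "q \<le> real (2 ^ Suc m)" using m0 unfolding m_def by linarith
  have "\<exists>C\<ge>0. \<forall>F s. F \<in> hom n \<longrightarrow> 0 < s \<longrightarrow> (\<integral>x. (F x)\<^sup>2 \<partial>\<mu>) \<le> s\<^sup>2 \<longrightarrow>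
     Lq_norm (wmeasure W) q (\<lambda>x. hs_norm W j (\<lambda>hs. dir_deriv F hs x)) \<le> ennreal (C * s)" for j
  proof -
    define f where "f = (\<Prod>i<j. real n - real i)"
    show ?thesis
    proof (cases "j \<le> n")
      case True
      obtain C where C: "C \<ge> 1" "\<And>(N::nat) c L. (\<forall>r<N. L r \<in> evaluation_forms T) \<Longrightarrow>
        (\<integral>x. cov_form N L j (\<lambda>r. c r * L r x ^ (n - j)) ^ 2 ^ Suc m0 \<partial>\<mu>) \<le> C * (\<integral>x. (\<Sum>r<N. c r * L r x ^ n)\<^sup>2 \<partial>\<mu>) ^ 2 ^ Suc m0"
        using cov_form_moment_bound[OF True] by blast
      define D where "D = (1 + (f\<^sup>2) ^ 2 ^ m * C) powr (1 / q)"
      show ?thesis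
      proof (intro exI[of _ D] conjI allI impI)
        show "0 \<le> D" by (simp add: D_def)
        fix F s assume F: "F \<in> hom n" and s: "0 < s" and Fs: "(\<integral>x. (F x)\<^sup>2 \<partial>\<mu>) \<le> s\<^sup>2"
        obtain N :: nat and c L where L: "\<And>r. r < N \<Longrightarrow> L r \<in> evaluation_forms T"
          and F_eq: "F = (\<lambda>x. \<Sum>r<N. c r * L r x ^ n)"
          using hom_rep[OF F] by metis
        define \<Phi> where "\<Phi> x = cov_form N L j (\<lambda>r. c r * L r x ^ (n - j))" for x
        have \<Phi>: "\<Phi> \<in> hom (2 * (n - j))" and \<Phi>0: "0 \<le> \<Phi> x" for x
          unfolding \<Phi>_def using L by (auto intro: cov_form_hom cov_form_nonneg)
        define v where "v x = sqrt (f\<^sup>2 * \<Phi> x)" for x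
        have v0: "0 \<le> v x" for x using \<Phi>0 by (simp add: v_def)
        show "Lq_norm (wmeasure W) q (\<lambda>x. hs_norm W j (\<lambda>hs. dir_deriv F hs x)) \<le> ennreal (D * s)"
        proof (rule Lq_norm_leI[where v = v])
          show "hs_norm W j (\<lambda>hs. dir_deriv F hs x) \<le> ennreal (v x)" for x
            unfolding F_eq v_def f_def \<Phi>_def by (rule hs_norm_le[OF L])
          have pow: "v x powr q \<le> s powr q * (1 + (f\<^sup>2) ^ 2 ^ m / s ^ 2 ^ Suc m * \<Phi> x ^ 2 ^ m)" for x
          proof -
            have "v x powr q = s powr q * (v x / s) powr q"
              using s v0 by (simp add: powr_divide)
            also have "\<dots> \<le> s powr q * (1 + (v x / s) ^ 2 ^ Suc m)"
              using v0 s q qQ by (intro mult_left_mono powr_le_one_plus) auto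
            also have "(v x / s) ^ 2 ^ Suc m = ((v x)\<^sup>2) ^ 2 ^ m / s ^ 2 ^ Suc m"
              by (simp add: power_divide power_mult)
            also have "(v x)\<^sup>2 = f\<^sup>2 * \<Phi> x" using \<Phi>0 by (simp add: v_def)
            finally show ?thesis by (simp add: power_mult_distrib)
          qed
          have int\<Phi>: "integrable \<mu> (\<lambda>x. \<Phi> x ^ 2 ^ m)" by (rule hom_power_integrable[OF \<Phi>])
          have "(\<integral>\<^sup>+x. ennreal (v x powr q) \<partial>wmeasure W) \<le> (\<integral>\<^sup>+x. ennreal (v x powr q) \<partial>\<mu>)"
            by (rule nn_integral_wmeasure_le)
          also have "\<dots> \<le> (\<integral>\<^sup>+x. ennreal (s powr q * (1 + (f\<^sup>2) ^ 2 ^ m / s ^ 2 ^ Suc m * \<Phi> x ^ 2 ^ m)) \<partial>\<mu>)"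
            by (intro nn_integral_mono ennreal_leI pow)
          also have "\<dots> = ennreal (\<integral>x. s powr q * (1 + (f\<^sup>2) ^ 2 ^ m / s ^ 2 ^ Suc m * \<Phi> x ^ 2 ^ m) \<partial>\<mu>)"
            using int\<Phi> s \<Phi>0 by (intro nn_integral_eq_integral) auto
          also have "(\<integral>x. s powr q * (1 + (f\<^sup>2) ^ 2 ^ m / s ^ 2 ^ Suc m * \<Phi> x ^ 2 ^ m) \<partial>\<mu>) =
             s powr q * (1 + (f\<^sup>2) ^ 2 ^ m / s ^ 2 ^ Suc m * (\<integral>x. \<Phi> x ^ 2 ^ m \<partial>\<mu>))"
            using int\<Phi> by (simp add: prob_space[unfolded space_path_law])
          also have "\<dots> \<le> s powr q * (1 + (f\<^sup>2) ^ 2 ^ m / s ^ 2 ^ Suc m * (C * (s\<^sup>2) ^ 2 ^ m))"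
          proof (intro mult_left_mono add_left_mono)
            have "(\<integral>x. \<Phi> x ^ 2 ^ m \<partial>\<mu>) \<le> C * (\<integral>x. (F x)\<^sup>2 \<partial>\<mu>) ^ 2 ^ m"
              using C(2)[of N L c] L by (simp add: \<Phi>_def F_eq m_def)
            also have "\<dots> \<le> C * (s\<^sup>2) ^ 2 ^ m"
              using C(1) Fs by (intro mult_left_mono power_mono) auto
            finally show "(\<integral>x. \<Phi> x ^ 2 ^ m \<partial>\<mu>) \<le> C * (s\<^sup>2) ^ 2 ^ m" .
          qed (use s in auto)
          also have "(f\<^sup>2) ^ 2 ^ m / s ^ 2 ^ Suc m * (C * (s\<^sup>2) ^ 2 ^ m) = (f\<^sup>2) ^ 2 ^ m * C"
            using s by (simp add: power_mult[symmetric] field_simps)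
          also have "s powr q * (1 + (f\<^sup>2) ^ 2 ^ m * C) = (D * s) powr q"
            using s C(1) q by (simp add: D_def powr_mult powr_powr add_nonneg_nonneg)
          finally show "(\<integral>\<^sup>+x. ennreal (v x powr q) \<partial>wmeasure W) \<le> ennreal ((D * s) powr q)"
            by (simp add: ennreal_leI)
        qed (use q s v0 in \<open>auto simp: D_def\<close>)
      qed
    next
      case False
      hence f0: "(\<Prod>i<j. real n - real i) = 0" by (intro prod_zero) (auto intro!: bexI[of _ n])
      show ?thesis
      proof (intro exI[of _ 0] conjI allI impI)
        fix F and s :: real assume F: "F \<in> hom n"
        obtain N :: nat and c L where L: "\<And>r. r < N \<Longrightarrow> L r \<in> evaluation_forms T"
          and F_eq: "F = (\<lambda>x. \<Sum>r<N. c r * L r x ^ n)"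
          using hom_rep[OF F] by metis
        show "Lq_norm (wmeasure W) q (\<lambda>x. hs_norm W j (\<lambda>hs. dir_deriv F hs x)) \<le> ennreal (0 * s)"
        proof (rule Lq_norm_leI[where v = "\<lambda>_. 0"])
          show "hs_norm W j (\<lambda>hs. dir_deriv F hs x) \<le> ennreal 0" for x
            using hs_norm_le[of N L j c n x] L by (simp add: F_eq f0)
        qed (use q in auto)
      qed simp
    qed
  qed
  then obtain C where C: "\<And>j. 0 \<le> C j" "\<And>j F s. F \<in> hom n \<Longrightarrow> 0 < s \<Longrightarrow> (\<integral>x. (F x)\<^sup>2 \<partial>\<mu>) \<le> s\<^sup>2 \<Longrightarrow>
     Lq_norm (wmeasure W) q (\<lambda>x. hs_norm W j (\<lambda>hs. dir_deriv F hs x)) \<le> ennreal (C j * s)"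
    by metis
  show ?thesis
  proof (rule that[of "\<Sum>j\<le>k. C j"])
    show "0 \<le> (\<Sum>j\<le>k. C j)" using C(1) by (intro sum_nonneg)
    fix F s assume F: "F \<in> hom n" "0 < s" "(\<integral>x. (F x)\<^sup>2 \<partial>\<mu>) \<le> s\<^sup>2"
    have "poly_sobolev_norm W q k F \<le> (\<Sum>j\<le>k. ennreal (C j * s))"
      unfolding poly_sobolev_norm_def by (intro sum_mono C(2) F)
    also have "\<dots> = ennreal ((\<Sum>j\<le>k. C j) * s)"
      using C(1) F(2) by (subst sum_ennreal) (auto simp: sum_distrib_right)
    finally show "poly_sobolev_norm W q k F \<le> ennreal ((\<Sum>j\<le>k. C j) * s)" .
  qed
qed

end

section \<open>Capacities of superlevel sets\<close>

lemma enn_powr_le_iff: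
  assumes "0 < q" "0 \<le> a" "enn_powr I (1 / q) \<le> ennreal a"
  shows "I \<le> ennreal (a powr q)"
proof -
  have fin: "I \<noteq> \<infinity>" using assms(3) by (auto simp: enn_powr_def top_unique)
  define i where "i = enn2real I"
  have I: "I = ennreal i" "0 \<le> i" using fin by (auto simp: i_def less_top)
  have "i powr (1 / q) \<le> a" using assms(2,3) I by (simp add: enn_powr_ennreal)
  hence "(i powr (1 / q)) powr q \<le> a powr q" using assms(1) by (intro powr_mono2) auto
  thus ?thesis using assms(1) I by (simp add: powr_powr ennreal_leI)
qed

lemma integral_square_sum_le:
  fixes f g :: "'a \<Rightarrow> real"
  assumes "integrable M (\<lambda>x. (f x)\<^sup>2)" "integrable M (\<lambda>x. (g x)\<^sup>2)" "integrable M (\<lambda>x. f x * g x)"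
    and ab: "0 \<le> a" "0 \<le> b" "(\<integral>x. (f x)\<^sup>2 \<partial>M) \<le> a\<^sup>2" "(\<integral>x. (g x)\<^sup>2 \<partial>M) \<le> b\<^sup>2"
  shows "(\<integral>x. (f x + g x)\<^sup>2 \<partial>M) \<le> (a + b)\<^sup>2"
proof -
  have "(\<integral>x. f x * g x \<partial>M)\<^sup>2 \<le> a\<^sup>2 * b\<^sup>2"
    by (rule order.trans[OF integral_Cauchy_Schwarz[OF assms(1-3)]]) (intro mult_mono ab; simp)
  hence "(\<integral>x. f x * g x \<partial>M)\<^sup>2 \<le> (a * b)\<^sup>2" by (simp add: power_mult_distrib)
  hence fg: "(\<integral>x. f x * g x \<partial>M) \<le> a * b" by (rule power2_le_imp_le) (use ab in simp)
  have "(\<integral>x. (f x + g x)\<^sup>2 \<partial>M) = (\<integral>x. (f x)\<^sup>2 + 2 * (f x * g x) + (g x)\<^sup>2 \<partial>M)"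
    by (rule Bochner_Integration.integral_cong[OF refl]) (simp add: power2_sum)
  also have "\<dots> = (\<integral>x. (f x)\<^sup>2 \<partial>M) + 2 * (\<integral>x. f x * g x \<partial>M) + (\<integral>x. (g x)\<^sup>2 \<partial>M)"
    using assms(1-3) by simp
  also have "\<dots> \<le> a\<^sup>2 + 2 * (a * b) + b\<^sup>2" using fg ab by linarith
  finally show ?thesis by (simp add: power2_sum)
qed

context gaussian_path
begin

lemma evaluation_form_dual:
  assumes "L \<in> evaluation_forms T"
  shows "L \<in> dual_functionals W"
proof -
  obtain S c where L: "L = (\<lambda>x. \<Sum>(t, i)\<in>S. c (t, i) * apply_bcontfun x t $ i)"
    using assms by (auto simp: evaluation_forms_def)
  have "\<bar>L x\<bar> \<le> (\<Sum>p\<in>S. \<bar>c p\<bar>) * norm x" for x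
  proof -
    have "\<bar>L x\<bar> \<le> (\<Sum>p\<in>S. \<bar>c p * apply_bcontfun x (fst p) $ snd p\<bar>)"
      by (simp add: L case_prod_beta' sum_abs)
    also have "\<dots> \<le> (\<Sum>p\<in>S. \<bar>c p\<bar> * norm x)"
    proof (rule sum_mono)
      fix p
      have "\<bar>apply_bcontfun x (fst p) $ snd p\<bar> \<le> norm (apply_bcontfun x (fst p))" by (rule component_le_norm_cart)
      also have "\<dots> \<le> norm x" by (rule norm_bounded)
      finally show "\<bar>c p * apply_bcontfun x (fst p) $ snd p\<bar> \<le> \<bar>c p\<bar> * norm x"
        by (simp add: abs_mult mult_left_mono)
    qed
    finally show ?thesis by (simp add: sum_distrib_right)
  qed
  thus ?thesis using assms unfolding dual_functionals_def
    by (auto simp: form_add form_scale)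
qed

lemma hom_polynomial_functional: "F \<in> hom n \<Longrightarrow> F \<in> polynomial_functionals W"
proof (induction rule: hom.induct)
  case (pow L c)
  have "(\<lambda>x. L x ^ n) \<in> polynomial_functionals W"
  proof (induction n)
    case (Suc n)
    show ?case using polynomial_functionals.mult[OF polynomial_functionals.dual[OF evaluation_form_dual[OF pow]] Suc] by simp
  qed (simp add: polynomial_functionals.const)
  thus ?case by (rule polynomial_functionals.mult[OF polynomial_functionals.const])
qed (rule polynomial_functionals.add)

text \<open>The empty family is orthonormal and admits exactly the empty word, so it already
  contributes the absolute value of \<open>F x\<close> to the supremum.\<close>

lemma hs_norm_0: "ennreal \<bar>F x\<bar> \<le> hs_norm W 0 (\<lambda>hs. dir_deriv F hs x)"
proof -
  have "{hs. set hs \<subseteq> {} \<and> length hs = 0} = {[]}" for hs :: "'d path list" by auto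
  hence "ennreal \<bar>F x\<bar> = ennreal (sqrt (\<Sum>hs | set hs \<subseteq> {} \<and> length hs = 0. (dir_deriv F hs x)\<^sup>2))"
    by simp
  also have "\<dots> \<le> hs_norm W 0 (\<lambda>hs. dir_deriv F hs x)"
    unfolding hs_norm_def by (rule SUP_upper) (auto simp: cm_orthonormal_def)
  finally show ?thesis .
qed

lemma Lq_norm_le_sobolev:
  assumes "0 < q"
  shows "Lq_norm (wmeasure W) q (\<lambda>x. ennreal \<bar>F x\<bar>) \<le> poly_sobolev_norm W q k F"
proof -
  have "Lq_norm (wmeasure W) q (\<lambda>x. ennreal \<bar>F x\<bar>) \<le> Lq_norm (wmeasure W) q (\<lambda>x. hs_norm W 0 (\<lambda>hs. dir_deriv F hs x))"
    unfolding Lq_norm_def using assms by (intro enn_powr_mono nn_integral_mono hs_norm_0) auto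
  also have "\<dots> \<le> (\<Sum>j\<in>{0}. Lq_norm (wmeasure W) q (\<lambda>x. hs_norm W j (\<lambda>hs. dir_deriv F hs x)))" by simp
  also have "\<dots> \<le> poly_sobolev_norm W q k F"
    unfolding poly_sobolev_norm_def by (rule sum_mono2) auto
  finally show ?thesis .
qed

lemma hom_L2_sum:
  assumes G: "\<And>m. G m \<in> hom n" and s: "\<And>m. 0 \<le> s m" "\<And>m. (\<integral>x. (G m x)\<^sup>2 \<partial>\<mu>) \<le> (s m)\<^sup>2"
    and "finite A"
  shows "(\<integral>x. (\<Sum>m\<in>A. G m x)\<^sup>2 \<partial>\<mu>) \<le> (\<Sum>m\<in>A. s m)\<^sup>2"
  using assms(4)
proof (induction A rule: finite_induct)
  case (insert a A)
  have S: "(\<lambda>x. \<Sum>m\<in>A. G m x) \<in> hom n" by (intro hom_sum G)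
  have "(\<integral>x. (G a x + (\<Sum>m\<in>A. G m x))\<^sup>2 \<partial>\<mu>) \<le> (s a + (\<Sum>m\<in>A. s m))\<^sup>2"
    by (intro integral_square_sum_le hom_power_integrable[OF G] hom_power_integrable[OF S]
         hom_integrable[OF hom_mult[OF G S]] s insert sum_nonneg)
  thus ?case using insert by simp
qed simp

text \<open>Chebyshev's argument with \<open>u = (\<Sum>m. G m) / K\<close>, which is at least 1
  wherever some \<open>G m\<close> exceeds \<open>K\<close>. That \<open>u\<close> lies in the
  Sobolev space comes from the common degree: all differences of partial sums belong to
  \<open>hom n\<close>, where the Sobolev norm is dominated by the L2 norm and hence by a tail of
  \<open>s\<close>.\<close>

theorem capacity_bound:
  assumes q: "1 < q"
  obtains C where "0 \<le> C"
    and "\<And>G s K. (\<And>m. G m \<in> hom n) \<Longrightarrow> (\<And>m x. 0 \<le> G m x) \<Longrightarrow> (\<And>m. 0 < s m) \<Longrightarrow> summable s \<Longrightarrow>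
      (\<And>m. (\<integral>x. (G m x)\<^sup>2 \<partial>\<mu>) \<le> (s m)\<^sup>2) \<Longrightarrow> 0 < K \<Longrightarrow>
      cap_open W q k {x \<in> wspace W. \<exists>m. K < G m x} \<le> ennreal (C * suminf s / K)"
proof -
  obtain C where C: "0 \<le> C" "\<And>F s. F \<in> hom n \<Longrightarrow> 0 < s \<Longrightarrow> (\<integral>x. (F x)\<^sup>2 \<partial>\<mu>) \<le> s\<^sup>2 \<Longrightarrow> poly_sobolev_norm W q k F \<le> ennreal (C * s)"
    using sobolev_norm_hom_bound[OF q, of n k] by blast
  show ?thesis
  proof (rule that[OF C(1)])
    fix G :: "nat \<Rightarrow> 'd path \<Rightarrow> real" and s :: "nat \<Rightarrow> real" and K :: real
    assume G: "\<And>m. G m \<in> hom n" and G0: "\<And>m x. 0 \<le> G m x" and s0: "\<And>m. 0 < s m"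
      and sum: "summable s" and Gs: "\<And>m. (\<integral>x. (G m x)\<^sup>2 \<partial>\<mu>) \<le> (s m)\<^sup>2" and K: "0 < K"
    have s1: "0 \<le> s m" for m using s0[of m] by simp
    define F where "F = (\<lambda>N x. (1 / K) * (\<Sum>m<N. G m x))"
    define D where "D = (\<lambda>N M x. (1 / K) * (\<Sum>m\<in>{N..<M}. G m x))"
    define tail where "tail N = (\<Sum>m. s (m + N))" for N
    have tail: "(\<Sum>m\<in>{N..<M}. s m) \<le> tail N" for N M
    proof -
      have "(\<Sum>m\<in>{N..<M}. s m) = (\<Sum>m<M - N. s (m + N))"
      proof (cases "N \<le> M")
        case True
        thus ?thesis using sum.shift_bounds_nat_ivl[of s 0 N "M - N"] by (simp add: atLeast0LessThan)
      qed simp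
      also have "\<dots> \<le> tail N" unfolding tail_def
        using sum s0 by (intro sum_le_suminf) (auto simp: summable_iff_shift less_imp_le)
      finally show ?thesis .
    qed
    have tail0: "0 < tail N" for N
      unfolding tail_def using sum s0 by (intro suminf_pos) (auto simp: summable_iff_shift)
    have tail_lim: "tail \<longlonglongrightarrow> 0"
    proof -
      have "tail = (\<lambda>N. suminf s - (\<Sum>m<N. s m))"
        unfolding tail_def using suminf_split_initial_segment[OF sum] by (intro ext) (simp add: algebra_simps)
      moreover have "(\<lambda>N. suminf s - (\<Sum>m<N. s m)) \<longlonglongrightarrow> suminf s - suminf s"
        by (intro tendsto_intros summable_LIMSEQ sum)
      ultimately show ?thesis by simp
    qed
    have Dhom: "D N M \<in> hom n" for N M unfolding D_def by (rule hom_scale, rule hom_sum, rule G)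
    have DL2: "(\<integral>x. (D N M x)\<^sup>2 \<partial>\<mu>) \<le> (tail N / K)\<^sup>2" for N M
    proof -
      have "(\<integral>x. (D N M x)\<^sup>2 \<partial>\<mu>) = (1 / K)\<^sup>2 * (\<integral>x. (\<Sum>m\<in>{N..<M}. G m x)\<^sup>2 \<partial>\<mu>)"
        unfolding D_def power_mult_distrib by simp
      also have "\<dots> \<le> (1 / K)\<^sup>2 * (\<Sum>m\<in>{N..<M}. s m)\<^sup>2"
        by (intro mult_left_mono hom_L2_sum[where n = n] G Gs s1) auto
      also have "\<dots> \<le> (1 / K)\<^sup>2 * (tail N)\<^sup>2"
        by (intro mult_left_mono power_mono tail sum_nonneg s1) auto
      finally show ?thesis by (simp add: power_divide)
    qed
    have Dnorm: "poly_sobolev_norm W q k (D N M) \<le> ennreal (C * (tail N / K))" for N M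
      by (rule C(2)[OF Dhom _ DL2]) (use tail0 K in simp)
    \<comment> \<open>The Cauchy condition allows the indices in either order, hence the sign
      \<open>a\<close> below.\<close>
    have D_swap: "poly_sobolev_norm W q k (\<lambda>x. F N x - F M x) \<le> ennreal (C * (tail (min N M) / K))" for N M
    proof (rule C(2))
      have diff: "F b x - F a x = D a b x" if "a \<le> b" for a b x
      proof -
        have "(\<Sum>m<b. G m x) = (\<Sum>m<a. G m x) + (\<Sum>m\<in>{a..<b}. G m x)"
          using that by (metis atLeast0LessThan sum.atLeastLessThan_concat le0)
        thus ?thesis by (simp add: F_def D_def algebra_simps add_divide_distrib)
      qed
      have "\<exists>a. (a = 1 \<or> a = -1) \<and> (\<lambda>x. F N x - F M x) = (\<lambda>x. a * D (min N M) (max N M) x)"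
      proof (cases "M \<le> N")
        case True
        thus ?thesis using diff[OF True] by (intro exI[of _ 1]) (simp add: min_absorb2 max_absorb1)
      next
        case False
        hence "F N x - F M x = - D N M x" for x using diff[of N M x] by simp
        thus ?thesis using False by (intro exI[of _ "-1"]) (simp add: min_absorb1 max_absorb2)
      qed
      then obtain a :: real where a: "a = 1 \<or> a = -1" and
        eq: "(\<lambda>x. F N x - F M x) = (\<lambda>x. a * D (min N M) (max N M) x)" by blast
      show "(\<lambda>x. F N x - F M x) \<in> hom n"
        unfolding eq by (rule hom_scale[OF Dhom])
      show "0 < tail (min N M) / K" using tail0 K by simp
      have "a\<^sup>2 = 1" using a by auto
      hence "(\<integral>x. (F N x - F M x)\<^sup>2 \<partial>\<mu>) = (\<integral>x. (D (min N M) (max N M) x)\<^sup>2 \<partial>\<mu>)"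
        unfolding fun_cong[OF eq] power_mult_distrib by simp
      thus "(\<integral>x. (F N x - F M x)\<^sup>2 \<partial>\<mu>) \<le> (tail (min N M) / K)\<^sup>2" using DL2 by simp
    qed
    have Fnorm: "poly_sobolev_norm W q k (F N) \<le> ennreal (C * suminf s / K)" for N
    proof -
      have "F N = D 0 N" by (simp add: F_def D_def fun_eq_iff atLeast0LessThan)
      thus ?thesis using Dnorm[of 0 N] by (simp add: tail_def)
    qed
    \<comment> \<open>Summed in \<open>ennreal\<close>, so that \<open>g\<close> is defined
      everywhere. Where the series diverges, a null set, \<open>enn2real\<close> gives
      \<open>u\<close> the value zero.\<close>
    define g where "g x = (\<Sum>m. ennreal (G m x))" for x
    define u where "u x = enn2real (g x) / K" for x
    have Gm [measurable]: "G m \<in> borel_measurable (wmeasure W)" for m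
      by (intro wmeasure_measurable hom_measurable[OF G])
    have um [measurable]: "u \<in> borel_measurable (wmeasure W)"
      unfolding u_def g_def by measurable
    have fin: "AE x in wmeasure W. g x \<noteq> \<infinity>"
    proof (rule nn_integral_PInf_AE)
      show "g \<in> borel_measurable (wmeasure W)" unfolding g_def by measurable
      have "(\<integral>\<^sup>+x. g x \<partial>wmeasure W) = (\<Sum>m. \<integral>\<^sup>+x. ennreal (G m x) \<partial>wmeasure W)"
        unfolding g_def by (rule nn_integral_suminf) measurable
      also have "\<dots> \<le> (\<Sum>m. ennreal (s m))"
      proof (rule suminf_le)
        fix m
        have "(\<integral>\<^sup>+x. ennreal (G m x) \<partial>wmeasure W) \<le> (\<integral>\<^sup>+x. ennreal (G m x) \<partial>\<mu>)" by (rule nn_integral_wmeasure_le)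
        also have "\<dots> = ennreal (\<integral>x. G m x \<partial>\<mu>)"
          using G0 hom_integrable[OF G] by (intro nn_integral_eq_integral) auto
        also have "(\<integral>x. G m x \<partial>\<mu>) \<le> s m"
        proof (rule power2_le_imp_le)
          show "(\<integral>x. G m x \<partial>\<mu>)\<^sup>2 \<le> (s m)\<^sup>2"
            by (rule order.trans[OF integral_square_le Gs]) (use hom_integrable[OF G] hom_power_integrable[OF G] in auto)
        qed (use s0 less_imp_le in blast)
        finally show "(\<integral>\<^sup>+x. ennreal (G m x) \<partial>wmeasure W) \<le> ennreal (s m)" by (simp add: ennreal_leI)
      qed auto
      also have "\<dots> = ennreal (suminf s)" using sum s0 less_imp_le by (intro suminf_ennreal2) auto
      finally show "(\<integral>\<^sup>+x. g x \<partial>wmeasure W) \<noteq> \<infinity>" by (auto simp: top_unique)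
    qed
    have lim: "(\<lambda>M. D N M x) \<longlonglongrightarrow> u x - F N x" if "g x \<noteq> \<infinity>" for N x
    proof -
      have su: "summable (\<lambda>m. G m x)"
        using that G0 unfolding g_def by (intro summable_suminf_not_top) auto
      hence "g x = ennreal (\<Sum>m. G m x)" unfolding g_def using G0 by (intro suminf_ennreal2) auto
      hence ux: "u x = (\<Sum>m. G m x) / K" using suminf_nonneg[OF su] G0 by (simp add: u_def)
      have "(\<lambda>M. (1 / K) * (\<Sum>m<M. G m x) - F N x) \<longlonglongrightarrow> (1 / K) * (\<Sum>m. G m x) - F N x"
        by (intro tendsto_intros summable_LIMSEQ su)
      moreover have "\<forall>\<^sub>F M in sequentially. (1 / K) * (\<Sum>m<M. G m x) - F N x = D N M x"
        using eventually_ge_at_top[of N]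
      proof eventually_elim
        case (elim M)
        hence "(\<Sum>m<M. G m x) = (\<Sum>m<N. G m x) + (\<Sum>m\<in>{N..<M}. G m x)"
          by (metis atLeast0LessThan sum.atLeastLessThan_concat le0)
        thus ?case by (simp add: F_def D_def algebra_simps add_divide_distrib)
      qed
      ultimately show ?thesis unfolding ux by (auto intro: Lim_transform_eventually)
    qed
    \<comment> \<open>For fixed \<open>N\<close> the functions \<open>D N M\<close> tend almost
      everywhere to \<open>u - F N\<close> as \<open>M\<close> grows and have uniformly bounded
      norm, so Fatou's lemma bounds the norm of the limit.\<close>
    have Lq: "Lq_norm (wmeasure W) q (\<lambda>x. ennreal \<bar>F N x - u x\<bar>) \<le> ennreal (C * (tail N / K))" for N
    proof (rule Lq_norm_leI[where v = "\<lambda>x. \<bar>F N x - u x\<bar>"])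
      have Dm [measurable]: "D N M \<in> borel_measurable (wmeasure W)" for M
        by (intro wmeasure_measurable hom_measurable[OF Dhom])
      have bd: "(\<integral>\<^sup>+x. ennreal (\<bar>D N M x\<bar> powr q) \<partial>wmeasure W) \<le> ennreal ((C * (tail N / K)) powr q)" for M
      proof (rule enn_powr_le_iff)
        have "Lq_norm (wmeasure W) q (\<lambda>x. ennreal \<bar>D N M x\<bar>) \<le> ennreal (C * (tail N / K))"
          by (rule order.trans[OF Lq_norm_le_sobolev[of q "D N M" k] Dnorm]) (use q in simp)
        thus "enn_powr (\<integral>\<^sup>+x. ennreal (\<bar>D N M x\<bar> powr q) \<partial>wmeasure W) (1 / q) \<le> ennreal (C * (tail N / K))"
          by (simp add: Lq_norm_def enn_powr_ennreal)
      qed (use q C(1) tail0[of N] K in auto)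
      have "(\<integral>\<^sup>+x. ennreal (\<bar>F N x - u x\<bar> powr q) \<partial>wmeasure W) \<le>
        (\<integral>\<^sup>+x. liminf (\<lambda>M. ennreal (\<bar>D N M x\<bar> powr q)) \<partial>wmeasure W)"
      proof (rule nn_integral_mono_AE)
        show "AE x in wmeasure W. ennreal (\<bar>F N x - u x\<bar> powr q) \<le> liminf (\<lambda>M. ennreal (\<bar>D N M x\<bar> powr q))"
          using fin
        proof eventually_elim
          case (elim x)
          have "(\<lambda>M. ennreal (\<bar>D N M x\<bar> powr q)) \<longlonglongrightarrow> ennreal (\<bar>u x - F N x\<bar> powr q)"
            using q by (intro tendsto_ennrealI tendsto_powr' tendsto_rabs lim elim tendsto_const) auto
          from lim_imp_Liminf[OF _ this] show ?case by (simp add: abs_minus_commute)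
        qed
      qed
      also have "\<dots> \<le> liminf (\<lambda>M. \<integral>\<^sup>+x. ennreal (\<bar>D N M x\<bar> powr q) \<partial>wmeasure W)"
        by (rule nn_integral_liminf) measurable
      also have "\<dots> \<le> liminf (\<lambda>M. ennreal ((C * (tail N / K)) powr q))"
        by (intro Liminf_mono always_eventually allI bd)
      also have "\<dots> = ennreal ((C * (tail N / K)) powr q)" by (simp add: Liminf_const)
      finally show "(\<integral>\<^sup>+x. ennreal (\<bar>F N x - u x\<bar> powr q) \<partial>wmeasure W) \<le> ennreal ((C * (tail N / K)) powr q)" .
    qed (use q C(1) tail0[of N] K in auto)
    have tailC: "(\<lambda>N. ennreal (C * (tail N / K))) \<longlonglongrightarrow> 0"
    proof -
      have "(\<lambda>N. C * (tail N / K)) \<longlonglongrightarrow> C * (0 / K)" using K by (intro tendsto_intros tail_lim) auto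
      thus ?thesis using tendsto_ennrealI by fastforce
    qed
    \<comment> \<open>\<open>sobolev_norm\<close> takes \<open>lim\<close> of the norms along an
      approximating sequence, which is meaningful only if they converge. Compactness of
      \<open>ennreal\<close> supplies a subsequence along which they do.\<close>
    obtain l r where r: "strict_mono (r :: nat \<Rightarrow> nat)" "((\<lambda>N. poly_sobolev_norm W q k (F N)) \<circ> r) \<longlonglongrightarrow> l"
      using compact_complete_linorder by blast
    have approx: "sobolev_approx W q k u (\<lambda>N. F (r N))"
      unfolding sobolev_approx_def
    proof (intro conjI allI impI)
      fix N
      show "F (r N) \<in> polynomial_functionals W"
        unfolding F_def by (intro hom_polynomial_functional[of _ n] hom_scale hom_sum G)
    next
      have "(\<lambda>N. Lq_norm (wmeasure W) q (\<lambda>x. ennreal \<bar>F N x - u x\<bar>)) \<longlonglongrightarrow> 0"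
        by (rule tendsto_sandwich[OF _ _ tendsto_const tailC]) (intro always_eventually allI Lq zero_le)+
      from LIMSEQ_subseq_LIMSEQ[OF this r(1)]
      show "(\<lambda>N. Lq_norm (wmeasure W) q (\<lambda>x. ennreal \<bar>F (r N) x - u x\<bar>)) \<longlonglongrightarrow> 0" by (simp add: o_def)
    next
      fix e :: real assume e: "0 < e"
      have "\<forall>\<^sub>F N in sequentially. ennreal (C * (tail N / K)) < ennreal e"
        using tailC e by (intro order_tendstoD) auto
      then obtain N0 where N0: "\<And>N. N0 \<le> N \<Longrightarrow> ennreal (C * (tail N / K)) < ennreal e"
        unfolding eventually_sequentially by blast
      show "\<exists>N. \<forall>m\<ge>N. \<forall>n\<ge>N. poly_sobolev_norm W q k (\<lambda>x. F (r m) x - F (r n) x) < ennreal e"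
      proof (intro exI[of _ N0] allI impI)
        fix m n assume "N0 \<le> m" "N0 \<le> n"
        hence "N0 \<le> min (r m) (r n)" using seq_suble[OF r(1), of m] seq_suble[OF r(1), of n] by linarith
        thus "poly_sobolev_norm W q k (\<lambda>x. F (r m) x - F (r n) x) < ennreal e"
          by (rule le_less_trans[OF D_swap N0])
      qed
    qed
    have "sobolev_norm W q k u \<le> lim (\<lambda>N. poly_sobolev_norm W q k (F (r N)))"
      unfolding sobolev_norm_def by (rule INF_lower) (simp add: approx)
    also have "\<dots> = l" using r(2) by (intro limI) (simp add: o_def)
    also have "l \<le> ennreal (C * suminf s / K)"
      by (rule LIMSEQ_le_const2[OF r(2)]) (auto intro: Fnorm)
    finally have su: "sobolev_norm W q k u \<le> ennreal (C * suminf s / K)" .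
    have "cap_open W q k {x \<in> wspace W. \<exists>m. K < G m x} \<le> sobolev_norm W q k u"
      unfolding cap_open_def
    proof (rule INF_lower, intro CollectI conjI)
      show "u \<in> sobolev_space W q k" using um approx by (auto simp: sobolev_space_def)
      show "AE x in wmeasure W. 0 \<le> u x" using K by (auto simp: u_def)
      show "AE x in wmeasure W. x \<in> {x \<in> wspace W. \<exists>m. K < G m x} \<longrightarrow> 1 \<le> u x"
        using fin
      proof eventually_elim
        case (elim x)
        show ?case
        proof
          assume "x \<in> {x \<in> wspace W. \<exists>m. K < G m x}"
          then obtain m where m: "K < G m x" by auto
          have "ennreal (G m x) \<le> g x"
            unfolding g_def using sum_le_suminf[of "\<lambda>m. ennreal (G m x)" "{m}"] by simp
          hence "enn2real (ennreal (G m x)) \<le> enn2real (g x)"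
            using elim by (intro enn2real_mono) (auto simp: less_top)
          hence "G m x \<le> enn2real (g x)" using G0[of m x] by simp
          thus "1 \<le> u x" using m K by (simp add: u_def)
        qed
      qed
    qed
    with su show "cap_open W q k {x \<in> wspace W. \<exists>m. K < G m x} \<le> ennreal (C * suminf s / K)"
      by (rule order.trans[rotated])
  qed
qed

lemma openin_superlevel:
  assumes "\<And>m. G m \<in> hom n"
  shows "openin (top_of_set (wspace W)) {x \<in> wspace W. \<exists>m. K < G m x}"
proof -
  have "open (\<Union>m. {x. K < G m x})"
    using hom_continuous[OF assms] by (intro open_UN ballI open_Collect_less continuous_on_const)
  moreover have "{x \<in> wspace W. \<exists>m. K < G m x} = wspace W \<inter> (\<Union>m. {x. K < G m x})" by auto
  ultimately show ?thesis by (simp add: openin_open_Int)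
qed

end

section \<open>Iterated integrals along paths with bounded density\<close>

lemma continuous_times_bounded_integrable:
  fixes f g :: "real \<Rightarrow> real"
  assumes f: "continuous_on {a..b} f" and g: "g \<in> borel_measurable borel" "\<And>r. \<bar>g r\<bar> \<le> L"
  shows "(\<lambda>r. f r * g r) integrable_on {a..b}"
proof -
  have f1: "set_integrable lborel {a..b} f" using f by (rule borel_integrable_atLeastAtMost')
  have "set_integrable lborel {a..b} (\<lambda>r. f r * g r)"
    unfolding set_integrable_def
  proof (rule Bochner_Integration.integrable_bound)
    show "integrable lborel (\<lambda>r. L * norm (indicator {a..b} r *\<^sub>R f r))"
      using f1 unfolding set_integrable_def by (intro integrable_mult_right integrable_norm)
    have [measurable]: "(\<lambda>r. indicator {a..b} r *\<^sub>R f r) \<in> borel_measurable lborel" "g \<in> borel_measurable lborel"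
      using f1 g(1) unfolding set_integrable_def by auto
    have "(\<lambda>r. (indicator {a..b} r *\<^sub>R f r) * g r) \<in> borel_measurable lborel" by measurable
    thus "(\<lambda>r. indicator {a..b} r *\<^sub>R (f r * g r)) \<in> borel_measurable lborel" by (simp add: mult.assoc)
    have "\<bar>f r\<bar> * \<bar>g r\<bar> \<le> \<bar>L\<bar> * \<bar>f r\<bar>" for r
      using g(2)[of r] by (subst mult.commute, intro mult_right_mono) auto
    thus "AE r in lborel. norm (indicator {a..b} r *\<^sub>R (f r * g r)) \<le> norm (L * norm (indicator {a..b} r *\<^sub>R f r))"
      by (auto simp: abs_mult indicator_def)
  qed
  thus ?thesis using set_borel_integral_eq_integral(1) by blast
qed

lemma integral_bound_real:
  fixes f :: "real \<Rightarrow> real"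
  assumes "f integrable_on {a..b}" "a \<le> b" "\<And>r. r \<in> {a..b} \<Longrightarrow> \<bar>f r\<bar> \<le> B"
  shows "\<bar>integral {a..b} f\<bar> \<le> B * (b - a)"
proof -
  have "0 \<le> B" using assms(3)[of a] assms(2) by (auto intro: order.trans[OF abs_ge_zero])
  thus ?thesis using has_integral_bound_real[of B "{}" f "integral {a..b} f" a b] assms integrable_integral[OF assms(1)] by auto
qed

lemma partitions_ends:
  assumes "p \<in> partitions a b"
  shows "p ! 0 = a" "p ! (length p - 1) = b" "0 < length p"
  using assms by (auto simp: partitions_def hd_conv_nth last_conv_nth)

lemma partitions_step:
  assumes "p \<in> partitions a b" "j < length p - 1"
  shows "p ! j < p ! Suc j" "a \<le> p ! j" "p ! Suc j \<le> b"
proof -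
  have s: "sorted_wrt (<) p" using assms by (auto simp: partitions_def)
  have mono: "p ! i \<le> p ! k" if "i \<le> k" "k < length p" for i k
    using that s by (cases "i = k") (auto simp: sorted_wrt_iff_nth_less less_imp_le)
  show "p ! j < p ! Suc j" using s assms(2) by (auto simp: sorted_wrt_iff_nth_less)
  show "a \<le> p ! j" using mono[of 0 j] partitions_ends[OF assms(1)] assms(2) by auto
  show "p ! Suc j \<le> b" using mono[of "Suc j" "length p - 1"] partitions_ends[OF assms(1)] assms(2) by auto
qed

lemma uniform_partition:
  assumes "a < b" "0 < n"
  shows "map (\<lambda>k. a + real k * ((b - a) / real n)) [0..<Suc n] \<in> partitions a b"
proof -
  have "real i * ((b - a) / real n) < real j * ((b - a) / real n)" if "i < j" for i j :: nat
    using assms that by (intro mult_strict_right_mono) auto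
  hence "sorted_wrt (<) (map (\<lambda>k. a + real k * ((b - a) / real n)) [0..<Suc n])"
    by (auto simp: sorted_wrt_map sorted_wrt_iff_nth_less simp del: upt_Suc)
  thus ?thesis using assms unfolding partitions_def
    by (auto simp: hd_map last_map simp del: upt_Suc)
qed

lemma partitions_mesh:
  assumes "a \<le> b" "0 < d"
  obtains p where "p \<in> partitions a b" "\<And>j. j < length p - 1 \<Longrightarrow> p ! Suc j - p ! j < d"
proof (cases "a = b")
  case True
  thus ?thesis using that[of "[a]"] by (simp add: partitions_def)
next
  case False
  obtain n :: nat where n: "(b - a) / d < real n" using reals_Archimedean2 by blast
  hence n0: "0 < n" using assms False by (metis divide_pos_pos diff_gt_0_iff_gt le_less of_nat_0_less_iff order_less_trans)
  let ?p = "map (\<lambda>k. a + real k * ((b - a) / real n)) [0..<Suc n]"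
  have "?p ! Suc j - ?p ! j < d" if "j < length ?p - 1" for j
  proof -
    have "?p ! Suc j - ?p ! j = (b - a) / real n"
      using that by (simp add: nth_append del: upt_Suc) (simp add: field_simps)
    also have "\<dots> < d" using n n0 assms by (simp add: field_simps)
    finally show ?thesis .
  qed
  thus ?thesis using that[of ?p] uniform_partition[of a b n] n0 False assms by auto
qed

text \<open>\<open>rs_integral\<close> is a definite description. Two candidate values are compared
  along one partition fine enough for both; if \<open>a = b\<close>, the one-point list is such a
  partition.\<close>

lemma has_rs_integral_unique:
  assumes "a \<le> b" "has_rs_integral f g a b I" "has_rs_integral f g a b J"
  shows "I = J"
proof (rule ccontr)
  assume "I \<noteq> J"
  hence e: "0 < \<bar>I - J\<bar> / 2" by simp
  let ?ok = "\<lambda>\<delta> I. \<forall>p\<in>partitions a b. \<forall>\<tau>.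
        (\<forall>j<length p - 1. p ! j \<le> \<tau> j \<and> \<tau> j \<le> p ! Suc j \<and> p ! Suc j - p ! j < \<delta>) \<longrightarrow>
        \<bar>(\<Sum>j<length p - 1. f (\<tau> j) * (g (p ! Suc j) - g (p ! j))) - I\<bar> < \<bar>I - J\<bar> / 2"
  obtain d1 where d1: "0 < d1" "\<forall>p\<in>partitions a b. \<forall>\<tau>.
        (\<forall>j<length p - 1. p ! j \<le> \<tau> j \<and> \<tau> j \<le> p ! Suc j \<and> p ! Suc j - p ! j < d1) \<longrightarrow>
        \<bar>(\<Sum>j<length p - 1. f (\<tau> j) * (g (p ! Suc j) - g (p ! j))) - I\<bar> < \<bar>I - J\<bar> / 2"
    using assms(2) e unfolding has_rs_integral_def by blast
  obtain d2 where d2: "0 < d2" "\<forall>p\<in>partitions a b. \<forall>\<tau>.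
        (\<forall>j<length p - 1. p ! j \<le> \<tau> j \<and> \<tau> j \<le> p ! Suc j \<and> p ! Suc j - p ! j < d2) \<longrightarrow>
        \<bar>(\<Sum>j<length p - 1. f (\<tau> j) * (g (p ! Suc j) - g (p ! j))) - J\<bar> < \<bar>I - J\<bar> / 2"
    using assms(3) e unfolding has_rs_integral_def by blast
  obtain p where p: "p \<in> partitions a b" "\<And>j. j < length p - 1 \<Longrightarrow> p ! Suc j - p ! j < min d1 d2"
    using partitions_mesh[OF assms(1), of "min d1 d2"] d1(1) d2(1) by auto
  let ?S = "\<Sum>j<length p - 1. f (p ! j) * (g (p ! Suc j) - g (p ! j))"
  have "\<bar>?S - I\<bar> < \<bar>I - J\<bar> / 2"
    using d1(2)[rule_format, OF p(1), of "\<lambda>j. p ! j"] p(2) partitions_step[OF p(1)] by (auto simp: less_imp_le)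
  moreover have "\<bar>?S - J\<bar> < \<bar>I - J\<bar> / 2"
    using d2(2)[rule_format, OF p(1), of "\<lambda>j. p ! j"] p(2) partitions_step[OF p(1)] by (auto simp: less_imp_le)
  moreover have "\<bar>I - J\<bar> \<le> \<bar>?S - I\<bar> + \<bar>?S - J\<bar>"
    using abs_triangle_ineq4[of "?S - J" "?S - I"] by simp
  ultimately show False by linarith
qed

lemma rs_integral_eqI: "a \<le> b \<Longrightarrow> has_rs_integral f g a b I \<Longrightarrow> rs_integral f g a b = I"
  unfolding rs_integral_def using has_rs_integral_unique by (intro the_equality) auto

text \<open>With a bounded density the Riemann-Stieltjes integrals of the signature become integrals
  against \<open>d\<close>. The bound \<open>L\<close> depends on the path and on the level of
  interpolation; it gives existence and continuity, whereas bounds uniform in the level come from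
  chaining.\<close>

locale density_path =
  fixes T L :: real and x d :: "real \<Rightarrow> real ^ 'd"
  assumes L_nonneg: "0 \<le> L"
    and density_measurable: "\<And>i. (\<lambda>r. d r $ i) \<in> borel_measurable borel"
    and density_bound: "\<And>i r. \<bar>d r $ i\<bar> \<le> L"
    and increment: "\<And>s t i. 0 \<le> s \<Longrightarrow> s \<le> t \<Longrightarrow> t \<le> T \<Longrightarrow> x t $ i - x s $ i = integral {s..t} (\<lambda>r. d r $ i)"
begin

lemma density_integrable: "continuous_on {s..t} f \<Longrightarrow> (\<lambda>r. f r * d r $ i) integrable_on {s..t}"
  by (rule continuous_times_bounded_integrable[OF _ density_measurable density_bound])

lemma has_rs_integral_density:
  assumes ab: "0 \<le> a" "a \<le> b" "b \<le> T" and f: "continuous_on {a..b} f"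
  shows "has_rs_integral f (\<lambda>u. x u $ i) a b (integral {a..b} (\<lambda>r. f r * d r $ i))"
  unfolding has_rs_integral_def
proof (intro allI impI)
  fix e :: real assume e: "0 < e"
  \<comment> \<open>The added \<open>1\<close> keeps the quotient meaningful if
    \<open>L * (b - a) = 0\<close>; the factor \<open>2\<close> makes the final inequality
    strict.\<close>
  define e' where "e' = e / (2 * (L * (b - a) + 1))"
  have pos: "0 < L * (b - a) + 1" using L_nonneg ab by (intro add_nonneg_pos mult_nonneg_nonneg) auto
  have e': "0 < e'" using e pos by (simp add: e'_def)
  have "uniformly_continuous_on {a..b} f" using f by (intro compact_uniformly_continuous) auto
  then obtain \<delta> where \<delta>: "0 < \<delta>" "\<And>r s. r \<in> {a..b} \<Longrightarrow> s \<in> {a..b} \<Longrightarrow> dist r s < \<delta> \<Longrightarrow> dist (f r) (f s) < e'"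
    using e' unfolding uniformly_continuous_on_def by metis
  show "\<exists>\<delta>>0. \<forall>p\<in>partitions a b. \<forall>\<tau>.
        (\<forall>j<length p - 1. p ! j \<le> \<tau> j \<and> \<tau> j \<le> p ! Suc j \<and> p ! Suc j - p ! j < \<delta>) \<longrightarrow>
        \<bar>(\<Sum>j<length p - 1. f (\<tau> j) * (x (p ! Suc j) $ i - x (p ! j) $ i)) - integral {a..b} (\<lambda>r. f r * d r $ i)\<bar> < e"
  proof (intro exI[of _ \<delta>] conjI \<delta>(1) ballI allI impI)
    fix p \<tau> assume p: "p \<in> partitions a b"
      and \<tau>: "\<forall>j<length p - 1. p ! j \<le> \<tau> j \<and> \<tau> j \<le> p ! Suc j \<and> p ! Suc j - p ! j < \<delta>"
    let ?n = "length p - 1"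
    let ?I = "\<lambda>s t. integral {s..t} (\<lambda>r. f r * d r $ i)"
    have int: "(\<lambda>r. f r * d r $ i) integrable_on {s..t}" if "a \<le> s" "t \<le> b" for s t
      using f that by (intro density_integrable continuous_on_subset[OF f]) auto
    have tel: "?I a b = (\<Sum>j<?n. ?I (p ! j) (p ! Suc j))"
    proof -
      have "?I (p ! j) (p ! Suc j) = ?I a (p ! Suc j) - ?I a (p ! j)" if "j < ?n" for j
        using Henstock_Kurzweil_Integration.integral_combine[of a "p ! j" "p ! Suc j" "\<lambda>r. f r * d r $ i"]
          partitions_step[OF p that] int[of a "p ! Suc j"] by simp
      hence "(\<Sum>j<?n. ?I (p ! j) (p ! Suc j)) = (\<Sum>j<?n. ?I a (p ! Suc j) - ?I a (p ! j))" by simp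
      also have "\<dots> = ?I a (p ! ?n) - ?I a (p ! 0)" by (rule sum_lessThan_telescope)
      finally show ?thesis using partitions_ends[OF p] by simp
    qed
    have piece: "\<bar>f (\<tau> j) * (x (p ! Suc j) $ i - x (p ! j) $ i) - ?I (p ! j) (p ! Suc j)\<bar> \<le> (e' * L) * (p ! Suc j - p ! j)"
      if j: "j < ?n" for j
    proof -
      note s = partitions_step[OF p j]
      have t: "p ! j \<le> \<tau> j" "\<tau> j \<le> p ! Suc j" "p ! Suc j - p ! j < \<delta>" using \<tau> j by auto
      have i1: "(\<lambda>r. f (\<tau> j) * d r $ i) integrable_on {p ! j..p ! Suc j}"
        by (intro density_integrable continuous_on_const)
      have "f (\<tau> j) * (x (p ! Suc j) $ i - x (p ! j) $ i) - ?I (p ! j) (p ! Suc j) =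
        integral {p ! j..p ! Suc j} (\<lambda>r. f (\<tau> j) * d r $ i) - ?I (p ! j) (p ! Suc j)"
        using s ab by (subst increment) auto
      also have "\<dots> = integral {p ! j..p ! Suc j} (\<lambda>r. f (\<tau> j) * d r $ i - f r * d r $ i)"
        using s by (intro Henstock_Kurzweil_Integration.integral_diff[symmetric] i1 int)
      also have "\<bar>\<dots>\<bar> \<le> (e' * L) * (p ! Suc j - p ! j)"
      proof (rule integral_bound_real)
        show "(\<lambda>r. f (\<tau> j) * d r $ i - f r * d r $ i) integrable_on {p ! j..p ! Suc j}"
          using s by (intro integrable_diff i1 int)
        fix r assume r: "r \<in> {p ! j..p ! Suc j}"
        have "dist (f (\<tau> j)) (f r) < e'" using r t s by (intro \<delta>(2)) (auto simp: dist_real_def)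
        hence "\<bar>f (\<tau> j) - f r\<bar> * \<bar>d r $ i\<bar> \<le> e' * L"
          using density_bound[of r i] e' by (intro mult_mono) (auto simp: dist_real_def)
        thus "\<bar>f (\<tau> j) * d r $ i - f r * d r $ i\<bar> \<le> e' * L"
          by (simp add: left_diff_distrib[symmetric] abs_mult)
      qed (use s in simp)
      finally show ?thesis .
    qed
    have "\<bar>(\<Sum>j<?n. f (\<tau> j) * (x (p ! Suc j) $ i - x (p ! j) $ i)) - ?I a b\<bar> \<le> (\<Sum>j<?n. (e' * L) * (p ! Suc j - p ! j))"
      unfolding tel sum_subtractf[symmetric] by (intro order.trans[OF sum_abs] sum_mono piece) auto
    also have "\<dots> = (e' * L) * (b - a)"
      unfolding sum_distrib_left[symmetric] sum_lessThan_telescope using partitions_ends[OF p] by simp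
    also have "\<dots> \<le> e' * (L * (b - a) + 1)" using e' by (simp add: algebra_simps)
    also have "\<dots> = e / 2"
    proof -
      have "e / (2 * c) * c = e / 2" if "0 < c" for c using that by (simp add: field_simps)
      from this[OF pos] show ?thesis by (simp add: e'_def)
    qed
    also have "\<dots> < e" using e by simp
    finally show "\<bar>(\<Sum>j<?n. f (\<tau> j) * (x (p ! Suc j) $ i - x (p ! j) $ i)) - ?I a b\<bar> < e" .
  qed
qed

text \<open>The head of the word belongs to the outermost variable \<open>t_1\<close>, so the
  recursion moves the left end point and keeps the right one.\<close>

primrec J :: "'d list \<Rightarrow> real \<Rightarrow> real \<Rightarrow> real" where
  "J [] s t = 1"
| "J (i # v) s t = integral {s..t} (\<lambda>r. J v r t * d r $ i)"

lemma J_props: "s \<le> t \<Longrightarrow> \<bar>J v s t\<bar> \<le> (L * (t - s)) ^ length v"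
  and J_continuous: "continuous_on {s..t} (\<lambda>r. J v r t)"
proof -
  have "(\<forall>s t. s \<le> t \<longrightarrow> \<bar>J v s t\<bar> \<le> (L * (t - s)) ^ length v) \<and> (\<forall>s t. continuous_on {s..t} (\<lambda>r. J v r t))"
  proof (induction v)
    case (Cons i v)
    have int: "(\<lambda>r. J v r t * d r $ i) integrable_on {s..t}" for s t
      using Cons by (intro density_integrable) auto
    have bd: "\<bar>J v r t * d r $ i\<bar> \<le> (L * (t - s)) ^ length v * L" if "r \<in> {s..t}" for r s t
    proof -
      have "\<bar>J v r t\<bar> \<le> (L * (t - r)) ^ length v" using Cons that by auto
      also have "\<dots> \<le> (L * (t - s)) ^ length v"
        using that L_nonneg by (intro power_mono mult_left_mono mult_nonneg_nonneg) auto
      finally show ?thesis unfolding abs_mult using density_bound[of r i] by (intro mult_mono) auto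
    qed
    have 1: "\<bar>J (i # v) s t\<bar> \<le> (L * (t - s)) ^ length (i # v)" if "s \<le> t" for s t
      using integral_bound_real[OF int that bd] by (simp add: mult_ac)
    have "continuous_on {s..t} (\<lambda>r. J (i # v) r t)" for s t
    proof (cases "s \<le> t")
      case True
      have "continuous_on {s..t} (\<lambda>r. integral {r..t} (\<lambda>u. J v u t * d u $ i))"
        by (rule indefinite_integral_continuous_1'[OF int])
      thus ?thesis by simp
    qed simp
    with 1 show ?case by blast
  qed simp
  thus "s \<le> t \<Longrightarrow> \<bar>J v s t\<bar> \<le> (L * (t - s)) ^ length v" "continuous_on {s..t} (\<lambda>r. J v r t)"
    by auto
qed

lemma J_integrable: "(\<lambda>r. J v r t * d r $ i) integrable_on {s..t}"
  by (intro density_integrable J_continuous)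

lemma iterated_integral_eq: "0 \<le> s \<Longrightarrow> s \<le> t \<Longrightarrow> t \<le> T \<Longrightarrow> iterated_integral x v s t = J v s t"
proof (induction v arbitrary: s)
  case (Cons i v)
  have eq: "iterated_integral x v u t = J v u t" if "u \<in> {s..t}" for u
    using Cons that by auto
  have "continuous_on {s..t} (\<lambda>u. iterated_integral x v u t)"
    by (subst continuous_on_cong[OF refl eq]) (auto intro: J_continuous)
  from has_rs_integral_density[OF Cons.prems this, of i]
  have "rs_integral (\<lambda>u. iterated_integral x v u t) (\<lambda>u. x u $ i) s t =
    integral {s..t} (\<lambda>r. iterated_integral x v r t * d r $ i)"
    using Cons.prems by (intro rs_integral_eqI)
  also have "\<dots> = integral {s..t} (\<lambda>r. J v r t * d r $ i)"
    by (intro Henstock_Kurzweil_Integration.integral_cong) (simp add: eq)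
  finally show ?case by simp
qed simp

text \<open>Splitting the outermost integral at \<open>u\<close>: on \<open>[s, u]\<close> the
  induction hypothesis expands the inner integral and yields the terms in which the first letter is
  spent before \<open>u\<close>; the part over \<open>[u, t]\<close> is the term
  \<open>j = 0\<close>.\<close>

lemma J_chen:
  assumes "s \<le> u" "u \<le> t"
  shows "J v s t = (\<Sum>j\<le>length v. J (take j v) s u * J (drop j v) u t)"
  using assms
proof (induction v arbitrary: s)
  case (Cons i v)
  have "J (i # v) s t = integral {s..u} (\<lambda>r. J v r t * d r $ i) + J (i # v) u t"
    using Henstock_Kurzweil_Integration.integral_combine[OF Cons.prems J_integrable[of v t i s]] by simp
  also have "integral {s..u} (\<lambda>r. J v r t * d r $ i) =
    integral {s..u} (\<lambda>r. \<Sum>j\<le>length v. J (drop j v) u t * (J (take j v) r u * d r $ i))"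
    using Cons.prems by (intro Henstock_Kurzweil_Integration.integral_cong)
      (simp add: Cons.IH sum_distrib_left mult_ac)
  also have "\<dots> = (\<Sum>j\<le>length v. integral {s..u} (\<lambda>r. J (drop j v) u t * (J (take j v) r u * d r $ i)))"
    by (intro Henstock_Kurzweil_Integration.integral_sum integrable_on_mult_right J_integrable) auto
  also have "\<dots> = (\<Sum>j\<le>length v. J (i # take j v) s u * J (drop j v) u t)"
    by (simp add: mult.commute)
  also have "\<dots> + J (i # v) u t = (\<Sum>j\<le>length (i # v). J (take j (i # v)) s u * J (drop j (i # v)) u t)"
    by (simp only: list.size add_Suc_right add_0_right sum.atMost_Suc_shift) simp
  finally show ?case .
qed simp

lemma J_increment: "0 \<le> s \<Longrightarrow> s \<le> t \<Longrightarrow> t \<le> T \<Longrightarrow> J [i] s t = x t $ i - x s $ i"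
  by (simp add: increment)

text \<open>By Chen's relation, moving one end point changes \<open>J\<close> by terms with a
  nonempty iterated integral over the short interval in between, which carries its length as a
  factor. To move both, the intermediate point must stay in the simplex: \<open>(s, t')\<close> if
  \<open>s \<le> t'\<close>, and \<open>(s', t)\<close> otherwise.\<close>

lemma J_joint_continuous: "continuous_on {(s, t). 0 \<le> s \<and> s \<le> t \<and> t \<le> T} (\<lambda>(s, t). J v s t)"
proof (cases v)
  case Nil
  thus ?thesis by (simp add: case_prod_beta')
next
  case v: (Cons i v')
  define K where "K = (\<Sum>j\<le>length v. (L * T) ^ j * (L * (L * T) ^ (length v - j - 1)))"
  let ?S = "{(s, t). 0 \<le> s \<and> s \<le> t \<and> t \<le> T}"
  have small: "\<bar>J w s t\<bar> \<le> (L * (L * T) ^ (length w - 1)) * (t - s)" if "w \<noteq> []" "0 \<le> s" "s \<le> t" "t \<le> T" for w s t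
  proof -
    obtain n where n: "length w = Suc n" using \<open>w \<noteq> []\<close> by (cases w) auto
    have "\<bar>J w s t\<bar> \<le> L * (t - s) * (L * (t - s)) ^ n" using J_props[OF that(3), of w] n by simp
    also have "\<dots> \<le> L * (t - s) * (L * T) ^ n"
      using that L_nonneg by (intro mult_left_mono power_mono) auto
    finally show ?thesis using n by (simp add: mult_ac)
  qed
  have large: "\<bar>J w s t\<bar> \<le> (L * T) ^ length w" if "0 \<le> s" "s \<le> t" "t \<le> T" for w s t
    by (rule order.trans[OF J_props[OF that(2)]]) (use that L_nonneg in \<open>auto intro!: power_mono mult_left_mono\<close>)
  have T0: "0 \<le> T" if "0 \<le> s" "s \<le> t" "t \<le> T" for s t using that by linarith
  have right: "\<bar>J v s t' - J v s t\<bar> \<le> K * (t' - t)" if st: "0 \<le> s" "s \<le> t" "t \<le> t'" "t' \<le> T" for s t t'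
  proof -
    let ?f = "\<lambda>j. J (take j v) s t * J (drop j v) t t'"
    have "J v s t' = (\<Sum>j<length v. ?f j) + J v s t"
      using J_chen[OF st(2,3), of v] by (simp add: lessThan_Suc_atMost[symmetric])
    hence "\<bar>J v s t' - J v s t\<bar> = \<bar>\<Sum>j<length v. ?f j\<bar>" by simp
    also have "\<dots> \<le> (\<Sum>j<length v. (L * T) ^ j * (L * (L * T) ^ (length v - j - 1)) * (t' - t))"
    proof (rule order.trans[OF sum_abs sum_mono])
      fix j assume j: "j \<in> {..<length v}"
      have "\<bar>J (take j v) s t\<bar> * \<bar>J (drop j v) t t'\<bar> \<le> (L * T) ^ j * ((L * (L * T) ^ (length v - j - 1)) * (t' - t))"
        using large[of s t "take j v"] small[of "drop j v" t t'] st j L_nonneg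
        by (intro mult_mono) (auto simp: min_def)
      thus "\<bar>?f j\<bar> \<le> (L * T) ^ j * (L * (L * T) ^ (length v - j - 1)) * (t' - t)"
        by (simp add: abs_mult mult_ac)
    qed
    also have "\<dots> \<le> (\<Sum>j\<le>length v. (L * T) ^ j * (L * (L * T) ^ (length v - j - 1)) * (t' - t))"
      using L_nonneg T0[of s t] st by (intro sum_mono2) auto
    finally show ?thesis by (simp add: K_def sum_distrib_right)
  qed
  have left: "\<bar>J v s t - J v s' t\<bar> \<le> K * (s' - s)" if st: "0 \<le> s" "s \<le> s'" "s' \<le> t" "t \<le> T" for s s' t
  proof -
    let ?f = "\<lambda>j. J (take j v) s s' * J (drop j v) s' t"
    have "J v s t = J v s' t + (\<Sum>j<length v. ?f (Suc j))"
      using J_chen[OF st(2,3), of v] by (simp add: sum.atMost_shift)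
    hence "\<bar>J v s t - J v s' t\<bar> = \<bar>\<Sum>j<length v. ?f (Suc j)\<bar>" by simp
    also have "\<dots> \<le> (\<Sum>j<length v. (L * T) ^ (length v - Suc j) * (L * (L * T) ^ j) * (s' - s))"
    proof (rule order.trans[OF sum_abs sum_mono])
      fix j assume j: "j \<in> {..<length v}"
      have "\<bar>J (take (Suc j) v) s s'\<bar> * \<bar>J (drop (Suc j) v) s' t\<bar> \<le> ((L * (L * T) ^ j) * (s' - s)) * (L * T) ^ (length v - Suc j)"
      proof (intro mult_mono)
        have len: "length (take (Suc j) v) - 1 = j" using j by auto
        show "\<bar>J (take (Suc j) v) s s'\<bar> \<le> (L * (L * T) ^ j) * (s' - s)"
          using small[of "take (Suc j) v" s s'] st v unfolding len by simp
        show "\<bar>J (drop (Suc j) v) s' t\<bar> \<le> (L * T) ^ (length v - Suc j)"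
          using large[of s' t "drop (Suc j) v"] st by simp
      qed (use st L_nonneg T0[of s t] in auto)
      thus "\<bar>?f (Suc j)\<bar> \<le> (L * T) ^ (length v - Suc j) * (L * (L * T) ^ j) * (s' - s)"
        by (simp add: abs_mult mult_ac)
    qed
    also have "\<dots> = (\<Sum>j<length v. (L * T) ^ j * (L * (L * T) ^ (length v - j - 1)) * (s' - s))"
      by (subst sum.nat_diff_reindex[symmetric]) (auto intro!: sum.cong simp: Suc_diff_Suc)
    also have "\<dots> \<le> (\<Sum>j\<le>length v. (L * T) ^ j * (L * (L * T) ^ (length v - j - 1)) * (s' - s))"
      using L_nonneg T0[of s t] st by (intro sum_mono2) auto
    finally show ?thesis by (simp add: K_def sum_distrib_right)
  qed
  have lip: "\<bar>J v s t - J v s' t'\<bar> \<le> K * (\<bar>s - s'\<bar> + \<bar>t - t'\<bar>)" if st: "(s, t) \<in> ?S" "(s', t') \<in> ?S" for s t s' t'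
  proof -
    have R: "\<bar>J v a b - J v a b'\<bar> \<le> K * \<bar>b - b'\<bar>" if "0 \<le> a" "a \<le> b" "a \<le> b'" "b \<le> T" "b' \<le> T" for a b b'
      using right[of a b b'] right[of a b' b] that by (cases "b \<le> b'") (auto simp: abs_minus_commute)
    have Lf: "\<bar>J v a b - J v a' b\<bar> \<le> K * \<bar>a - a'\<bar>" if "0 \<le> a" "0 \<le> a'" "a \<le> b" "a' \<le> b" "b \<le> T" for a a' b
      using left[of a a' b] left[of a' a b] that by (cases "a \<le> a'") (auto simp: abs_minus_commute)
    show ?thesis
    proof (cases "s \<le> t'")
      case True
      have "\<bar>J v s t - J v s' t'\<bar> \<le> \<bar>J v s t - J v s t'\<bar> + \<bar>J v s t' - J v s' t'\<bar>" by linarith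
      also have "\<dots> \<le> K * \<bar>t - t'\<bar> + K * \<bar>s - s'\<bar>" using st True by (intro add_mono R Lf) auto
      finally show ?thesis by (simp add: algebra_simps)
    next
      case False
      have "\<bar>J v s t - J v s' t'\<bar> \<le> \<bar>J v s t - J v s' t\<bar> + \<bar>J v s' t - J v s' t'\<bar>" by linarith
      also have "\<dots> \<le> K * \<bar>s - s'\<bar> + K * \<bar>t - t'\<bar>" using st False by (intro add_mono R Lf) auto
      finally show ?thesis by (simp add: algebra_simps)
    qed
  qed
  have K0: "0 \<le> K" if "0 \<le> T" unfolding K_def using that L_nonneg by (intro sum_nonneg) auto
  show ?thesis
  proof (cases "0 \<le> T")
    case True
    have "(2 * K)-lipschitz_on ?S (\<lambda>(s, t). J v s t)"
    proof (rule lipschitz_onI)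
      fix p q assume pq: "p \<in> ?S" "q \<in> ?S"
      obtain s t where p: "p = (s, t)" by (cases p)
      obtain s' t' where q: "q = (s', t')" by (cases q)
      have "\<bar>J v s t - J v s' t'\<bar> \<le> K * (\<bar>s - s'\<bar> + \<bar>t - t'\<bar>)" using lip pq unfolding p q by blast
      also have "\<dots> \<le> K * (dist p q + dist p q)"
        using K0[OF True] dist_fst_le[of p q] dist_snd_le[of p q] unfolding p q
        by (intro mult_left_mono add_mono) (auto simp: dist_real_def)
      finally show "dist (case p of (s, t) \<Rightarrow> J v s t) (case q of (s, t) \<Rightarrow> J v s t) \<le> 2 * K * dist p q"
        by (simp add: p q dist_real_def)
    qed (use K0[OF True] in simp)
    thus ?thesis by (rule lipschitz_on_continuous_on)
  next
    case False
    hence "?S = {}" by auto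
    thus ?thesis by (simp only: continuous_on_empty)
  qed
qed

text \<open>The density is prescribed for \<open>r < t\<close> only, because cells are half-open;
  the right end point is a null set.\<close>

lemma J_affine:
  assumes st: "s \<le> t" and d: "\<And>r i. s \<le> r \<Longrightarrow> r < t \<Longrightarrow> d r $ i = m i"
  shows "J v s t = (\<Prod>i\<leftarrow>v. m i) * (t - s) ^ length v / fact (length v)"
  using assms
proof (induction v arbitrary: s)
  case (Cons i v)
  let ?k = "length v"
  have "integral {s..t} (\<lambda>r. J v r t * d r $ i) =
    integral {s..t} (\<lambda>r. ((\<Prod>i\<leftarrow>v. m i) * m i / fact ?k) * (t - r) ^ ?k)"
  proof (rule integral_spike[of "{t}"])
    fix r assume "r \<in> {s..t} - {t}"
    hence r: "s \<le> r" "r < t" by auto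
    have "J v r t = (\<Prod>i\<leftarrow>v. m i) * (t - r) ^ ?k / fact ?k"
      using r Cons.prems by (intro Cons.IH) auto
    thus "((\<Prod>i\<leftarrow>v. m i) * m i / fact ?k) * (t - r) ^ ?k = J v r t * d r $ i"
      using r Cons.prems by simp
  qed simp
  also have "\<dots> = ((\<Prod>i\<leftarrow>v. m i) * m i / fact ?k) * integral {s..t} (\<lambda>r. (t - r) ^ ?k)" by simp
  also have "integral {s..t} (\<lambda>r. (t - r) ^ ?k) = (t - s) ^ Suc ?k / real (Suc ?k)"
  proof (rule integral_unique)
    have "((\<lambda>r. (t - r) ^ ?k) has_integral (- ((t - t) ^ Suc ?k / real (Suc ?k)) - (- ((t - s) ^ Suc ?k / real (Suc ?k))))) {s..t}"
    proof (rule fundamental_theorem_of_calculus[OF Cons.prems(1)])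
      fix r assume "r \<in> {s..t}"
      have "((\<lambda>r. - ((t - r) ^ Suc ?k / real (Suc ?k))) has_real_derivative (t - r) ^ ?k) (at r within {s..t})"
        by (auto intro!: derivative_eq_intros simp: field_simps simp del: of_nat_Suc power_Suc)
      thus "((\<lambda>r. - ((t - r) ^ Suc ?k / real (Suc ?k))) has_vector_derivative (t - r) ^ ?k) (at r within {s..t})"
        by (simp add: has_real_derivative_iff_has_vector_derivative)
    qed
    thus "((\<lambda>r. (t - r) ^ ?k) has_integral ((t - s) ^ Suc ?k / real (Suc ?k))) {s..t}" by simp
  qed
  finally show ?case by (simp add: field_simps)
qed simp

end

text \<open>The densities are exchanged one at a time, \<open>(X - Y) d + Y (d - e)\<close>. Each
  letter contributes one factor \<open>\<eta>\<close> and leaves \<open>length v - 1\<close> factors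
  \<open>L\<close>.\<close>

lemma J_difference_bound:
  assumes "density_path T L x d" "density_path T L y e" and \<eta>: "\<And>i r. \<bar>d r $ i - e r $ i\<bar> \<le> \<eta>" and st: "s \<le> t"
  shows "\<bar>density_path.J d v s t - density_path.J e v s t\<bar> \<le> real (length v) * L ^ (length v - 1) * \<eta> * (t - s) ^ length v"
proof -
  interpret X: density_path T L x d by fact
  interpret Y: density_path T L y e by fact
  have \<eta>0: "0 \<le> \<eta>" using \<eta>[of 0 undefined] by (rule order.trans[OF abs_ge_zero])
  show ?thesis using st
  proof (induction v arbitrary: s)
    case (Cons i v)
    let ?k = "length v"
    have "X.J (i # v) s t - Y.J (i # v) s t = integral {s..t} (\<lambda>r. X.J v r t * d r $ i - Y.J v r t * e r $ i)"
      by (simp add: Henstock_Kurzweil_Integration.integral_diff X.J_integrable Y.J_integrable)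
    also have "\<bar>\<dots>\<bar> \<le> ((real ?k * L ^ (?k - 1) * \<eta> * (t - s) ^ ?k) * L + (L * (t - s)) ^ ?k * \<eta>) * (t - s)"
    proof (rule integral_bound_real[OF integrable_diff[OF X.J_integrable Y.J_integrable] Cons.prems])
      fix r assume r: "r \<in> {s..t}"
      have "X.J v r t * d r $ i - Y.J v r t * e r $ i = (X.J v r t - Y.J v r t) * d r $ i + Y.J v r t * (d r $ i - e r $ i)"
        by (simp add: algebra_simps)
      also have "\<bar>\<dots>\<bar> \<le> \<bar>X.J v r t - Y.J v r t\<bar> * \<bar>d r $ i\<bar> + \<bar>Y.J v r t\<bar> * \<bar>d r $ i - e r $ i\<bar>"
        by (rule order.trans[OF abs_triangle_ineq]) (simp add: abs_mult)
      also have "\<dots> \<le> (real ?k * L ^ (?k - 1) * \<eta> * (t - s) ^ ?k) * L + (L * (t - s)) ^ ?k * \<eta>"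
      proof (intro add_mono mult_mono)
        have "\<bar>X.J v r t - Y.J v r t\<bar> \<le> real ?k * L ^ (?k - 1) * \<eta> * (t - r) ^ ?k" using Cons.IH[of r] r by auto
        also have "\<dots> \<le> real ?k * L ^ (?k - 1) * \<eta> * (t - s) ^ ?k"
          using r \<eta>0 X.L_nonneg by (intro mult_left_mono power_mono) auto
        finally show "\<bar>X.J v r t - Y.J v r t\<bar> \<le> real ?k * L ^ (?k - 1) * \<eta> * (t - s) ^ ?k" .
        have "\<bar>Y.J v r t\<bar> \<le> (L * (t - r)) ^ ?k" using r by (intro Y.J_props) auto
        also have "\<dots> \<le> (L * (t - s)) ^ ?k" using r X.L_nonneg by (intro power_mono mult_left_mono) auto
        finally show "\<bar>Y.J v r t\<bar> \<le> (L * (t - s)) ^ ?k" .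
      qed (use X.density_bound \<eta> \<eta>0 X.L_nonneg Cons.prems in auto)
      finally show "\<bar>X.J v r t * d r $ i - Y.J v r t * e r $ i\<bar> \<le> (real ?k * L ^ (?k - 1) * \<eta> * (t - s) ^ ?k) * L + (L * (t - s)) ^ ?k * \<eta>" .
    qed
    also have "\<dots> = real (length (i # v)) * L ^ (length (i # v) - 1) * \<eta> * (t - s) ^ length (i # v)"
      unfolding power_mult_distrib by (cases "?k") (simp_all add: algebra_simps)
    finally show ?case .
  qed simp
qed

section \<open>Lifts of dyadic interpolations\<close>

text \<open>Both sides are the length of the overlap of \<open>[s, t]\<close> with the
  \<open>k\<close>-th cell, in units of a cell.\<close>

lemma ramp_integral:
  assumes T: "0 < T" and N: "0 < N" and st: "s \<le> t"
  shows "((\<lambda>r. real N / T * indicator {real k * T / real N..<real (Suc k) * T / real N} r) has_integral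
    (ramp (real N * t / T - real k) - ramp (real N * s / T - real k))) {s..t}"
proof -
  let ?a = "real k * T / real N" and ?b = "real (Suc k) * T / real N"
  have N': "0 < real N" using N by simp
  have ab: "?a \<le> ?b" using T N' by (intro divide_right_mono mult_right_mono) auto
  have val: "real N / T * max 0 (min t ?b - max s ?a) = ramp (real N * t / T - real k) - ramp (real N * s / T - real k)"
  proof -
    define c where "c = real N / T"
    have c: "0 < c" using T N' by (simp add: c_def)
    have ca: "c * ?a = real k" "c * ?b = real k + 1" using T N' by (auto simp: c_def field_simps)
    have m: "c * max p q = max (c * p) (c * q)" "c * min p q = min (c * p) (c * q)" for p q
      using c by (auto simp: max_def min_def)
    have "c * max 0 (min t ?b - max s ?a) = max 0 (min (c * t) (real k + 1) - max (c * s) (real k))"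
      unfolding m right_diff_distrib ca by simp
    also have "\<dots> = ramp (c * t - real k) - ramp (c * s - real k)"
      using mult_left_mono[OF st less_imp_le[OF c]] unfolding ramp_def by linarith
    finally show ?thesis by (simp add: c_def)
  qed
  have "((\<lambda>r. indicator {?a..?b} r :: real) has_integral max 0 (min t ?b - max s ?a)) {s..t}"
  proof -
    have "((\<lambda>r. 1 :: real) has_integral max 0 (min t ?b - max s ?a)) {max s ?a..min t ?b}"
      using has_integral_const_real[of "1 :: real" "max s ?a" "min t ?b"] by (auto simp: max_def split: if_splits)
    hence "((\<lambda>r. if r \<in> {max s ?a..min t ?b} then 1 else 0 :: real) has_integral max 0 (min t ?b - max s ?a)) {s..t}"
      by (subst has_integral_restrict) auto
    thus ?thesis by (rule has_integral_eq[rotated]) (auto simp: indicator_def)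
  qed
  hence "((\<lambda>r. indicator {?a..<?b} r :: real) has_integral max 0 (min t ?b - max s ?a)) {s..t}"
    by (rule has_integral_spike[of "{?b}", rotated 2]) (auto simp: indicator_def)
  from has_integral_mult_right[OF this, of "real N / T"] show ?thesis unfolding val .
qed

definition polygon_density :: "real \<Rightarrow> nat \<Rightarrow> (nat \<Rightarrow> real ^ 'd) \<Rightarrow> real \<Rightarrow> real ^ 'd" where
  "polygon_density T N c r =
     (\<Sum>k<N. (real N / T * indicator {real k * T / real N..<real (Suc k) * T / real N} r) *\<^sub>R (c (Suc k) - c k))"

lemma polygon_increment:
  assumes "0 < T" "0 < N" "s \<le> t"
  shows "((\<lambda>r. polygon_density T N c r $ i) has_integral (polygon T N c t $ i - polygon T N c s $ i)) {s..t}"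
proof -
  have "((\<lambda>r. \<Sum>k<N. (real N / T * indicator {real k * T / real N..<real (Suc k) * T / real N} r) * (c (Suc k) $ i - c k $ i))
    has_integral (\<Sum>k<N. (ramp (real N * t / T - real k) - ramp (real N * s / T - real k)) * (c (Suc k) $ i - c k $ i))) {s..t}"
    by (intro has_integral_sum has_integral_mult_left ramp_integral assms) auto
  thus ?thesis
    by (simp add: polygon_density_def polygon_def sum_component left_diff_distrib sum_subtractf)
qed

lemma polygon_density_bound:
  assumes "0 < T"
  shows "\<bar>polygon_density T N c r $ i\<bar> \<le> real N / T * (\<Sum>k<N. norm (c (Suc k) - c k))"
proof -
  have "\<bar>polygon_density T N c r $ i\<bar> \<le> norm (polygon_density T N c r)" by (rule component_le_norm_cart)
  also have "\<dots> \<le> (\<Sum>k<N. norm ((real N / T * indicator {real k * T / real N..<real (Suc k) * T / real N} r) *\<^sub>R (c (Suc k) - c k)))"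
    unfolding polygon_density_def by (rule norm_sum)
  also have "\<dots> \<le> (\<Sum>k<N. real N / T * norm (c (Suc k) - c k))"
    using assms by (intro sum_mono) (auto simp: indicator_def)
  finally show ?thesis by (simp add: sum_distrib_left)
qed

lemma polygon_density_diff:
  "polygon_density T N c r - polygon_density T N c' r = polygon_density T N (\<lambda>k. c k - c' k) r"
  by (simp add: polygon_density_def sum_subtractf[symmetric] algebra_simps)

lemma polygon_density_on_cell:
  assumes "0 < T" "j < N" "real j * T / real N \<le> r" "r < real (Suc j) * T / real N"
  shows "polygon_density T N c r = (real N / T) *\<^sub>R (c (Suc j) - c j)"
proof -
  have N: "0 < real N" using assms(2) by simp
  have ind: "indicator {real k * T / real N..<real (Suc k) * T / real N} r = (if k = j then 1 else 0 :: real)" for k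
  proof -
    have "real k * T / real N \<le> r \<and> r < real (Suc k) * T / real N \<longleftrightarrow> k = j"
    proof
      assume k: "real k * T / real N \<le> r \<and> r < real (Suc k) * T / real N"
      have "real k * T / real N < real (Suc j) * T / real N" "real j * T / real N < real (Suc k) * T / real N"
        using k assms by linarith+
      hence "real k * T < real (Suc j) * T" "real j * T < real (Suc k) * T"
        using N by (metis divide_less_cancel order_less_not_sym)+
      hence "real k < real (Suc j)" "real j < real (Suc k)"
        using assms(1) by (metis mult_less_cancel_right_pos)+
      thus "k = j" by linarith
    qed (use assms in auto)
    thus ?thesis by (auto simp: indicator_def)
  qed
  have "polygon_density T N c r = (\<Sum>k<N. if k = j then (real N / T) *\<^sub>R (c (Suc j) - c j) else 0)"
    unfolding polygon_density_def ind by (intro sum.cong) auto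
  thus ?thesis using assms(2) by simp
qed

lemma dyadic_density_path:
  fixes x :: "'d::finite path"
  assumes T: "0 < T" and c: "c = (\<lambda>k. apply_bcontfun x (real k * T / 2 ^ l))"
    and L: "2 ^ l / T * (\<Sum>k<2 ^ l. norm (c (Suc k) - c k)) \<le> L"
  shows "density_path T L (dyadic_interpolation T l x) (polygon_density T (2 ^ l) c)"
proof
  show "0 \<le> L" using T by (intro order.trans[OF _ L] mult_nonneg_nonneg sum_nonneg) auto
  show "(\<lambda>r. polygon_density T (2 ^ l) c r $ i) \<in> borel_measurable borel" for i
    unfolding polygon_density_def sum_component vector_scaleR_component by measurable
  show "\<bar>polygon_density T (2 ^ l) c r $ i\<bar> \<le> L" for i r
    using polygon_density_bound[OF T, of "2 ^ l" c r i] L by simp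
  fix s t i assume st: "0 \<le> s" "s \<le> t" "t \<le> T"
  have "dyadic_interpolation T l x t $ i - dyadic_interpolation T l x s $ i = polygon T (2 ^ l) c t $ i - polygon T (2 ^ l) c s $ i"
    using st T by (simp add: dyadic_interpolation_polygon c)
  also have "\<dots> = integral {s..t} (\<lambda>r. polygon_density T (2 ^ l) c r $ i)"
    using polygon_increment[OF T _ st(2), of "2 ^ l" c i] by (simp add: integral_unique)
  finally show "dyadic_interpolation T l x t $ i - dyadic_interpolation T l x s $ i = integral {s..t} (\<lambda>r. polygon_density T (2 ^ l) c r $ i)" .
qed

definition dyadic_integral :: "real \<Rightarrow> nat \<Rightarrow> 'd::finite path \<Rightarrow> 'd list \<Rightarrow> real \<Rightarrow> real \<Rightarrow> real" where
  "dyadic_integral T l x v s t = iterated_integral (dyadic_interpolation T l x) v s t"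

definition cell_increment :: "real \<Rightarrow> nat \<Rightarrow> nat \<Rightarrow> 'd \<Rightarrow> 'd::finite path \<Rightarrow> real" where
  "cell_increment T l k i x = apply_bcontfun x (real (Suc k) * T / 2 ^ l) $ i - apply_bcontfun x (real k * T / 2 ^ l) $ i"

context
  fixes T :: real and l :: nat and x :: "'d::finite path"
  assumes T: "0 < T"
begin

interpretation D: density_path T "2 ^ l / T * (\<Sum>k<2 ^ l. norm (apply_bcontfun x (real (Suc k) * T / 2 ^ l) - apply_bcontfun x (real k * T / 2 ^ l)))"
  "dyadic_interpolation T l x" "polygon_density T (2 ^ l) (\<lambda>k. apply_bcontfun x (real k * T / 2 ^ l))"
  by (rule dyadic_density_path[OF T refl]) simp

lemma dyadic_integral_Nil [simp]: "dyadic_integral T l x [] s t = 1"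
  by (simp add: dyadic_integral_def)

lemma dyadic_integral_chen:
  assumes "0 \<le> s" "s \<le> u" "u \<le> t" "t \<le> T"
  shows "dyadic_integral T l x v s t =
    (\<Sum>j\<le>length v. dyadic_integral T l x (take j v) s u * dyadic_integral T l x (drop j v) u t)"
  using assms D.J_chen[of s u t v] by (simp add: dyadic_integral_def D.iterated_integral_eq)

lemma dyadic_integral_bound:
  "\<exists>L\<ge>0. \<forall>v s t. 0 \<le> s \<longrightarrow> s \<le> t \<longrightarrow> t \<le> T \<longrightarrow> \<bar>dyadic_integral T l x v s t\<bar> \<le> (L * (t - s)) ^ length v"
  using D.J_props D.L_nonneg by (auto simp: dyadic_integral_def D.iterated_integral_eq)

lemma dyadic_integral_continuous:
  "continuous_on {(s, t). 0 \<le> s \<and> s \<le> t \<and> t \<le> T} (\<lambda>(s, t). dyadic_integral T l x v s t)"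
  by (rule continuous_on_eq[OF D.J_joint_continuous[of v]])
     (auto simp: dyadic_integral_def D.iterated_integral_eq)

lemma dyadic_integral_single:
  "0 \<le> s \<Longrightarrow> s \<le> t \<Longrightarrow> t \<le> T \<Longrightarrow>
    dyadic_integral T l x [i] s t = dyadic_interpolation T l x t $ i - dyadic_interpolation T l x s $ i"
  by (simp only: dyadic_integral_def D.iterated_integral_eq D.J_increment)

lemma dyadic_integral_on_cell:
  assumes k: "k < 2 ^ l" and st: "real k * T / 2 ^ l \<le> s" "s \<le> t" "t \<le> real (Suc k) * T / 2 ^ l"
  shows "dyadic_integral T l x v s t =
    (\<Prod>i\<leftarrow>v. cell_increment T l k i x) * (2 ^ l / T * (t - s)) ^ length v / fact (length v)"
proof -
  have "0 \<le> real k * T / 2 ^ l" using T by simp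
  hence s0: "0 \<le> s" using st by linarith
  have "real (Suc k) \<le> 2 ^ l" using k by (metis Suc_leI of_nat_le_iff of_nat_numeral of_nat_power)
  hence "real (Suc k) * T \<le> 2 ^ l * T" using T by (intro mult_right_mono) auto
  hence "real (Suc k) * T / 2 ^ l \<le> T" by (simp add: divide_le_eq mult.commute)
  hence tT: "t \<le> T" using st by linarith
  have "D.J v s t = (\<Prod>i\<leftarrow>v. 2 ^ l / T * cell_increment T l k i x) * (t - s) ^ length v / fact (length v)"
  proof (rule D.J_affine[OF st(2)])
    fix r i assume r: "s \<le> r" "r < t"
    show "polygon_density T (2 ^ l) (\<lambda>k. apply_bcontfun x (real k * T / 2 ^ l)) r $ i = 2 ^ l / T * cell_increment T l k i x"
      using polygon_density_on_cell[OF T, of k "2 ^ l" r "\<lambda>k. apply_bcontfun x (real k * T / 2 ^ l)"] k r st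
      by (simp add: cell_increment_def)
  qed
  also have "(\<Prod>i\<leftarrow>v. 2 ^ l / T * cell_increment T l k i x) = (2 ^ l / T) ^ length v * (\<Prod>i\<leftarrow>v. cell_increment T l k i x)"
    by (induction v) auto
  finally show ?thesis
    using s0 st tT unfolding dyadic_integral_def by (simp add: D.iterated_integral_eq power_mult_distrib power_divide)
qed

lemma dyadic_interpolation_grid:
  assumes "k \<le> 2 ^ l"
  shows "dyadic_interpolation T l x (real k * T / 2 ^ l) = apply_bcontfun x (real k * T / 2 ^ l)"
proof -
  have "\<lfloor>real k * T / 2 ^ l / (T / 2 ^ l)\<rfloor> = int k" using T by simp
  thus ?thesis using T by (simp add: dyadic_interpolation_def Let_def)
qed

lemma dyadic_interpolation_lipschitz:
  assumes "x \<in> C0 T"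
  shows "dyadic_interpolation T l x \<in> lipschitz_paths T"
proof -
  let ?L = "2 ^ l / T * (\<Sum>k<2 ^ l. norm (apply_bcontfun x (real (Suc k) * T / 2 ^ l) - apply_bcontfun x (real k * T / 2 ^ l)))"
  have "dyadic_interpolation T l x 0 = 0"
    using dyadic_interpolation_grid[of 0] assms by (simp add: C0_def)
  moreover have "(real CARD('d) * ?L)-lipschitz_on {0..T} (dyadic_interpolation T l x)"
  proof (rule lipschitz_onI)
    have le: "norm (dyadic_interpolation T l x t - dyadic_interpolation T l x s) \<le> real CARD('d) * ?L * (t - s)"
      if "0 \<le> s" "s \<le> t" "t \<le> T" for s t
    proof -
      have "norm (dyadic_interpolation T l x t - dyadic_interpolation T l x s) \<le>
        (\<Sum>i\<in>UNIV. \<bar>(dyadic_interpolation T l x t - dyadic_interpolation T l x s) $ i\<bar>)" by (rule norm_le_l1_cart)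
      also have "\<dots> \<le> (\<Sum>i\<in>(UNIV :: 'd set). ?L * (t - s))"
      proof (rule sum_mono)
        fix i
        have "\<bar>D.J [i] s t\<bar> \<le> (?L * (t - s)) ^ length [i]" using that by (intro D.J_props)
        thus "\<bar>(dyadic_interpolation T l x t - dyadic_interpolation T l x s) $ i\<bar> \<le> ?L * (t - s)"
          using D.J_increment[OF that, of i] by simp
      qed
      finally show ?thesis by (simp add: mult.assoc)
    qed
    fix s t assume st: "s \<in> {0..T}" "t \<in> {0..T}"
    show "dist (dyadic_interpolation T l x s) (dyadic_interpolation T l x t) \<le> real CARD('d) * ?L * dist s t"
    proof (cases "s \<le> t")
      case True
      thus ?thesis using le[of s t] st by (simp add: dist_norm norm_minus_commute)
    next
      case False
      thus ?thesis using le[of t s] st by (simp add: dist_norm norm_minus_commute)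
    qed
  qed (rule mult_nonneg_nonneg[OF of_nat_0_le_iff D.L_nonneg])
  ultimately show ?thesis unfolding lipschitz_paths_def by blast
qed

end

text \<open>For fixed \<open>l\<close> the density depends linearly on \<open>2 ^ l\<close>
  increments of the path, each at most twice its sup norm. The constant grows with \<open>l\<close>;
  it is meant for the continuity of each single lift.\<close>

lemma dyadic_integral_diff_bound:
  assumes T: "0 < T"
  obtains C where "0 \<le> C" and "\<And>(x :: 'd::finite path) y R v s t. norm x \<le> R \<Longrightarrow> norm y \<le> R \<Longrightarrow> 0 \<le> s \<Longrightarrow> s \<le> t \<Longrightarrow> t \<le> T \<Longrightarrow>
    \<bar>dyadic_integral T l x v s t - dyadic_integral T l y v s t\<bar> \<le>
      real (length v) * (C * R) ^ (length v - 1) * (C * norm (x - y)) * (t - s) ^ length v"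
proof -
  define C where "C = 2 ^ l / T * (2 ^ l * 2)"
  show ?thesis
  proof (rule that[of C])
    show "0 \<le> C" using T by (simp add: C_def)
    fix x y :: "'d path" and R v s t
    assume R: "norm x \<le> R" "norm y \<le> R" and st: "0 \<le> s" "s \<le> t" "t \<le> T"
    define cx where "cx = (\<lambda>k. apply_bcontfun x (real k * T / 2 ^ l))"
    define cy where "cy = (\<lambda>k. apply_bcontfun y (real k * T / 2 ^ l))"
    have bd: "2 ^ l / T * (\<Sum>k<2 ^ l. norm (apply_bcontfun z (real (Suc k) * T / 2 ^ l) - apply_bcontfun z (real k * T / 2 ^ l))) \<le> C * norm z"
      for z :: "'d path"
    proof -
      have "(\<Sum>k<2 ^ l :: nat. norm (apply_bcontfun z (real (Suc k) * T / 2 ^ l) - apply_bcontfun z (real k * T / 2 ^ l))) \<le> (\<Sum>k<2 ^ l :: nat. 2 * norm z)"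
      proof (rule sum_mono)
        fix k
        show "norm (apply_bcontfun z (real (Suc k) * T / 2 ^ l) - apply_bcontfun z (real k * T / 2 ^ l)) \<le> 2 * norm z"
          using norm_bounded[of z "real (Suc k) * T / 2 ^ l"] norm_bounded[of z "real k * T / 2 ^ l"]
          by (intro order.trans[OF norm_triangle_ineq4]) linarith
      qed
      from mult_left_mono[OF this, of "2 ^ l / T"] show ?thesis using T by (simp add: C_def mult_ac)
    qed
    have CR: "C * norm z \<le> C * R" if "norm z \<le> R" for z :: "'d path"
      using that T by (intro mult_left_mono) (auto simp: C_def)
    have X: "density_path T (C * R) (dyadic_interpolation T l x) (polygon_density T (2 ^ l) cx)"
      by (rule dyadic_density_path[OF T cx_def]) (use bd[of x] CR[OF R(1)] in \<open>simp add: cx_def\<close>)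
    have Y: "density_path T (C * R) (dyadic_interpolation T l y) (polygon_density T (2 ^ l) cy)"
      by (rule dyadic_density_path[OF T cy_def]) (use bd[of y] CR[OF R(2)] in \<open>simp add: cy_def\<close>)
    have \<eta>: "\<bar>polygon_density T (2 ^ l) cx r $ i - polygon_density T (2 ^ l) cy r $ i\<bar> \<le> C * norm (x - y)" for i r
    proof -
      have "polygon_density T (2 ^ l) cx r $ i - polygon_density T (2 ^ l) cy r $ i = polygon_density T (2 ^ l) (\<lambda>k. cx k - cy k) r $ i"
        by (simp add: polygon_density_diff[symmetric])
      also have "\<bar>\<dots>\<bar> \<le> 2 ^ l / T * (\<Sum>k<2 ^ l. norm ((cx (Suc k) - cy (Suc k)) - (cx k - cy k)))"
        using polygon_density_bound[OF T, of "2 ^ l" "\<lambda>k. cx k - cy k" r i] by simp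
      also have "\<dots> \<le> C * norm (x - y)"
        using bd[of "x - y"] by (simp add: cx_def cy_def minus_bcontfun.rep_eq)
      finally show ?thesis .
    qed
    interpret X: density_path T "C * R" "dyadic_interpolation T l x" "polygon_density T (2 ^ l) cx" by (rule X)
    interpret Y: density_path T "C * R" "dyadic_interpolation T l y" "polygon_density T (2 ^ l) cy" by (rule Y)
    show "\<bar>dyadic_integral T l x v s t - dyadic_integral T l y v s t\<bar> \<le>
      real (length v) * (C * R) ^ (length v - 1) * (C * norm (x - y)) * (t - s) ^ length v"
      using J_difference_bound[OF X Y \<eta> st(2), of v] st
      by (simp add: dyadic_integral_def X.iterated_integral_eq Y.iterated_integral_eq)
  qed
qed

section \<open>The metric of rough paths\<close>

lemma card_words: "card {v :: 'd::finite list. length v = i} = CARD('d) ^ i"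
  using card_lists_length_eq[of "UNIV :: 'd set" i] by simp

lemma hoelder_norm_le:
  fixes D :: "'d::finite two_param"
  assumes "0 \<le> B" and "\<And>s t v. 0 \<le> s \<Longrightarrow> s < t \<Longrightarrow> t \<le> T \<Longrightarrow> length v = i \<Longrightarrow> \<bar>D s t v\<bar> \<le> B * (t - s) powr \<gamma>"
  shows "hoelder_norm T \<gamma> i D \<le> ennreal (real CARD('d) ^ i * B)"
  unfolding hoelder_norm_def
proof (rule SUP_least, clarify)
  fix s t :: real assume st: "0 \<le> s" "s < t" "t \<le> T"
  have "level_norm i (D s t) \<le> (\<Sum>v | length v = i. \<bar>D s t v\<bar>)"
    unfolding level_norm_def by (rule L2_set_le_sum_abs)
  also have "\<dots> \<le> (\<Sum>v | length (v :: 'd list) = i. B * (t - s) powr \<gamma>)"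
    using assms(2) st by (intro sum_mono) auto
  also have "\<dots> = real CARD('d) ^ i * B * (t - s) powr \<gamma>" by (simp add: card_words)
  finally have "level_norm i (D s t) / (t - s) powr \<gamma> \<le> real CARD('d) ^ i * B"
    using st by (simp add: divide_le_eq)
  thus "ennreal (level_norm i (D s t) / (t - s) powr \<gamma>) \<le> ennreal (real CARD('d) ^ i * B)" by (rule ennreal_leI)
qed

definition word_constant :: "'d::finite itself \<Rightarrow> real \<Rightarrow> real" where
  "word_constant _ \<alpha> = (\<Sum>i=1..rp_level \<alpha>. real CARD('d) ^ i)"

lemma word_constant_nonneg: "0 \<le> word_constant TYPE('d::finite) \<alpha>"
  by (simp add: word_constant_def sum_nonneg)

lemma rp_dist_le:
  fixes X Y :: "'d::finite two_param"
  assumes "0 \<le> B" and "\<And>s t v. 0 \<le> s \<Longrightarrow> s < t \<Longrightarrow> t \<le> T \<Longrightarrow> v \<noteq> [] \<Longrightarrow> length v \<le> rp_level \<alpha> \<Longrightarrow>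
      \<bar>X s t v - Y s t v\<bar> \<le> B * (t - s) powr (real (length v) * \<alpha>)"
  shows "rp_dist T \<alpha> X Y \<le> word_constant TYPE('d) \<alpha> * B"
proof -
  have "(\<Sum>i=1..rp_level \<alpha>. hoelder_norm T (real i * \<alpha>) i (\<lambda>s t v. X s t v - Y s t v)) \<le>
    (\<Sum>i=1..rp_level \<alpha>. ennreal (real CARD('d) ^ i * B))"
  proof (intro sum_mono hoelder_norm_le assms(1))
    fix i s t v assume "i \<in> {1..rp_level \<alpha>}" "0 \<le> s" "s < t" "t \<le> T" "length (v :: 'd list) = i"
    thus "\<bar>X s t v - Y s t v\<bar> \<le> B * (t - s) powr (real i * \<alpha>)" using assms(2)[of s t v] by (cases v) auto
  qed
  also have "\<dots> = ennreal (word_constant TYPE('d) \<alpha> * B)"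
    using assms(1) by (subst sum_ennreal) (auto simp: word_constant_def sum_distrib_right)
  finally show ?thesis
    unfolding rp_dist_def by (rule enn2real_leI[rotated]) (intro mult_nonneg_nonneg word_constant_nonneg assms(1))
qed

lemma rough_pathsI:
  fixes X :: "'d::finite two_param"
  assumes "\<And>s t v. \<not> (0 \<le> s \<and> s \<le> t \<and> t \<le> T \<and> length v \<le> rp_level \<alpha>) \<Longrightarrow> X s t v = 0"
    and "\<And>v. continuous_on {(s, t). 0 \<le> s \<and> s \<le> t \<and> t \<le> T} (\<lambda>(s, t). X s t v)"
    and "\<And>s t. 0 \<le> s \<Longrightarrow> s \<le> t \<Longrightarrow> t \<le> T \<Longrightarrow> X s t [] = 1"
    and "\<And>s u t v. 0 \<le> s \<Longrightarrow> s \<le> u \<Longrightarrow> u \<le> t \<Longrightarrow> t \<le> T \<Longrightarrow> length v \<le> rp_level \<alpha> \<Longrightarrow>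
      X s t v = (\<Sum>j\<le>length v. X s u (take j v) * X u t (drop j v))"
    and "0 \<le> B" and "\<And>s t v. 0 \<le> s \<Longrightarrow> s < t \<Longrightarrow> t \<le> T \<Longrightarrow> v \<noteq> [] \<Longrightarrow> length v \<le> rp_level \<alpha> \<Longrightarrow>
      \<bar>X s t v\<bar> \<le> B * (t - s) powr (real (length v) * \<alpha>)"
  shows "X \<in> rough_paths T \<alpha>"
proof -
  have "hoelder_norm T (real i * \<alpha>) i X < \<infinity>" if "i \<in> {1..rp_level \<alpha>}" for i
  proof -
    have "hoelder_norm T (real i * \<alpha>) i X \<le> ennreal (real CARD('d) ^ i * B)"
    proof (rule hoelder_norm_le[OF assms(5)])
      fix s t v assume "0 \<le> s" "s < t" "t \<le> T" "length (v :: 'd list) = i"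
      thus "\<bar>X s t v\<bar> \<le> B * (t - s) powr (real i * \<alpha>)" using assms(6)[of s t v] that by (cases v) auto
    qed
    thus ?thesis by (rule le_less_trans) simp
  qed
  thus ?thesis unfolding rough_paths_def tensor_mult_def using assms(1-4) by blast
qed

text \<open>Converts bounds of Lipschitz type into \<alpha>-Hoelder bounds on
  \<open>[0, T]\<close>.\<close>

lemma powr_power_le:
  assumes "0 < a" "a \<le> T" "0 \<le> \<alpha>" "\<alpha> \<le> 1"
  shows "a ^ k \<le> T powr (real k * (1 - \<alpha>)) * a powr (real k * \<alpha>)"
proof -
  have "a ^ k = a powr (real k * (1 - \<alpha>) + real k * \<alpha>)" using assms(1) by (simp add: powr_realpow[symmetric] algebra_simps)
  also have "\<dots> = a powr (real k * (1 - \<alpha>)) * a powr (real k * \<alpha>)" by (rule powr_add)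
  also have "\<dots> \<le> T powr (real k * (1 - \<alpha>)) * a powr (real k * \<alpha>)"
    using assms by (intro mult_right_mono powr_mono2) auto
  finally show ?thesis .
qed

section \<open>From dyadic increments to Hoelder bounds\<close>

lemma finite_words_le: "finite {v :: 'd::finite list. length v \<le> m}"
  using finite_lists_length_le[of "UNIV :: 'd set" m] by simp

text \<open>The l1 norm after a dilation: level \<open>k\<close> is measured in units of
  \<open>s ^ k\<close>, so that a tensor of the natural size for scale \<open>s\<close> has norm of
  order one on every level at once.\<close>

definition weighted_norm :: "nat \<Rightarrow> real \<Rightarrow> ('d::finite list \<Rightarrow> real) \<Rightarrow> real" where
  "weighted_norm m s a = (\<Sum>v | length v \<le> m. \<bar>a v\<bar> / s ^ length v)"

text \<open>A word together with a cut position determines a pair of words, and injectively so; the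
  weights multiply along the cut. Pairs whose concatenation is longer than \<open>m\<close> only
  enlarge the right side.\<close>

lemma weighted_norm_mult:
  assumes s: "0 < s"
  shows "weighted_norm m s (tensor_mult a b) \<le> weighted_norm m s a * weighted_norm m s b"
proof -
  let ?W = "{v :: 'd::finite list. length v \<le> m}"
  let ?f = "\<lambda>(u, w). (\<bar>a u\<bar> / s ^ length u) * (\<bar>b w\<bar> / s ^ length w)"
  have "\<bar>tensor_mult a b v\<bar> / s ^ length v \<le> (\<Sum>j\<le>length v. ?f (take j v, drop j v))" for v
  proof -
    have "\<bar>tensor_mult a b v\<bar> / s ^ length v \<le> (\<Sum>j\<le>length v. \<bar>a (take j v) * b (drop j v)\<bar>) / s ^ length v"
      unfolding tensor_mult_def using s by (intro divide_right_mono sum_abs) simp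
    also have "\<dots> = (\<Sum>j\<le>length v. ?f (take j v, drop j v))"
      unfolding sum_divide_distrib by (intro sum.cong) (auto simp: abs_mult min_absorb2 simp flip: power_add)
    finally show ?thesis .
  qed
  hence "weighted_norm m s (tensor_mult a b) \<le> (\<Sum>v\<in>?W. \<Sum>j\<le>length v. ?f (take j v, drop j v))"
    unfolding weighted_norm_def by (rule sum_mono)
  also have "\<dots> = (\<Sum>p\<in>(SIGMA v:?W. {..length v}). ?f (take (snd p) (fst p), drop (snd p) (fst p)))"
    by (subst sum.Sigma) (auto simp: finite_words_le case_prod_beta)
  also have "\<dots> = sum ?f ((\<lambda>p. (take (snd p) (fst p), drop (snd p) (fst p))) ` (SIGMA v:?W. {..length v}))"
  proof (rule sum.reindex_cong[symmetric, OF _ refl refl])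
    show "inj_on (\<lambda>p. (take (snd p) (fst p), drop (snd p) (fst p))) (SIGMA v:?W. {..length v})"
    proof (rule inj_onI, clarsimp)
      fix v w :: "'d list" and i j
      assume "i \<le> length v" "j \<le> length w" and eq: "take i v = take j w" "drop i v = drop j w"
      moreover have "v = w" using append_take_drop_id[of i v] append_take_drop_id[of j w] eq by simp
      moreover have "min (length v) i = min (length w) j" using arg_cong[OF eq(1), of length] by (simp only: length_take)
      ultimately show "v = w \<and> i = j" by (simp add: min_absorb2)
    qed
  qed
  also have "\<dots> \<le> sum ?f (?W \<times> ?W)"
    using s by (intro sum_mono2 finite_cartesian_product finite_words_le) auto
  also have "\<dots> = weighted_norm m s a * weighted_norm m s b"
    by (simp add: weighted_norm_def sum_product sum.cartesian_product)
  finally show ?thesis .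
qed

lemma weighted_norm_nonneg: "0 < s \<Longrightarrow> 0 \<le> weighted_norm m s a"
  unfolding weighted_norm_def by (intro sum_nonneg) auto

lemma weighted_norm_triangle: "0 < s \<Longrightarrow> weighted_norm m s (\<lambda>v. a v + b v) \<le> weighted_norm m s a + weighted_norm m s b"
  unfolding weighted_norm_def sum.distrib[symmetric] add_divide_distrib[symmetric] by (intro sum_mono divide_right_mono) auto

text \<open>A piece of small scale \<open>x\<close> seen at the scale \<open>s\<close>: as
  \<open>x / s \<le> 1\<close>, all levels from 1 on are dominated by the first power of
  \<open>x / s\<close>.\<close>

lemma weighted_norm_unit:
  fixes a :: "'d::finite list \<Rightarrow> real"
  assumes s: "0 < s" and x: "0 \<le> x" "x \<le> s" and K: "0 \<le> K"
    and a: "\<And>v. v \<noteq> [] \<Longrightarrow> length v \<le> m \<Longrightarrow> \<bar>a v\<bar> \<le> K * x ^ length v"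
  shows "weighted_norm m s a \<le> \<bar>a []\<bar> + K * real (card {v :: 'd list. length v \<le> m}) * (x / s)"
proof -
  let ?W = "{v :: 'd list. length v \<le> m}"
  have "weighted_norm m s a = \<bar>a []\<bar> + (\<Sum>v\<in>?W - {[]}. \<bar>a v\<bar> / s ^ length v)"
    unfolding weighted_norm_def by (subst sum.remove[of _ "[]"]) (auto simp: finite_words_le)
  also have "(\<Sum>v\<in>?W - {[]}. \<bar>a v\<bar> / s ^ length v) \<le> (\<Sum>v\<in>?W - {[]}. K * (x / s))"
  proof (rule sum_mono)
    fix v assume v: "v \<in> ?W - {[]}"
    have "\<bar>a v\<bar> / s ^ length v \<le> K * x ^ length v / s ^ length v" using a[of v] v s by (intro divide_right_mono) auto
    also have "\<dots> = K * (x / s) ^ length v" by (simp add: power_divide)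
    also have "\<dots> \<le> K * (x / s) ^ 1"
      using v s x K by (intro mult_left_mono power_decreasing) (auto simp: Suc_le_eq)
    finally show "\<bar>a v\<bar> / s ^ length v \<le> K * (x / s)" by simp
  qed
  also have "\<dots> = real (card (?W - {[]})) * (K * (x / s))" by simp
  also have "\<dots> \<le> real (card ?W) * (K * (x / s))"
    using s x K by (intro mult_right_mono) (auto intro!: card_mono simp: finite_words_le)
  finally show ?thesis by (simp add: mult_ac)
qed

lemma weighted_norm_component:
  assumes "0 < s" "length v \<le> m"
  shows "\<bar>a v\<bar> \<le> s ^ length v * weighted_norm m s a"
proof -
  have "\<bar>a v\<bar> / s ^ length v \<le> weighted_norm m s a"
    unfolding weighted_norm_def using assms by (intro member_le_sum finite_words_le) auto
  thus ?thesis using assms by (simp add: field_simps)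
qed

text \<open>The index \<open>y\<close> is additive under products, since
  \<open>(a\<^sup>2 - 1) b + a (b\<^sup>2 - 1) \<le> a\<^sup>2 b\<^sup>2 - 1\<close> for \<open>a, b \<ge> 1\<close>.\<close>

definition tensor_close :: "nat \<Rightarrow> real \<Rightarrow> real \<Rightarrow> real \<Rightarrow> ('d::finite list \<Rightarrow> real) \<Rightarrow> ('d list \<Rightarrow> real) \<Rightarrow> bool" where
  "tensor_close m s \<eta> y a b \<longleftrightarrow> 0 \<le> y \<and> weighted_norm m s a \<le> exp y \<and> weighted_norm m s b \<le> exp y \<and>
     weighted_norm m s (\<lambda>v. a v - b v) \<le> \<eta> * ((exp y)\<^sup>2 - 1)"

lemma tensor_close_mult:
  assumes "tensor_close m s \<eta> y a b" "tensor_close m s \<eta> y' a' b'" and s: "0 < s" and \<eta>: "0 \<le> \<eta>"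
  shows "tensor_close m s \<eta> (y + y') (tensor_mult a a') (tensor_mult b b')"
proof -
  let ?n = "weighted_norm m s" and ?e = "exp y" and ?e' = "exp y'"
  note h = assms(1,2)[unfolded tensor_close_def]
  have prod: "?n (tensor_mult c c') \<le> u * u'" if "?n c \<le> u" "?n c' \<le> u'" for c c' u u'
    using weighted_norm_mult[OF s, of m c c'] mult_mono[OF that order.trans[OF weighted_norm_nonneg[OF s] that(1)] weighted_norm_nonneg[OF s]] by simp
  have "?n (\<lambda>v. tensor_mult a a' v - tensor_mult b b' v) =
    ?n (\<lambda>v. tensor_mult (\<lambda>v. a v - b v) a' v + tensor_mult b (\<lambda>v. a' v - b' v) v)"
    by (simp add: tensor_mult_def algebra_simps sum_subtractf[symmetric] flip: sum.distrib)
  also have "\<dots> \<le> (\<eta> * (?e\<^sup>2 - 1)) * ?e' + ?e * (\<eta> * (?e'\<^sup>2 - 1))"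
    by (rule order.trans[OF weighted_norm_triangle[OF s] add_mono[OF prod prod]]) (use h in auto)
  also have "\<dots> = \<eta> * ((?e * ?e')\<^sup>2 - 1 - (?e * ?e' - 1) * ((?e - 1) * (?e' - 1)))"
    by (simp add: algebra_simps power2_eq_square)
  also have "\<dots> \<le> \<eta> * ((?e * ?e')\<^sup>2 - 1)"
  proof -
    have "1 \<le> ?e" "1 \<le> ?e'" using h by auto
    moreover have "1 \<le> ?e * ?e'" using mult_mono[OF \<open>1 \<le> ?e\<close> \<open>1 \<le> ?e'\<close>] by simp
    ultimately have "0 \<le> (?e * ?e' - 1) * ((?e - 1) * (?e' - 1))" by (intro mult_nonneg_nonneg) auto
    thus ?thesis using \<eta> by (intro mult_left_mono) auto
  qed
  finally show ?thesis
    using h prod[of a ?e a' ?e'] prod[of b ?e b' ?e'] by (simp add: tensor_close_def exp_add)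
qed

lemma tensor_close_unit:
  fixes a b :: "'d::finite list \<Rightarrow> real"
  assumes s: "0 < s" and x: "0 \<le> x" "x \<le> s" and K: "0 \<le> K" "0 \<le> \<eta>" and one: "a [] = 1" "b [] = 1"
    and ab: "\<And>v. v \<noteq> [] \<Longrightarrow> length v \<le> m \<Longrightarrow> \<bar>a v\<bar> \<le> K * x ^ length v \<and> \<bar>b v\<bar> \<le> K * x ^ length v \<and> \<bar>a v - b v\<bar> \<le> K * \<eta> * x ^ length v"
    and y: "y = K * real (card {v :: 'd list. length v \<le> m}) * (x / s)"
  shows "tensor_close m s \<eta> y a b"
proof -
  have y0: "0 \<le> y" using s x K by (simp add: y)
  have "weighted_norm m s (\<lambda>v. a v - b v) \<le> \<bar>a [] - b []\<bar> + K * \<eta> * real (card {v :: 'd list. length v \<le> m}) * (x / s)"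
    by (rule weighted_norm_unit[OF s x]) (use K ab in auto)
  also have "\<dots> = \<eta> * y" by (simp add: one y)
  also have "\<dots> \<le> \<eta> * ((exp y)\<^sup>2 - 1)"
  proof (rule mult_left_mono[OF _ K(2)])
    have "1 + y \<le> exp y * 1" using exp_ge_add_one_self[of y] by simp
    also have "\<dots> \<le> exp y * exp y" using y0 by (intro mult_left_mono) auto
    finally show "y \<le> (exp y)\<^sup>2 - 1" by (simp add: power2_eq_square)
  qed
  finally have "weighted_norm m s (\<lambda>v. a v - b v) \<le> \<eta> * ((exp y)\<^sup>2 - 1)" .
  moreover have "weighted_norm m s a \<le> 1 + y" "weighted_norm m s b \<le> 1 + y"
    using weighted_norm_unit[OF s x K(1), of m a] weighted_norm_unit[OF s x K(1), of m b] ab by (simp_all add: y one)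
  ultimately show ?thesis using y0 exp_ge_add_one_self[of y] unfolding tensor_close_def by linarith
qed

lemma tensor_close_mono:
  assumes "tensor_close m s \<eta> y a b" "y \<le> y'" "0 \<le> \<eta>"
  shows "tensor_close m s \<eta> y' a b"
proof -
  have e: "exp y \<le> exp y'" using assms by simp
  hence "\<eta> * ((exp y)\<^sup>2 - 1) \<le> \<eta> * ((exp y')\<^sup>2 - 1)"
    using assms(3) by (intro mult_left_mono diff_right_mono power_mono) auto
  thus ?thesis using assms(1,2) e unfolding tensor_close_def by linarith
qed

lemma tensor_close_cong:
  assumes "tensor_close m s \<eta> y a b" "\<And>v. length v \<le> m \<Longrightarrow> a' v = a v" "\<And>v. length v \<le> m \<Longrightarrow> b' v = b v"
  shows "tensor_close m s \<eta> y a' b'"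
proof -
  have "weighted_norm m s a' = weighted_norm m s a" "weighted_norm m s b' = weighted_norm m s b"
    "weighted_norm m s (\<lambda>v. a' v - b' v) = weighted_norm m s (\<lambda>v. a v - b v)"
    unfolding weighted_norm_def using assms(2,3) by (auto intro!: sum.cong)
  thus ?thesis using assms(1) by (simp add: tensor_close_def)
qed

text \<open>As opposed to \<open>two_param\<close>, the word is the first argument here.\<close>

definition multiplicative :: "nat \<Rightarrow> real \<Rightarrow> ('d list \<Rightarrow> real \<Rightarrow> real \<Rightarrow> real) \<Rightarrow> bool" where
  "multiplicative m T A \<longleftrightarrow> (\<forall>s t. 0 \<le> s \<longrightarrow> s \<le> t \<longrightarrow> t \<le> T \<longrightarrow> A [] s t = 1) \<and>
     (\<forall>s v. v \<noteq> [] \<longrightarrow> length v \<le> m \<longrightarrow> 0 \<le> s \<longrightarrow> s \<le> T \<longrightarrow> A v s s = 0) \<and>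
     (\<forall>s u t v. 0 \<le> s \<longrightarrow> s \<le> u \<longrightarrow> u \<le> t \<longrightarrow> t \<le> T \<longrightarrow> length v \<le> m \<longrightarrow>
        A v s t = tensor_mult (\<lambda>v. A v s u) (\<lambda>v. A v u t) v)"

section \<open>Chaining over dyadic grids\<close>

definition grid :: "real \<Rightarrow> nat \<Rightarrow> nat \<Rightarrow> real" where
  "grid T n j = real j * T / 2 ^ n"

lemma grid_mono: "0 \<le> T \<Longrightarrow> i \<le> j \<Longrightarrow> grid T n i \<le> grid T n j"
  unfolding grid_def by (intro divide_right_mono mult_right_mono) auto

lemma grid_range:
  assumes "0 \<le> T" "j \<le> 2 ^ n"
  shows "0 \<le> grid T n j" "grid T n j \<le> T"
proof -
  show "0 \<le> grid T n j" using assms by (simp add: grid_def)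
  have "real j \<le> 2 ^ n" using assms(2) by (metis of_nat_le_iff of_nat_numeral of_nat_power)
  hence "real j * T \<le> 2 ^ n * T" using assms(1) by (intro mult_right_mono)
  thus "grid T n j \<le> T" by (simp add: grid_def divide_le_eq mult.commute)
qed

lemma grid_refine: "grid T (n + d) (j * 2 ^ d) = grid T n j"
  by (simp add: grid_def power_add)

text \<open>For \<open>q = 2 powr - \<alpha>\<close> the factor \<open>(q ^ n) ^ length v\<close>
  is, up to a power of \<open>T\<close>, the \<alpha>-Hoelder size of the level
  \<open>length v\<close> on an interval of length \<open>T / 2 ^ n\<close>; \<open>\<eta>\<close>
  is the relative size of the difference.\<close>

definition dyadically_close :: "nat \<Rightarrow> real \<Rightarrow> real \<Rightarrow> real \<Rightarrow> real \<Rightarrow> ('d list \<Rightarrow> real \<Rightarrow> real \<Rightarrow> real) \<Rightarrow> ('d list \<Rightarrow> real \<Rightarrow> real \<Rightarrow> real) \<Rightarrow> bool" where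
  "dyadically_close m T K \<eta> q A B \<longleftrightarrow> (\<forall>n j v. j < 2 ^ n \<longrightarrow> v \<noteq> [] \<longrightarrow> length v \<le> m \<longrightarrow>
     (let a = A v (grid T n j) (grid T n (Suc j)); b = B v (grid T n j) (grid T n (Suc j))
      in \<bar>a\<bar> \<le> K * (q ^ n) ^ length v \<and> \<bar>b\<bar> \<le> K * (q ^ n) ^ length v \<and> \<bar>a - b\<bar> \<le> K * \<eta> * (q ^ n) ^ length v))"

context
  fixes m :: nat and T K \<eta> q c :: real and A B :: "'d::finite list \<Rightarrow> real \<Rightarrow> real \<Rightarrow> real"
  assumes T: "0 < T" and A: "multiplicative m T A" and B: "multiplicative m T B"
    and close: "dyadically_close m T K \<eta> q A B" and K: "0 \<le> K" "0 \<le> \<eta>" and q: "0 < q" "q < 1"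
    and c: "c = K * real (card {v :: 'd list. length v \<le> m})"
begin

abbreviation "close_on s y N a b \<equiv> tensor_close m s \<eta> y
  (\<lambda>v. A v (grid T N a) (grid T N b)) (\<lambda>v. B v (grid T N a) (grid T N b))"

lemma close_on_append:
  assumes "0 < s" "close_on s y N a b" "close_on s y' N b d" "a \<le> b" "b \<le> d" "d \<le> 2 ^ N"
  shows "close_on s (y + y') N a d"
proof (rule tensor_close_cong[OF tensor_close_mult[OF assms(2,3,1) K(2)]])
  have "0 \<le> grid T N a" "grid T N a \<le> grid T N b" "grid T N b \<le> grid T N d" "grid T N d \<le> T"
    using T assms by (auto intro!: grid_range grid_mono)
  thus "A v (grid T N a) (grid T N d) =
      tensor_mult (\<lambda>v. A v (grid T N a) (grid T N b)) (\<lambda>v. A v (grid T N b) (grid T N d)) v"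
    "B v (grid T N a) (grid T N d) =
      tensor_mult (\<lambda>v. B v (grid T N a) (grid T N b)) (\<lambda>v. B v (grid T N b) (grid T N d)) v"
    if "length v \<le> m" for v
    using A B that by (auto simp: multiplicative_def)
qed

text \<open>The case \<open>a = b\<close> is included, because the pieces cut off at the ends of a
  longer interval may be empty.\<close>

lemma close_on_short:
  assumes "0 < s" "q ^ N \<le> s" "a \<le> b" "b \<le> Suc a" "b \<le> 2 ^ N"
  shows "close_on s (c * (q ^ N / s)) N a b"
proof (rule tensor_close_unit[OF assms(1) _ assms(2) K])
  have r: "0 \<le> grid T N a" "grid T N a \<le> grid T N b" "grid T N b \<le> T"
    using T assms by (auto intro!: grid_range grid_mono)
  show "A [] (grid T N a) (grid T N b) = 1" "B [] (grid T N a) (grid T N b) = 1"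
    using A B r by (auto simp: multiplicative_def)
  fix v :: "'d list" assume v: "v \<noteq> []" "length v \<le> m"
  show "\<bar>A v (grid T N a) (grid T N b)\<bar> \<le> K * (q ^ N) ^ length v \<and>
    \<bar>B v (grid T N a) (grid T N b)\<bar> \<le> K * (q ^ N) ^ length v \<and>
    \<bar>A v (grid T N a) (grid T N b) - B v (grid T N a) (grid T N b)\<bar> \<le> K * \<eta> * (q ^ N) ^ length v"
  proof (cases "a = b")
    case True
    hence "A v (grid T N a) (grid T N b) = 0" "B v (grid T N a) (grid T N b) = 0"
      using A B r v by (auto simp: multiplicative_def)
    thus ?thesis using K q by simp
  next
    case False
    hence "b = Suc a" "a < 2 ^ N" using assms by auto
    thus ?thesis using close v by (simp add: dyadically_close_def Let_def)
  qed
qed (use q c in auto)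

text \<open>An interval of the grid of level \<open>n + d + 1\<close> consists of an interval of the grid of level \<open>n + d\<close>
  and at most one cell on either side.\<close>

lemma close_on_chain:
  "a \<le> b \<Longrightarrow> b \<le> 2 ^ (n + d) \<Longrightarrow> b \<le> a + 2 ^ d \<Longrightarrow> close_on (q ^ n) (2 * c * (\<Sum>e\<le>d. q ^ e)) (n + d) a b"
proof (induction d arbitrary: a b)
  case 0
  have "close_on (q ^ n) c n a b" using close_on_short[of "q ^ n" n a b] 0 q by auto
  moreover have "c \<le> 2 * c * (\<Sum>e\<le>0. q ^ e)" using K by (simp add: c)
  ultimately have "close_on (q ^ n) (2 * c * (\<Sum>e\<le>0. q ^ e)) n a b" by (rule tensor_close_mono) (rule K)
  thus ?case by simp
next
  case (Suc d)
  let ?N = "n + Suc d" and ?y = "2 * c * (\<Sum>e\<le>d. q ^ e)" and ?z = "c * (q ^ (n + Suc d) / q ^ n)"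
  have s: "0 < q ^ n" "q ^ ?N \<le> q ^ n" using q by (simp, intro power_decreasing) auto
  have z: "?z = c * q ^ Suc d" using q by (simp add: power_add)
  \<comment> \<open>Half of \<open>a\<close> rounded up and half of \<open>b\<close> rounded down,
    so that the coarser interval lies inside the given one.\<close>
  define a' where "a' = Suc a div 2"
  define b' where "b' = b div 2"
  have a': "a \<le> 2 * a'" "2 * a' \<le> Suc a" and b': "2 * b' \<le> b" "b \<le> Suc (2 * b')" by (auto simp: a'_def b'_def)
  show ?case
  proof (cases "a' \<le> b'")
    case True
    have "close_on (q ^ n) ?y (n + d) a' b'" using True Suc.prems a' b' by (intro Suc.IH) auto
    hence "close_on (q ^ n) ?y ?N (2 * a') (2 * b')" by (simp add: grid_def)
    moreover have "close_on (q ^ n) ?z ?N a (2 * a')" "close_on (q ^ n) ?z ?N (2 * b') b"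
      using Suc.prems a' b' True by (intro close_on_short s; linarith)+
    ultimately have "close_on (q ^ n) (?z + ?y + ?z) ?N a b"
      using Suc.prems a' b' True by (intro close_on_append[OF s(1) close_on_append[OF s(1)]]) auto
    moreover have "?z + ?y + ?z = 2 * c * (\<Sum>e\<le>Suc d. q ^ e)" unfolding z by (simp add: algebra_simps)
    ultimately show ?thesis by simp
  next
    case False
    \<comment> \<open>Rounding inward crosses over only if \<open>a = b\<close> is odd, so this is
      the empty interval.\<close>
    hence "close_on (q ^ n) ?z ?N a b" using Suc.prems a' b' by (intro close_on_short s) auto
    thus ?thesis
    proof (rule tensor_close_mono[OF _ _ K(2)])
      have "0 \<le> c" "0 \<le> c * (\<Sum>e\<le>d. q ^ e)" "0 \<le> c * q ^ Suc d" using K q by (auto simp: c intro!: mult_nonneg_nonneg sum_nonneg)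
      thus "?z \<le> 2 * c * (\<Sum>e\<le>Suc d. q ^ e)" unfolding z by (simp add: algebra_simps)
    qed
  qed
qed

end

text \<open>An interval of the grid is built from at most two cells on each finer scale, and the
  indices of the cells form a geometric series in \<open>q\<close>. The bound stays linear in
  \<open>\<eta>\<close>, and since the norm is weighted at the scale of the interval, all levels are
  obtained together. \<open>\<kappa>\<close> bounds \<open>(exp y)^2\<close> for
  \<open>y = 2 * c * \<Sum> q ^ e \<le> 2 * c / (1 - q)\<close>. Other end points follow by
  continuity.\<close>

theorem chaining:
  fixes A B :: "'d::finite list \<Rightarrow> real \<Rightarrow> real \<Rightarrow> real"
  assumes T: "0 < T" and A: "multiplicative m T A" and B: "multiplicative m T B"
    and cont: "\<And>v. continuous_on {(s, t). 0 \<le> s \<and> s \<le> t \<and> t \<le> T} (\<lambda>(s, t). A v s t)"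
      "\<And>v. continuous_on {(s, t). 0 \<le> s \<and> s \<le> t \<and> t \<le> T} (\<lambda>(s, t). B v s t)"
    and close: "dyadically_close m T K \<eta> (2 powr - \<alpha>) A B"
    and K: "0 \<le> K" "0 \<le> \<eta>" and \<alpha>: "0 < \<alpha>"
    and \<kappa>: "\<kappa> = exp (4 * (K * real (card {v :: 'd list. length v \<le> m})) / (1 - 2 powr - \<alpha>))"
    and st: "0 \<le> s" "s < t" "t \<le> T" and v: "length v \<le> m"
  shows "\<bar>A v s t - B v s t\<bar> \<le> \<kappa> * \<eta> * ((2 / T) powr \<alpha>) ^ length v * (t - s) powr (real (length v) * \<alpha>)"
proof -
  let ?k = "length v"
  define q where "q = 2 powr - \<alpha>"
  have q: "0 < q" "q < 1" using \<alpha> powr_less_mono[of "- \<alpha>" 0 2] by (simp_all add: q_def)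
  let ?S = "{(s, t). 0 \<le> s \<and> s \<le> t \<and> t \<le> T}"
  define c where "c = K * real (card {v :: 'd list. length v \<le> m})"
  have c0: "0 \<le> c" using K by (simp add: c_def)
  define C where "C = \<kappa> * \<eta> * ((2 / T) powr \<alpha>) ^ ?k"
  have C0: "0 \<le> C" unfolding C_def \<kappa> using K by simp
  have dyadic: "\<bar>A v (grid T N a) (grid T N b) - B v (grid T N a) (grid T N b)\<bar> \<le>
      C * (grid T N b - grid T N a) powr (real ?k * \<alpha>)" if ab': "a \<le> b" "b \<le> 2 ^ N" for N a b
  proof (cases "a = b")
    case True
    have r: "0 \<le> grid T N a" "grid T N a \<le> T" using T ab' True by (auto intro: grid_range)
    have "A v (grid T N a) (grid T N a) = B v (grid T N a) (grid T N a)"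
      using A B v r by (cases "v = []") (auto simp: multiplicative_def)
    thus ?thesis using True C0 by simp
  next
    case False
    hence ab: "a < b" "b \<le> 2 ^ N" using ab' by auto
    \<comment> \<open>\<open>2 ^ d\<close> cells cover the interval and are at most twice as many as
      it has, so \<open>n = N - d\<close> is the level whose cells are comparable to the whole
      interval.\<close>
    obtain d where d: "b - a \<le> 2 ^ d" "2 ^ d \<le> 2 * (b - a)" "d \<le> N"
    proof (cases "b - a = 1")
      case True
      thus ?thesis using that[of 0] by simp
    next
      case False
      hence "1 \<le> b - a - 1" using ab by linarith
      then obtain d where d: "2 ^ d \<le> b - a - 1" "b - a - 1 < 2 ^ Suc d"
        using ex_power_ivl1[of 2 "b - a - 1"] by auto
      have "(2::nat) ^ d < 2 ^ N" using d ab by linarith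
      hence "Suc d \<le> N" by simp
      thus ?thesis using d that[of "Suc d"] by simp
    qed
    define n where "n = N - d"
    have N: "N = n + d" using d by (simp add: n_def)
    define h where "h = grid T N b - grid T N a"
    have h: "h = real (b - a) * T / 2 ^ N" using ab by (simp add: h_def grid_def of_nat_diff field_simps)
    have h0: "0 < h" unfolding h using ab T by simp
    have "real (2 ^ d) \<le> real (2 * (b - a))" unfolding of_nat_le_iff by (rule d(2))
    hence nn: "2 powr - real n \<le> (2 / T) * h"
      using T by (simp add: h N powr_minus powr_realpow power_add field_simps)
    have "q ^ n = (2 powr - real n) powr \<alpha>" by (simp add: q_def powr_powr powr_realpow[symmetric] mult.commute)
    also have "\<dots> \<le> ((2 / T) * h) powr \<alpha>" using nn \<alpha> by (intro powr_mono2) auto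
    also have "\<dots> = (2 / T) powr \<alpha> * h powr \<alpha>" by (rule powr_mult)
    finally have qn: "q ^ n \<le> (2 / T) powr \<alpha> * h powr \<alpha>" .
    let ?D = "weighted_norm m (q ^ n) (\<lambda>v. A v (grid T N a) (grid T N b) - B v (grid T N a) (grid T N b))"
    have "?D \<le> \<eta> * ((exp (2 * c * (\<Sum>e\<le>d. q ^ e)))\<^sup>2 - 1)"
      using close_on_chain[OF T A B close[folded q_def] K q c_def, of a b n d] ab d N by (simp add: tensor_close_def)
    also have "\<dots> \<le> \<eta> * \<kappa>"
    proof (rule mult_left_mono[OF _ K(2)])
      have "(\<Sum>e\<le>d. q ^ e) \<le> 1 / (1 - q)" using q by (simp add: sum_gp0 divide_right_mono)
      hence "2 * (2 * c * (\<Sum>e\<le>d. q ^ e)) \<le> 2 * (2 * c * (1 / (1 - q)))" using c0 by (intro mult_left_mono) auto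
      hence "exp (2 * (2 * c * (\<Sum>e\<le>d. q ^ e))) \<le> \<kappa>" unfolding \<kappa> c_def[symmetric] q_def[symmetric] by simp
      thus "(exp (2 * c * (\<Sum>e\<le>d. q ^ e)))\<^sup>2 - 1 \<le> \<kappa>" by (simp add: exp_double[symmetric])
    qed
    finally have D: "?D \<le> \<kappa> * \<eta>" by (simp only: mult.commute)
    have "\<bar>A v (grid T N a) (grid T N b) - B v (grid T N a) (grid T N b)\<bar> \<le> (q ^ n) ^ ?k * ?D"
      by (rule weighted_norm_component) (use q v in auto)
    also have "\<dots> \<le> ((2 / T) powr \<alpha> * h powr \<alpha>) ^ ?k * (\<kappa> * \<eta>)"
      using q qn D by (intro mult_mono power_mono weighted_norm_nonneg) auto
    also have "\<dots> = C * h powr (real ?k * \<alpha>)"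
    proof -
      have "(h powr \<alpha>) ^ ?k = h powr (real ?k * \<alpha>)" using h0 by (simp add: powr_realpow[symmetric] powr_powr mult.commute)
      thus ?thesis by (simp add: C_def power_mult_distrib)
    qed
    finally show ?thesis by (simp add: h_def)
  qed
  \<comment> \<open>Grid points approaching \<open>r\<close> from the left; monotonicity in
    \<open>r\<close> keeps the approximating pair in the simplex.\<close>
  define a where "a r N = nat \<lfloor>r * 2 ^ N / T\<rfloor>" for r and N :: nat
  have a_lim: "(\<lambda>N. grid T N (a r N)) \<longlonglongrightarrow> r" if "0 \<le> r" for r
  proof -
    have fl: "real (a r N) = of_int \<lfloor>r * 2 ^ N / T\<rfloor>" for N using that T by (simp add: a_def)
    have up: "grid T N (a r N) \<le> r" for N
    proof -
      have "real (a r N) \<le> r * 2 ^ N / T" unfolding fl by linarith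
      thus ?thesis using T by (simp add: grid_def field_simps)
    qed
    have lo: "r - T / 2 ^ N \<le> grid T N (a r N)" for N
    proof -
      have "r * 2 ^ N / T \<le> real (a r N) + 1" unfolding fl by linarith
      hence "(r * 2 ^ N / T) * (T / 2 ^ N) \<le> (real (a r N) + 1) * (T / 2 ^ N)"
        using T by (intro mult_right_mono) auto
      thus ?thesis using T by (simp add: grid_def distrib_right add_divide_distrib)
    qed
    have "(\<lambda>N. r - T * (1 / 2) ^ N) \<longlonglongrightarrow> r - T * 0"
      by (intro tendsto_intros LIMSEQ_power_zero) auto
    hence "(\<lambda>N. r - T / 2 ^ N) \<longlonglongrightarrow> r" by (simp add: power_divide)
    thus ?thesis
      by (rule tendsto_sandwich[OF _ _ _ tendsto_const, rotated 2])
         (rule always_eventually, rule allI, rule lo up)+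
  qed
  have amono: "a s N \<le> a t N" for N
    unfolding a_def using st T by (intro nat_mono floor_mono divide_right_mono mult_right_mono) auto
  have aN: "a t N \<le> 2 ^ N" for N
  proof -
    have "t * 2 ^ N / T \<le> 2 ^ N" using st T by (simp add: field_simps)
    hence "(of_int \<lfloor>t * 2 ^ N / T\<rfloor> :: real) \<le> 2 ^ N"
      by (rule order.trans[OF of_int_floor_le])
    also have "(2 ^ N :: real) = of_int (2 ^ N)" by simp
    finally have "(of_int \<lfloor>t * 2 ^ N / T\<rfloor> :: real) \<le> of_int (2 ^ N)" .
    hence "\<lfloor>t * 2 ^ N / T\<rfloor> \<le> 2 ^ N" by (simp only: of_int_le_iff)
    thus ?thesis unfolding a_def by (simp add: nat_le_iff)
  qed
  let ?p = "\<lambda>N. (grid T N (a s N), grid T N (a t N))"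
  have p_lim: "?p \<longlonglongrightarrow> (s, t)" using st by (intro tendsto_Pair a_lim) auto
  have p_in: "?p N \<in> ?S" for N
  proof -
    have "0 \<le> grid T N (a s N)" using T by (simp add: grid_def)
    moreover have "grid T N (a s N) \<le> grid T N (a t N)"
      using T by (intro grid_mono amono) simp
    moreover have "grid T N (a t N) \<le> T" using T by (intro grid_range aN) simp
    ultimately show ?thesis by simp
  qed
  have lim: "(\<lambda>N. f (grid T N (a s N)) (grid T N (a t N))) \<longlonglongrightarrow> f s t"
    if "continuous_on ?S (\<lambda>(s, t). f s t)" for f :: "real \<Rightarrow> real \<Rightarrow> real"
  proof -
    have "(\<lambda>N. (\<lambda>(s, t). f s t) (?p N)) \<longlonglongrightarrow> (\<lambda>(s, t). f s t) (s, t)"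
      by (rule continuous_on_tendsto_compose[OF that p_lim]) (use st p_in in simp_all)
    thus ?thesis by simp
  qed
  have "(\<lambda>N. \<bar>A v (grid T N (a s N)) (grid T N (a t N)) - B v (grid T N (a s N)) (grid T N (a t N))\<bar>)
     \<longlonglongrightarrow> \<bar>A v s t - B v s t\<bar>"
    by (intro tendsto_intros lim cont)
  moreover have "(\<lambda>N. C * (grid T N (a t N) - grid T N (a s N)) powr (real ?k * \<alpha>)) \<longlonglongrightarrow> C * (t - s) powr (real ?k * \<alpha>)"
    using st by (intro tendsto_intros a_lim) auto
  ultimately have "\<bar>A v s t - B v s t\<bar> \<le> C * (t - s) powr (real ?k * \<alpha>)"
    by (rule LIMSEQ_le) (use dyadic[OF amono aN] in blast)
  thus ?thesis by (simp add: C_def)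
qed

section \<open>Uniform convergence of rough paths\<close>

lemma rough_paths_continuous:
  "X \<in> rough_paths T \<alpha> \<Longrightarrow> continuous_on {(s, t). 0 \<le> s \<and> s \<le> t \<and> t \<le> T} (\<lambda>(s, t). X s t v)"
  unfolding rough_paths_def by blast

text \<open>The telescoping series converges pointwise with the tails of \<open>b\<close> as Hoelder
  bounds. Chen's relation and the normalization are closed under pointwise limits; continuity
  follows because the convergence is uniform on the simplex.\<close>

lemma rough_path_limit:
  fixes X :: "nat \<Rightarrow> 'd::finite two_param"
  assumes X: "\<And>m. X m \<in> rough_paths T \<alpha>" and \<alpha>: "0 \<le> \<alpha>"
    and b: "\<And>m. 0 \<le> b m" "summable b"
    and step: "\<And>m s t v. 0 \<le> s \<Longrightarrow> s < t \<Longrightarrow> t \<le> T \<Longrightarrow> v \<noteq> [] \<Longrightarrow> length v \<le> rp_level \<alpha> \<Longrightarrow>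
      \<bar>X (Suc m) s t v - X m s t v\<bar> \<le> b m * (t - s) powr (real (length v) * \<alpha>)"
  obtains Y where "Y \<in> rough_paths T \<alpha>" and "\<And>m. rp_dist T \<alpha> (X m) Y \<le> word_constant TYPE('d) \<alpha> * (\<Sum>i. b (i + m))"
proof -
  \<comment> \<open>The absolute value makes the bound on \<open>\<delta>\<close> meaningful for all
    arguments: off the simplex, on the diagonal and for the empty word \<open>\<delta>\<close> is
    zero, as the case distinction shows.\<close>
  define g where "g s t v = \<bar>t - s\<bar> powr (real (length v) * \<alpha>)" for s t :: real and v :: "'d list"
  define \<delta> where "\<delta> m s t v = X (Suc m) s t v - X m s t v" for m s t v
  have g0: "0 \<le> g s t v" for s t v by (simp add: g_def)
  have \<delta>: "\<bar>\<delta> m s t v\<bar> \<le> b m * g s t v" for m s t v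
  proof -
    consider "\<not> (0 \<le> s \<and> s \<le> t \<and> t \<le> T \<and> length v \<le> rp_level \<alpha>)"
      | "0 \<le> s" "s \<le> t" "t \<le> T" "v = []"
      | "0 \<le> s" "s = t" "t \<le> T" "v \<noteq> []"
      | "0 \<le> s" "s < t" "t \<le> T" "v \<noteq> []" "length v \<le> rp_level \<alpha>" by fastforce
    thus ?thesis
    proof cases
      case 1
      hence "\<delta> m s t v = 0" using rough_paths_zero[OF X] by (simp add: \<delta>_def)
      thus ?thesis using b g0 by simp
    next
      case 2
      hence "\<delta> m s t v = 0" using rough_paths_unit[OF X, of s t] by (simp add: \<delta>_def)
      thus ?thesis using b g0 by simp
    next
      case 3
      hence "\<delta> m s t v = 0" using rough_path_diagonal[OF X, of s v] by (simp add: \<delta>_def)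
      thus ?thesis using b g0 by simp
    next
      case 4
      thus ?thesis using step[of s t v m] by (simp add: \<delta>_def g_def)
    qed
  qed
  have s1: "summable (\<lambda>i. \<delta> (i + m) s t v)" for m s t v
    by (rule summable_comparison_test'[OF summable_mult2[OF summable_ignore_initial_segment[OF b(2), of m], of "g s t v"]])
       (use \<delta> in simp)
  define Y where "Y s t v = X 0 s t v + (\<Sum>i. \<delta> i s t v)" for s t v
  have tail: "Y s t v - X m s t v = (\<Sum>i. \<delta> (i + m) s t v)" for m s t v
  proof -
    have "(\<Sum>i<m. \<delta> i s t v) = X m s t v - X 0 s t v" unfolding \<delta>_def by (rule sum_lessThan_telescope)
    thus ?thesis using suminf_split_initial_segment[OF s1[of 0 s t v, simplified], of m] by (simp add: Y_def)
  qed
  have bs: "summable (\<lambda>i. b (i + m))" for m by (rule summable_ignore_initial_segment[OF b(2)])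
  have dist: "\<bar>Y s t v - X m s t v\<bar> \<le> (\<Sum>i. b (i + m)) * g s t v" for m s t v
  proof -
    have sg: "summable (\<lambda>i. b (i + m) * g s t v)" by (rule summable_mult2[OF bs])
    have sa: "summable (\<lambda>i. \<bar>\<delta> (i + m) s t v\<bar>)"
      by (rule summable_comparison_test'[OF sg]) (use \<delta> in simp)
    have "\<bar>\<Sum>i. \<delta> (i + m) s t v\<bar> \<le> (\<Sum>i. \<bar>\<delta> (i + m) s t v\<bar>)" by (rule summable_rabs[OF sa])
    also have "\<dots> \<le> (\<Sum>i. b (i + m) * g s t v)" by (rule suminf_le[OF \<delta> sa sg])
    also have "\<dots> = (\<Sum>i. b (i + m)) * g s t v" by (rule suminf_mult2[OF bs, symmetric])
    finally show ?thesis by (simp add: tail)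
  qed
  have t0: "(\<lambda>m. \<Sum>i. b (i + m)) \<longlonglongrightarrow> 0" by (rule suminf_exist_split2[OF b(2)])
  have sb0: "0 \<le> (\<Sum>i. b (i + m))" for m by (rule suminf_nonneg[OF bs b(1)])
  have lim: "(\<lambda>m. X m s t v) \<longlonglongrightarrow> Y s t v" for s t v
  proof (rule LIMSEQ_I)
    fix e :: real assume e: "0 < e"
    have "(\<lambda>m. (\<Sum>i. b (i + m)) * g s t v) \<longlonglongrightarrow> 0" using tendsto_mult_left_zero[OF t0] .
    from LIMSEQ_D[OF this e] obtain N where N: "\<forall>m\<ge>N. norm ((\<Sum>i. b (i + m)) * g s t v - 0) < e" by blast
    have "norm (X m s t v - Y s t v) < e" if "N \<le> m" for m
      using N that dist[of s t v m] by (auto simp: abs_minus_commute)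
    thus "\<exists>N. \<forall>m\<ge>N. norm (X m s t v - Y s t v) < e" by blast
  qed
  have dX: "rp_dist T \<alpha> (X m) Y \<le> word_constant TYPE('d) \<alpha> * (\<Sum>i. b (i + m))" for m
  proof (rule rp_dist_le[OF sb0])
    fix s t :: real and v :: "'d list" assume "s < t"
    thus "\<bar>X m s t v - Y s t v\<bar> \<le> (\<Sum>i. b (i + m)) * (t - s) powr (real (length v) * \<alpha>)"
      using dist[of s t v m] by (simp add: g_def abs_minus_commute)
  qed
  have "Y \<in> rough_paths T \<alpha>"
    unfolding rough_paths_def mem_Collect_eq
  proof (intro conjI allI impI ballI)
    fix s t v assume "Y s t v \<noteq> 0"
    hence "\<exists>m. X m s t v \<noteq> 0" using lim[of s t v] by (metis LIMSEQ_const_iff ext)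
    then obtain m where "X m s t v \<noteq> 0" by blast
    thus "0 \<le> s" "s \<le> t" "t \<le> T" "length v \<le> rp_level \<alpha>" using rough_paths_zero[OF X[of m], of s t v] by blast+
  next
    fix v
    let ?S = "{(s, t). 0 \<le> s \<and> s \<le> t \<and> t \<le> T}"
    show "continuous_on ?S (\<lambda>(s, t). Y s t v)"
    proof (rule uniform_limit_theorem[of _ "\<lambda>m (s, t). X m s t v" sequentially])
      show "\<forall>\<^sub>F m in sequentially. continuous_on ?S (\<lambda>(s, t). X m s t v)"
        by (intro always_eventually allI rough_paths_continuous[OF X])
      have tl: "(\<lambda>m. (\<Sum>i. b (i + m)) * T powr (real (length v) * \<alpha>)) \<longlonglongrightarrow> 0" using tendsto_mult_left_zero[OF t0] .
      show "uniform_limit ?S (\<lambda>m (s, t). X m s t v) (\<lambda>(s, t). Y s t v) sequentially"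
      proof (rule uniform_limitI)
        fix e :: real assume "0 < e"
        from order_tendstoD(2)[OF tl this]
        show "\<forall>\<^sub>F m in sequentially. \<forall>p\<in>?S. dist (case p of (s, t) \<Rightarrow> X m s t v) (case p of (s, t) \<Rightarrow> Y s t v) < e"
        proof eventually_elim
          case (elim m)
          have "\<bar>X m s t v - Y s t v\<bar> < e" if "0 \<le> s" "s \<le> t" "t \<le> T" for s t
          proof -
            have "\<bar>X m s t v - Y s t v\<bar> \<le> (\<Sum>i. b (i + m)) * g s t v" using dist[of s t v m] by (simp only: abs_minus_commute)
            also have "\<dots> \<le> (\<Sum>i. b (i + m)) * T powr (real (length v) * \<alpha>)"
              unfolding g_def using that \<alpha> by (intro mult_left_mono sb0 powr_mono2) auto
            finally show ?thesis using elim by simp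
          qed
          thus ?case by (auto simp: dist_real_def)
        qed
      qed
    qed simp
  next
    fix s t :: real assume "0 \<le> s \<and> s \<le> t \<and> t \<le> T"
    hence "X m s t [] = 1" for m using rough_paths_unit[OF X] by blast
    thus "Y s t [] = 1" using lim[of s t "[]"] by (simp add: LIMSEQ_const_iff)
  next
    fix s u t :: real and v :: "'d list"
    assume a: "0 \<le> s \<and> s \<le> u \<and> u \<le> t \<and> t \<le> T \<and> length v \<le> rp_level \<alpha>"
    have "X m s t v = tensor_mult (X m s u) (X m u t) v" for m using rough_paths_mult[OF X] a by blast
    hence "(\<lambda>m. \<Sum>j\<le>length v. X m s u (take j v) * X m u t (drop j v)) \<longlonglongrightarrow> Y s t v"
      using lim[of s t v] by (simp add: tensor_mult_def)
    moreover have "(\<lambda>m. \<Sum>j\<le>length v. X m s u (take j v) * X m u t (drop j v)) \<longlonglongrightarrow>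
      (\<Sum>j\<le>length v. Y s u (take j v) * Y u t (drop j v))" by (intro tendsto_intros lim)
    ultimately show "Y s t v = tensor_mult (Y s u) (Y u t) v"
      unfolding tensor_mult_def by (rule LIMSEQ_unique)
  next
    fix i assume i: "i \<in> {1..rp_level \<alpha>}"
    have "hoelder_norm T (real i * \<alpha>) i (\<lambda>s t v. Y s t v - 0) \<le>
      hoelder_norm T (real i * \<alpha>) i (\<lambda>s t v. Y s t v - X 0 s t v) + hoelder_norm T (real i * \<alpha>) i (\<lambda>s t v. X 0 s t v - 0)"
      by (rule hoelder_norm_diff_triangle[of T "real i * \<alpha>" i Y "\<lambda>_ _ _. 0" "X 0"])
    also have "\<dots> < \<infinity>"
    proof -
      have "hoelder_norm T (real i * \<alpha>) i (\<lambda>s t v. Y s t v - X 0 s t v) \<le> ennreal (real CARD('d) ^ i * (\<Sum>i. b (i + 0)))"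
      proof (rule hoelder_norm_le[OF sb0])
        fix s t :: real and v :: "'d list" assume "0 \<le> s" "s < t" "t \<le> T" "length v = i"
        thus "\<bar>Y s t v - X 0 s t v\<bar> \<le> (\<Sum>i. b (i + 0)) * (t - s) powr (real i * \<alpha>)"
          using dist[of s t v 0] by (simp add: g_def)
      qed
      also have "\<dots> < \<infinity>" by simp
      finally show ?thesis using rough_paths_finite[OF X[of 0] i] by simp
    qed
    finally show "hoelder_norm T (real i * \<alpha>) i Y < \<infinity>" by simp
  qed
  thus ?thesis using dX that by blast
qed

lemma dyadic_lift_eq:
  "dyadic_lift T \<alpha> l x s t v = (if 0 \<le> s \<and> s \<le> t \<and> t \<le> T \<and> length v \<le> rp_level \<alpha> then dyadic_integral T l x v s t else 0)"
  by (simp add: dyadic_lift_def signature_def dyadic_integral_def)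

lemma dyadic_lift_rough_path:
  fixes x :: "'d::finite path"
  assumes T: "0 < T" and \<alpha>: "0 \<le> \<alpha>" "\<alpha> \<le> 1"
  shows "dyadic_lift T \<alpha> l x \<in> rough_paths T \<alpha>"
proof -
  let ?k = "rp_level \<alpha>"
  let ?V = "{v :: 'd list. length v \<le> ?k}"
  have fin: "finite ?V" using finite_lists_length_le[of "UNIV :: 'd set" ?k] by simp
  obtain L where L: "0 \<le> L" "\<And>v s t. 0 \<le> s \<Longrightarrow> s \<le> t \<Longrightarrow> t \<le> T \<Longrightarrow> \<bar>dyadic_integral T l x v s t\<bar> \<le> (L * (t - s)) ^ length v"
    using dyadic_integral_bound[OF T, of l x] by blast
  define c where "c v = L ^ length v * T powr (real (length v) * (1 - \<alpha>))" for v :: "'d list"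
  have c0: "0 \<le> c v" for v using L(1) by (simp add: c_def)
  show ?thesis
  proof (rule rough_pathsI[where B = "\<Sum>v\<in>?V. c v"])
    show "continuous_on {(s, t). 0 \<le> s \<and> s \<le> t \<and> t \<le> T} (\<lambda>(s, t). dyadic_lift T \<alpha> l x s t v)" for v
    proof (cases "length v \<le> ?k")
      case True
      show ?thesis
        by (rule continuous_on_eq[OF dyadic_integral_continuous[OF T, of l x v]]) (use True in \<open>auto simp: dyadic_lift_eq\<close>)
    next
      case False
      thus ?thesis by (simp add: dyadic_lift_eq)
    qed
  next
    fix s u t :: real and v :: "'d list"
    assume "0 \<le> s" "s \<le> u" "u \<le> t" "t \<le> T" "length v \<le> ?k"
    thus "dyadic_lift T \<alpha> l x s t v = (\<Sum>j\<le>length v. dyadic_lift T \<alpha> l x s u (take j v) * dyadic_lift T \<alpha> l x u t (drop j v))"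
      using dyadic_integral_chen[OF T, of s u t l x v] by (auto simp: dyadic_lift_eq intro!: sum.cong)
  next
    show "0 \<le> (\<Sum>v\<in>?V. c v)" by (intro sum_nonneg c0)
  next
    fix s t :: real and v :: "'d list"
    assume st: "0 \<le> s" "s < t" "t \<le> T" and v: "v \<noteq> []" "length v \<le> ?k"
    have "\<bar>dyadic_lift T \<alpha> l x s t v\<bar> \<le> (L * (t - s)) ^ length v" using L(2)[of s t v] st v by (simp add: dyadic_lift_eq)
    also have "\<dots> = L ^ length v * (t - s) ^ length v" by (rule power_mult_distrib)
    also have "\<dots> \<le> L ^ length v * (T powr (real (length v) * (1 - \<alpha>)) * (t - s) powr (real (length v) * \<alpha>))"
      using st \<alpha> L(1) by (intro mult_left_mono powr_power_le zero_le_power) auto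
    also have "\<dots> = c v * (t - s) powr (real (length v) * \<alpha>)" by (simp add: c_def)
    also have "\<dots> \<le> (\<Sum>v\<in>?V. c v) * (t - s) powr (real (length v) * \<alpha>)"
      using v c0 by (intro mult_right_mono member_le_sum fin) auto
    finally show "\<bar>dyadic_lift T \<alpha> l x s t v\<bar> \<le> (\<Sum>v\<in>?V. c v) * (t - s) powr (real (length v) * \<alpha>)" .
  qed (use dyadic_integral_Nil[OF T, of l x] in \<open>auto simp: dyadic_lift_eq\<close>)
qed

lemma dyadic_lift_geometric:
  fixes x :: "'d::finite path"
  assumes T: "0 < T" and \<alpha>: "0 \<le> \<alpha>" "\<alpha> \<le> 1" and x: "x \<in> C0 T"
  shows "dyadic_lift T \<alpha> l x \<in> geometric_rough_paths T \<alpha>"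
proof -
  interpret R: Metric_space "rough_paths T \<alpha> :: 'd two_param set" "rp_dist T \<alpha>" by (rule Metric_space_rough_paths)
  let ?S = "signature T (rp_level \<alpha>) ` lipschitz_paths T :: 'd two_param set"
  have "dyadic_lift T \<alpha> l x \<in> topspace (rp_topology T \<alpha>) \<inter> ?S"
    using dyadic_lift_rough_path[OF T \<alpha>, of l x] dyadic_interpolation_lipschitz[OF T x, of l]
    by (auto simp: rp_topology_def dyadic_lift_def)
  thus ?thesis unfolding geometric_rough_paths_def using closure_of_subset_Int by fastforce
qed

text \<open>The default value of the lift has to lie in the target space; it is the lift of the zero
  path.\<close>

lemma zero_rough_path_geometric:
  assumes T: "0 < T" and \<alpha>: "0 \<le> \<alpha>" "\<alpha> \<le> 1"
  shows "(zero_rough_path T :: 'd::finite two_param) \<in> geometric_rough_paths T \<alpha>"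
proof -
  have "dyadic_lift T \<alpha> 0 (0 :: 'd path) = (zero_rough_path T :: 'd two_param)"
  proof (intro ext)
    fix s t :: real and v :: "'d list"
    have "dyadic_integral T 0 0 v s t = 0" if "0 \<le> s" "s \<le> t" "t \<le> T" "v \<noteq> []"
    proof -
      have "(\<Prod>i\<leftarrow>v. cell_increment T 0 0 i 0) = 0" using that(4) by (cases v) (simp_all add: cell_increment_def)
      thus ?thesis using dyadic_integral_on_cell[OF T, of 0 0 s t 0 v] that by simp
    qed
    thus "dyadic_lift T \<alpha> 0 0 s t v = zero_rough_path T s t v"
      using dyadic_integral_Nil[OF T, of 0 "0 :: 'd path" s t]
      by (auto simp: dyadic_lift_eq zero_rough_path_def)
  qed
  moreover have "(0 :: 'd path) \<in> C0 T" by (simp add: C0_def)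
  ultimately show ?thesis using dyadic_lift_geometric[OF T \<alpha>, of "0 :: 'd path" 0] by simp
qed

text \<open>On the ball of radius \<open>norm x + 1\<close> the iterated integrals are Lipschitz in
  the path by \<open>dyadic_integral_diff_bound\<close>, with a constant that suits all words of the
  relevant lengths.\<close>

lemma dyadic_lift_continuous:
  fixes S :: "'d::finite path set"
  assumes T: "0 < T" and \<alpha>: "0 \<le> \<alpha>" "\<alpha> \<le> 1"
  shows "continuous_map (top_of_set S) (rp_topology T \<alpha>) (dyadic_lift T \<alpha> l)"
proof -
  interpret R: Metric_space "rough_paths T \<alpha> :: 'd two_param set" "rp_dist T \<alpha>" by (rule Metric_space_rough_paths)
  let ?k = "rp_level \<alpha>" and ?N = "word_constant TYPE('d) \<alpha>"
  obtain C where C: "0 \<le> C" and diff: "\<And>(x :: 'd path) y R v s t. norm x \<le> R \<Longrightarrow> norm y \<le> R \<Longrightarrow> 0 \<le> s \<Longrightarrow> s \<le> t \<Longrightarrow> t \<le> T \<Longrightarrow>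
    \<bar>dyadic_integral T l x v s t - dyadic_integral T l y v s t\<bar> \<le>
      real (length v) * (C * R) ^ (length v - 1) * (C * norm (x - y)) * (t - s) ^ length v"
    using dyadic_integral_diff_bound[OF T, of l] by blast
  show ?thesis
    unfolding rp_topology_def R.continuous_map_to_metric
  proof (intro ballI allI impI)
    fix x :: "'d path" and \<epsilon> :: real
    assume x: "x \<in> topspace (top_of_set S)" and \<epsilon>: "0 < \<epsilon>"
    define R where "R = norm x + 1"
    define D where "D = (\<Sum>j\<le>?k. real j * (C * R) ^ (j - 1) * C * T powr (real j * (1 - \<alpha>)))"
    have R0: "0 \<le> R" by (simp add: R_def)
    have D0: "0 \<le> D" unfolding D_def using C R0 by (intro sum_nonneg mult_nonneg_nonneg zero_le_power) auto
    have dist: "rp_dist T \<alpha> (dyadic_lift T \<alpha> l x) (dyadic_lift T \<alpha> l y) \<le> ?N * (D * norm (x - y))" if y: "norm y \<le> R" for y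
    proof (rule rp_dist_le)
      show "0 \<le> D * norm (x - y)" using D0 by simp
      fix s t :: real and v :: "'d list"
      assume st: "0 \<le> s" "s < t" "t \<le> T" and v: "v \<noteq> []" "length v \<le> ?k"
      let ?j = "length v"
      have "\<bar>dyadic_lift T \<alpha> l x s t v - dyadic_lift T \<alpha> l y s t v\<bar> \<le>
          real ?j * (C * R) ^ (?j - 1) * (C * norm (x - y)) * (t - s) ^ ?j"
        using diff[of x R y s t v] y st v by (simp add: dyadic_lift_eq R_def)
      also have "\<dots> \<le> real ?j * (C * R) ^ (?j - 1) * (C * norm (x - y)) *
          (T powr (real ?j * (1 - \<alpha>)) * (t - s) powr (real ?j * \<alpha>))"
        using st \<alpha> C R0 by (intro mult_left_mono powr_power_le mult_nonneg_nonneg zero_le_power) auto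
      also have "\<dots> = (real ?j * (C * R) ^ (?j - 1) * C * T powr (real ?j * (1 - \<alpha>))) * (norm (x - y) * (t - s) powr (real ?j * \<alpha>))"
        by (simp only: mult_ac)
      also have "\<dots> \<le> D * (norm (x - y) * (t - s) powr (real ?j * \<alpha>))"
        unfolding D_def using v C R0
        by (intro mult_right_mono member_le_sum[of ?j "{..?k}" "\<lambda>j. real j * (C * R) ^ (j - 1) * C * T powr (real j * (1 - \<alpha>))"] mult_nonneg_nonneg zero_le_power) auto
      finally show "\<bar>dyadic_lift T \<alpha> l x s t v - dyadic_lift T \<alpha> l y s t v\<bar> \<le> D * norm (x - y) * (t - s) powr (real ?j * \<alpha>)"
        by (simp only: mult_ac)
    qed
    define r where "r = min 1 (\<epsilon> / (?N * D + 1))"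
    have p: "0 < ?N * D + 1" using D0 word_constant_nonneg[of \<alpha>, where ?'d = 'd] by (simp add: add_nonneg_pos)
    have r: "0 < r" "r \<le> 1" using \<epsilon> p by (auto simp: r_def)
    have r': "r * (?N * D + 1) \<le> \<epsilon>"
    proof -
      have "r \<le> \<epsilon> / (?N * D + 1)" by (simp add: r_def)
      thus ?thesis using p by (simp only: pos_le_divide_eq)
    qed
    show "\<exists>U. openin (top_of_set S) U \<and> x \<in> U \<and> (\<forall>y\<in>U. dyadic_lift T \<alpha> l y \<in> R.mball (dyadic_lift T \<alpha> l x) \<epsilon>)"
    proof (intro exI[of _ "S \<inter> ball x r"] conjI ballI)
      show "openin (top_of_set S) (S \<inter> ball x r)" by (simp add: openin_open_Int)
      show "x \<in> S \<inter> ball x r" using x r by simp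
      fix y assume y: "y \<in> S \<inter> ball x r"
      hence n: "norm (x - y) < r" by (simp add: dist_norm)
      have "norm y \<le> norm x + norm (x - y)" using norm_triangle_sub[of y x] by (simp add: norm_minus_commute)
      hence "norm y \<le> R" using n r by (simp add: R_def)
      from dist[OF this] have "rp_dist T \<alpha> (dyadic_lift T \<alpha> l x) (dyadic_lift T \<alpha> l y) \<le> (?N * D) * norm (x - y)" by (simp only: mult.assoc)
      also have "\<dots> \<le> (?N * D) * r" using n D0 word_constant_nonneg[of \<alpha>, where ?'d = 'd] by (intro mult_left_mono) auto
      also have "\<dots> < \<epsilon>" using r r' by (simp add: algebra_simps)
      finally show "dyadic_lift T \<alpha> l y \<in> R.mball (dyadic_lift T \<alpha> l x) \<epsilon>"
        by (simp add: dyadic_lift_rough_path[OF T \<alpha>])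
    qed
  qed
qed

lemma uniformly_convergent_lift:
  fixes B :: "'d::finite path wiener_space"
  assumes T: "0 < T" and \<alpha>: "0 \<le> \<alpha>" "\<alpha> \<le> 1" and S: "S \<subseteq> wspace B" "wspace B \<subseteq> C0 T"
    and b: "\<And>m. 0 \<le> b m" "summable b"
    and step: "\<And>x m s t v. x \<in> S \<Longrightarrow> 0 \<le> s \<Longrightarrow> s < t \<Longrightarrow> t \<le> T \<Longrightarrow> v \<noteq> [] \<Longrightarrow> length v \<le> rp_level \<alpha> \<Longrightarrow>
      \<bar>dyadic_integral T (Suc m) x v s t - dyadic_integral T m x v s t\<bar> \<le> b m * (t - s) powr (real (length v) * \<alpha>)"
  shows "S \<subseteq> lift_domain T \<alpha> B" "continuous_map (top_of_set S) (geometric_rp_topology T \<alpha>) (rp_lift T \<alpha> B)"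
proof -
  interpret R: Metric_space "rough_paths T \<alpha> :: 'd two_param set" "rp_dist T \<alpha>" by (rule Metric_space_rough_paths)
  let ?lim = "\<lambda>x X. limitin (geometric_rp_topology T \<alpha>) (\<lambda>l. dyadic_lift T \<alpha> l x) X sequentially"
  let ?N = "word_constant TYPE('d) \<alpha>"
  have t0: "(\<lambda>m. ?N * (\<Sum>i. b (i + m))) \<longlonglongrightarrow> 0"
    using tendsto_mult_right_zero[OF suminf_exist_split2[OF b(2)]] .
  have limit: "\<exists>Y. ?lim x Y \<and> Y \<in> rough_paths T \<alpha> \<and> (\<forall>m. rp_dist T \<alpha> (dyadic_lift T \<alpha> m x) Y \<le> ?N * (\<Sum>i. b (i + m)))" if x: "x \<in> S" for x
  proof -
    have st: "\<bar>dyadic_lift T \<alpha> (Suc m) x s t v - dyadic_lift T \<alpha> m x s t v\<bar> \<le> b m * (t - s) powr (real (length v) * \<alpha>)"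
      if "0 \<le> s" "s < t" "t \<le> T" "v \<noteq> []" "length v \<le> rp_level \<alpha>" for m s t v
      using step[OF x that, of m] that by (simp add: dyadic_lift_eq)
    obtain Y where Y: "Y \<in> rough_paths T \<alpha>" "\<And>m. rp_dist T \<alpha> (dyadic_lift T \<alpha> m x) Y \<le> ?N * (\<Sum>i. b (i + m))"
      using rough_path_limit[OF dyadic_lift_rough_path[OF T \<alpha>] \<alpha>(1) b st] by blast
    have lm: "limitin (rp_topology T \<alpha>) (\<lambda>l. dyadic_lift T \<alpha> l x) Y sequentially"
      unfolding rp_topology_def R.limitin_metric
    proof (intro conjI allI impI Y(1))
      fix \<epsilon> :: real assume "0 < \<epsilon>"
      from order_tendstoD(2)[OF t0 this]
      show "\<forall>\<^sub>F l in sequentially. dyadic_lift T \<alpha> l x \<in> rough_paths T \<alpha> \<and> rp_dist T \<alpha> (dyadic_lift T \<alpha> l x) Y < \<epsilon>"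
        by eventually_elim (use Y(2) le_less_trans dyadic_lift_rough_path[OF T \<alpha>] in blast)
    qed
    have xC: "x \<in> C0 T" using x S by blast
    have g: "dyadic_lift T \<alpha> l x \<in> geometric_rough_paths T \<alpha>" for l by (rule dyadic_lift_geometric[OF T \<alpha> xC])
    \<comment> \<open>The limit was found among all rough paths; the geometric ones form a closed
      set, so it also is a limit in the subspace.\<close>
    have "Y \<in> geometric_rough_paths T \<alpha>"
      unfolding geometric_rough_paths_def
      by (rule limitin_closedin[OF lm closedin_closure_of]) (use g in \<open>auto simp: geometric_rough_paths_def\<close>)
    hence "?lim x Y" using lm g by (simp add: geometric_rp_topology_def limitin_subtopology)
    thus ?thesis using Y by blast
  qed
  have unique: "X = Y" if "?lim x X" "?lim x Y" for x :: "'d path" and X Y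
    using that R.limitin_metric_unique[of "\<lambda>l. dyadic_lift T \<alpha> l x" X sequentially Y]
    by (simp add: geometric_rp_topology_def limitin_subtopology rp_topology_def)
  show sub: "S \<subseteq> lift_domain T \<alpha> B" using limit S(1) unfolding lift_domain_def by blast
  have val: "?lim x (rp_lift T \<alpha> B x) \<and> rp_lift T \<alpha> B x \<in> rough_paths T \<alpha> \<and>
     (\<forall>m. rp_dist T \<alpha> (dyadic_lift T \<alpha> m x) (rp_lift T \<alpha> B x) \<le> ?N * (\<Sum>i. b (i + m)))" if x: "x \<in> S" for x
  proof -
    obtain Y where Y: "?lim x Y" "Y \<in> rough_paths T \<alpha>" "\<forall>m. rp_dist T \<alpha> (dyadic_lift T \<alpha> m x) Y \<le> ?N * (\<Sum>i. b (i + m))"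
      using limit[OF x] by blast
    have "(THE X. ?lim x X) = Y" using Y(1) unique by (intro the_equality) blast+
    hence "rp_lift T \<alpha> B x = Y" using sub x by (auto simp: rp_lift_def)
    thus ?thesis using Y by simp
  qed
  have "continuous_map (top_of_set S) (rp_topology T \<alpha>) (rp_lift T \<alpha> B)"
    unfolding rp_topology_def
  proof (rule R.continuous_map_uniform_limit[where f = "dyadic_lift T \<alpha>" and F = sequentially])
    show "\<forall>\<^sub>F l in sequentially. continuous_map (top_of_set S) R.mtopology (dyadic_lift T \<alpha> l)"
      by (intro always_eventually allI) (rule dyadic_lift_continuous[OF T \<alpha>, unfolded rp_topology_def])
    fix \<epsilon> :: real assume "0 < \<epsilon>"
    from order_tendstoD(2)[OF t0 this]
    show "\<forall>\<^sub>F l in sequentially. \<forall>x\<in>topspace (top_of_set S). rp_lift T \<alpha> B x \<in> rough_paths T \<alpha> \<and>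
        rp_dist T \<alpha> (dyadic_lift T \<alpha> l x) (rp_lift T \<alpha> B x) < \<epsilon>"
    proof eventually_elim
      case (elim l)
      show ?case
      proof
        fix x assume "x \<in> topspace (top_of_set S)"
        hence "x \<in> S" by simp
        from val[OF this] elim show "rp_lift T \<alpha> B x \<in> rough_paths T \<alpha> \<and> rp_dist T \<alpha> (dyadic_lift T \<alpha> l x) (rp_lift T \<alpha> B x) < \<epsilon>"
          by (meson le_less_trans)
      qed
    qed
  qed simp
  moreover have "rp_lift T \<alpha> B x \<in> geometric_rough_paths T \<alpha>" if "x \<in> S" for x
    using val[OF that] by (simp add: geometric_rp_topology_def limitin_subtopology)
  ultimately show "continuous_map (top_of_set S) (geometric_rp_topology T \<alpha>) (rp_lift T \<alpha> B)"
    by (auto simp: geometric_rp_topology_def continuous_map_in_subtopology)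
qed

lemma rp_lift_in_topspace:
  fixes B :: "'d::finite path wiener_space"
  assumes T: "0 < T" and \<alpha>: "0 \<le> \<alpha>" "\<alpha> \<le> 1"
  shows "rp_lift T \<alpha> B \<in> wspace B \<rightarrow> topspace (geometric_rp_topology T \<alpha>)"
proof
  interpret R: Metric_space "rough_paths T \<alpha> :: 'd two_param set" "rp_dist T \<alpha>" by (rule Metric_space_rough_paths)
  let ?lim = "\<lambda>x X. limitin (geometric_rp_topology T \<alpha>) (\<lambda>l. dyadic_lift T \<alpha> l x) X sequentially"
  fix x assume "x \<in> wspace B"
  show "rp_lift T \<alpha> B x \<in> topspace (geometric_rp_topology T \<alpha>)"
  proof (cases "x \<in> lift_domain T \<alpha> B")
    case True
    then obtain Y where Y: "?lim x Y" by (auto simp: lift_domain_def)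
    have "(THE X. ?lim x X) = Y"
    proof (rule the_equality[of "?lim x", OF Y])
      fix X assume "?lim x X"
      thus "X = Y" using Y R.limitin_metric_unique[of "\<lambda>l. dyadic_lift T \<alpha> l x" X sequentially Y]
        by (simp add: geometric_rp_topology_def limitin_subtopology rp_topology_def)
    qed
    thus ?thesis using True Y limitin_topspace[OF Y] by (simp add: rp_lift_def)
  next
    case False
    have "geometric_rough_paths T \<alpha> \<subseteq> topspace (rp_topology T \<alpha> :: 'd two_param topology)"
      unfolding geometric_rough_paths_def by (rule closure_of_subset_topspace)
    thus ?thesis using False zero_rough_path_geometric[OF T \<alpha>, where ?'d = 'd] by (auto simp: rp_lift_def geometric_rp_topology_def)
  qed
qed

section \<open>Consecutive dyadic approximations\<close>

lemma dyadic_integral_multiplicative: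
  assumes T: "0 < T"
  shows "multiplicative m T (dyadic_integral T l x)"
  unfolding multiplicative_def
proof (intro conjI allI impI)
  fix s :: real and v :: "'a list" assume a: "v \<noteq> []" "0 \<le> s" "s \<le> T"
  obtain L where "\<And>v s t. 0 \<le> s \<Longrightarrow> s \<le> t \<Longrightarrow> t \<le> T \<Longrightarrow> \<bar>dyadic_integral T l x v s t\<bar> \<le> (L * (t - s)) ^ length v"
    using dyadic_integral_bound[OF T, of l x] by blast
  from this[of s s v] a show "dyadic_integral T l x v s s = 0" by (simp add: power_0_left)
next
  fix s u t :: real and v :: "'a list" assume "0 \<le> s" "s \<le> u" "u \<le> t" "t \<le> T"
  thus "dyadic_integral T l x v s t = tensor_mult (\<lambda>v. dyadic_integral T l x v s u) (\<lambda>v. dyadic_integral T l x v u t) v"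
    unfolding tensor_mult_def by (rule dyadic_integral_chen[OF T])
qed (rule dyadic_integral_Nil[OF T])

lemma dyadic_integral_cell:
  assumes T: "0 < T" and k: "k < 2 ^ l"
  shows "dyadic_integral T l x v (grid T l k) (grid T l (Suc k)) =
    (\<Prod>i\<leftarrow>v. cell_increment T l k i x) / fact (length v)"
proof -
  have "2 ^ l / T * (real (Suc k) * T / 2 ^ l - real k * T / 2 ^ l) = 1"
    using T by (simp add: field_simps)
  thus ?thesis
    using dyadic_integral_on_cell[OF T k, of "real k * T / 2 ^ l" "real (Suc k) * T / 2 ^ l" x v] T
    by (simp add: grid_def divide_right_mono)
qed

lemma dyadic_integral_increment:
  assumes T: "0 < T" and pq: "p \<le> q" "q \<le> 2 ^ m"
  shows "dyadic_integral T m x [i] (grid T m p) (grid T m q) =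
    apply_bcontfun x (grid T m q) $ i - apply_bcontfun x (grid T m p) $ i"
proof -
  have "0 \<le> grid T m p" "grid T m p \<le> grid T m q" "grid T m q \<le> T"
    using T pq grid_range[of T p m] grid_range[of T q m] grid_mono[of T p q m] by auto
  from dyadic_integral_single[OF T this, of m x i] show ?thesis
    using dyadic_interpolation_grid[OF T, of p m x] dyadic_interpolation_grid[OF T, of q m x] pq
    by (simp add: grid_def)
qed

text \<open>The antisymmetrized product of the increments over the two halves of the cell
  \<open>l\<close> of level \<open>m\<close>. Half of it is what refining this cell adds to the
  second level, an area of Levy type.\<close>

definition bracket :: "real \<Rightarrow> nat \<Rightarrow> nat \<Rightarrow> 'd \<Rightarrow> 'd \<Rightarrow> 'd::finite path \<Rightarrow> real" where
  "bracket T m l i j x =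
     cell_increment T (Suc m) (2 * l) i x * cell_increment T (Suc m) (Suc (2 * l)) j x -
     cell_increment T (Suc m) (Suc (2 * l)) i x * cell_increment T (Suc m) (2 * l) j x"

lemma grid_double: "grid T m p = grid T (Suc m) (2 * p)"
  by (simp add: grid_def)

lemma cell_increment_split:
  "cell_increment T m l i x = cell_increment T (Suc m) (2 * l) i x + cell_increment T (Suc m) (Suc (2 * l)) i x"
proof -
  have "real (Suc l) * T / 2 ^ m = real (Suc (Suc (2 * l))) * T / 2 ^ Suc m" "real l * T / 2 ^ m = real (2 * l) * T / 2 ^ Suc m"
    by (simp_all add: field_simps)
  thus ?thesis by (simp only: cell_increment_def)
qed

lemma cell_increment_point:
  "cell_increment T m l i x = apply_bcontfun x (grid T m (Suc l)) $ i - apply_bcontfun x (grid T m l) $ i"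
  by (simp add: cell_increment_def grid_def)

context
  fixes T :: real and x :: "'d::finite path"
  assumes T: "0 < T"
begin

lemma dyadic_integral_split_cell:
  assumes "l < 2 ^ m"
  shows "dyadic_integral T (Suc m) x v (grid T m l) (grid T m (Suc l)) =
    (\<Sum>j\<le>length v. ((\<Prod>i\<leftarrow>take j v. cell_increment T (Suc m) (2 * l) i x) / fact j) *
       ((\<Prod>i\<leftarrow>drop j v. cell_increment T (Suc m) (Suc (2 * l)) i x) / fact (length v - j)))"
proof -
  let ?g = "grid T (Suc m)"
  have l: "2 * l < 2 ^ Suc m" "Suc (2 * l) < 2 ^ Suc m" "Suc (Suc (2 * l)) \<le> 2 ^ Suc m" using assms by auto
  have "0 \<le> ?g (2 * l)" "?g (2 * l) \<le> ?g (Suc (2 * l))" "?g (Suc (2 * l)) \<le> ?g (Suc (Suc (2 * l)))" "?g (Suc (Suc (2 * l))) \<le> T"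
    using T grid_range(1)[of T "2 * l" "Suc m"] grid_range(2)[OF _ l(3), of T] l by (auto intro!: grid_mono)
  from dyadic_integral_chen[OF T this, of "Suc m" x v]
  show ?thesis
    unfolding dyadic_integral_cell[OF T l(1)] dyadic_integral_cell[OF T l(2)] grid_double[of T m]
    by (simp add: min_absorb2)
qed

lemma chen_step:
  assumes "p \<le> q" "Suc q \<le> 2 ^ m"
  shows "dyadic_integral T m' x v (grid T m p) (grid T m (Suc q)) =
    (\<Sum>j\<le>length v. dyadic_integral T m' x (take j v) (grid T m p) (grid T m q) *
       dyadic_integral T m' x (drop j v) (grid T m q) (grid T m (Suc q)))"
proof (rule dyadic_integral_chen[OF T])
  show "0 \<le> grid T m p" "grid T m (Suc q) \<le> T"
    using T assms by (auto intro: grid_range)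
  show "grid T m p \<le> grid T m q" "grid T m q \<le> grid T m (Suc q)"
    using T assms by (auto intro!: grid_mono)
qed

text \<open>Grid points of level \<open>m\<close> are nodes of both interpolations.\<close>

lemma dyadic_difference_1:
  assumes "p \<le> q" "q \<le> 2 ^ m"
  shows "dyadic_integral T (Suc m) x [i] (grid T m p) (grid T m q) =
    dyadic_integral T m x [i] (grid T m p) (grid T m q)"
  using dyadic_integral_increment[OF T, of "2 * p" "2 * q" "Suc m" x i] dyadic_integral_increment[OF T, of p q m x i] assms
  by (simp add: grid_double[of T m])

text \<open>With \<open>a\<close>, \<open>b\<close> the increments over the halves of a cell, the
  refined path contributes \<open>a_i a_j / 2 + a_i b_j + b_i b_j / 2\<close> and the coarse one
  \<open>(a_i + b_i) (a_j + b_j) / 2\<close>. The other terms of Chen's relation involve only first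
  levels, which agree, so the cell differences add up.\<close>

lemma dyadic_difference_2:
  assumes "p \<le> q" "q \<le> 2 ^ m"
  shows "dyadic_integral T (Suc m) x [i, j] (grid T m p) (grid T m q) -
    dyadic_integral T m x [i, j] (grid T m p) (grid T m q) = (\<Sum>l=p..<q. bracket T m l i j x / 2)"
  using assms
proof (induction q rule: dec_induct)
  case base
  have z: "0 \<le> grid T m p" "grid T m p \<le> T" using T base by (auto intro: grid_range)
  show ?case
    using dyadic_integral_multiplicative[OF T, of 2 "Suc m" x] dyadic_integral_multiplicative[OF T, of 2 m x] z
    by (auto simp: multiplicative_def)
next
  case (step q)
  let ?A = "\<lambda>m' v. dyadic_integral T m' x v (grid T m p) (grid T m q)"
  let ?C = "\<lambda>m' v. dyadic_integral T m' x v (grid T m q) (grid T m (Suc q))"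
  have q: "q < 2 ^ m" using step by simp
  have "dyadic_integral T m' x [i, j] (grid T m p) (grid T m (Suc q)) = ?A m' [i, j] + ?A m' [i] * ?C m' [j] + ?C m' [i, j]" for m'
    using chen_step[of p q m m' "[i, j]"] step by (simp add: atMost_Suc dyadic_integral_Nil[OF T])
  moreover have "?A (Suc m) [i] = ?A m [i]" "?C (Suc m) [j] = ?C m [j]"
    using step by (auto intro!: dyadic_difference_1)
  moreover have "?C (Suc m) [i, j] - ?C m [i, j] = bracket T m q i j x / 2"
    unfolding dyadic_integral_split_cell[OF q] dyadic_integral_cell[OF T q] bracket_def
    by (simp add: atMost_Suc cell_increment_split[of T m] fact_numeral algebra_simps add_divide_distrib)
  ultimately show ?case using step by simp
qed

text \<open>A bracket of the first two letters is multiplied by the increment to the right of its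
  cell, a bracket of the last two by the increment to the left; the weights 1/3 and 1/6 account for
  the third letter falling into the cell itself. Writing the difference with long increments,
  instead of expanding these into cells, leaves a single sum over \<open>l\<close>.\<close>

lemma dyadic_difference_3:
  assumes "p \<le> q" "q \<le> 2 ^ m"
  shows "dyadic_integral T (Suc m) x [i, j, k] (grid T m p) (grid T m q) -
    dyadic_integral T m x [i, j, k] (grid T m p) (grid T m q) =
    (\<Sum>l=p..<q.
      ((apply_bcontfun x (grid T m l) $ i - apply_bcontfun x (grid T m p) $ i) / 2 +
         cell_increment T (Suc m) (2 * l) i x / 3 + cell_increment T (Suc m) (Suc (2 * l)) i x / 6) * bracket T m l j k x +
      bracket T m l i j x *
      ((apply_bcontfun x (grid T m q) $ k - apply_bcontfun x (grid T m (Suc l)) $ k) / 2 +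
         cell_increment T (Suc m) (2 * l) k x / 6 + cell_increment T (Suc m) (Suc (2 * l)) k x / 3))"
  using assms
proof (induction q rule: dec_induct)
  case base
  have z: "0 \<le> grid T m p" "grid T m p \<le> T" using T base by (auto intro: grid_range)
  show ?case
    using dyadic_integral_multiplicative[OF T, of 3 "Suc m" x] dyadic_integral_multiplicative[OF T, of 3 m x] z
    by (auto simp: multiplicative_def)
next
  case (step q)
  let ?A = "\<lambda>m' v. dyadic_integral T m' x v (grid T m p) (grid T m q)"
  let ?C = "\<lambda>m' v. dyadic_integral T m' x v (grid T m q) (grid T m (Suc q))"
  let ?e = "\<lambda>l i. apply_bcontfun x (grid T m l) $ i"
  let ?a = "\<lambda>l i. cell_increment T (Suc m) (2 * l) i x" and ?b = "\<lambda>l i. cell_increment T (Suc m) (Suc (2 * l)) i x"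
  let ?f = "\<lambda>r l. ((?e l i - ?e p i) / 2 + ?a l i / 3 + ?b l i / 6) * bracket T m l j k x +
      bracket T m l i j x * ((?e r k - ?e (Suc l) k) / 2 + ?a l k / 6 + ?b l k / 3)"
  have q: "q < 2 ^ m" using step by simp
  have chen: "dyadic_integral T m' x [i, j, k] (grid T m p) (grid T m (Suc q)) =
      ?A m' [i, j, k] + ?A m' [i, j] * ?C m' [k] + ?A m' [i] * ?C m' [j, k] + ?C m' [i, j, k]" for m'
    using chen_step[of p q m m' "[i, j, k]"] step by (simp add: atMost_Suc dyadic_integral_Nil[OF T])
  have same: "?A (Suc m) [i] = ?e q i - ?e p i" "?A m [i] = ?e q i - ?e p i" "?C (Suc m) [k] = ?e (Suc q) k - ?e q k" "?C m [k] = ?e (Suc q) k - ?e q k"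
    using step dyadic_difference_1[of p q m i] dyadic_difference_1[of q "Suc q" m k]
      dyadic_integral_increment[OF T, of p q m x i] dyadic_integral_increment[OF T, of q "Suc q" m x k] by simp_all
  have A2: "?A (Suc m) [i, j] - ?A m [i, j] = (\<Sum>l=p..<q. bracket T m l i j x / 2)"
    and C2: "?C (Suc m) [j, k] - ?C m [j, k] = bracket T m q j k x / 2"
    using dyadic_difference_2[of p q m i j] dyadic_difference_2[of q "Suc q" m j k] step by simp_all
  have C3: "?C (Suc m) [i, j, k] - ?C m [i, j, k] = (?a q i / 3 + ?b q i / 6) * bracket T m q j k x + bracket T m q i j x * (?a q k / 6 + ?b q k / 3)"
    unfolding dyadic_integral_split_cell[OF q] dyadic_integral_cell[OF T q] bracket_def
    by (simp add: atMost_Suc cell_increment_split[of T m] fact_numeral field_simps)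
  have IH: "?A (Suc m) [i, j, k] - ?A m [i, j, k] = (\<Sum>l=p..<q. ?f q l)" using step by simp
  have "(\<Sum>l=p..<Suc q. ?f (Suc q) l) = (\<Sum>l=p..<q. ?f (Suc q) l) + ?f (Suc q) q" using step by simp
  \<comment> \<open>The increments on the right end at the end of the whole interval, so appending a
    cell alters every earlier summand by its bracket times half of the new increment.\<close>
  also have "(\<Sum>l=p..<q. ?f (Suc q) l) = (\<Sum>l=p..<q. ?f q l) + (\<Sum>l=p..<q. bracket T m l i j x / 2) * (?e (Suc q) k - ?e q k)"
    unfolding sum_distrib_right sum.distrib[symmetric] by (intro sum.cong refl) (simp add: field_simps)
  finally have S: "(\<Sum>l=p..<Suc q. ?f (Suc q) l) = (\<Sum>l=p..<q. ?f q l) +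
    (\<Sum>l=p..<q. bracket T m l i j x / 2) * (?e (Suc q) k - ?e q k) + ?f (Suc q) q" by simp
  have F: "?f (Suc q) q = (?e q i - ?e p i) * (bracket T m q j k x / 2) + (?a q i / 3 + ?b q i / 6) * bracket T m q j k x + bracket T m q i j x * (?a q k / 6 + ?b q k / 3)"
    by (simp add: algebra_simps diff_divide_distrib)
  have P1: "?A (Suc m) [i, j] * (?e (Suc q) k - ?e q k) - ?A m [i, j] * (?e (Suc q) k - ?e q k) =
      (\<Sum>l=p..<q. bracket T m l i j x / 2) * (?e (Suc q) k - ?e q k)"
    by (simp only: left_diff_distrib[symmetric] A2)
  have P2: "(?e q i - ?e p i) * ?C (Suc m) [j, k] - (?e q i - ?e p i) * ?C m [j, k] = (?e q i - ?e p i) * (bracket T m q j k x / 2)"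
    by (simp only: right_diff_distrib[symmetric] C2)
  show ?case
    unfolding S F IH[symmetric] chen same P1[symmetric] P2[symmetric] using C3 by linarith
qed

text \<open>An interval of level \<open>n \<ge> m\<close> lies in one cell of level
  \<open>m\<close>, where the interpolation is affine, so the increment shrinks by
  \<open>2 ^ (n - m)\<close>. As \<open>1 / 2 \<le> q\<close>, this is at least as good as the
  required factor \<open>q\<close> per level.\<close>

lemma dyadic_integral_fine_bound:
  assumes inc: "\<And>j i. j < 2 ^ m \<Longrightarrow> \<bar>cell_increment T m j i x\<bar> \<le> K * q ^ m * r ^ m"
    and K: "0 \<le> K" and q: "1 / 2 \<le> q" and r: "0 < r" "r < 1"
    and n: "m \<le> n" "j < 2 ^ n" and v: "v \<noteq> []" "length v \<le> k"
  shows "\<bar>dyadic_integral T m x v (grid T n j) (grid T n (Suc j))\<bar> \<le> (1 + K) ^ k * r ^ m * (q ^ n) ^ length v"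
proof -
  obtain d where d: "n = m + d" using le_Suc_ex[OF n(1)] by blast
  define h where "h = j div 2 ^ d"
  have h: "h < 2 ^ m" using n(2) by (simp add: h_def d less_mult_imp_div_less power_add)
  have j1: "h * 2 ^ d \<le> j" unfolding h_def by (rule div_times_less_eq_dividend)
  have j2: "Suc j \<le> Suc h * 2 ^ d"
    using dividend_less_div_times[of "2 ^ d" j] by (simp add: h_def)
  have g: "grid T m h \<le> grid T n j" "grid T n j \<le> grid T n (Suc j)" "grid T n (Suc j) \<le> grid T m (Suc h)"
    using T j1 j2 unfolding d grid_refine[of T m d h, symmetric] grid_refine[of T m d "Suc h", symmetric]
    by (auto intro!: grid_mono)
  have len: "2 ^ m / T * (grid T n (Suc j) - grid T n j) = (1 / 2) ^ d"
    using T by (simp add: d grid_def power_add field_simps)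
  have eq: "dyadic_integral T m x v (grid T n j) (grid T n (Suc j)) =
      (\<Prod>i\<leftarrow>v. cell_increment T m h i x) * ((1 / 2) ^ d) ^ length v / fact (length v)"
    using dyadic_integral_on_cell[OF T h g[unfolded grid_def[of T m]], of x v] unfolding len .
  have pr: "\<bar>\<Prod>i\<leftarrow>u. cell_increment T m h i x\<bar> \<le> (K * q ^ m * r ^ m) ^ length u" for u
  proof (induction u)
    case (Cons i u)
    have "\<bar>cell_increment T m h i x\<bar> * \<bar>\<Prod>i\<leftarrow>u. cell_increment T m h i x\<bar> \<le> (K * q ^ m * r ^ m) * (K * q ^ m * r ^ m) ^ length u"
      using Cons inc[OF h, of i] K q r by (intro mult_mono) auto
    thus ?case by (simp add: abs_mult)
  qed simp
  have "\<bar>dyadic_integral T m x v (grid T n j) (grid T n (Suc j))\<bar> =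
      \<bar>\<Prod>i\<leftarrow>v. cell_increment T m h i x\<bar> * ((1 / 2) ^ d) ^ length v / fact (length v)"
    unfolding eq by (simp add: abs_mult)
  also have "\<dots> \<le> \<bar>\<Prod>i\<leftarrow>v. cell_increment T m h i x\<bar> * ((1 / 2) ^ d) ^ length v / 1"
    by (intro divide_left_mono) auto
  also have "\<dots> \<le> (K * q ^ m * r ^ m) ^ length v * (q ^ d) ^ length v / 1"
    using pr[of v] q K r by (intro divide_right_mono mult_mono power_mono) auto
  also have "\<dots> = K ^ length v * (r ^ m) ^ length v * (q ^ n) ^ length v"
    by (simp add: d power_add power_mult_distrib mult_ac)
  also have "\<dots> \<le> (1 + K) ^ k * r ^ m * (q ^ n) ^ length v"
  proof (intro mult_right_mono mult_mono)
    have "K ^ length v \<le> (1 + K) ^ length v" using K by (intro power_mono) auto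
    also have "\<dots> \<le> (1 + K) ^ k" using K v by (intro power_increasing) auto
    finally show "K ^ length v \<le> (1 + K) ^ k" .
    show "(r ^ m) ^ length v \<le> r ^ m"
      using power_decreasing[of 1 "length v" "r ^ m"] v r by (cases v) (auto simp: power_le_one)
  qed (use K r q in auto)
  finally show ?thesis .
qed

text \<open>On an interval of level \<open>n\<close> the interpolations up to level \<open>n\<close>
  are affine and satisfy \<open>dyadic_integral_fine_bound\<close>; those beyond differ from the one
  of level \<open>n\<close> by a geometric series of steps, which gives \<open>K / (1 - r)\<close>.
  The difference of levels \<open>m\<close> and \<open>m + 1\<close> is assumed to be small if
  \<open>n \<le> m\<close> (and is zero for single letters); if \<open>m < n\<close>, both terms are
  small separately, whence the factor 2.\<close>

lemma dyadically_close_of_bounds: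
  assumes inc: "\<And>n j i. j < 2 ^ n \<Longrightarrow> \<bar>cell_increment T n j i x\<bar> \<le> K * q ^ n * r ^ n"
    and diff: "\<And>m n j v. n \<le> m \<Longrightarrow> j < 2 ^ n \<Longrightarrow> 2 \<le> length v \<Longrightarrow> length v \<le> k \<Longrightarrow>
      \<bar>dyadic_integral T (Suc m) x v (grid T n j) (grid T n (Suc j)) -
       dyadic_integral T m x v (grid T n j) (grid T n (Suc j))\<bar> \<le> K * r ^ m * (q ^ n) ^ length v"
    and K: "0 \<le> K" and q: "1 / 2 \<le> q" and r: "0 < r" "r < 1"
  shows "dyadically_close k T (2 * (1 + K) ^ k + K / (1 - r)) (r ^ m) q (dyadic_integral T (Suc m) x) (dyadic_integral T m x)"
  unfolding dyadically_close_def Let_def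
proof (intro allI impI conjI)
  fix n j :: nat and v :: "'d list" assume j: "j < 2 ^ n" and v: "v \<noteq> []" "length v \<le> k"
  let ?A = "\<lambda>m. dyadic_integral T m x v (grid T n j) (grid T n (Suc j))"
  let ?K = "2 * (1 + K) ^ k + K / (1 - r)"
  let ?q = "(q ^ n) ^ length v"
  have q0: "0 \<le> ?q" using q by simp
  have fine: "\<bar>?A l\<bar> \<le> (1 + K) ^ k * r ^ l * ?q" if "l \<le> n" for l
    by (rule dyadic_integral_fine_bound[OF inc K q r that j v])
  have Kk: "0 \<le> (1 + K) ^ k" "0 \<le> K / (1 - r)" using K r by simp_all
  have diff': "\<bar>?A (Suc l) - ?A l\<bar> \<le> K * r ^ l * ?q" if nl: "n \<le> l" for l
  proof (cases "2 \<le> length v")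
    case True
    thus ?thesis using diff[OF nl j] v by blast
  next
    case False
    moreover have "length v \<noteq> 0" using v by simp
    ultimately have "length v = 1" by linarith
    then obtain i where i: "v = [i]" by (cases v) auto
    obtain d where d: "l = n + d" using le_Suc_ex[OF nl] by blast
    have "Suc j * 2 ^ d \<le> 2 ^ n * 2 ^ d" using j by (intro mult_right_mono) auto
    hence "?A (Suc l) = ?A l"
      using dyadic_difference_1[of "j * 2 ^ d" "Suc j * 2 ^ d" l i]
      by (simp only: i d grid_refine power_add mult_le_mono1 le_SucI order.refl)
    thus ?thesis using K r q by simp
  qed
  have bound: "\<bar>?A l\<bar> \<le> ?K * ?q" for l
  proof (cases "l \<le> n")
    case True
    have "(1 + K) ^ k * r ^ l * ?q \<le> (1 + K) ^ k * 1 * ?q"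
      using Kk q0 r by (intro mult_right_mono mult_left_mono power_le_one) auto
    also have "\<dots> \<le> ?K * ?q" using Kk q0 by (intro mult_right_mono) auto
    finally show ?thesis using fine[OF True] by simp
  next
    case False
    hence "n \<le> l" by simp
    then obtain d where d: "l = n + d" using le_Suc_ex by blast
    have "\<bar>?A (n + d)\<bar> \<le> ((1 + K) ^ k + K * (\<Sum>i<d. r ^ (n + i))) * ?q" for d
    proof (induction d)
      case 0
      have "(1 + K) ^ k * r ^ n * ?q \<le> (1 + K) ^ k * 1 * ?q"
        using Kk q0 r by (intro mult_right_mono mult_left_mono power_le_one) auto
      thus ?case using fine[of n] by simp
    next
      case (Suc d)
      have "\<bar>?A (n + Suc d)\<bar> \<le> \<bar>?A (n + d)\<bar> + \<bar>?A (Suc (n + d)) - ?A (n + d)\<bar>" by simp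
      also have "\<dots> \<le> ((1 + K) ^ k + K * (\<Sum>i<d. r ^ (n + i))) * ?q + K * r ^ (n + d) * ?q"
        using Suc diff'[of "n + d"] by (intro add_mono) auto
      also have "\<dots> = ((1 + K) ^ k + K * (\<Sum>i<Suc d. r ^ (n + i))) * ?q" by (simp add: algebra_simps)
      finally show ?case .
    qed
    hence "\<bar>?A l\<bar> \<le> ((1 + K) ^ k + K * (\<Sum>i<d. r ^ (n + i))) * ?q" unfolding d .
    also have "\<dots> \<le> ?K * ?q"
    proof (intro mult_right_mono q0)
      have "(\<Sum>i<d. r ^ (n + i)) \<le> (\<Sum>i<d. r ^ i)" using r by (intro sum_mono power_decreasing) auto
      also have "\<dots> \<le> 1 / (1 - r)" using r by (simp add: sum_gp_strict divide_right_mono)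
      finally have "K * (\<Sum>i<d. r ^ (n + i)) \<le> K * (1 / (1 - r))" using K by (rule mult_left_mono)
      thus "(1 + K) ^ k + K * (\<Sum>i<d. r ^ (n + i)) \<le> ?K" using Kk by simp
    qed
    finally show ?thesis .
  qed
  show "\<bar>?A (Suc m)\<bar> \<le> ?K * ?q" "\<bar>?A m\<bar> \<le> ?K * ?q" by (rule bound)+
  show "\<bar>?A (Suc m) - ?A m\<bar> \<le> ?K * r ^ m * ?q"
  proof (cases "n \<le> m")
    case True
    have "K \<le> K / (1 - r)" using K r by (simp add: le_divide_eq mult_left_le)
    hence "K * r ^ m * ?q \<le> ?K * r ^ m * ?q" using q0 r Kk by (intro mult_right_mono) auto
    thus ?thesis using diff'[OF True] by simp
  next
    case False
    have "(1 + K) ^ k * r ^ Suc m * ?q \<le> (1 + K) ^ k * r ^ m * ?q"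
      using Kk q0 r by (intro mult_right_mono mult_left_mono power_decreasing) auto
    hence "\<bar>?A (Suc m) - ?A m\<bar> \<le> 2 * (1 + K) ^ k * r ^ m * ?q" using fine[of "Suc m"] fine[of m] False by simp
    also have "\<dots> \<le> ?K * r ^ m * ?q" using q0 r Kk by (intro mult_right_mono) auto
    finally show ?thesis .
  qed
qed

end

section \<open>Covariances of dyadic increments\<close>

text \<open>Interpolation between \<open>\<ell>\<^sup>\<rho>\<close> and \<open>\<ell>\<^sup>\<infinity>\<close>: after normalization, \<open>a b \<le> (a\<^sup>2 + b\<^sup>2) / 2\<close> and \<open>a\<^sup>2 \<le> \<eta> powr (2 - \<rho>) * a powr \<rho>\<close>.\<close>

lemma sum_product_le:
  fixes x y :: "'a \<Rightarrow> real"
  assumes A: "finite A" and \<rho>: "1 \<le> \<rho>" "\<rho> < 2" and \<eta>: "0 < \<eta>" and X: "0 < X" and Y: "0 < Y"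
    and x: "\<And>k. k \<in> A \<Longrightarrow> \<bar>x k\<bar> \<le> \<eta> * X" "(\<Sum>k\<in>A. \<bar>x k\<bar> powr \<rho>) \<le> X powr \<rho>"
    and y: "\<And>k. k \<in> A \<Longrightarrow> \<bar>y k\<bar> \<le> \<eta> * Y" "(\<Sum>k\<in>A. \<bar>y k\<bar> powr \<rho>) \<le> Y powr \<rho>"
  shows "(\<Sum>k\<in>A. \<bar>x k\<bar> * \<bar>y k\<bar>) \<le> \<eta> powr (2 - \<rho>) * X * Y"
proof -
  have sq: "(\<Sum>k\<in>A. (\<bar>z k\<bar> / Z)\<^sup>2) \<le> \<eta> powr (2 - \<rho>)"
    if Z: "0 < Z" and z: "\<And>k. k \<in> A \<Longrightarrow> \<bar>z k\<bar> \<le> \<eta> * Z" "(\<Sum>k\<in>A. \<bar>z k\<bar> powr \<rho>) \<le> Z powr \<rho>" for z :: "'a \<Rightarrow> real" and Z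
  proof -
    have "(\<bar>z k\<bar> / Z)\<^sup>2 \<le> \<eta> powr (2 - \<rho>) * (\<bar>z k\<bar> powr \<rho> / Z powr \<rho>)" if k: "k \<in> A" for k
    proof (cases "z k = 0")
      case False
      define a where "a = \<bar>z k\<bar> / Z"
      have a: "0 < a" "a \<le> \<eta>" using False Z z(1)[OF k] by (simp_all add: a_def divide_le_eq)
      have "a\<^sup>2 = a powr (2 - \<rho>) * a powr \<rho>" using a by (simp flip: powr_add)
      also have "\<dots> \<le> \<eta> powr (2 - \<rho>) * a powr \<rho>" using a \<rho> by (intro mult_right_mono powr_mono2) auto
      finally show ?thesis using Z by (simp add: a_def powr_divide)
    qed simp
    hence "(\<Sum>k\<in>A. (\<bar>z k\<bar> / Z)\<^sup>2) \<le> (\<Sum>k\<in>A. \<eta> powr (2 - \<rho>) * (\<bar>z k\<bar> powr \<rho> / Z powr \<rho>))" by (rule sum_mono)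
    also have "\<dots> = \<eta> powr (2 - \<rho>) * ((\<Sum>k\<in>A. \<bar>z k\<bar> powr \<rho>) / Z powr \<rho>)"
      by (simp add: sum_distrib_left sum_divide_distrib)
    also have "\<dots> \<le> \<eta> powr (2 - \<rho>) * 1" using z(2) Z by (intro mult_left_mono) auto
    finally show ?thesis by simp
  qed
  have "\<bar>x k\<bar> * \<bar>y k\<bar> \<le> X * Y * (((\<bar>x k\<bar> / X)\<^sup>2 + (\<bar>y k\<bar> / Y)\<^sup>2) / 2)" for k
  proof -
    have "(\<bar>x k\<bar> / X) * (\<bar>y k\<bar> / Y) \<le> ((\<bar>x k\<bar> / X)\<^sup>2 + (\<bar>y k\<bar> / Y)\<^sup>2) / 2"
      using sum_squares_bound[of "\<bar>x k\<bar> / X" "\<bar>y k\<bar> / Y"] by (simp add: mult_ac)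
    hence "X * Y * ((\<bar>x k\<bar> / X) * (\<bar>y k\<bar> / Y)) \<le> X * Y * (((\<bar>x k\<bar> / X)\<^sup>2 + (\<bar>y k\<bar> / Y)\<^sup>2) / 2)"
      using X Y by (intro mult_left_mono) auto
    thus ?thesis using X Y by simp
  qed
  hence "(\<Sum>k\<in>A. \<bar>x k\<bar> * \<bar>y k\<bar>) \<le> (\<Sum>k\<in>A. X * Y * (((\<bar>x k\<bar> / X)\<^sup>2 + (\<bar>y k\<bar> / Y)\<^sup>2) / 2))" by (rule sum_mono)
  also have "\<dots> = X * Y * (((\<Sum>k\<in>A. (\<bar>x k\<bar> / X)\<^sup>2) + (\<Sum>k\<in>A. (\<bar>y k\<bar> / Y)\<^sup>2)) / 2)"
    by (simp only: sum_distrib_left[symmetric] sum_divide_distrib[symmetric] sum.distrib)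
  also have "\<dots> \<le> X * Y * ((\<eta> powr (2 - \<rho>) + \<eta> powr (2 - \<rho>)) / 2)"
    using sq[OF X x] sq[OF Y y] X Y by (intro mult_left_mono divide_right_mono add_mono) auto
  finally show ?thesis by (simp add: mult_ac)
qed

text \<open>The stretch of length \<open>r\<close> is cut according to the binary digits of
  \<open>r\<close>, the largest block first; a digit that is set costs the bound for its block size
  once.\<close>

lemma dyadic_prefix_bound:
  fixes f :: "nat \<Rightarrow> real"
  assumes "\<And>e' k. e' \<le> e \<Longrightarrow> Suc k * 2 ^ e' \<le> L \<Longrightarrow> \<bar>f (Suc k * 2 ^ e') - f (k * 2 ^ e')\<bar> \<le> M e'"
    and "\<And>e. 0 \<le> M e" and "s * 2 ^ e + r \<le> L" and "r < 2 ^ Suc e"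
  shows "\<bar>f (s * 2 ^ e + r) - f (s * 2 ^ e)\<bar> \<le> (\<Sum>e'\<le>e. M e')"
  using assms(1,3,4)
proof (induction e arbitrary: s r)
  case 0
  have "r = 0 \<or> r = 1" using "0.prems"(3) by auto
  thus ?case using "0.prems"(1)[of 0 s] "0.prems"(2) assms(2)[of 0] by auto
next
  case (Suc e)
  have hyp: "\<bar>f (Suc k * 2 ^ e') - f (k * 2 ^ e')\<bar> \<le> M e'" if "e' \<le> e" "Suc k * 2 ^ e' \<le> L" for e' k
    using Suc.prems(1) that by simp
  show ?case
  proof (cases "r < 2 ^ Suc e")
    case True
    have "\<bar>f (2 * s * 2 ^ e + r) - f (2 * s * 2 ^ e)\<bar> \<le> (\<Sum>e'\<le>e. M e')"
      by (rule Suc.IH[OF hyp]) (use Suc.prems True in \<open>auto simp: mult_ac\<close>)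
    thus ?thesis using assms(2)[of "Suc e"] by (simp add: mult_ac)
  next
    case False
    define r' where "r' = r - 2 ^ Suc e"
    have r: "r = 2 ^ Suc e + r'" using False by (simp add: r'_def)
    have "\<bar>f (2 * Suc s * 2 ^ e + r') - f (2 * Suc s * 2 ^ e)\<bar> \<le> (\<Sum>e'\<le>e. M e')"
      by (rule Suc.IH[OF hyp]) (use Suc.prems r in \<open>auto simp: algebra_simps\<close>)
    moreover have "\<bar>f (Suc s * 2 ^ Suc e) - f (s * 2 ^ Suc e)\<bar> \<le> M (Suc e)"
      by (rule Suc.prems(1)) (use Suc.prems r in \<open>auto simp: algebra_simps\<close>)
    moreover have "2 * Suc s * 2 ^ e + r' = s * 2 ^ Suc e + r" "2 * Suc s * 2 ^ e = Suc s * 2 ^ Suc e"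
      unfolding r by (simp_all add: algebra_simps)
    ultimately have "\<bar>f (s * 2 ^ Suc e + r) - f (Suc s * 2 ^ Suc e)\<bar> \<le> (\<Sum>e'\<le>e. M e')"
      "\<bar>f (Suc s * 2 ^ Suc e) - f (s * 2 ^ Suc e)\<bar> \<le> M (Suc e)" by (simp_all only:)
    thus ?thesis unfolding sum.atMost_Suc by linarith
  qed
qed

text \<open>The sum is at most \<open>D + 1\<close> times its largest term. The lost power of
  \<open>D\<close> is affordable, since \<open>eps D\<close> decays geometrically.\<close>

lemma powr_sum_le:
  fixes M :: "nat \<Rightarrow> real"
  assumes "1 \<le> \<rho>" "\<And>e. 0 \<le> M e"
  shows "(\<Sum>e\<le>D. M e) powr \<rho> \<le> (real D + 1) powr \<rho> * (\<Sum>e\<le>D. M e powr \<rho>)"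
proof -
  obtain e where e: "e \<le> D" "\<And>e'. e' \<le> D \<Longrightarrow> M e' \<le> M e"
    using finite_set_choice[of "{..D}"] Max_in[of "M ` {..D}"] Max_ge[of "M ` {..D}"] by fastforce
  have "(\<Sum>e\<le>D. M e) \<le> (real D + 1) * M e" using sum_bounded_above[of "{..D}" M "M e"] e(2) by (simp add: add.commute)
  hence "(\<Sum>e\<le>D. M e) powr \<rho> \<le> ((real D + 1) * M e) powr \<rho>" using assms by (intro powr_mono2 sum_nonneg) auto
  also have "\<dots> = (real D + 1) powr \<rho> * M e powr \<rho>" using assms by (simp add: powr_mult)
  also have "\<dots> \<le> (real D + 1) powr \<rho> * (\<Sum>e\<le>D. M e powr \<rho>)"
    using e(1) by (intro mult_left_mono member_le_sum) auto
  finally show ?thesis .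
qed

section \<open>Covariances and Wick moments under the variation bound\<close>

locale controlled_gaussian_path = gaussian_path M T w
  for M :: "'a measure" and T :: real and w :: "real \<Rightarrow> 'a \<Rightarrow> real ^ 'd::finite" +
  fixes \<rho> C :: real
  assumes \<rho>: "1 \<le> \<rho>" "\<rho> < 2" and C_pos: "0 < C"
    and control: "\<And>i s t. 0 \<le> s \<Longrightarrow> s \<le> t \<Longrightarrow> t \<le> T \<Longrightarrow>
      rho_variation \<rho> (incr_cov M (\<lambda>r \<omega>. w r \<omega> $ i)) s t s t \<le> ennreal (C * (t - s) powr (1 / \<rho>))"
begin

lemma variation_le:
  assumes st: "0 \<le> s" "s \<le> t" "t \<le> T" and p: "p \<in> partitions s t" "p' \<in> partitions s t"
  shows "(\<Sum>j<length p - 1. \<Sum>k<length p' - 1. \<bar>incr_cov M (\<lambda>r \<omega>. w r \<omega> $ i) (p ! j) (p ! Suc j) (p' ! k) (p' ! Suc k)\<bar> powr \<rho>)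
    \<le> (C * (t - s) powr (1 / \<rho>)) powr \<rho>"
proof -
  let ?S = "\<Sum>j<length p - 1. \<Sum>k<length p' - 1. \<bar>incr_cov M (\<lambda>r \<omega>. w r \<omega> $ i) (p ! j) (p ! Suc j) (p' ! k) (p' ! Suc k)\<bar> powr \<rho>"
  have S: "0 \<le> ?S" by (intro sum_nonneg) auto
  have "ennreal (?S powr (1 / \<rho>)) \<le> rho_variation \<rho> (incr_cov M (\<lambda>r \<omega>. w r \<omega> $ i)) s t s t"
    unfolding rho_variation_def by (rule SUP_upper2[OF p(1)], rule SUP_upper2[OF p(2)]) simp
  also have "\<dots> \<le> ennreal (C * (t - s) powr (1 / \<rho>))" by (rule control[OF st])
  finally have "?S powr (1 / \<rho>) \<le> C * (t - s) powr (1 / \<rho>)"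
    using C_pos by (subst (asm) ennreal_le_iff) auto
  hence "(?S powr (1 / \<rho>)) powr \<rho> \<le> (C * (t - s) powr (1 / \<rho>)) powr \<rho>" using \<rho> by (intro powr_mono2) auto
  thus ?thesis using S \<rho> by (simp add: powr_powr)
qed

definition inc :: "nat \<Rightarrow> 'd \<Rightarrow> nat \<Rightarrow> nat \<Rightarrow> 'd path \<Rightarrow> real" where
  "inc N i u v = (\<lambda>x. ev (grid T N v) i x - ev (grid T N u) i x)"

lemma inc_form: "u \<le> 2 ^ N \<Longrightarrow> v \<le> 2 ^ N \<Longrightarrow> inc N i u v \<in> evaluation_forms T"
  unfolding inc_def using T_pos by (intro increment_form grid_range) auto

lemma cov_inc:
  assumes "u \<le> 2 ^ N" "v \<le> 2 ^ N" "u' \<le> 2 ^ N" "v' \<le> 2 ^ N"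
  shows "cov (inc N i u v) (inc N i u' v') = incr_cov M (\<lambda>r \<omega>. w r \<omega> $ i)
    (grid T N u) (grid T N v) (grid T N u') (grid T N v')"
  unfolding inc_def using T_pos assms by (intro cov_increment grid_range) auto

lemma cov_inc_independent:
  assumes ij: "i \<noteq> j" and uv: "u \<le> 2 ^ N" "v \<le> 2 ^ N" "u' \<le> 2 ^ N" "v' \<le> 2 ^ N"
  shows "cov (inc N i u v) (inc N j u' v') = 0"
proof -
  have z: "has_bochner_integral \<mu> (\<lambda>x. ev (grid T N a) i x * ev (grid T N b) j x) 0" if "a \<le> 2 ^ N" "b \<le> 2 ^ N" for a b
  proof -
    have r: "0 \<le> grid T N a" "grid T N a \<le> T" "0 \<le> grid T N b" "grid T N b \<le> T"
      using that T_pos by (auto intro: grid_range)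
    show ?thesis
      using cov_independent[OF ij r] cov_integrable[OF ev_form[OF r(1,2)] ev_form[OF r(3,4)], of i j]
      by (simp add: has_bochner_integral_iff)
  qed
  have "has_bochner_integral \<mu> (\<lambda>x. (ev (grid T N v) i x * ev (grid T N v') j x - ev (grid T N v) i x * ev (grid T N u') j x)
     - (ev (grid T N u) i x * ev (grid T N v') j x - ev (grid T N u) i x * ev (grid T N u') j x)) ((0 - 0) - (0 - 0))"
    by (intro has_bochner_integral_diff z uv)
  hence "has_bochner_integral \<mu> (\<lambda>x. inc N i u v x * inc N j u' v' x) 0"
    by (simp add: inc_def algebra_simps)
  thus ?thesis by (rule has_bochner_integral_integral_eq)
qed

lemma inc_hom: "u \<le> 2 ^ N \<Longrightarrow> v \<le> 2 ^ N \<Longrightarrow> inc N i u v \<in> hom 1"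
  using hom_form[OF inc_form] by simp

text \<open>The bound for the variance over a block of \<open>2 ^ D\<close> cells of level
  \<open>N\<close>, used as the unit for all covariances inside such a block.\<close>

definition V :: "nat \<Rightarrow> nat \<Rightarrow> real" where
  "V N D = C * (real (2 ^ D) * T / 2 ^ N) powr (1 / \<rho>)"

lemma V_pos: "0 < V N D"
  using C_pos T_pos by (simp add: V_def)

lemma grid_partition:
  assumes e: "e \<le> D" and a: "a + 2 ^ D \<le> 2 ^ N"
  shows "map (\<lambda>k. grid T N (a + k * 2 ^ e)) [0..<Suc (2 ^ (D - e))] \<in> partitions (grid T N a) (grid T N (a + 2 ^ D))"
proof -
  have "grid T N a < grid T N (a + 2 ^ D)"
    using T_pos by (simp add: grid_def divide_strict_right_mono)
  from uniform_partition[OF this, of "2 ^ (D - e)"]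
  have "map (\<lambda>k. grid T N a + real k * ((grid T N (a + 2 ^ D) - grid T N a) / real (2 ^ (D - e)))) [0..<Suc (2 ^ (D - e))]
    \<in> partitions (grid T N a) (grid T N (a + 2 ^ D))" by simp
  moreover have "grid T N a + real k * ((grid T N (a + 2 ^ D) - grid T N a) / real (2 ^ (D - e))) = grid T N (a + k * 2 ^ e)" for k
  proof -
    have "(2::real) ^ D = 2 ^ (D - e) * 2 ^ e" using e by (simp flip: power_add)
    thus ?thesis by (simp add: grid_def field_simps)
  qed
  ultimately show ?thesis by (simp only:)
qed

text \<open>The two-dimensional variation admits different partitions in the two variables; this is
  exploited with cells in one variable and blocks of \<open>2 ^ e\<close> cells in the
  other.\<close>

lemma grid_variation:
  assumes e: "e \<le> D" "e' \<le> D" and a: "a + 2 ^ D \<le> 2 ^ N"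
  shows "(\<Sum>j<2 ^ (D - e). \<Sum>k<2 ^ (D - e').
    \<bar>cov (inc N i (a + j * 2 ^ e) (a + Suc j * 2 ^ e)) (inc N i (a + k * 2 ^ e') (a + Suc k * 2 ^ e'))\<bar> powr \<rho>) \<le> V N D powr \<rho>"
proof -
  let ?p = "\<lambda>e. map (\<lambda>k. grid T N (a + k * 2 ^ e)) [0..<Suc (2 ^ (D - e))]"
  have le: "a + Suc k * 2 ^ e \<le> 2 ^ N" if "k < 2 ^ (D - e)" "e \<le> D" for k e
  proof -
    have "Suc k * 2 ^ e \<le> 2 ^ (D - e) * 2 ^ e" using that by (intro mult_right_mono) auto
    also have "\<dots> = 2 ^ D" using that by (simp flip: power_add)
    finally show ?thesis using a by simp
  qed
  have st: "0 \<le> grid T N a" "grid T N a \<le> grid T N (a + 2 ^ D)" "grid T N (a + 2 ^ D) \<le> T"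
    using T_pos a by (auto intro!: grid_range grid_mono)
  have len: "grid T N (a + 2 ^ D) - grid T N a = real (2 ^ D) * T / 2 ^ N"
    by (simp add: grid_def field_simps)
  have nth: "?p e ! k = grid T N (a + k * 2 ^ e)" if "k \<le> 2 ^ (D - e)" for k e
    using that by (simp del: upt_Suc add: nth_map)
  have "(\<Sum>j<2 ^ (D - e). \<Sum>k<2 ^ (D - e').
    \<bar>cov (inc N i (a + j * 2 ^ e) (a + Suc j * 2 ^ e)) (inc N i (a + k * 2 ^ e') (a + Suc k * 2 ^ e'))\<bar> powr \<rho>) =
    (\<Sum>j<length (?p e) - 1. \<Sum>k<length (?p e') - 1.
      \<bar>incr_cov M (\<lambda>r \<omega>. w r \<omega> $ i) (?p e ! j) (?p e ! Suc j) (?p e' ! k) (?p e' ! Suc k)\<bar> powr \<rho>)"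
  proof (rule sum.cong, simp, rule sum.cong, simp)
    fix j k assume jk: "j \<in> {..<length (?p e) - 1}" "k \<in> {..<length (?p e') - 1}"
    hence jk': "j < 2 ^ (D - e)" "k < 2 ^ (D - e')" by simp_all
    have b: "a + j * 2 ^ e \<le> 2 ^ N" "a + k * 2 ^ e' \<le> 2 ^ N" using le[OF jk'(1) e(1)] le[OF jk'(2) e(2)] by simp_all
    have n: "?p e ! j = grid T N (a + j * 2 ^ e)" "?p e ! Suc j = grid T N (a + Suc j * 2 ^ e)"
      "?p e' ! k = grid T N (a + k * 2 ^ e')" "?p e' ! Suc k = grid T N (a + Suc k * 2 ^ e')"
      using jk' by (auto simp del: upt_Suc mult_Suc intro!: nth)
    show "\<bar>cov (inc N i (a + j * 2 ^ e) (a + Suc j * 2 ^ e)) (inc N i (a + k * 2 ^ e') (a + Suc k * 2 ^ e'))\<bar> powr \<rho> =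
      \<bar>incr_cov M (\<lambda>r \<omega>. w r \<omega> $ i) (?p e ! j) (?p e ! Suc j) (?p e' ! k) (?p e' ! Suc k)\<bar> powr \<rho>"
      unfolding cov_inc[OF b(1) le[OF jk'(1) e(1)] b(2) le[OF jk'(2) e(2)]] n ..
  qed
  also have "\<dots> \<le> (C * (grid T N (a + 2 ^ D) - grid T N a) powr (1 / \<rho>)) powr \<rho>"
    by (rule variation_le[OF st grid_partition[OF e(1) a] grid_partition[OF e(2) a]])
  finally show ?thesis unfolding len V_def .
qed

lemma cov_inc_self:
  assumes "u \<le> v" "v \<le> u + 2 ^ D" "v \<le> 2 ^ N"
  shows "cov (inc N i u v) (inc N i u v) \<le> V N D"
proof (cases "u = v")
  case True
  thus ?thesis using V_pos[of N D] by (simp add: inc_def)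
next
  case False
  hence uv: "u < v" using assms by simp
  have st: "0 \<le> grid T N u" "grid T N u < grid T N v" "grid T N v \<le> T"
    using T_pos assms uv grid_range(2)[of T v N] by (auto simp: grid_def divide_strict_right_mono)
  have "[grid T N u, grid T N v] \<in> partitions (grid T N u) (grid T N v)"
    using st by (simp add: partitions_def)
  from variation_le[OF st(1) less_imp_le[OF st(2)] st(3) this this, of i]
  have "\<bar>cov (inc N i u v) (inc N i u v)\<bar> powr \<rho> \<le> (C * (grid T N v - grid T N u) powr (1 / \<rho>)) powr \<rho>"
    using assms by (subst cov_inc) auto
  also have "\<dots> \<le> V N D powr \<rho>"
  proof -
    have "real (v - u) \<le> real (2 ^ D)" unfolding of_nat_le_iff using assms by linarith
    hence "real (v - u) * T / 2 ^ N \<le> real (2 ^ D) * T / 2 ^ N" using T_pos by (intro divide_right_mono mult_right_mono) auto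
    moreover have "grid T N v - grid T N u = real (v - u) * T / 2 ^ N"
      using uv by (simp add: grid_def of_nat_diff field_simps)
    ultimately show ?thesis unfolding V_def using C_pos \<rho> st by (intro powr_mono2 mult_left_mono) auto
  qed
  finally have "\<bar>cov (inc N i u v) (inc N i u v)\<bar> \<le> V N D"
    using \<rho> V_pos[of N D] powr_less_mono2[of \<rho> "V N D" "\<bar>cov (inc N i u v) (inc N i u v)\<bar>"] by linarith
  thus ?thesis by simp
qed

lemma cov_square_le:
  assumes "A \<in> evaluation_forms T" "B \<in> evaluation_forms T"
  shows "(cov A B)\<^sup>2 \<le> cov A A * cov B B"
  using integral_Cauchy_Schwarz[of \<mu> A B] cov_integrable[OF assms] cov_integrable[OF assms(1,1)] cov_integrable[OF assms(2,2)]
  by (simp add: power2_eq_square)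

text \<open>The ratio of the variance bounds of one cell and of a block of \<open>2 ^ D\<close>
  cells. Every gain from refinement is a positive power of it.\<close>

definition eps :: "nat \<Rightarrow> real" where "eps D = 2 powr (- real D / \<rho>)"

lemma eps_pos: "0 < eps D" by (simp add: eps_def)

lemma V_cell: "V N 0 = eps D * V N D"
proof -
  have "(real (2 ^ D) * T / 2 ^ N) powr (1 / \<rho>) = (2 powr real D) powr (1 / \<rho>) * (T / 2 ^ N) powr (1 / \<rho>)"
    using T_pos by (simp add: powr_realpow flip: powr_mult)
  moreover have "2 powr (- real D / \<rho>) * (2 powr real D) powr (1 / \<rho>) = 1"
    by (simp add: powr_powr flip: powr_add)
  ultimately show ?thesis unfolding V_def eps_def by simp
qed

lemma cov_inc_le:
  assumes "u \<le> v" "v \<le> u + 2 ^ D" "v \<le> 2 ^ N" "u' \<le> v'" "v' \<le> u' + 2 ^ D'" "v' \<le> 2 ^ N"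
  shows "\<bar>cov (inc N i u v) (inc N j u' v')\<bar> \<le> sqrt (V N D * V N D')"
proof -
  have f: "inc N i u v \<in> evaluation_forms T" "inc N j u' v' \<in> evaluation_forms T" using assms by (auto intro!: inc_form)
  have "(cov (inc N i u v) (inc N j u' v'))\<^sup>2 \<le> cov (inc N i u v) (inc N i u v) * cov (inc N j u' v') (inc N j u' v')"
    by (rule cov_square_le[OF f])
  also have "\<dots> \<le> V N D * V N D'"
    by (intro mult_mono cov_inc_self assms less_imp_le[OF V_pos] integral_nonneg_AE always_eventually allI zero_le_square)
  finally have "sqrt ((cov (inc N i u v) (inc N j u' v'))\<^sup>2) \<le> sqrt (V N D * V N D')" by (rule real_sqrt_le_mono)
  thus ?thesis by simp
qed

abbreviation cell :: "nat \<Rightarrow> 'd \<Rightarrow> nat \<Rightarrow> 'd path \<Rightarrow> real" where "cell N i l \<equiv> inc N i l (Suc l)"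

lemma cov_cell_le: "k < 2 ^ N \<Longrightarrow> l < 2 ^ N \<Longrightarrow> \<bar>cov (cell N i k) (cell N j l)\<bar> \<le> eps D * V N D"
  using cov_inc_le[of k "Suc k" 0 N l "Suc l" 0 i j] V_pos[of N 0] by (simp flip: V_cell)

lemma cov_inc_diff:
  assumes "L \<in> evaluation_forms T" "a \<le> 2 ^ N" "u \<le> 2 ^ N" "v \<le> 2 ^ N"
  shows "cov L (inc N i a v) - cov L (inc N i a u) = cov L (inc N i u v)"
proof -
  have "cov L (inc N i a v) - cov L (inc N i a u) = (\<integral>x. L x * inc N i a v x - L x * inc N i a u x \<partial>\<mu>)"
    by (rule Bochner_Integration.integral_diff[symmetric]) (intro cov_integrable assms inc_form)+
  also have "\<dots> = cov L (inc N i u v)"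
    by (intro Bochner_Integration.integral_cong) (simp_all add: inc_def algebra_simps)
  finally show ?thesis .
qed

lemma shifted_sum: "(\<Sum>x\<in>{a..<a + n}. g x) = (\<Sum>j<n. g (a + j :: nat))"
  by (rule sum.reindex_bij_witness[of _ "\<lambda>j. a + j" "\<lambda>x. x - a"]) auto

text \<open>The covariance of a cell with an arbitrary grid interval is controlled by splitting the
  interval, starting from the left end point, into dyadic blocks, at most one of each size; this costs a power of \<open>D\<close>.\<close>

lemma cell_covariance_envelope:
  assumes a: "a + 2 ^ D \<le> 2 ^ N"
  obtains S where "\<And>l. 0 \<le> S l" "\<And>l. S l \<le> sqrt (eps D) * V N D"
    "\<And>l u v. a \<le> l \<Longrightarrow> l < a + 2 ^ D \<Longrightarrow> a \<le> u \<Longrightarrow> u \<le> v \<Longrightarrow> v \<le> a + 2 ^ D \<Longrightarrow> \<bar>cov (cell N i l) (inc N i u v)\<bar> \<le> S l"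
    "(\<Sum>l\<in>{a..<a + 2 ^ D}. S l powr \<rho>) \<le> (2 * (real D + 1)\<^sup>2 * V N D) powr \<rho>"
proof -
  define c where "c l e k = \<bar>cov (cell N i l) (inc N i (a + k * 2 ^ e) (a + Suc k * 2 ^ e))\<bar>" for l e k
  \<comment> \<open>The l^\<rho> norm dominates the covariance with each single block of this size,
    and its \<rho>-th powers sum over \<open>l\<close> to an expression that
    \<open>grid_variation\<close> bounds.\<close>
  define m where "m l e = (\<Sum>k<2 ^ (D - e). c l e k powr \<rho>) powr (1 / \<rho>)" for l e
  define Y where "Y l = (\<Sum>e\<le>D. m l e)" for l
  \<comment> \<open>\<open>sum_product_le\<close> asks for a bound in l^\<rho> and a uniform bound:
    \<open>2 * Y\<close> provides the former, because an interval is a difference of two prefixes,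
    and Cauchy-Schwarz provides the latter.\<close>
  define S where "S l = min (2 * Y l) (sqrt (eps D) * V N D)" for l
  have m0: "0 \<le> m l e" for l e by (simp add: m_def)
  have mp: "m l e powr \<rho> = (\<Sum>k<2 ^ (D - e). c l e k powr \<rho>)" for l e
    using \<rho> by (simp add: m_def powr_powr sum_nonneg)
  have Y0: "0 \<le> Y l" for l by (simp add: Y_def m0 sum_nonneg)
  show thesis
  proof (rule that[of S])
    show S0: "0 \<le> S l" for l using Y0 V_pos[of N D] eps_pos[of D] by (simp add: S_def)
    show "S l \<le> sqrt (eps D) * V N D" for l by (simp add: S_def)
    show "\<bar>cov (cell N i l) (inc N i u v)\<bar> \<le> S l"
      if l: "a \<le> l" "l < a + 2 ^ D" and uv: "a \<le> u" "u \<le> v" "v \<le> a + 2 ^ D" for l u v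
    proof -
      have cf: "cell N i l \<in> evaluation_forms T" using l a by (intro inc_form) auto
      define f where "f r = cov (cell N i l) (inc N i a (a + r))" for r
      have f0: "f 0 = 0" by (simp add: f_def inc_def)
      have fd: "f s - f r = cov (cell N i l) (inc N i (a + r) (a + s))" if "r \<le> 2 ^ D" "s \<le> 2 ^ D" for r s
        unfolding f_def using that a by (intro cov_inc_diff cf) auto
      have step: "\<bar>f (Suc k * 2 ^ e) - f (k * 2 ^ e)\<bar> \<le> m l e" if e: "e \<le> D" and k: "Suc k * 2 ^ e \<le> 2 ^ D" for e k
      proof -
        have kk: "k < 2 ^ (D - e)"
        proof -
          have "(2::nat) ^ D = 2 ^ (D - e) * 2 ^ e" using e by (simp flip: power_add)
          hence "Suc k * 2 ^ e \<le> 2 ^ (D - e) * 2 ^ e" using k by simp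
          hence "Suc k \<le> 2 ^ (D - e)" by (simp only: mult_le_cancel2) simp
          thus ?thesis by simp
        qed
        have "\<bar>f (Suc k * 2 ^ e) - f (k * 2 ^ e)\<bar> = c l e k"
          using k by (subst fd) (simp_all add: c_def)
        also have "\<dots> = (c l e k powr \<rho>) powr (1 / \<rho>)" using \<rho> by (simp add: powr_powr c_def)
        also have "\<dots> \<le> m l e" unfolding m_def using \<rho> kk by (intro powr_mono2 member_le_sum) auto
        finally show ?thesis .
      qed
      have pre: "\<bar>f r\<bar> \<le> Y l" if "r \<le> 2 ^ D" for r
        using dyadic_prefix_bound[of D "2 ^ D" f "m l" 0 r] step m0 that f0
        by (simp add: Y_def le_less_trans)
      have "cov (cell N i l) (inc N i u v) = f (v - a) - f (u - a)" using uv by (subst fd) auto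
      hence "\<bar>cov (cell N i l) (inc N i u v)\<bar> \<le> 2 * Y l" using pre[of "v - a"] pre[of "u - a"] uv by linarith
      moreover have "\<bar>cov (cell N i l) (inc N i u v)\<bar> \<le> sqrt (V N 0 * V N D)"
        using l uv a by (intro cov_inc_le) auto
      moreover have "sqrt (V N 0 * V N D) = sqrt (eps D) * V N D"
        using V_pos[of N D] by (simp add: V_cell[of N D] real_sqrt_mult)
      ultimately show ?thesis by (simp add: S_def)
    qed
    have "(\<Sum>l\<in>{a..<a + 2 ^ D}. S l powr \<rho>) \<le> (\<Sum>l\<in>{a..<a + 2 ^ D}. (2 * Y l) powr \<rho>)"
      using \<rho> S0 by (intro sum_mono powr_mono2) (auto simp: S_def)
    also have "\<dots> \<le> (\<Sum>l\<in>{a..<a + 2 ^ D}. 2 powr \<rho> * ((real D + 1) powr \<rho> * (\<Sum>e\<le>D. m l e powr \<rho>)))"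
    proof (rule sum_mono)
      fix l
      have "(2 * Y l) powr \<rho> = 2 powr \<rho> * Y l powr \<rho>" using Y0 by (simp add: powr_mult)
      also have "\<dots> \<le> 2 powr \<rho> * ((real D + 1) powr \<rho> * (\<Sum>e\<le>D. m l e powr \<rho>))"
        unfolding Y_def using \<rho> m0 by (intro mult_left_mono powr_sum_le) auto
      finally show "(2 * Y l) powr \<rho> \<le> 2 powr \<rho> * ((real D + 1) powr \<rho> * (\<Sum>e\<le>D. m l e powr \<rho>))" .
    qed
    also have "\<dots> = 2 powr \<rho> * ((real D + 1) powr \<rho> * (\<Sum>e\<le>D. \<Sum>l\<in>{a..<a + 2 ^ D}. m l e powr \<rho>))"
      by (subst sum.swap) (simp only: sum_distrib_left)
    also have "\<dots> \<le> 2 powr \<rho> * ((real D + 1) powr \<rho> * (\<Sum>e\<le>D. V N D powr \<rho>))"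
    proof (intro mult_left_mono sum_mono)
      fix e assume "e \<in> {..D}"
      hence "e \<le> D" by simp
      from grid_variation[OF _ this a, of 0 i]
      show "(\<Sum>l\<in>{a..<a + 2 ^ D}. m l e powr \<rho>) \<le> V N D powr \<rho>"
        unfolding mp c_def shifted_sum by simp
    qed auto
    also have "\<dots> = 2 powr \<rho> * ((real D + 1) powr (\<rho> + 1) * V N D powr \<rho>)"
      by (simp add: powr_add mult_ac)
    also have "\<dots> \<le> 2 powr \<rho> * ((real D + 1) powr (2 * \<rho>) * V N D powr \<rho>)"
      using \<rho> by (intro mult_left_mono mult_right_mono powr_mono) auto
    also have "(real D + 1) powr (2 * \<rho>) = ((real D + 1)\<^sup>2) powr \<rho>"
      by (simp add: powr_powr flip: powr_numeral)
    also have "2 powr \<rho> * (((real D + 1)\<^sup>2) powr \<rho> * V N D powr \<rho>) = (2 * (real D + 1)\<^sup>2 * V N D) powr \<rho>"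
      using V_pos[of N D] by (simp add: powr_mult)
    finally show "(\<Sum>l\<in>{a..<a + 2 ^ D}. S l powr \<rho>) \<le> (2 * (real D + 1)\<^sup>2 * V N D) powr \<rho>" .
  qed
qed

lemma cell_covariance_sum:
  assumes a: "a + 2 ^ D \<le> 2 ^ N" and L: "finite L" "inj_on \<sigma> L" "\<sigma> ` L \<subseteq> {a..<a + 2 ^ D}"
  shows "(\<Sum>p\<in>L \<times> L. \<bar>cov (cell N i (\<sigma> (fst p))) (cell N i (\<sigma> (snd p)))\<bar> powr \<rho>) \<le> V N D powr \<rho>"
proof -
  let ?I = "{a..<a + 2 ^ D}" and ?g = "\<lambda>p. \<bar>cov (cell N i (fst p)) (cell N i (snd p))\<bar> powr \<rho>"
  have inj: "inj_on (map_prod \<sigma> \<sigma>) (L \<times> L)" by (rule map_prod_inj_on[OF L(2,2)])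
  have "(\<Sum>p\<in>L \<times> L. \<bar>cov (cell N i (\<sigma> (fst p))) (cell N i (\<sigma> (snd p)))\<bar> powr \<rho>) = sum ?g (map_prod \<sigma> \<sigma> ` (L \<times> L))"
    by (subst sum.reindex[OF inj]) simp
  also have "\<dots> \<le> sum ?g (?I \<times> ?I)" using L by (intro sum_mono2) auto
  also have "\<dots> = (\<Sum>j\<in>?I. \<Sum>k\<in>?I. ?g (j, k))" by (simp add: sum.cartesian_product case_prod_beta)
  also have "\<dots> \<le> V N D powr \<rho>" using grid_variation[OF _ _ a, of 0 0 i] by (simp add: shifted_sum)
  finally show ?thesis .
qed

lemma second_moment_expand:
  assumes "finite L" "\<And>l. l \<in> L \<Longrightarrow> F l \<in> hom n"
  shows "(\<integral>x. (\<Sum>l\<in>L. F l x)\<^sup>2 \<partial>\<mu>) = (\<Sum>p\<in>L \<times> L. \<integral>x. F (fst p) x * F (snd p) x \<partial>\<mu>)"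
proof -
  have "(\<Sum>l\<in>L. F l x)\<^sup>2 = (\<Sum>p\<in>L \<times> L. F (fst p) x * F (snd p) x)" for x
    unfolding power2_eq_square sum_product sum.cartesian_product by (simp add: case_prod_beta)
  hence "(\<integral>x. (\<Sum>l\<in>L. F l x)\<^sup>2 \<partial>\<mu>) = (\<integral>x. (\<Sum>p\<in>L \<times> L. F (fst p) x * F (snd p) x) \<partial>\<mu>)" by simp
  also have "\<dots> = (\<Sum>p\<in>L \<times> L. \<integral>x. F (fst p) x * F (snd p) x \<partial>\<mu>)"
  proof (rule Bochner_Integration.integral_sum)
    fix p assume "p \<in> L \<times> L"
    hence "F (fst p) \<in> hom n" "F (snd p) \<in> hom n" using assms(2) by auto
    thus "integrable \<mu> (\<lambda>x. F (fst p) x * F (snd p) x)" by (rule hom_integrable[OF hom_mult])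
  qed
  finally show ?thesis .
qed

text \<open>Since \<open>i \<noteq> j\<close>, only the pairing of equal components survives in
  Wick's formula, and the moment is a double sum of products of two covariances. Both factors are
  bounded by \<open>V\<close> in l^\<rho> and by \<open>eps D * V\<close> uniformly, so
  \<open>sum_product_le\<close> gains \<open>eps D powr (2 - \<rho>)\<close>. The maps
  \<open>\<sigma>\<close> and \<open>\<tau>\<close> will select left or right halves of
  cells.\<close>

lemma second_level_moment:
  assumes a: "a + 2 ^ D \<le> 2 ^ N" and ij: "i \<noteq> j" and L: "finite L"
    and \<sigma>: "inj_on \<sigma> L" "\<sigma> ` L \<subseteq> {a..<a + 2 ^ D}" and \<tau>: "inj_on \<tau> L" "\<tau> ` L \<subseteq> {a..<a + 2 ^ D}"
  shows "(\<integral>x. (\<Sum>l\<in>L. cell N i (\<sigma> l) x * cell N j (\<tau> l) x)\<^sup>2 \<partial>\<mu>) \<le> eps D powr (2 - \<rho>) * (V N D)\<^sup>2"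
proof -
  have r: "\<sigma> l < 2 ^ N" "\<tau> l < 2 ^ N" if "l \<in> L" for l using \<sigma>(2) \<tau>(2) a that by force+
  have r': "Suc (\<sigma> l) \<le> 2 ^ N" "Suc (\<tau> l) \<le> 2 ^ N" "\<sigma> l \<le> 2 ^ N" "\<tau> l \<le> 2 ^ N" if "l \<in> L" for l using r[OF that] by simp_all
  have h: "(\<lambda>x. cell N i (\<sigma> l) x * cell N j (\<tau> l) x) \<in> hom (1 + 1)" if "l \<in> L" for l
    using r'[OF that] by (intro hom_mult inc_hom)
  have "(\<integral>x. (\<Sum>l\<in>L. cell N i (\<sigma> l) x * cell N j (\<tau> l) x)\<^sup>2 \<partial>\<mu>) =
    (\<Sum>p\<in>L \<times> L. \<integral>x. (cell N i (\<sigma> (fst p)) x * cell N j (\<tau> (fst p)) x) * (cell N i (\<sigma> (snd p)) x * cell N j (\<tau> (snd p)) x) \<partial>\<mu>)"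
    by (rule second_moment_expand[OF L h])
  also have "\<dots> \<le> (\<Sum>p\<in>L \<times> L. \<bar>cov (cell N i (\<sigma> (fst p))) (cell N i (\<sigma> (snd p)))\<bar> * \<bar>cov (cell N j (\<tau> (fst p))) (cell N j (\<tau> (snd p)))\<bar>)"
  proof (rule sum_mono)
    fix p assume "p \<in> L \<times> L"
    hence p: "fst p \<in> L" "snd p \<in> L" by auto
    let ?A = "cell N i (\<sigma> (fst p))" and ?B = "cell N j (\<tau> (fst p))" and ?A' = "cell N i (\<sigma> (snd p))" and ?B' = "cell N j (\<tau> (snd p))"
    have z: "cov ?A ?B = 0" "cov ?A ?B' = 0"
      using ij r'[OF p(1)] r'[OF p(2)] by (auto intro!: cov_inc_independent)
    have "(\<integral>x. (?A x * ?B x) * (?A' x * ?B' x) \<partial>\<mu>) = cov ?A ?A' * cov ?B ?B'"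
      using wick4[of ?A ?B ?A' ?B'] z r'[OF p(1)] r'[OF p(2)] by (simp add: inc_form mult.assoc)
    also have "\<dots> \<le> \<bar>cov ?A ?A'\<bar> * \<bar>cov ?B ?B'\<bar>" using abs_ge_self[of "cov ?A ?A' * cov ?B ?B'"] by (simp only: abs_mult)
    finally show "(\<integral>x. (?A x * ?B x) * (?A' x * ?B' x) \<partial>\<mu>) \<le> \<bar>cov ?A ?A'\<bar> * \<bar>cov ?B ?B'\<bar>" .
  qed
  also have "\<dots> \<le> eps D powr (2 - \<rho>) * V N D * V N D"
  proof (rule sum_product_le[OF _ \<rho> eps_pos V_pos V_pos])
    fix p assume "p \<in> L \<times> L"
    hence p: "fst p \<in> L" "snd p \<in> L" by auto
    show "\<bar>cov (cell N i (\<sigma> (fst p))) (cell N i (\<sigma> (snd p)))\<bar> \<le> eps D * V N D"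
      "\<bar>cov (cell N j (\<tau> (fst p))) (cell N j (\<tau> (snd p)))\<bar> \<le> eps D * V N D"
      by (rule cov_cell_le r p)+
  qed (use L in \<open>simp_all add: cell_covariance_sum[OF a L \<sigma>] cell_covariance_sum[OF a L \<tau>]\<close>)
  finally show ?thesis by (simp add: power2_eq_square mult_ac)
qed

text \<open>Of the fifteen pairings, those joining a \<open>j\<close>-cell to a
  \<open>k\<close>-cell vanish and five remain. One pairs the long increments with each other, at
  the price of \<open>V\<close>. In the other four, both long increments meet a cell; these
  covariances are replaced by envelopes that do not depend on \<open>u\<close> and \<open>v\<close>,
  and the product of two envelopes takes the place of one covariance in
  \<open>sum_product_le\<close>. With the envelope bound \<open>2 * (D + 1)^2 * V\<close> the four
  terms give \<open>4 * 4 = 16\<close>, hence 17 in all.\<close>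

lemma third_level_moment:
  assumes a: "a + 2 ^ D \<le> 2 ^ N" and jk: "j \<noteq> k" and L: "finite L"
    and \<sigma>: "inj_on \<sigma> L" "\<sigma> ` L \<subseteq> {a..<a + 2 ^ D}" and \<tau>: "inj_on \<tau> L" "\<tau> ` L \<subseteq> {a..<a + 2 ^ D}"
    and uv: "\<And>l. l \<in> L \<Longrightarrow> a \<le> u l" "\<And>l. l \<in> L \<Longrightarrow> u l \<le> v l" "\<And>l. l \<in> L \<Longrightarrow> v l \<le> a + 2 ^ D"
  shows "(\<integral>x. (\<Sum>l\<in>L. inc N i (u l) (v l) x * (cell N j (\<sigma> l) x * cell N k (\<tau> l) x))\<^sup>2 \<partial>\<mu>)
    \<le> 17 * (real D + 1) ^ 4 * eps D powr (2 - \<rho>) * V N D ^ 3"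
proof -
  obtain S where S: "\<And>l. 0 \<le> S l" "\<And>l. S l \<le> sqrt (eps D) * V N D"
    "\<And>l u v. a \<le> l \<Longrightarrow> l < a + 2 ^ D \<Longrightarrow> a \<le> u \<Longrightarrow> u \<le> v \<Longrightarrow> v \<le> a + 2 ^ D \<Longrightarrow> \<bar>cov (cell N j l) (inc N j u v)\<bar> \<le> S l"
    "(\<Sum>l\<in>{a..<a + 2 ^ D}. S l powr \<rho>) \<le> (2 * (real D + 1)\<^sup>2 * V N D) powr \<rho>"
    using cell_covariance_envelope[OF a, of j] by blast
  obtain S' where S': "\<And>l. 0 \<le> S' l" "\<And>l. S' l \<le> sqrt (eps D) * V N D"
    "\<And>l u v. a \<le> l \<Longrightarrow> l < a + 2 ^ D \<Longrightarrow> a \<le> u \<Longrightarrow> u \<le> v \<Longrightarrow> v \<le> a + 2 ^ D \<Longrightarrow> \<bar>cov (cell N k l) (inc N k u v)\<bar> \<le> S' l"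
    "(\<Sum>l\<in>{a..<a + 2 ^ D}. S' l powr \<rho>) \<le> (2 * (real D + 1)\<^sup>2 * V N D) powr \<rho>"
    using cell_covariance_envelope[OF a, of k] by blast
  define X where "X l = inc N i (u l) (v l)" for l
  define A where "A l = cell N j (\<sigma> l)" for l
  define B where "B l = cell N k (\<tau> l)" for l
  let ?v = "V N D" and ?Z = "2 * (real D + 1)\<^sup>2 * V N D"
  have v0: "0 < ?v" by (rule V_pos)
  have Z0: "0 < ?Z" using v0 by simp
  have vZ: "?v \<le> ?Z"
  proof -
    have "1 \<le> (real D + 1)\<^sup>2" by (rule one_le_power) simp
    hence "1 \<le> 2 * (real D + 1)\<^sup>2" by linarith
    thus ?thesis using v0 by (simp add: mult_le_cancel_right1)
  qed
  have r: "a \<le> \<sigma> l" "\<sigma> l < a + 2 ^ D" "a \<le> \<tau> l" "\<tau> l < a + 2 ^ D" if "l \<in> L" for l using \<sigma>(2) \<tau>(2) that by force+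
  have r': "Suc (\<sigma> l) \<le> 2 ^ N" "Suc (\<tau> l) \<le> 2 ^ N" "\<sigma> l \<le> 2 ^ N" "\<tau> l \<le> 2 ^ N" "u l \<le> 2 ^ N" "v l \<le> 2 ^ N" if "l \<in> L" for l
    using r[OF that] uv[OF that] a by linarith+
  have forms: "X l \<in> evaluation_forms T" "A l \<in> evaluation_forms T" "B l \<in> evaluation_forms T" if "l \<in> L" for l
    unfolding X_def A_def B_def using r'[OF that] by (auto intro!: inc_form)
  have h: "(\<lambda>x. X l x * (A l x * B l x)) \<in> hom (1 + (1 + 1))" if "l \<in> L" for l
    unfolding X_def A_def B_def using r'[OF that] by (intro hom_mult inc_hom)
  have AB: "cov (A l) (B l') = 0" "cov (B l) (A l') = 0" if "l \<in> L" "l' \<in> L" for l l'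
    unfolding A_def B_def using jk r'[OF that(1)] r'[OF that(2)] by (auto intro!: cov_inc_independent)
  have sym: "cov f g = cov g f" for f g :: "'d path \<Rightarrow> real" by (simp add: mult.commute)
  have XA: "\<bar>cov (A l) (X l')\<bar> \<le> S (\<sigma> l)" if "l \<in> L" "l' \<in> L" for l l'
  proof (cases "i = j")
    case True
    thus ?thesis unfolding X_def A_def using S(3) r[OF that(1)] uv[OF that(2)] by blast
  next
    case False
    hence "cov (A l) (X l') = 0"
      unfolding X_def A_def using r'[OF that(1)] r'[OF that(2)] by (intro cov_inc_independent) auto
    thus ?thesis using S(1) by simp
  qed
  have XB: "\<bar>cov (B l) (X l')\<bar> \<le> S' (\<tau> l)" if "l \<in> L" "l' \<in> L" for l l'
  proof (cases "i = k")
    case True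
    thus ?thesis unfolding X_def B_def using S'(3) r[OF that(1)] uv[OF that(2)] by blast
  next
    case False
    hence "cov (B l) (X l') = 0"
      unfolding X_def B_def using r'[OF that(1)] r'[OF that(2)] by (intro cov_inc_independent) auto
    thus ?thesis using S'(1) by simp
  qed
  have XX: "\<bar>cov (X l) (X l')\<bar> \<le> ?v" if "l \<in> L" "l' \<in> L" for l l'
  proof -
    have "u l' \<le> v l'" "v l' \<le> u l' + 2 ^ D" "v l' \<le> 2 ^ N" if "l' \<in> L" for l'
      using uv[OF that] a by linarith+
    from cov_inc_le[OF this[OF that(1)] this[OF that(2)]] show ?thesis unfolding X_def using v0 by simp
  qed
  let ?AA = "\<lambda>p. \<bar>cov (A (fst p)) (A (snd p))\<bar>" and ?BB = "\<lambda>p. \<bar>cov (B (fst p)) (B (snd p))\<bar>"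
  let ?SS = "\<lambda>p. \<bar>S (\<sigma> (fst p)) * S (\<sigma> (snd p))\<bar>" and ?SS' = "\<lambda>p. \<bar>S' (\<tau> (fst p)) * S' (\<tau> (snd p))\<bar>"
  have "(\<integral>x. (\<Sum>l\<in>L. inc N i (u l) (v l) x * (cell N j (\<sigma> l) x * cell N k (\<tau> l) x))\<^sup>2 \<partial>\<mu>) =
    (\<Sum>p\<in>L \<times> L. \<integral>x. (X (fst p) x * (A (fst p) x * B (fst p) x)) * (X (snd p) x * (A (snd p) x * B (snd p) x)) \<partial>\<mu>)"
    using second_moment_expand[OF L h] unfolding X_def A_def B_def .
  also have "\<dots> \<le> (\<Sum>p\<in>L \<times> L. 2 * (?BB p * ?SS p) + 2 * (?AA p * ?SS' p) + ?v * (?AA p * ?BB p))"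
  proof (rule sum_mono)
    fix p assume "p \<in> L \<times> L"
    hence p: "fst p \<in> L" "snd p \<in> L" by auto
    let ?l = "fst p" and ?m = "snd p"
    note z = AB[OF p(1,1)] AB[OF p(1,2)] AB[OF p(2,1)] AB[OF p(2,2)]
    have "(\<integral>x. (X ?l x * (A ?l x * B ?l x)) * (X ?m x * (A ?m x * B ?m x)) \<partial>\<mu>) =
       (\<integral>x. X ?l x * (A ?l x * (B ?l x * (X ?m x * (A ?m x * B ?m x)))) \<partial>\<mu>)" by (simp only: mult.assoc)
    also have "\<dots> = cov (X ?l) (A ?l) * (cov (B ?l) (B ?m) * cov (X ?m) (A ?m)) +
        cov (X ?l) (B ?l) * (cov (A ?l) (A ?m) * cov (X ?m) (B ?m)) +
        cov (X ?l) (X ?m) * (cov (A ?l) (A ?m) * cov (B ?l) (B ?m)) +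
        cov (X ?l) (A ?m) * (cov (A ?l) (X ?m) * cov (B ?l) (B ?m)) +
        cov (X ?l) (B ?m) * (cov (A ?l) (A ?m) * cov (B ?l) (X ?m))"
      unfolding wick6[OF forms[OF p(1)] forms[OF p(2)]] z by simp
    also have "\<dots> \<le> S (\<sigma> ?l) * (?BB p * S (\<sigma> ?m)) + S' (\<tau> ?l) * (?AA p * S' (\<tau> ?m)) + ?v * (?AA p * ?BB p) +
        S (\<sigma> ?m) * (S (\<sigma> ?l) * ?BB p) + S' (\<tau> ?m) * (?AA p * S' (\<tau> ?l))"
    proof -
      have m: "x * (y * z) \<le> x' * (y' * z')" if "\<bar>x\<bar> \<le> x'" "\<bar>y\<bar> \<le> y'" "\<bar>z\<bar> \<le> z'" for x y z x' y' z' :: real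
      proof -
        have "x * (y * z) \<le> \<bar>x\<bar> * (\<bar>y\<bar> * \<bar>z\<bar>)" using abs_ge_self[of "x * (y * z)"] by (simp only: abs_mult)
        also have "\<dots> \<le> x' * (y' * z')" using that by (intro mult_mono mult_nonneg_nonneg order.trans[OF abs_ge_zero]) auto
        finally show ?thesis .
      qed
      show ?thesis
        using XA[OF p(1,1)] XA[OF p(1,2)] XA[OF p(2,1)] XA[OF p(2,2)] XB[OF p(1,1)] XB[OF p(1,2)] XB[OF p(2,1)] XB[OF p(2,2)] XX[OF p]
        unfolding sym[of "A ?l" "X ?l"] sym[of "A ?m" "X ?l"] sym[of "A ?m" "X ?m"] sym[of "B ?l" "X ?l"] sym[of "B ?m" "X ?l"] sym[of "B ?m" "X ?m"]
        by (intro add_mono m order.refl)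
    qed
    also have "\<dots> = 2 * (?BB p * ?SS p) + 2 * (?AA p * ?SS' p) + ?v * (?AA p * ?BB p)"
      using S(1) S'(1) by (simp add: abs_mult algebra_simps)
    finally show "(\<integral>x. (X ?l x * (A ?l x * B ?l x)) * (X ?m x * (A ?m x * B ?m x)) \<partial>\<mu>) \<le>
      2 * (?BB p * ?SS p) + 2 * (?AA p * ?SS' p) + ?v * (?AA p * ?BB p)" .
  qed
  also have "\<dots> = 2 * (\<Sum>p\<in>L \<times> L. ?BB p * ?SS p) + 2 * (\<Sum>p\<in>L \<times> L. ?AA p * ?SS' p) + ?v * (\<Sum>p\<in>L \<times> L. ?AA p * ?BB p)"
    by (simp only: sum.distrib sum_distrib_left)
  also have "\<dots> \<le> 2 * (eps D powr (2 - \<rho>) * ?v * ?Z\<^sup>2) + 2 * (eps D powr (2 - \<rho>) * ?v * ?Z\<^sup>2) + ?v * (eps D powr (2 - \<rho>) * ?v * ?v)"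
  proof -
    have AAp: "?AA p \<le> eps D * ?v" "?BB p \<le> eps D * ?v" if "p \<in> L \<times> L" for p
    proof -
      have p: "fst p \<in> L" "snd p \<in> L" using that by auto
      show "?AA p \<le> eps D * ?v" "?BB p \<le> eps D * ?v"
        unfolding A_def B_def using r'[OF p(1)] r'[OF p(2)] by (intro cov_cell_le; simp)+
    qed
    have AAs: "(\<Sum>p\<in>L \<times> L. ?AA p powr \<rho>) \<le> ?v powr \<rho>" "(\<Sum>p\<in>L \<times> L. ?BB p powr \<rho>) \<le> ?v powr \<rho>"
      unfolding A_def B_def by (rule cell_covariance_sum[OF a L \<sigma>] cell_covariance_sum[OF a L \<tau>])+
    have env: "\<bar>s (\<phi> (fst p)) * s (\<phi> (snd p))\<bar> \<le> eps D * ?Z\<^sup>2"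
      "(\<Sum>p\<in>L \<times> L. \<bar>s (\<phi> (fst p)) * s (\<phi> (snd p))\<bar> powr \<rho>) \<le> (?Z\<^sup>2) powr \<rho>"
      if s: "\<And>l. 0 \<le> s l" "\<And>l. s l \<le> sqrt (eps D) * ?v" "(\<Sum>l\<in>{a..<a + 2 ^ D}. s l powr \<rho>) \<le> ?Z powr \<rho>"
        and \<phi>: "inj_on \<phi> L" "\<phi> ` L \<subseteq> {a..<a + 2 ^ D}" for s \<phi> p
    proof -
      have "s (\<phi> (fst p)) * s (\<phi> (snd p)) \<le> (sqrt (eps D) * ?v) * (sqrt (eps D) * ?v)"
        using s eps_pos[of D] v0 by (intro mult_mono) auto
      also have "\<dots> = eps D * ?v\<^sup>2" using eps_pos[of D] by (simp add: power2_eq_square mult_ac)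
      also have "\<dots> \<le> eps D * ?Z\<^sup>2" using vZ v0 eps_pos[of D] by (intro mult_left_mono power_mono) auto
      finally show "\<bar>s (\<phi> (fst p)) * s (\<phi> (snd p))\<bar> \<le> eps D * ?Z\<^sup>2" using s(1) by simp
      have "(\<Sum>p\<in>L \<times> L. \<bar>s (\<phi> (fst p)) * s (\<phi> (snd p))\<bar> powr \<rho>) = (\<Sum>p\<in>L \<times> L. s (\<phi> (fst p)) powr \<rho> * s (\<phi> (snd p)) powr \<rho>)"
        using s(1) by (simp add: powr_mult)
      also have "\<dots> = (\<Sum>l\<in>L. s (\<phi> l) powr \<rho>) * (\<Sum>l\<in>L. s (\<phi> l) powr \<rho>)"
        by (simp add: sum_product sum.cartesian_product case_prod_beta)
      also have "\<dots> \<le> ?Z powr \<rho> * ?Z powr \<rho>"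
      proof -
        have "(\<Sum>l\<in>L. s (\<phi> l) powr \<rho>) = (\<Sum>l\<in>\<phi> ` L. s l powr \<rho>)" by (simp add: sum.reindex[OF \<phi>(1)])
        also have "\<dots> \<le> (\<Sum>l\<in>{a..<a + 2 ^ D}. s l powr \<rho>)" using \<phi>(2) by (intro sum_mono2) auto
        finally have "(\<Sum>l\<in>L. s (\<phi> l) powr \<rho>) \<le> ?Z powr \<rho>" using s(3) by simp
        thus ?thesis by (intro mult_mono) (auto intro!: sum_nonneg)
      qed
      also have "\<dots> = (?Z\<^sup>2) powr \<rho>" using Z0 powr_mult[of ?Z ?Z \<rho>] by (simp only: power2_eq_square)
      finally show "(\<Sum>p\<in>L \<times> L. \<bar>s (\<phi> (fst p)) * s (\<phi> (snd p))\<bar> powr \<rho>) \<le> (?Z\<^sup>2) powr \<rho>" .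
    qed
    have Z2: "0 < ?Z\<^sup>2" by (rule zero_less_power[OF Z0])
    have fin: "finite (L \<times> L)" using L by simp
    note eS = env[of S \<sigma>, OF S(1,2,4) \<sigma>] and eS' = env[of S' \<tau>, OF S'(1,2,4) \<tau>]
    show ?thesis
      by (intro add_mono mult_left_mono sum_product_le[OF fin \<rho> eps_pos v0 Z2 AAp(2) AAs(2) eS]
          sum_product_le[OF fin \<rho> eps_pos v0 Z2 AAp(1) AAs(1) eS'] sum_product_le[OF fin \<rho> eps_pos v0 v0 AAp(1) AAs(1) AAp(2) AAs(2)])
         (use v0 in auto)
  qed
  also have "\<dots> = (16 * (real D + 1) ^ 4 + 1) * (eps D powr (2 - \<rho>) * ?v ^ 3)"
    by (simp add: power_mult_distrib power2_eq_square power3_eq_cube power4_eq_xxxx algebra_simps)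
  also have "\<dots> \<le> (17 * (real D + 1) ^ 4) * (eps D powr (2 - \<rho>) * ?v ^ 3)"
  proof (intro mult_right_mono)
    have "1 \<le> (real D + 1) ^ 4" by (rule one_le_power) simp
    thus "16 * (real D + 1) ^ 4 + 1 \<le> 17 * (real D + 1) ^ 4" by linarith
  qed (use v0 in auto)
  finally show ?thesis by (simp add: mult.assoc)
qed

end

section \<open>Moments of the differences of consecutive approximations\<close>

context controlled_gaussian_path
begin

text \<open>Degree and L2 bound are bundled so that estimates of explicit sums can be composed;
  \<open>0 \<le> b\<close> lets radii be added and compared through their squares.\<close>

definition hom_ball :: "nat \<Rightarrow> real \<Rightarrow> ('d path \<Rightarrow> real) set" where
  "hom_ball n b = {F \<in> hom n. 0 \<le> b \<and> (\<integral>x. (F x)\<^sup>2 \<partial>\<mu>) \<le> b\<^sup>2}"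

lemma hom_ball_add: "F \<in> hom_ball n a \<Longrightarrow> G \<in> hom_ball n b \<Longrightarrow> (\<lambda>x. F x + G x) \<in> hom_ball n (a + b)"
  unfolding hom_ball_def
  by (auto intro!: hom.add integral_square_sum_le hom_power_integrable hom_integrable[OF hom_mult])

lemma hom_ball_scale: "F \<in> hom_ball n b \<Longrightarrow> (\<lambda>x. c * F x) \<in> hom_ball n (\<bar>c\<bar> * b)"
  by (auto simp: hom_ball_def power_mult_distrib intro!: hom_scale mult_left_mono)

lemma hom_ball_zero: "0 \<le> b \<Longrightarrow> (\<lambda>x. 0) \<in> hom_ball n b"
  by (simp add: hom_ball_def hom_zero)

lemma hom_ball_sum:
  assumes "finite A" "\<And>a. a \<in> A \<Longrightarrow> F a \<in> hom_ball n (b a)"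
  shows "(\<lambda>x. \<Sum>a\<in>A. F a x) \<in> hom_ball n (\<Sum>a\<in>A. b a)"
  using assms by (induction A rule: finite_induct) (auto intro: hom_ball_zero hom_ball_add)

lemma hom_ball_mono:
  assumes "F \<in> hom_ball n a" "a \<le> b"
  shows "F \<in> hom_ball n b"
proof -
  have F: "F \<in> hom n" "0 \<le> a" "(\<integral>x. (F x)\<^sup>2 \<partial>\<mu>) \<le> a\<^sup>2" using assms(1) by (simp_all add: hom_ball_def)
  from F(3) power_mono[OF assms(2) F(2), of 2] have "(\<integral>x. (F x)\<^sup>2 \<partial>\<mu>) \<le> b\<^sup>2" by (rule order.trans)
  thus ?thesis using F assms(2) by (simp add: hom_ball_def)
qed

definition delta :: "nat \<Rightarrow> nat \<Rightarrow> nat \<Rightarrow> 'd list \<Rightarrow> 'd path \<Rightarrow> real" where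
  "delta m n j v = (\<lambda>x. dyadic_integral T (Suc m) x v (grid T n j) (grid T n (Suc j)) -
     dyadic_integral T m x v (grid T n j) (grid T n (Suc j)))"

lemma cell_increment_cell: "cell_increment T N l i x = cell N i l x"
  by (simp add: cell_increment_point inc_def)

lemma bracket_cells:
  "bracket T m l i k x = cell (Suc m) i (2 * l) x * cell (Suc m) k (Suc (2 * l)) x - cell (Suc m) i (Suc (2 * l)) x * cell (Suc m) k (2 * l) x"
  by (simp add: bracket_def cell_increment_cell)

text \<open>The dyadic interval \<open>j\<close> of level \<open>n\<close> consists of the cells
  \<open>L\<close> of level \<open>m\<close>. Their halves are \<open>2 ^ D\<close> cells of level
  \<open>m + 1\<close>, starting at index \<open>a\<close>, which explains
  \<open>D = d + 1\<close>.\<close>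

context
  fixes m n j d D a :: nat and L :: "nat set"
  assumes nm: "m = n + d" and j: "j < 2 ^ n" and D: "D = Suc d" and a: "a = j * 2 ^ D"
    and L_def: "L = {j * 2 ^ d..<Suc j * 2 ^ d}"
begin

lemma block_bound: "a + 2 ^ D \<le> 2 ^ Suc m"
proof -
  have "Suc j * 2 ^ D \<le> 2 ^ n * 2 ^ D" using j by (intro mult_right_mono) auto
  thus ?thesis by (simp add: a nm D power_add)
qed

lemma halves:
  "finite L" "inj_on (\<lambda>l. 2 * l) L" "(\<lambda>l. 2 * l) ` L \<subseteq> {a..<a + 2 ^ D}"
  "inj_on (\<lambda>l. Suc (2 * l)) L" "(\<lambda>l. Suc (2 * l)) ` L \<subseteq> {a..<a + 2 ^ D}"
  by (auto simp: L_def a D inj_on_def)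

lemma block_points:
  "grid T n j = grid T m (j * 2 ^ d)" "grid T n (Suc j) = grid T m (Suc j * 2 ^ d)"
  "j * 2 ^ d \<le> Suc j * 2 ^ d" "Suc j * 2 ^ d \<le> 2 ^ m"
proof -
  have "Suc j * 2 ^ d \<le> 2 ^ n * 2 ^ d" using j by (intro mult_right_mono) auto
  thus "Suc j * 2 ^ d \<le> 2 ^ m" by (simp add: nm power_add)
qed (simp_all only: nm grid_refine, simp)

text \<open>For equal letters the bracket vanishes. Otherwise it splits into two sums of the kind
  treated in \<open>second_level_moment\<close>, with left and right halves as
  \<open>\<sigma>\<close> and \<open>\<tau>\<close> and vice versa; each enters with weight
  1/2.\<close>

lemma delta_2: "delta m n j [i, k] \<in> hom_ball 2 (sqrt (eps D powr (2 - \<rho>)) * V (Suc m) D)"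
proof -
  let ?b = "sqrt (eps D powr (2 - \<rho>)) * V (Suc m) D"
  have b0: "0 \<le> ?b" using V_pos[of "Suc m" D] by simp
  have b2: "?b\<^sup>2 = eps D powr (2 - \<rho>) * (V (Suc m) D)\<^sup>2" by (simp add: power_mult_distrib)
  have eq: "delta m n j [i, k] x = (\<Sum>l\<in>L. bracket T m l i k x / 2)" for x
    unfolding delta_def block_points L_def by (rule dyadic_difference_2[OF T_pos block_points(3,4)])
  show ?thesis
  proof (cases "i = k")
    case True
    have "delta m n j [i, k] = (\<lambda>x. 0)"
    proof
      show "delta m n j [i, k] x = 0" for x unfolding eq unfolding bracket_cells True by (simp add: mult.commute)
    qed
    thus ?thesis using hom_ball_zero[OF b0] by simp
  next
    case False
    let ?F = "\<lambda>\<sigma> \<tau> x. \<Sum>l\<in>L. cell (Suc m) i (\<sigma> l) x * cell (Suc m) k (\<tau> l) x"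
    have F: "?F \<sigma> \<tau> \<in> hom_ball 2 ?b"
      if "inj_on \<sigma> L" "\<sigma> ` L \<subseteq> {a..<a + 2 ^ D}" "inj_on \<tau> L" "\<tau> ` L \<subseteq> {a..<a + 2 ^ D}" for \<sigma> \<tau>
    proof -
      have r: "\<sigma> l < 2 ^ Suc m" "\<tau> l < 2 ^ Suc m" if "l \<in> L" for l using \<open>\<sigma> ` L \<subseteq> _\<close> \<open>\<tau> ` L \<subseteq> _\<close> block_bound that by force+
      have "(\<lambda>x. cell (Suc m) i (\<sigma> l) x * cell (Suc m) k (\<tau> l) x) \<in> hom (1 + 1)" if "l \<in> L" for l
        using r[OF that] by (intro hom_mult inc_hom) auto
      hence "?F \<sigma> \<tau> \<in> hom 2" by (intro hom_sum) (simp add: numeral_2_eq_2)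
      thus ?thesis unfolding hom_ball_def mem_Collect_eq b2
        using second_level_moment[OF block_bound False halves(1) that] b0 by blast
    qed
    have "(\<lambda>x. (1 / 2) * ?F (\<lambda>l. 2 * l) (\<lambda>l. Suc (2 * l)) x + (- 1 / 2) * ?F (\<lambda>l. Suc (2 * l)) (\<lambda>l. 2 * l) x) \<in> hom_ball 2 (\<bar>1 / 2\<bar> * ?b + \<bar>- 1 / 2\<bar> * ?b)"
      by (intro hom_ball_add hom_ball_scale F halves)
    moreover have "(1 / 2) * ?F (\<lambda>l. 2 * l) (\<lambda>l. Suc (2 * l)) x + (- 1 / 2) * ?F (\<lambda>l. Suc (2 * l)) (\<lambda>l. 2 * l) x = delta m n j [i, k] x" for x
      unfolding eq bracket_cells unfolding sum_distrib_left sum.distrib[symmetric] by (intro sum.cong refl) (simp add: field_simps)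
    ultimately show ?thesis by (simp add: mult.commute)
  qed
qed

text \<open>A cell is itself an increment inside the block, so all three summands fall under
  \<open>third_level_moment\<close>; the factor 2 counts the two products in the bracket.\<close>

lemma bracket_product_ball:
  assumes uv: "\<And>l. l \<in> L \<Longrightarrow> a \<le> u l" "\<And>l. l \<in> L \<Longrightarrow> u l \<le> v l" "\<And>l. l \<in> L \<Longrightarrow> v l \<le> a + 2 ^ D"
  shows "(\<lambda>x. \<Sum>l\<in>L. (c1 * inc (Suc m) i (u l) (v l) x + c2 * cell (Suc m) i (2 * l) x + c3 * cell (Suc m) i (Suc (2 * l)) x) *
     bracket T m l i' k x) \<in> hom_ball 3 (2 * (\<bar>c1\<bar> + \<bar>c2\<bar> + \<bar>c3\<bar>) * sqrt (17 * (real D + 1) ^ 4 * eps D powr (2 - \<rho>) * V (Suc m) D ^ 3))"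
    (is "?G \<in> hom_ball 3 (2 * _ * ?b)")
proof -
  have B0: "0 \<le> 17 * (real D + 1) ^ 4 * eps D powr (2 - \<rho>) * V (Suc m) D ^ 3" using V_pos[of "Suc m" D] by simp
  have b2: "?b\<^sup>2 = 17 * (real D + 1) ^ 4 * eps D powr (2 - \<rho>) * V (Suc m) D ^ 3" using B0 by simp
  have b0: "0 \<le> ?b" using B0 by (rule real_sqrt_ge_zero)
  show ?thesis
  proof (cases "i' = k")
    case True
    have "?G = (\<lambda>x. 0)" unfolding True bracket_cells by (simp add: mult.commute)
    thus ?thesis using b0 by (simp add: hom_ball_zero del: real_sqrt_mult)
  next
    case False
    let ?F = "\<lambda>u v \<sigma> \<tau> x. \<Sum>l\<in>L. inc (Suc m) i (u l) (v l) x * (cell (Suc m) i' (\<sigma> l) x * cell (Suc m) k (\<tau> l) x)"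
    have F: "?F u v \<sigma> \<tau> \<in> hom_ball 3 ?b"
      if "inj_on \<sigma> L" "\<sigma> ` L \<subseteq> {a..<a + 2 ^ D}" "inj_on \<tau> L" "\<tau> ` L \<subseteq> {a..<a + 2 ^ D}"
        and uv: "\<And>l. l \<in> L \<Longrightarrow> a \<le> u l" "\<And>l. l \<in> L \<Longrightarrow> u l \<le> v l" "\<And>l. l \<in> L \<Longrightarrow> v l \<le> a + 2 ^ D" for \<sigma> \<tau> u v
    proof -
      have r: "\<sigma> l < 2 ^ Suc m" "\<tau> l < 2 ^ Suc m" if "l \<in> L" for l using \<open>\<sigma> ` L \<subseteq> _\<close> \<open>\<tau> ` L \<subseteq> _\<close> block_bound that by force+
      have "(\<lambda>x. inc (Suc m) i (u l) (v l) x * (cell (Suc m) i' (\<sigma> l) x * cell (Suc m) k (\<tau> l) x)) \<in> hom (1 + (1 + 1))" if "l \<in> L" for l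
        using r[OF that] uv[OF that] block_bound by (intro hom_mult inc_hom) linarith+
      hence "?F u v \<sigma> \<tau> \<in> hom 3" by (intro hom_sum) (simp add: numeral_3_eq_3)
      moreover have "(\<integral>x. (?F u v \<sigma> \<tau> x)\<^sup>2 \<partial>\<mu>) \<le> 17 * (real D + 1) ^ 4 * eps D powr (2 - \<rho>) * V (Suc m) D ^ 3"
        by (rule third_level_moment[OF block_bound False halves(1) that(1-4)]) (use uv in auto)
      ultimately show ?thesis unfolding hom_ball_def mem_Collect_eq b2 using b0 by blast
    qed
    have e: "a \<le> 2 * l" "2 * l \<le> Suc (2 * l)" "Suc (2 * l) \<le> a + 2 ^ D" "a \<le> Suc (2 * l)" "Suc (2 * l) \<le> Suc (Suc (2 * l))" "Suc (Suc (2 * l)) \<le> a + 2 ^ D"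
      if "l \<in> L" for l using halves(3,5) that by force+
    let ?s = "\<lambda>l. 2 * l" and ?t = "\<lambda>l. Suc (2 * l)"
    have P: "(\<lambda>x. c * (?F u v ?s ?t x + (- 1) * ?F u v ?t ?s x)) \<in> hom_ball 3 (\<bar>c\<bar> * (?b + \<bar>- 1\<bar> * ?b))"
      if "\<And>l. l \<in> L \<Longrightarrow> a \<le> u l" "\<And>l. l \<in> L \<Longrightarrow> u l \<le> v l" "\<And>l. l \<in> L \<Longrightarrow> v l \<le> a + 2 ^ D" for c u v
      by (intro hom_ball_scale hom_ball_add F halves) (use that in auto)
    have "(\<lambda>x. c1 * (?F u v ?s ?t x + (- 1) * ?F u v ?t ?s x) + (c2 * (?F ?s ?t ?s ?t x + (- 1) * ?F ?s ?t ?t ?s x) +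
        c3 * (?F ?t (\<lambda>l. Suc (Suc (2 * l))) ?s ?t x + (- 1) * ?F ?t (\<lambda>l. Suc (Suc (2 * l))) ?t ?s x)))
      \<in> hom_ball 3 (\<bar>c1\<bar> * (?b + \<bar>- 1\<bar> * ?b) + (\<bar>c2\<bar> * (?b + \<bar>- 1\<bar> * ?b) + \<bar>c3\<bar> * (?b + \<bar>- 1\<bar> * ?b)))"
      by (intro hom_ball_add P uv e)
    moreover have "c1 * (?F u v ?s ?t x + (- 1) * ?F u v ?t ?s x) + (c2 * (?F ?s ?t ?s ?t x + (- 1) * ?F ?s ?t ?t ?s x) +
        c3 * (?F ?t (\<lambda>l. Suc (Suc (2 * l))) ?s ?t x + (- 1) * ?F ?t (\<lambda>l. Suc (Suc (2 * l))) ?t ?s x)) = ?G x" for x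
      unfolding bracket_cells sum_distrib_left sum.distrib[symmetric] by (intro sum.cong refl) algebra
    moreover have "\<bar>c1\<bar> * (?b + \<bar>- 1\<bar> * ?b) + (\<bar>c2\<bar> * (?b + \<bar>- 1\<bar> * ?b) + \<bar>c3\<bar> * (?b + \<bar>- 1\<bar> * ?b)) = 2 * (\<bar>c1\<bar> + \<bar>c2\<bar> + \<bar>c3\<bar>) * ?b"
      by (simp add: algebra_simps)
    ultimately show ?thesis by simp
  qed
qed

text \<open>The weights 1/2, 1/3 and 1/6 add up to one in each of the two sums, so each sum costs
  2.\<close>

lemma delta_3: "delta m n j [i, k, h] \<in> hom_ball 3 (4 * sqrt (17 * (real D + 1) ^ 4 * eps D powr (2 - \<rho>) * V (Suc m) D ^ 3))"
proof -
  let ?b = "sqrt (17 * (real D + 1) ^ 4 * eps D powr (2 - \<rho>) * V (Suc m) D ^ 3)"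
  let ?p = "j * 2 ^ d" and ?q = "Suc j * 2 ^ d"
  let ?F = "\<lambda>x. \<Sum>l\<in>L. (1 / 2 * inc (Suc m) i (2 * ?p) (2 * l) x + 1 / 3 * cell (Suc m) i (2 * l) x + 1 / 6 * cell (Suc m) i (Suc (2 * l)) x) * bracket T m l k h x"
  let ?G = "\<lambda>x. \<Sum>l\<in>L. (1 / 2 * inc (Suc m) h (2 * Suc l) (2 * ?q) x + 1 / 6 * cell (Suc m) h (2 * l) x + 1 / 3 * cell (Suc m) h (Suc (2 * l)) x) * bracket T m l i k x"
  have "?F \<in> hom_ball 3 (2 * (\<bar>1 / 2\<bar> + \<bar>1 / 3\<bar> + \<bar>1 / 6\<bar>) * ?b)"
    by (rule bracket_product_ball) (auto simp: L_def a D)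
  moreover have "?G \<in> hom_ball 3 (2 * (\<bar>1 / 2\<bar> + \<bar>1 / 6\<bar> + \<bar>1 / 3\<bar>) * ?b)"
    by (rule bracket_product_ball) (auto simp: L_def a D)
  ultimately have "(\<lambda>x. ?F x + ?G x) \<in> hom_ball 3 (2 * (\<bar>1 / 2\<bar> + \<bar>1 / 3\<bar> + \<bar>1 / 6\<bar>) * ?b + 2 * (\<bar>1 / 2\<bar> + \<bar>1 / 6\<bar> + \<bar>1 / 3\<bar>) * ?b)"
    by (rule hom_ball_add)
  moreover have "?F x + ?G x = delta m n j [i, k, h] x" for x
  proof -
    have "delta m n j [i, k, h] x = (\<Sum>l\<in>L.
      ((ev (grid T m l) i x - ev (grid T m ?p) i x) / 2 +
         cell_increment T (Suc m) (2 * l) i x / 3 + cell_increment T (Suc m) (Suc (2 * l)) i x / 6) * bracket T m l k h x +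
      bracket T m l i k x * ((ev (grid T m ?q) h x - ev (grid T m (Suc l)) h x) / 2 +
         cell_increment T (Suc m) (2 * l) h x / 6 + cell_increment T (Suc m) (Suc (2 * l)) h x / 3))"
      unfolding delta_def block_points L_def by (rule dyadic_difference_3[OF T_pos block_points(3,4)])
    also have "\<dots> = ?F x + ?G x"
      unfolding sum.distrib[symmetric] inc_def grid_double[of T m] cell_increment_point
      by (intro sum.cong refl) (simp add: algebra_simps diff_divide_distrib)
    finally show ?thesis ..
  qed
  moreover have "2 * (\<bar>1 / 2\<bar> + \<bar>1 / 3\<bar> + \<bar>1 / 6\<bar>) * ?b + 2 * (\<bar>1 / 2\<bar> + \<bar>1 / 6\<bar> + \<bar>1 / 3\<bar>) * ?b = 4 * ?b" by simp
  ultimately show ?thesis by simp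
qed

end

end

section \<open>Moments of powers\<close>

context gaussian_forms
begin

text \<open>Cauchy-Schwarz between the fourth and the eighth moment. A factor 3 in the exponents is
  unavoidable later: polynomials of degrees 1, 2 and 3 are raised to powers that make their degrees
  equal.\<close>

lemma sixth_moment: "\<exists>C\<ge>1. \<forall>F\<in>hom n. (\<integral>x. F x ^ 6 \<partial>\<mu>) \<le> C * (\<integral>x. (F x)\<^sup>2 \<partial>\<mu>) ^ 3"
proof -
  obtain C where C: "1 \<le> C" "\<And>F. F \<in> hom n \<Longrightarrow> (\<integral>x. F x ^ 4 \<partial>\<mu>) \<le> C * (\<integral>x. (F x)\<^sup>2 \<partial>\<mu>) ^ 2"
    using hypercontractivity_power[of n 1] by auto
  obtain C' where C': "1 \<le> C'" "\<And>F. F \<in> hom n \<Longrightarrow> (\<integral>x. F x ^ 8 \<partial>\<mu>) \<le> C' * (\<integral>x. (F x)\<^sup>2 \<partial>\<mu>) ^ 4"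
    using hypercontractivity_power[of n 2] by auto
  have CC: "1 \<le> C * C'" using mult_mono[OF C(1) C'(1)] C(1) by simp
  have "(\<integral>x. F x ^ 6 \<partial>\<mu>) \<le> C * C' * (\<integral>x. (F x)\<^sup>2 \<partial>\<mu>) ^ 3" if F: "F \<in> hom n" for F
  proof -
    let ?s = "\<integral>x. (F x)\<^sup>2 \<partial>\<mu>"
    have s: "0 \<le> ?s" by simp
    have "(\<integral>x. (F x)\<^sup>2 * F x ^ 4 \<partial>\<mu>)\<^sup>2 \<le> (\<integral>x. ((F x)\<^sup>2)\<^sup>2 \<partial>\<mu>) * (\<integral>x. (F x ^ 4)\<^sup>2 \<partial>\<mu>)"
      by (rule integral_Cauchy_Schwarz) (simp_all add: hom_power_integrable[OF F] flip: power_mult power_add)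
    hence "(\<integral>x. F x ^ 6 \<partial>\<mu>)\<^sup>2 \<le> (\<integral>x. F x ^ 4 \<partial>\<mu>) * (\<integral>x. F x ^ 8 \<partial>\<mu>)"
      by (simp flip: power_mult power_add)
    also have "\<dots> \<le> (C * ?s ^ 2) * (C' * ?s ^ 4)"
      by (intro mult_mono C(2) C'(2) F mult_nonneg_nonneg zero_le_power s integral_nonneg_AE always_eventually allI zero_le_even_power) (use C in auto)
    also have "\<dots> = (C * C') * (?s ^ 3)\<^sup>2" by (simp add: mult_ac flip: power_mult power_add)
    also have "\<dots> \<le> (C * C')\<^sup>2 * (?s ^ 3)\<^sup>2"
      using CC by (intro mult_right_mono) (auto simp: power2_eq_square mult_le_cancel_left1)
    finally have "(\<integral>x. F x ^ 6 \<partial>\<mu>)\<^sup>2 \<le> (C * C' * ?s ^ 3)\<^sup>2" by (simp add: power_mult_distrib)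
    moreover have "0 \<le> C * C' * ?s ^ 3" using CC s by (intro mult_nonneg_nonneg[of "C * C'"] zero_le_power) linarith+
    ultimately show ?thesis by (rule power2_le_imp_le)
  qed
  thus ?thesis using CC by blast
qed

lemma moment_power_2: "\<exists>C\<ge>1. \<forall>F\<in>hom n. (\<integral>x. (F x ^ 2 ^ k)\<^sup>2 \<partial>\<mu>) \<le> C * (\<integral>x. (F x)\<^sup>2 \<partial>\<mu>) ^ 2 ^ k"
  using hypercontractivity_power[of n k] by (simp add: mult.commute flip: power_mult)

lemma moment_power_3: "\<exists>C\<ge>1. \<forall>F\<in>hom n. (\<integral>x. (F x ^ (3 * 2 ^ k))\<^sup>2 \<partial>\<mu>) \<le> C * (\<integral>x. (F x)\<^sup>2 \<partial>\<mu>) ^ (3 * 2 ^ k)"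
proof -
  obtain C where C: "1 \<le> C" "\<And>F. F \<in> hom (n * 3) \<Longrightarrow> (\<integral>x. (F x ^ 2 ^ k)\<^sup>2 \<partial>\<mu>) \<le> C * (\<integral>x. (F x)\<^sup>2 \<partial>\<mu>) ^ 2 ^ k"
    using moment_power_2 by blast
  obtain C' where C': "1 \<le> C'" "\<And>F. F \<in> hom n \<Longrightarrow> (\<integral>x. F x ^ 6 \<partial>\<mu>) \<le> C' * (\<integral>x. (F x)\<^sup>2 \<partial>\<mu>) ^ 3"
    using sixth_moment by blast
  have "(\<integral>x. (F x ^ (3 * 2 ^ k))\<^sup>2 \<partial>\<mu>) \<le> (C * C' ^ 2 ^ k) * (\<integral>x. (F x)\<^sup>2 \<partial>\<mu>) ^ (3 * 2 ^ k)" if F: "F \<in> hom n" for F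
  proof -
    let ?s = "\<integral>x. (F x)\<^sup>2 \<partial>\<mu>"
    have "(\<integral>x. (F x ^ (3 * 2 ^ k))\<^sup>2 \<partial>\<mu>) \<le> C * (\<integral>x. (F x ^ 3)\<^sup>2 \<partial>\<mu>) ^ 2 ^ k"
      using C(2)[OF hom_power[OF F]] by (simp flip: power_mult)
    also have "\<dots> = C * (\<integral>x. F x ^ 6 \<partial>\<mu>) ^ 2 ^ k" by (simp flip: power_mult)
    also have "\<dots> \<le> C * (C' * ?s ^ 3) ^ 2 ^ k"
      using C(1) C'(2)[OF F] by (intro mult_left_mono power_mono integral_nonneg_AE always_eventually allI zero_le_even_power) auto
    also have "\<dots> = (C * C' ^ 2 ^ k) * ?s ^ (3 * 2 ^ k)" by (simp add: power_mult_distrib mult_ac flip: power_mult)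
    finally show ?thesis .
  qed
  moreover have "1 \<le> C * C' ^ 2 ^ k" using mult_mono[OF C(1) one_le_power[OF C'(1), of "2 ^ k"]] C(1) by simp
  ultimately show ?thesis by blast
qed

end

text \<open>With \<open>s = sqrt r\<close> the expression is the square of
  \<open>(D + 1) * s ^ D\<close>, which is bounded.\<close>

lemma bounded_power_times_square:
  assumes "0 < r" "r < 1"
  obtains B where "1 \<le> B" and "\<And>D. (real D + 1)\<^sup>2 * r ^ D \<le> (B :: real)"
proof -
  define s where "s = sqrt r"
  have s: "0 < s" "s < 1" "s\<^sup>2 = r" using assms by (simp_all add: s_def)
  have "(\<lambda>n. real n * s ^ n) \<longlonglongrightarrow> 0" using s by (intro powser_times_n_limit_0) simp
  hence "Bseq (\<lambda>n. real n * s ^ n)" by (intro convergent_imp_Bseq) (auto simp: convergent_def)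
  then obtain B where B: "0 < B" "\<And>n. norm (real n * s ^ n) \<le> B" by (auto simp: Bseq_def)
  show thesis
  proof (rule that[of "(B + 1)\<^sup>2"])
    show "1 \<le> (B + 1)\<^sup>2" using B by (intro one_le_power) simp
    fix D
    have "(real D + 1) * s ^ D = real D * s ^ D + s ^ D" by (simp add: algebra_simps)
    also have "\<dots> \<le> B + 1" using B(2)[of D] s power_le_one[of s D] by (intro add_mono) auto
    finally have "((real D + 1) * s ^ D)\<^sup>2 \<le> (B + 1)\<^sup>2" using s by (intro power_mono) auto
    moreover have "((real D + 1) * s ^ D)\<^sup>2 = (real D + 1)\<^sup>2 * r ^ D"
      by (simp add: power_mult_distrib s(3)[symmetric] mult.commute flip: power_mult)
    ultimately show "(real D + 1)\<^sup>2 * r ^ D \<le> (B + 1)\<^sup>2" by simp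
  qed
qed

context controlled_gaussian_path
begin

text \<open>The block has length \<open>T / 2 ^ n\<close> whatever the level \<open>m + 1\<close> of
  its cells.\<close>

lemma V_block:
  assumes "n \<le> m"
  shows "V (Suc m) (Suc m - n) = C * T powr (1 / \<rho>) * 2 powr (- real n / \<rho>)"
proof -
  have "(2::real) ^ Suc m = 2 ^ (Suc m - n) * 2 ^ n" using assms by (simp flip: power_add)
  hence "real (2 ^ (Suc m - n)) * T / 2 ^ Suc m = T * 2 powr (- real n)" by (simp add: powr_minus powr_realpow field_simps)
  thus ?thesis using T_pos by (simp add: V_def powr_mult powr_powr)
qed

text \<open>Each letter contributes the root of a variance over the interval of level
  \<open>n\<close>, which gives \<open>2 powr (- n * length v / (2 * \<rho>))\<close>. The root of
  the power of \<open>eps\<close> decays like \<open>2 powr (- D * k / 2)\<close> with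
  \<open>k = (2 - \<rho>) / \<rho>\<close>; on the third level half of this exponent absorbs the
  factor \<open>(D + 1)^2\<close>, and the other half is the decay in \<open>m - n\<close> that is
  stated.\<close>

lemma delta_ball:
  obtains c where "0 < c" and "\<And>m n j v. n \<le> m \<Longrightarrow> j < 2 ^ n \<Longrightarrow> length v = 2 \<or> length v = 3 \<Longrightarrow>
    delta m n j v \<in> hom_ball (length v) (c * 2 powr (- real n * real (length v) / (2 * \<rho>)) * 2 powr (- real (m - n) * ((2 - \<rho>) / \<rho>) / 4))"
proof -
  define k where "k = (2 - \<rho>) / \<rho>"
  have k: "0 < k" using \<rho> by (simp add: k_def)
  define A where "A = C * T powr (1 / \<rho>)"
  have A: "0 < A" using C_pos T_pos by (simp add: A_def)
  have r: "0 < 2 powr (- k / 4)" "2 powr (- k / 4) < 1"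
    using k powr_less_mono[of "- k / 4" 0 2] by simp_all
  obtain B where B: "1 \<le> B" "\<And>D. (real D + 1)\<^sup>2 * (2 powr (- k / 4)) ^ D \<le> B"
    using bounded_power_times_square[OF r] by blast
  have root: "sqrt (eps D powr (2 - \<rho>)) = 2 powr (- real D * k / 2)" for D
  proof -
    have "eps D powr (2 - \<rho>) = 2 powr (- real D * k)" by (simp add: eps_def powr_powr k_def)
    hence "sqrt (eps D powr (2 - \<rho>)) = (2 powr (- real D * k)) powr (1 / 2)" by (simp only: powr_half_sqrt powr_ge_zero)
    thus ?thesis by (simp add: powr_powr)
  qed
  have dec: "2 powr (- real (Suc m - n) * k / 4) \<le> 2 powr (- real (m - n) * k / 4)" if "n \<le> m" for m n
    using k that by (intro powr_mono) (auto simp: Suc_diff_le mult_right_mono)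
  have half: "2 powr (- real D * k / 2) = 2 powr (- real D * k / 4) * 2 powr (- real D * k / 4)" for D
    by (simp add: mult.commute flip: powr_add)
  define c where "c = A + 4 * sqrt 17 * B * A powr (3 / 2)"
  show thesis
  proof (rule that[of c])
    show c: "0 < c" using A B by (simp add: c_def add_pos_nonneg)
    fix m n j :: nat and v :: "'d list"
    assume nm: "n \<le> m" and j: "j < 2 ^ n" and v: "length v = 2 \<or> length v = 3"
    let ?D = "Suc m - n"
    have nm': "m = n + (m - n)" "?D = Suc (m - n)" using nm by auto
    have V: "V (Suc m) ?D = A * 2 powr (- real n / \<rho>)" using V_block[OF nm] by (simp add: A_def)
    have "2 powr (- real ?D * k / 4) \<le> 2 powr 0" using k by (intro powr_mono) auto
    hence d1: "2 powr (- real ?D * k / 4) \<le> 1" by simp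
    from v show "delta m n j v \<in> hom_ball (length v) (c * 2 powr (- real n * real (length v) / (2 * \<rho>)) * 2 powr (- real (m - n) * ((2 - \<rho>) / \<rho>) / 4))"
    proof
      assume l: "length v = 2"
      obtain i w where w: "v = i # w" "length w = 1" using l by (cases v) auto
      obtain h where "w = [h]" using w(2) by (cases w) auto
      hence v: "v = [i, h]" using w by simp
      have "delta m n j v \<in> hom_ball 2 (2 powr (- real ?D * k / 2) * (A * 2 powr (- real n / \<rho>)))"
        using delta_2[OF nm'(1) j nm'(2) refl refl, of i h] unfolding v root V .
      moreover have "2 powr (- real ?D * k / 2) * (A * 2 powr (- real n / \<rho>)) \<le> c * 2 powr (- real n / \<rho>) * 2 powr (- real (m - n) * k / 4)"
      proof -
        have "2 powr (- real ?D * k / 2) \<le> 1 * 2 powr (- real (m - n) * k / 4)"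
          unfolding half using d1 dec[OF nm] by (intro mult_mono) auto
        moreover have "A \<le> c" using B A by (simp add: c_def)
        ultimately have "2 powr (- real ?D * k / 2) * (A * 2 powr (- real n / \<rho>)) \<le> 2 powr (- real (m - n) * k / 4) * (c * 2 powr (- real n / \<rho>))"
          using A c by (intro mult_mono) auto
        thus ?thesis by (simp only: mult_ac)
      qed
      ultimately have "delta m n j v \<in> hom_ball 2 (c * 2 powr (- real n / \<rho>) * 2 powr (- real (m - n) * k / 4))" by (rule hom_ball_mono)
      thus ?thesis unfolding l k_def[symmetric] by simp
    next
      assume l: "length v = 3"
      obtain i w where w: "v = i # w" "length w = 2" using l by (cases v) auto
      obtain h w' where w': "w = h # w'" "length w' = 1" using w(2) by (cases w) auto
      obtain i' where "w' = [i']" using w'(2) by (cases w') auto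
      hence v: "v = [i, h, i']" using w w' by simp
      have "delta m n j v \<in> hom_ball 3 (4 * sqrt (17 * (real ?D + 1) ^ 4 * eps ?D powr (2 - \<rho>) * V (Suc m) ?D ^ 3))"
        using delta_3[OF nm'(1) j nm'(2) refl refl, of i h i'] unfolding v .
      moreover have "4 * sqrt (17 * (real ?D + 1) ^ 4 * eps ?D powr (2 - \<rho>) * V (Suc m) ?D ^ 3) \<le>
        c * 2 powr (- real n * 3 / (2 * \<rho>)) * 2 powr (- real (m - n) * k / 4)"
      proof -
        have s4: "sqrt ((real ?D + 1) ^ 4) = (real ?D + 1)\<^sup>2"
        proof -
          have "(real ?D + 1) ^ 4 = ((real ?D + 1)\<^sup>2)\<^sup>2" by simp
          thus ?thesis by (simp only: real_sqrt_abs) simp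
        qed
        have s3: "sqrt (V (Suc m) ?D ^ 3) = A powr (3 / 2) * 2 powr (- real n * 3 / (2 * \<rho>))"
        proof -
          have "sqrt (V (Suc m) ?D ^ 3) = (V (Suc m) ?D powr 3) powr (1 / 2)"
            using V_pos[of "Suc m" ?D] by (simp add: powr_half_sqrt)
          also have "\<dots> = V (Suc m) ?D powr (3 / 2)" by (simp only: powr_powr) simp
          also have "\<dots> = A powr (3 / 2) * (2 powr (- real n / \<rho>)) powr (3 / 2)"
            unfolding V using A by (simp add: powr_mult)
          also have "(2 powr (- real n / \<rho>)) powr (3 / 2) = 2 powr (- real n * 3 / (2 * \<rho>))"
            by (simp add: powr_powr mult.commute)
          finally show ?thesis .
        qed
        have "(real ?D + 1)\<^sup>2 * 2 powr (- real ?D * k / 2) = ((real ?D + 1)\<^sup>2 * (2 powr (- k / 4)) ^ ?D) * 2 powr (- real ?D * k / 4)"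
        proof -
          have "(2 powr (- k / 4)) ^ ?D = (2 powr (- k / 4)) powr real ?D" by (rule powr_realpow[symmetric]) simp
          also have "\<dots> = 2 powr (- real ?D * k / 4)" by (simp only: powr_powr) (simp add: mult.commute)
          finally show ?thesis unfolding half by (simp only: mult.assoc)
        qed
        also have "\<dots> \<le> B * 2 powr (- real (m - n) * k / 4)"
          using B(1) by (intro mult_mono B(2) dec[OF nm]) auto
        finally have b: "(real ?D + 1)\<^sup>2 * 2 powr (- real ?D * k / 2) \<le> B * 2 powr (- real (m - n) * k / 4)" .
        have "4 * sqrt (17 * (real ?D + 1) ^ 4 * eps ?D powr (2 - \<rho>) * V (Suc m) ?D ^ 3) =
          (4 * sqrt 17 * A powr (3 / 2) * 2 powr (- real n * 3 / (2 * \<rho>))) * ((real ?D + 1)\<^sup>2 * 2 powr (- real ?D * k / 2))"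
          unfolding real_sqrt_mult s4 s3 root by (simp only: mult_ac)
        also have "\<dots> \<le> (4 * sqrt 17 * A powr (3 / 2) * 2 powr (- real n * 3 / (2 * \<rho>))) * (B * 2 powr (- real (m - n) * k / 4))"
          by (rule mult_left_mono[OF b]) simp
        also have "\<dots> = (4 * sqrt 17 * B * A powr (3 / 2)) * (2 powr (- real n * 3 / (2 * \<rho>)) * 2 powr (- real (m - n) * k / 4))"
          by (simp only: mult_ac)
        also have "\<dots> \<le> c * (2 powr (- real n * 3 / (2 * \<rho>)) * 2 powr (- real (m - n) * k / 4))"
          using A by (intro mult_right_mono) (auto simp: c_def)
        finally show ?thesis by (simp only: mult_ac)
      qed
      ultimately have "delta m n j v \<in> hom_ball 3 (c * 2 powr (- real n * 3 / (2 * \<rho>)) * 2 powr (- real (m - n) * k / 4))" by (rule hom_ball_mono)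
      thus ?thesis unfolding l k_def[symmetric] by simp
    qed
  qed
qed

text \<open>\<open>Z\<close> collects the increments over the dyadic intervals of level \<open>m\<close> and the differences of the \<open>m\<close>-th and the \<open>m + 1\<close>-st
  approximation over all dyadic intervals of level at most \<open>m\<close>, normalized by the size that is needed for uniform
  convergence in the rough path metric. The exponents \<open>e\<close> make the summands of \<open>G\<close> homogeneous of the same degree.\<close>

lemma uniform_convergence_polynomials:
  assumes \<alpha>: "2 * \<rho> < 1 / \<alpha>" "0 < \<alpha>" "\<alpha> \<le> 1"
  obtains N G s r where "\<And>m. G m \<in> hom N" "\<And>m x. 0 \<le> G m x" "\<And>m. 0 < s m" "summable s"
    "\<And>m. (\<integral>x. (G m x)\<^sup>2 \<partial>\<mu>) \<le> (s m)\<^sup>2" "0 < r" "r < 1"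
    "\<And>x K n j i. \<forall>m. G m x \<le> K \<Longrightarrow> 1 \<le> K \<Longrightarrow> j < 2 ^ n \<Longrightarrow> \<bar>cell_increment T n j i x\<bar> \<le> K * (2 powr - \<alpha>) ^ n * r ^ n"
    "\<And>x K m n j v. \<forall>m. G m x \<le> K \<Longrightarrow> 1 \<le> K \<Longrightarrow> n \<le> m \<Longrightarrow> j < 2 ^ n \<Longrightarrow> 2 \<le> length v \<Longrightarrow> length v \<le> 3 \<Longrightarrow>
      \<bar>delta m n j v x\<bar> \<le> K * r ^ m * ((2 powr - \<alpha>) ^ n) ^ length v"
proof -
  \<comment> \<open>The margin in the regularity: up to a constant, a cell increment of level
    \<open>m\<close> has L2 norm \<open>2 powr (- m / (2 * \<rho>))\<close>, which is smaller than
    \<open>2 powr (- m * \<alpha>)\<close> by \<open>2 powr (- m * \<gamma> / 2)\<close>.\<close>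
  define \<gamma> where "\<gamma> = 1 / \<rho> - 2 * \<alpha>"
  have \<gamma>: "0 < \<gamma>"
  proof -
    have "\<alpha> * (2 * \<rho>) < 1" using mult_strict_left_mono[OF \<alpha>(1,2)] \<alpha>(2) by simp
    thus ?thesis using \<rho> by (simp add: \<gamma>_def field_simps)
  qed
  define k where "k = (2 - \<rho>) / \<rho>"
  have k: "0 < k" using \<rho> by (simp add: k_def)
  \<comment> \<open>The rate \<open>\<theta>\<close> is paid twice, once in the normalization of
    \<open>Z\<close> and once as the decay \<open>r ^ m\<close> of its norm. The bounds
    \<open>\<gamma> / 4\<close> and \<open>k / 8\<close> make \<open>2 * \<theta>\<close> affordable
    per level up to \<open>n\<close>, through the size of the interval, and per level from
    \<open>n\<close> to \<open>m\<close>, through the refinement.\<close>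
  define \<theta> where "\<theta> = min (\<gamma> / 4) (k / 8)"
  have \<theta>: "0 < \<theta>" "\<theta> \<le> \<gamma> / 4" "\<theta> \<le> k / 8" using \<gamma> k by (auto simp: \<theta>_def)
  define r where "r = 2 powr - \<theta>"
  have r: "0 < r" "r < 1" using \<theta>(1) powr_less_mono[of "- \<theta>" 0 2] by (simp_all add: r_def)
  have rm: "r ^ m = 2 powr (- \<theta> * real m)" for m by (simp add: r_def powr_powr flip: powr_realpow)
  obtain c where c: "0 < c" "\<And>m n j v. n \<le> m \<Longrightarrow> j < 2 ^ n \<Longrightarrow> length v = 2 \<or> length v = 3 \<Longrightarrow>
    delta m n j v \<in> hom_ball (length v) (c * 2 powr (- real n * real (length v) / (2 * \<rho>)) * 2 powr (- real (m - n) * k / 4))"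
    using delta_ball unfolding k_def by blast
  define A where "A = C * T powr (1 / \<rho>)"
  have A: "0 < A" using C_pos T_pos by (simp add: A_def)
  define c2 where "c2 = 1 + c + sqrt A"
  have c2: "1 \<le> c2" "c \<le> c2" "sqrt A \<le> c2" using c A by (simp_all add: c2_def)
  \<comment> \<open>With \<open>p = 2 ^ a\<close> the power \<open>2 * p\<close> of
    \<open>r ^ m\<close> is at most \<open>(1 / 4) ^ m\<close>, which outweighs the number of
    indices in \<open>Idx m\<close>, of order \<open>2 ^ m\<close>.\<close>
  obtain a where a: "1 \<le> 2 ^ a * \<theta>" "1 \<le> a"
  proof -
    obtain b where "1 / \<theta> < 2 ^ b" using real_arch_pow[of 2 "1 / \<theta>"] by auto
    moreover have "(2::real) ^ b \<le> 2 ^ Suc b" by simp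
    ultimately have "1 / \<theta> \<le> 2 ^ Suc b" by linarith
    hence "1 \<le> 2 ^ Suc b * \<theta>" using \<theta>(1) by (simp add: divide_le_eq mult.commute)
    thus ?thesis using that[of "Suc b"] by simp
  qed
  define p :: nat where "p = 2 ^ a"
  have p: "even p" "0 < p" using a by (simp_all add: p_def)
  define e where "e v = 6 * p div length v" for v :: "'d list"
  have len: "length v = 1 \<or> length v = 2 \<or> length v = 3 \<Longrightarrow>
    even (e v) \<and> 2 * p \<le> e v \<and> e v \<le> 6 * p \<and> length v * e v = 6 * p" for v :: "'d list"
    using p by (auto simp: e_def)
  \<comment> \<open>Single letters occur for \<open>n = m\<close> only: they stand for the cell
    increments of level \<open>m\<close>, and over all \<open>m\<close> every cell is
    covered.\<close>
  define Idx where "Idx m = {(n, j, v :: 'd list). n \<le> m \<and> j < (2::nat) ^ n \<and> (length v = 1 \<and> n = m \<or> length v = 2 \<or> length v = 3)}" for m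
  define Z where "Z m = (\<lambda>(n, j, v :: 'd list) x. if length v = 1 then 2 powr (real m * (\<alpha> + \<theta>)) * cell m (hd v) j x
     else 2 powr (real n * real (length v) * \<alpha> + real m * \<theta>) * delta m n j v x)" for m
  have Zball: "Z m (n, j, v) \<in> hom_ball (length v) (c2 * r ^ m)" if "(n, j, v) \<in> Idx m" for m n j v
  proof -
    from that have nj: "n \<le> m" "j < 2 ^ n" and v: "length v = 1 \<and> n = m \<or> length v = 2 \<or> length v = 3" by (auto simp: Idx_def)
    from v consider "length v = 1" "n = m" | "length v = 2 \<or> length v = 3" by blast
    thus ?thesis
    proof cases
      case 1
      have j: "Suc j \<le> 2 ^ m" using nj 1 by simp
      have Vm: "V m 0 = A * 2 powr (- real m / \<rho>)"
      proof -
        have "T / 2 ^ m = T * 2 powr (- real m)" by (simp add: powr_minus powr_realpow divide_inverse)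
        thus ?thesis using T_pos by (simp add: V_def A_def powr_mult powr_powr)
      qed
      have "cell m (hd v) j \<in> hom_ball 1 (sqrt (V m 0))"
        unfolding hom_ball_def mem_Collect_eq
        using inc_hom[of j m "Suc j" "hd v"] cov_inc_self[of j "Suc j" 0 m "hd v"] V_pos[of m 0] j
        by (simp add: power2_eq_square)
      from hom_ball_scale[OF this, of "2 powr (real m * (\<alpha> + \<theta>))"]
      have "Z m (n, j, v) \<in> hom_ball 1 (2 powr (real m * (\<alpha> + \<theta>)) * sqrt (V m 0))" using 1 by (simp add: Z_def)
      moreover have "2 powr (real m * (\<alpha> + \<theta>)) * sqrt (V m 0) \<le> c2 * r ^ m"
      proof -
        have "sqrt (V m 0) = sqrt A * sqrt (2 powr (- real m / \<rho>))" unfolding Vm by (rule real_sqrt_mult)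
        also have "sqrt (2 powr (- real m / \<rho>)) = (2 powr (- real m / \<rho>)) powr (1 / 2)" by (simp only: powr_half_sqrt powr_ge_zero)
        also have "\<dots> = 2 powr (- real m / (2 * \<rho>))" by (simp add: powr_powr mult.commute)
        finally have "2 powr (real m * (\<alpha> + \<theta>)) * sqrt (V m 0) = sqrt A * 2 powr (real m * (\<alpha> + \<theta>) + - real m / (2 * \<rho>))"
          by (simp only: powr_add mult_ac)
        also have "real m * (\<alpha> + \<theta>) + - real m / (2 * \<rho>) = real m * (\<theta> - \<gamma> / 2)"
          using \<rho> by (simp add: \<gamma>_def field_simps)
        also have "sqrt A * 2 powr (real m * (\<theta> - \<gamma> / 2)) \<le> c2 * 2 powr (- \<theta> * real m)"
        proof (rule mult_mono[OF c2(3) powr_mono])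
          have "real m * (\<theta> - \<gamma> / 2) \<le> real m * (- \<theta>)" using \<theta> by (intro mult_left_mono) auto
          thus "real m * (\<theta> - \<gamma> / 2) \<le> - \<theta> * real m" by (simp add: mult.commute)
        qed (use c2 A in auto)
        finally show ?thesis by (simp add: rm)
      qed
      ultimately show ?thesis using 1 by (simp add: hom_ball_mono)
    next
      case 2
      let ?E = "real n * real (length v) * \<alpha> + real m * \<theta>"
      from hom_ball_scale[OF c(2)[OF nj 2], of "2 powr ?E"]
      have "Z m (n, j, v) \<in> hom_ball (length v) (2 powr ?E * (c * 2 powr (- real n * real (length v) / (2 * \<rho>)) * 2 powr (- real (m - n) * k / 4)))"
        using 2 by (auto simp: Z_def)
      moreover have "2 powr ?E * (c * 2 powr (- real n * real (length v) / (2 * \<rho>)) * 2 powr (- real (m - n) * k / 4)) \<le> c2 * r ^ m"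
      proof -
        have "2 powr ?E * (c * 2 powr (- real n * real (length v) / (2 * \<rho>)) * 2 powr (- real (m - n) * k / 4)) =
          c * 2 powr (?E + (- real n * real (length v) / (2 * \<rho>) + - real (m - n) * k / 4))"
          by (simp only: powr_add mult_ac)
        also have "\<dots> \<le> c2 * 2 powr (- \<theta> * real m)"
        proof (rule mult_mono[OF c2(2) powr_mono])
          have 1: "real n * real (length v) * \<alpha> + - real n * real (length v) / (2 * \<rho>) = - (real n * (real (length v) * \<gamma> / 2))"
            using \<rho> by (simp add: \<gamma>_def field_simps)
          have 2: "real n * (2 * \<theta>) \<le> real n * (real (length v) * \<gamma> / 2)"
          proof (rule mult_left_mono)
            have "2 * \<gamma> \<le> real (length v) * \<gamma>" using 2 \<gamma> by (intro mult_right_mono) auto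
            thus "2 * \<theta> \<le> real (length v) * \<gamma> / 2" using \<theta> \<gamma> by linarith
          qed simp
          have 3: "real (m - n) * (2 * \<theta>) \<le> real (m - n) * (k / 4)" using \<theta> by (intro mult_left_mono) auto
          have m: "real m = real n + real (m - n)" using nj by simp
          have 4: "real m * \<theta> = real n * \<theta> + real (m - n) * \<theta>" by (subst m) (rule distrib_right)
          show "?E + (- real n * real (length v) / (2 * \<rho>) + - real (m - n) * k / 4) \<le> - \<theta> * real m"
            using 1 2 3 4 by (simp add: mult.commute)
        qed (use c c2 in auto)
        finally show ?thesis by (simp add: rm)
      qed
      ultimately show ?thesis by (rule hom_ball_mono)
    qed
  qed
  \<comment> \<open>The exponents for degrees 1, 2 and 3 are \<open>3 * 2 ^ (a + 1)\<close>,
    \<open>3 * 2 ^ a\<close> and \<open>2 ^ (a + 1)\<close>, so the moment bounds for powers of two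
    and for three times such powers cover them.\<close>
  have "\<exists>Q\<ge>1. \<forall>F\<in>hom n. (\<integral>x. (F x ^ (6 * p div n))\<^sup>2 \<partial>\<mu>) \<le> Q * (\<integral>x. (F x)\<^sup>2 \<partial>\<mu>) ^ (6 * p div n)" if "n = 1 \<or> n = 2 \<or> n = 3" for n
  proof -
    have "6 * p div 1 = 3 * 2 ^ Suc a" "6 * p div 2 = 3 * 2 ^ a" "6 * p div 3 = 2 ^ Suc a" by (simp_all add: p_def)
    thus ?thesis using that moment_power_3[of 1 "Suc a"] moment_power_3[of 2 a] moment_power_2[of 3 "Suc a"] by (elim disjE) (simp_all only:)
  qed
  hence "\<forall>n\<in>{n. n = 1 \<or> n = 2 \<or> n = 3}. \<exists>Q\<ge>1. \<forall>F\<in>hom n. (\<integral>x. (F x ^ (6 * p div n))\<^sup>2 \<partial>\<mu>) \<le> Q * (\<integral>x. (F x)\<^sup>2 \<partial>\<mu>) ^ (6 * p div n)"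
    by (intro ballI) (simp only: mem_Collect_eq)
  from bchoice[OF this] obtain Q where Q':
    "\<forall>n\<in>{n. n = 1 \<or> n = 2 \<or> n = 3}. 1 \<le> Q n \<and> (\<forall>F\<in>hom n. (\<integral>x. (F x ^ (6 * p div n))\<^sup>2 \<partial>\<mu>) \<le> Q n * (\<integral>x. (F x)\<^sup>2 \<partial>\<mu>) ^ (6 * p div n))" ..
  have Q: "1 \<le> Q n" "F \<in> hom n \<Longrightarrow> (\<integral>x. (F x ^ (6 * p div n))\<^sup>2 \<partial>\<mu>) \<le> Q n * (\<integral>x. (F x)\<^sup>2 \<partial>\<mu>) ^ (6 * p div n)"
    if "n = 1 \<or> n = 2 \<or> n = 3" for n F
    using bspec[OF Q', of n] that by (simp_all only: mem_Collect_eq simp_thms)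
  define B where "B = (Q 1 + Q 2 + Q 3) * c2 ^ (6 * p)"
  have QB: "1 \<le> Q 1 + Q 2 + Q 3" "Q n \<le> Q 1 + Q 2 + Q 3" if "n = 1 \<or> n = 2 \<or> n = 3" for n
    using Q(1)[of 1] Q(1)[of 2] Q(1)[of 3] that by auto
  have B: "0 < B" using QB(1)[of 1] c2(1) by (simp add: B_def)
  have Zpow: "(\<lambda>x. Z m (n, j, v) x ^ e v) \<in> hom_ball (6 * p) (B * (1 / 4) ^ m)" if i: "(n, j, v) \<in> Idx m" for m n j v
  proof -
    from i have v: "length v = 1 \<or> length v = 2 \<or> length v = 3" by (auto simp: Idx_def)
    note l = len[OF v]
    have F: "Z m (n, j, v) \<in> hom (length v)" "(\<integral>x. (Z m (n, j, v) x)\<^sup>2 \<partial>\<mu>) \<le> (c2 * r ^ m)\<^sup>2"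
      using Zball[OF i] by (simp_all add: hom_ball_def)
    have "(\<integral>x. (Z m (n, j, v) x ^ e v)\<^sup>2 \<partial>\<mu>) \<le> Q (length v) * (\<integral>x. (Z m (n, j, v) x)\<^sup>2 \<partial>\<mu>) ^ e v"
      unfolding e_def by (rule Q(2)[OF v F(1)])
    also have "\<dots> \<le> (Q 1 + Q 2 + Q 3) * ((c2 * r ^ m)\<^sup>2) ^ e v"
      using QB[OF v] F(2) by (intro mult_mono power_mono) auto
    also have "((c2 * r ^ m)\<^sup>2) ^ e v = (c2 ^ e v * (r ^ m) ^ e v)\<^sup>2"
    proof -
      have "((c2 * r ^ m)\<^sup>2) ^ e v = ((c2 * r ^ m) ^ e v)\<^sup>2" unfolding power_mult[symmetric] by (simp only: mult.commute)
      thus ?thesis by (simp only: power_mult_distrib)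
    qed
    also have "(Q 1 + Q 2 + Q 3) * (c2 ^ e v * (r ^ m) ^ e v)\<^sup>2 \<le> (Q 1 + Q 2 + Q 3)\<^sup>2 * (c2 ^ (6 * p) * (1 / 4) ^ m)\<^sup>2"
    proof (intro mult_mono power_mono)
      show "Q 1 + Q 2 + Q 3 \<le> (Q 1 + Q 2 + Q 3)\<^sup>2" using QB(1)[OF v] by (simp add: power2_eq_square mult_le_cancel_left1)
      show "c2 ^ e v \<le> c2 ^ (6 * p)" using c2 l by (intro power_increasing) auto
      have "(r ^ m) ^ e v \<le> (r ^ m) ^ (2 * p)" using l r by (intro power_decreasing) (auto simp: power_le_one)
      also have "\<dots> = (2 powr (- (2 * (2 ^ a * \<theta>)))) ^ m"
        by (simp add: r_def p_def powr_powr mult_ac flip: powr_realpow power_mult)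
      also have "\<dots> \<le> (2 powr (- 2)) ^ m" using a by (intro power_mono powr_mono) auto
      also have "(2::real) powr (- 2) = 1 / 4" by (simp add: powr_minus)
      finally show "(r ^ m) ^ e v \<le> (1 / 4) ^ m" .
    qed (use c2 r QB(1)[OF v] in auto)
    also have "\<dots> = (B * (1 / 4) ^ m)\<^sup>2" by (simp add: B_def power_mult_distrib)
    finally have "(\<integral>x. (Z m (n, j, v) x ^ e v)\<^sup>2 \<partial>\<mu>) \<le> (B * (1 / 4) ^ m)\<^sup>2" .
    moreover have "(\<lambda>x. Z m (n, j, v) x ^ e v) \<in> hom (6 * p)" using hom_power[OF F(1), of "e v"] l by simp
    ultimately show ?thesis using B by (simp add: hom_ball_def)
  qed
  define G where "G m = (\<lambda>x. \<Sum>(n, j, v)\<in>Idx m. Z m (n, j, v) x ^ e v)" for m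
  define wd where "wd = real (card {v :: 'd list. length v \<le> 3})"
  have wd: "0 < wd"
    unfolding wd_def using finite_words_le[of 3] by (auto simp: card_gt_0_iff intro: exI[of _ "[]"])
  define s where "s m = 2 * wd * B * (1 / 2) ^ m" for m :: nat
  have sub: "Idx m \<subseteq> (SIGMA n:{..m}. {..<2 ^ n} \<times> {v :: 'd list. length v \<le> 3})" for m
    by (auto simp: Idx_def)
  have finS: "finite (SIGMA n:{..m}. {..<(2::nat) ^ n} \<times> {v :: 'd list. length v \<le> 3})" for m
    by (intro finite_SigmaI finite_cartesian_product finite_words_le) auto
  have fin: "finite (Idx m)" for m by (rule finite_subset[OF sub finS])
  have card: "real (card (Idx m)) \<le> 2 * wd * 2 ^ m" for m
  proof -
    have "card (Idx m) \<le> card (SIGMA n:{..m}. {..<(2::nat) ^ n} \<times> {v :: 'd list. length v \<le> 3})" by (rule card_mono[OF finS sub])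
    also have "\<dots> = (\<Sum>n\<le>m. 2 ^ n * card {v :: 'd list. length v \<le> 3})"
      by (subst card_SigmaI) (auto simp: finite_words_le)
    finally have "real (card (Idx m)) \<le> real (\<Sum>n\<le>m. 2 ^ n * card {v :: 'd list. length v \<le> 3})" by (simp only: of_nat_le_iff)
    also have "\<dots> = (\<Sum>n\<le>m. 2 ^ n) * wd" by (simp add: wd_def sum_distrib_right)
    also have "(\<Sum>n\<le>m. (2::real) ^ n) \<le> 2 * 2 ^ m" by (induction m) auto
    finally show ?thesis using wd by (simp add: mult_ac)
  qed
  have Gball: "G m \<in> hom_ball (6 * p) (s m)" for m
  proof -
    have "(\<lambda>x. \<Sum>i\<in>Idx m. (case i of (n, j, v) \<Rightarrow> Z m (n, j, v) x ^ e v)) \<in> hom_ball (6 * p) (\<Sum>i\<in>Idx m. B * (1 / 4) ^ m)"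
      by (rule hom_ball_sum[OF fin]) (use Zpow in auto)
    moreover have "(\<Sum>i\<in>Idx m. B * (1 / 4) ^ m) \<le> s m"
    proof -
      have "(\<Sum>i\<in>Idx m. B * (1 / 4) ^ m) = real (card (Idx m)) * (B * (1 / 4) ^ m)" by simp
      also have "\<dots> \<le> (2 * wd * 2 ^ m) * (B * (1 / 4) ^ m)" using B by (intro mult_right_mono card) auto
      also have "\<dots> = s m"
      proof -
        have "(2::real) ^ m * (1 / 4) ^ m = (1 / 2) ^ m" by (simp flip: power_mult_distrib)
        thus ?thesis by (simp add: s_def mult_ac)
      qed
      finally show ?thesis .
    qed
    ultimately show ?thesis unfolding G_def by (rule hom_ball_mono)
  qed
  have Z0: "0 \<le> Z m (n, j, v) x ^ e v" if "(n, j, v) \<in> Idx m" for m n j v x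
  proof -
    from that have "length v = 1 \<or> length v = 2 \<or> length v = 3" by (auto simp: Idx_def)
    hence "even (e v)" using len by blast
    thus ?thesis by (rule zero_le_even_power)
  qed
  have ZK: "\<bar>Z m (n, j, v) x\<bar> \<le> K" if G: "\<And>m. G m x \<le> K" and K: "1 \<le> K" and i: "(n, j, v) \<in> Idx m" for m n j v x K
  proof -
    from i have v: "length v = 1 \<or> length v = 2 \<or> length v = 3" by (auto simp: Idx_def)
    note l = len[OF v]
    have e0: "0 < e v" using l p by linarith
    have "\<bar>Z m (n, j, v) x\<bar> ^ e v = Z m (n, j, v) x ^ e v" using l by (simp add: power_even_abs)
    also have "\<dots> \<le> G m x"
      unfolding G_def using member_le_sum[of "(n, j, v)" "Idx m" "\<lambda>(n, j, v). Z m (n, j, v) x ^ e v", OF i _ fin] Z0 by auto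
    also have "\<dots> \<le> K" by (rule G)
    \<comment> \<open>\<open>K \<ge> 1\<close> turns a bound \<open>K\<close> on the power into the
      same bound on its base, uniformly in the exponent.\<close>
    also have "\<dots> \<le> K ^ e v" using self_le_power[OF K e0] .
    finally show ?thesis using K e0 by (simp add: power_mono_iff)
  qed
  show thesis
  proof (rule that[of G "6 * p" s r])
    show "G m \<in> hom (6 * p)" "(\<integral>x. (G m x)\<^sup>2 \<partial>\<mu>) \<le> (s m)\<^sup>2" for m using Gball[of m] by (simp_all add: hom_ball_def)
    show "0 \<le> G m x" for m x unfolding G_def by (rule sum_nonneg) (use Z0 in auto)
    show "0 < s m" for m using wd B by (simp add: s_def)
    show "summable s" unfolding s_def by (intro summable_mult summable_geometric) simp
    show "0 < r" "r < 1" by (rule r)+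
    have cancel: "y \<le> K * 2 powr (- E)" if "2 powr E * y \<le> K" for y E K :: real
      using that by (simp add: powr_minus field_simps)
    fix x K assume "\<forall>m. G m x \<le> K" and K: "1 \<le> K"
    hence G: "\<And>m. G m x \<le> K" by blast
    show "\<bar>cell_increment T n j i x\<bar> \<le> K * (2 powr - \<alpha>) ^ n * r ^ n" if j: "j < 2 ^ n" for n j i
    proof -
      have "(n, j, [i]) \<in> Idx n" using j by (simp add: Idx_def)
      from ZK[OF G K this] have "2 powr (real n * (\<alpha> + \<theta>)) * \<bar>cell n i j x\<bar> \<le> K" by (simp add: Z_def abs_mult)
      hence "\<bar>cell n i j x\<bar> \<le> K * 2 powr (- (real n * (\<alpha> + \<theta>)))" by (rule cancel)
      also have "2 powr (- (real n * (\<alpha> + \<theta>))) = (2 powr - \<alpha>) ^ n * r ^ n"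
        by (simp add: r_def powr_powr algebra_simps flip: powr_realpow powr_add)
      finally show ?thesis by (simp add: cell_increment_cell mult.assoc)
    qed
    show "\<bar>delta m n j v x\<bar> \<le> K * r ^ m * ((2 powr - \<alpha>) ^ n) ^ length v"
      if nj: "n \<le> m" "j < 2 ^ n" and v: "2 \<le> length v" "length v \<le> 3" for m n j v
    proof -
      let ?E = "real n * real (length v) * \<alpha> + real m * \<theta>"
      have "(n, j, v) \<in> Idx m" using nj v by (auto simp: Idx_def)
      from ZK[OF G K this] have "2 powr ?E * \<bar>delta m n j v x\<bar> \<le> K" using v by (simp add: Z_def abs_mult)
      hence "\<bar>delta m n j v x\<bar> \<le> K * 2 powr (- ?E)" by (rule cancel)
      also have "2 powr (- ?E) = r ^ m * ((2 powr - \<alpha>) ^ n) ^ length v"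
        by (simp add: r_def powr_powr algebra_simps flip: powr_realpow powr_add power_mult)
      finally show ?thesis by (simp only: mult.assoc)
    qed
  qed
qed

section \<open>Exceptional sets\<close>

text \<open>Off \<open>U\<close> all \<open>G m\<close> are at most \<open>K\<close>, so the
  constants in the dyadic bounds, and after chaining the step sizes \<open>b m\<close>, are common
  to all remaining paths. The same set serves the existence of the limit and the continuity.\<close>

lemma small_exceptional_set:
  assumes \<alpha>: "2 * \<rho> < 1 / \<alpha>" "1 / 4 < \<alpha>" "\<alpha> \<le> 1" and q: "1 < q" and \<epsilon>: "0 < \<epsilon>"
  obtains U where "openin (top_of_set (wspace W)) U" "cap_open W q k U < ennreal \<epsilon>" "wspace W - U \<subseteq> lift_domain T \<alpha> W"
    "continuous_map (top_of_set (wspace W - U)) (geometric_rp_topology T \<alpha>) (rp_lift T \<alpha> W)"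
proof -
  have \<alpha>0: "0 < \<alpha>" using \<alpha>(2) by simp
  obtain N G s r where G: "\<And>m. G m \<in> hom N" "\<And>m x. 0 \<le> G m x" and s: "\<And>m. 0 < s m" "summable s"
    and Gs: "\<And>m. (\<integral>x. (G m x)\<^sup>2 \<partial>\<mu>) \<le> (s m)\<^sup>2" and r: "0 < r" "r < 1"
    and inc: "\<And>x K n j i. \<forall>m. G m x \<le> K \<Longrightarrow> 1 \<le> K \<Longrightarrow> j < 2 ^ n \<Longrightarrow> \<bar>cell_increment T n j i x\<bar> \<le> K * (2 powr - \<alpha>) ^ n * r ^ n"
    and diff: "\<And>x K m n j v. \<forall>m. G m x \<le> K \<Longrightarrow> 1 \<le> K \<Longrightarrow> n \<le> m \<Longrightarrow> j < 2 ^ n \<Longrightarrow> 2 \<le> length v \<Longrightarrow> length v \<le> 3 \<Longrightarrow>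
      \<bar>delta m n j v x\<bar> \<le> K * r ^ m * ((2 powr - \<alpha>) ^ n) ^ length v"
    by (rule uniform_convergence_polynomials[OF \<alpha>(1) \<alpha>0 \<alpha>(3)], rule that)
  obtain Cc where Cc: "0 \<le> Cc" "\<And>K. 0 < K \<Longrightarrow> cap_open W q k {x \<in> wspace W. \<exists>m. K < G m x} \<le> ennreal (Cc * suminf s / K)"
  proof (rule capacity_bound[OF q, of N k])
    fix C assume "0 \<le> C" and C: "\<And>G s K. (\<And>m. G m \<in> hom N) \<Longrightarrow> (\<And>m x. 0 \<le> G m x) \<Longrightarrow> (\<And>m. 0 < s m) \<Longrightarrow> summable s \<Longrightarrow>
      (\<And>m. (\<integral>x. (G m x)\<^sup>2 \<partial>\<mu>) \<le> (s m)\<^sup>2) \<Longrightarrow> 0 < K \<Longrightarrow>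
      cap_open W q k {x \<in> wspace W. \<exists>m. K < G m x} \<le> ennreal (C * suminf s / K)"
    show thesis by (rule that[of C, OF \<open>0 \<le> C\<close> C[OF G s Gs]])
  qed
  \<comment> \<open>Large enough for the capacity bound to fall below \<open>\<epsilon>\<close>, and
    at least 1 as the bounds drawn from \<open>G\<close> require.\<close>
  define K where "K = 1 + Cc * suminf s / \<epsilon>"
  have S: "0 \<le> suminf s" by (rule suminf_nonneg[OF s(2)]) (use s(1) less_imp_le in blast)
  have K: "1 \<le> K" using S Cc(1) \<epsilon> by (simp add: K_def)
  have small: "Cc * suminf s / K < \<epsilon>"
  proof -
    have "Cc * suminf s < \<epsilon> * K" using \<epsilon> by (simp add: K_def field_simps)
    thus ?thesis using K by (simp add: divide_less_eq)
  qed
  define U where "U = {x \<in> wspace W. \<exists>m. K < G m x}"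
  define Kd where "Kd = 2 * (1 + K) ^ 3 + K / (1 - r)"
  define \<kappa> where "\<kappa> = exp (4 * (Kd * real (card {v :: 'd list. length v \<le> 3})) / (1 - 2 powr - \<alpha>))"
  \<comment> \<open>\<open>(1 + (2 / T) powr \<alpha>) ^ 3\<close> dominates
    \<open>((2 / T) powr \<alpha>) ^ length v\<close> for all lengths up to 3, whether the base is
    below or above 1.\<close>
  define b where "b m = \<kappa> * (1 + (2 / T) powr \<alpha>) ^ 3 * r ^ m" for m :: nat
  have Kd: "0 \<le> Kd" using K r by (simp add: Kd_def)
  have b: "0 \<le> b m" "summable b" for m
  proof -
    show "0 \<le> b m" unfolding b_def using r by (simp add: \<kappa>_def)
    show "summable b" unfolding b_def using r by (intro summable_mult summable_geometric) simp
  qed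
  have half: "1 / 2 \<le> 2 powr - \<alpha>"
  proof -
    have "2 powr - 1 \<le> 2 powr - \<alpha>" using \<alpha>(3) by (intro powr_mono) auto
    thus ?thesis by (simp add: powr_minus)
  qed
  \<comment> \<open>As \<open>\<alpha> > 1 / 4\<close>, at most three levels occur, and these are
    the ones for which differences were computed.\<close>
  have lev: "rp_level \<alpha> \<le> 3"
  proof -
    have "1 / \<alpha> < 4" using \<alpha>(2) \<alpha>0 by (simp add: divide_less_eq)
    thus ?thesis unfolding rp_level_def nat_le_iff by linarith
  qed
  have step: "\<bar>dyadic_integral T (Suc m) x v u t - dyadic_integral T m x v u t\<bar> \<le> b m * (t - u) powr (real (length v) * \<alpha>)"
    if x: "x \<in> wspace W - U" and ut: "0 \<le> u" "u < t" "t \<le> T" and v: "v \<noteq> []" "length v \<le> rp_level \<alpha>" for x m u t and v :: "'d list"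
  proof -
    have GK: "\<forall>m. G m x \<le> K" using x by (auto simp: U_def not_less)
    have v3: "length v \<le> 3" using v lev by simp
    have "dyadically_close 3 T Kd (r ^ m) (2 powr - \<alpha>) (dyadic_integral T (Suc m) x) (dyadic_integral T m x)"
      unfolding Kd_def
      by (rule dyadically_close_of_bounds[OF T_pos inc[OF GK K] diff[OF GK K, unfolded delta_def] _ half r]) (use K in auto)
    from chaining[OF T_pos dyadic_integral_multiplicative[OF T_pos] dyadic_integral_multiplicative[OF T_pos]
        dyadic_integral_continuous[OF T_pos] dyadic_integral_continuous[OF T_pos] this Kd _ \<alpha>0 \<kappa>_def ut v3]
    have "\<bar>dyadic_integral T (Suc m) x v u t - dyadic_integral T m x v u t\<bar> \<le>
      \<kappa> * r ^ m * ((2 / T) powr \<alpha>) ^ length v * (t - u) powr (real (length v) * \<alpha>)"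
      using r by simp
    also have "\<dots> \<le> \<kappa> * r ^ m * (1 + (2 / T) powr \<alpha>) ^ 3 * (t - u) powr (real (length v) * \<alpha>)"
    proof (intro mult_right_mono mult_left_mono)
      have "((2 / T) powr \<alpha>) ^ length v \<le> (1 + (2 / T) powr \<alpha>) ^ length v" by (intro power_mono) auto
      also have "\<dots> \<le> (1 + (2 / T) powr \<alpha>) ^ 3" using v3 by (intro power_increasing) auto
      finally show "((2 / T) powr \<alpha>) ^ length v \<le> (1 + (2 / T) powr \<alpha>) ^ 3" .
    qed (use r in \<open>auto simp: \<kappa>_def\<close>)
    finally show ?thesis by (simp only: b_def mult_ac)
  qed
  have sub: "wspace W - U \<subseteq> wspace W" "wspace W \<subseteq> C0 T" by (auto simp: wspace_eq)
  note lift = uniformly_convergent_lift[OF T_pos less_imp_le[OF \<alpha>0] \<alpha>(3) sub b step]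
  show thesis
  proof (rule that[of U])
    show "openin (top_of_set (wspace W)) U" unfolding U_def by (rule openin_superlevel[OF G(1)])
    have "cap_open W q k U \<le> ennreal (Cc * suminf s / K)" unfolding U_def using K by (intro Cc(2)) simp
    also have "\<dots> < ennreal \<epsilon>" using small \<epsilon> by (simp add: ennreal_less_iff ennreal_lessI)
    finally show "cap_open W q k U < ennreal \<epsilon>" .
    show "wspace W - U \<subseteq> lift_domain T \<alpha> W" by (rule lift(1))
    show "continuous_map (top_of_set (wspace W - U)) (geometric_rp_topology T \<alpha>) (rp_lift T \<alpha> W)" by (rule lift(2))
  qed
qed

text \<open>The open sets of \<open>small_exceptional_set\<close> contain the complement of the
  domain and have arbitrarily small capacity; on their complements the lift is continuous.\<close>

lemma lift_slim_quasi_continuous: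
  assumes \<alpha>: "2 * \<rho> < 1 / \<alpha>" "1 / 4 < \<alpha>" "\<alpha> \<le> 1"
  shows "slim W (wspace W - lift_domain T \<alpha> W)"
    and "infty_quasi_continuous W (geometric_rp_topology T \<alpha>) (rp_lift T \<alpha> W)"
proof -
  have "cap W q k (wspace W - lift_domain T \<alpha> W) \<le> 0" if q: "1 < q" for q k
  proof (rule ennreal_le_epsilon)
    fix \<epsilon> :: real assume "0 < \<epsilon>"
    then obtain U where U: "openin (top_of_set (wspace W)) U" "cap_open W q k U < ennreal \<epsilon>" "wspace W - U \<subseteq> lift_domain T \<alpha> W"
      using small_exceptional_set[OF \<alpha> q] by metis
    have "cap W q k (wspace W - lift_domain T \<alpha> W) \<le> cap_open W q k U"
      unfolding cap_def by (rule INF_lower) (use U in auto)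
    thus "cap W q k (wspace W - lift_domain T \<alpha> W) \<le> 0 + ennreal \<epsilon>" using U(2) by simp
  qed
  thus "slim W (wspace W - lift_domain T \<alpha> W)" by (simp add: slim_def)
  show "infty_quasi_continuous W (geometric_rp_topology T \<alpha>) (rp_lift T \<alpha> W)"
    unfolding infty_quasi_continuous_def
  proof (intro conjI allI impI)
    show "rp_lift T \<alpha> W \<in> wspace W \<rightarrow> topspace (geometric_rp_topology T \<alpha>)"
      using T_pos \<alpha> by (intro rp_lift_in_topspace) auto
    fix q \<epsilon> :: real and k :: nat assume "1 < q" "0 < \<epsilon>"
    thus "\<exists>U. openin (top_of_set (wspace W)) U \<and> cap_open W q k U < ennreal \<epsilon> \<and>
        continuous_map (top_of_set (wspace W - U)) (geometric_rp_topology T \<alpha>) (rp_lift T \<alpha> W)"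
      using small_exceptional_set[OF \<alpha>] by metis
  qed
qed

end

theorem corollary3p4:
  fixes M :: "'a measure" and w :: "real \<Rightarrow> 'a \<Rightarrow> real ^ ('d::finite)"
    and T \<rho> \<alpha> :: real
  assumes "0 < T"
    and "gaussian_process M T w"
    and "1 \<le> \<rho>" and "\<rho> < 2"
    and "hoelder_controlled_covariance M T \<rho> w"
    and "1 / 4 < \<alpha>" and "\<alpha> \<le> 1 / 2"
    and "2 * \<rho> < 1 / \<alpha>" and "1 / \<alpha> < real_of_int (\<lfloor>2 * \<rho>\<rfloor> + 1)"
  shows "slim (wiener_space_of M T w)
           (wspace (wiener_space_of M T w) - lift_domain T \<alpha> (wiener_space_of M T w)) \<and>
         infty_quasi_continuous (wiener_space_of M T w) (geometric_rp_topology T \<alpha>)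
           (rp_lift T \<alpha> (wiener_space_of M T w))"
proof -
  obtain C where C: "\<And>i. 0 < C i" "\<And>i s t. 0 \<le> s \<Longrightarrow> s \<le> t \<Longrightarrow> t \<le> T \<Longrightarrow>
      rho_variation \<rho> (incr_cov M (\<lambda>r \<omega>. w r \<omega> $ i)) s t s t \<le> ennreal (C i * (t - s) powr (1 / \<rho>))"
    using assms(5) unfolding hoelder_controlled_covariance_def by metis
  \<comment> \<open>One constant for all of the finitely many components, as the locale
    demands.\<close>
  define C' where "C' = (\<Sum>i\<in>UNIV. C i)"
  have C': "C i \<le> C'" for i unfolding C'_def using C(1) less_imp_le by (intro member_le_sum) auto
  have "0 < C'" unfolding C'_def using C(1) by (intro sum_pos) auto
  moreover have "rho_variation \<rho> (incr_cov M (\<lambda>r \<omega>. w r \<omega> $ i)) s t s t \<le> ennreal (C' * (t - s) powr (1 / \<rho>))"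
    if "0 \<le> s" "s \<le> t" "t \<le> T" for i s t
    by (rule order.trans[OF C(2)[OF that] ennreal_leI]) (intro mult_right_mono C' powr_ge_zero)
  ultimately interpret controlled_gaussian_path M T w \<rho> C'
    using assms(1-4) by unfold_locales auto
  show ?thesis using lift_slim_quasi_continuous[of \<alpha>] assms(6-8) by simp
qed

end
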